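(* Let $P,Q$ be polynomials as in the context, and assume that $2R$, where $$R=\frac12\left(\frac{P''}{P}-\frac32\Bigl(\frac{P'}{P}\Bigr)^2\right)+\frac QP,$$ satisfies the Laine condition. Then every local solution of $$g''-\frac{P'}{P}g'+\frac QPg=0$$ extends to an entire function. Let $g_1,g_2$ be a fundamental system of solutions of this equation, and for $[\alpha:\beta]\in\mathbb P^1$ put $g_{\alpha,\beta}=\alpha g_1+\beta g_2$. Then there exists a finite set $E\subset\mathbb P^1$ such that, for every $[\alpha:\beta]\notin E$, the function $g_{\alpha,\beta}$ tends to $\infty$ in every Stokes sector. Consequently, for such $[\alpha:\beta]$, if $g_{\alpha,\beta}$ and $P$ have no common zeros, then $$\frac{P(z)}{g_{\alpha,\beta}(z)^2}=\sum_{n=1}^{\infty}\frac{c_n}{(z-t_n)^2},$$ where $\{t_n\}$ is the zero set of $g_{\alpha,\beta}$, $c_n\in\mathbb C$, and $\sum_n|c_n|/|t_n|^2<\infty$.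
   Context: Setting. $\mathbb P^1$ is the complex projective line. $P(z)=z^p+az^{p-1}+O(z^{p-2})$ and $Q(z)=bz^q+cz^{q-1}+O(z^{q-2})$ are polynomials, $b\ne0$, $q\ge p\ge0$, $N=q-p$, and $Q/P$ equals a polynomial of degree $N$ plus $\sum_jD_j/(z-p_j)$ over the zeros $p_j$ of $P$ (at most simple poles). Put $d=\frac{ab-c}{bN}$ if $N\ge1$, $d=0$ if $N=0$, and $\theta_k=\frac{2\pi k-\arg b}{N+2}$. The Stokes sectors are $S_k=\{\arg(z-d)\in(\theta_k,\theta_{k+1})\}$, $k=0,\dots,N+1$; "$g\to\infty$ in $S_k$" means that for every sufficiently small $\delta>0$, $g(z)\to\infty$ as $z\to\infty$ with $\arg(z-d)\in(\theta_k+\delta,\theta_{k+1}-\delta)$. In the summability condition a possible term with $t_n=0$ is omitted. Laine condition: "$2R$ satisfies the Laine condition" means that at every pole $z_0$ of $R$ the Laurent expansion has the form $R(z)=\frac{1-m^2}{4(z-z_0)^2}+\frac{b_1}{z-z_0}+b_2+b_3(z-z_0)+\cdots$ with an integer $m=m(z_0)\ge2$, and $\mathcal D_m(z_0)=0$, where $\mathcal D_m(z_0)$ is the determinant of the $m\times m$ matrix whose $j$-th row ($1\le j\le m$) has: for columns $i=1,\dots,m-1$, entry $b_{j-i}$ if $i<j$, entry $j^2-jm$ if $i=j$, and $0$ if $i>j$; and in the last column $i=m$ the entry $b_j$. *)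

theory Defs
  imports
    "HOL-Complex_Analysis.Complex_Analysis"
    "Jordan_Normal_Form.Determinant"
begin

text \<open>
  The coefficient next to the leading one. For \<open>P(z) = z^p + a z^(p-1) + O(z^(p-2))\<close> with
  \<open>p = 0\<close> this forces \<open>a = 0\<close>, whereas \<open>coeff P (degree P - 1)\<close> would yield \<open>1\<close>.
\<close>

definition subleading_coeff :: "complex poly \<Rightarrow> complex" where
  "subleading_coeff P =
     (if degree P = 0 then 0 else Polynomial.coeff P (degree P - 1))"

definition admissible :: "complex poly \<Rightarrow> complex poly \<Rightarrow> bool" where
  "admissible P Q \<longleftrightarrow>
     lead_coeff P = 1 \<and> Q \<noteq> 0 \<and> degree P \<le> degree Q \<and>
     (\<exists>H D. degree H = degree Q - degree P \<and>
        (\<forall>z. poly P z \<noteq> 0 \<longrightarrow>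
           poly Q z / poly P z = poly H z + (\<Sum>w | poly P w = 0. D w / (z - w))))"

definition stokes_center :: "complex poly \<Rightarrow> complex poly \<Rightarrow> complex" where
  "stokes_center P Q =
     (let N = degree Q - degree P; a = subleading_coeff P;
          b = lead_coeff Q; c = subleading_coeff Q
      in if N \<ge> 1 then (a * b - c) / (b * of_nat N) else 0)"

definition stokes_angle :: "complex poly \<Rightarrow> complex poly \<Rightarrow> nat \<Rightarrow> real" where
  "stokes_angle P Q k =
     (2 * pi * real k - Arg (lead_coeff Q)) / (real (degree Q - degree P) + 2)"

text \<open>
  The angles \<open>stokes_angle P Q k\<close> may lie outside the range of the principal argument;
  \<open>arg (z - d) \<in> (u, v)\<close> means that some value of the argument lies in the interval.
\<close>

definition open_sector :: "complex \<Rightarrow> real \<Rightarrow> real \<Rightarrow> complex set" where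
  "open_sector d u v = {d + rcis r \<phi> | r \<phi>. r > 0 \<and> u < \<phi> \<and> \<phi> < v}"

definition tends_to_infinity_in_stokes_sector ::
    "complex poly \<Rightarrow> complex poly \<Rightarrow> nat \<Rightarrow> (complex \<Rightarrow> complex) \<Rightarrow> bool" where
  "tends_to_infinity_in_stokes_sector P Q k g \<longleftrightarrow>
     (\<forall>\<^sub>F \<delta> in at_right 0.
        filterlim g at_infinity
          (inf at_infinity (principal (open_sector (stokes_center P Q)
             (stokes_angle P Q k + \<delta>) (stokes_angle P Q (Suc k) - \<delta>)))))"

definition schwarzian_potential :: "complex poly \<Rightarrow> complex poly \<Rightarrow> complex \<Rightarrow> complex" where
  "schwarzian_potential P Q z =
     1 / 2 * (poly (pderiv (pderiv P)) z / poly P z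
              - 3 / 2 * (poly (pderiv P) z / poly P z) ^ 2)
     + poly Q z / poly P z"

text \<open>
  Matrix positions in \<open>mat\<close> count from \<open>0\<close>, hence the shifts \<open>j = Suc r\<close> and \<open>i = Suc s\<close>.
\<close>

definition laine_matrix :: "nat \<Rightarrow> (nat \<Rightarrow> complex) \<Rightarrow> complex mat" where
  "laine_matrix m b = mat m m (\<lambda>(r, s).
     let j = Suc r; i = Suc s in
       if i = m then b j
       else if i < j then b (j - i)
       else if i = j then of_nat j ^ 2 - of_nat j * of_nat m
       else 0)"

text \<open>
  The condition is imposed on \<open>F = 2 R\<close>, but the Laurent expansions are those of \<open>R\<close>;
  the coefficient \<open>b\<^sub>j\<close> belongs to the power \<open>j - 2\<close> of \<open>z - z\<^sub>0\<close>.
\<close>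

definition laine_condition :: "(complex \<Rightarrow> complex) \<Rightarrow> bool" where
  "laine_condition F \<longleftrightarrow>
     (let R = (\<lambda>z. F z / 2) in
      \<forall>z\<^sub>0. is_pole R z\<^sub>0 \<longrightarrow>
        (\<exists>L (m::nat). (\<lambda>h. R (z\<^sub>0 + h)) has_laurent_expansion L \<and>
           m \<ge> 2 \<and>
           (\<forall>n < -2. fls_nth L n = 0) \<and>
           fls_nth L (-2) = (1 - of_nat m ^ 2) / 4 \<and>
           Determinant.det (laine_matrix m (\<lambda>j. fls_nth L (int j - 2))) = 0))"

text \<open>
  At the zeros of \<open>P\<close> the equation has no meaning (division by zero), so it is required only
  away from them; a solution may nevertheless be holomorphic at such points.
\<close>

definition solution_on ::
    "complex poly \<Rightarrow> complex poly \<Rightarrow> complex set \<Rightarrow> (complex \<Rightarrow> complex) \<Rightarrow> bool" where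
  "solution_on P Q U g \<longleftrightarrow>
     g holomorphic_on U \<and>
     (\<forall>z\<in>U. poly P z \<noteq> 0 \<longrightarrow>
        deriv (deriv g) z - poly (pderiv P) z / poly P z * deriv g z
          + poly Q z / poly P z * g z = 0)"

definition fundamental_system ::
    "complex poly \<Rightarrow> complex poly \<Rightarrow> (complex \<Rightarrow> complex) \<Rightarrow> (complex \<Rightarrow> complex) \<Rightarrow> bool" where
  "fundamental_system P Q g\<^sub>1 g\<^sub>2 \<longleftrightarrow>
     solution_on P Q UNIV g\<^sub>1 \<and> solution_on P Q UNIV g\<^sub>2 \<and>
     (\<forall>\<alpha> \<beta>. (\<forall>z. \<alpha> * g\<^sub>1 z + \<beta> * g\<^sub>2 z = 0) \<longrightarrow> \<alpha> = 0 \<and> \<beta> = 0)"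

definition proportional :: "((complex \<times> complex) \<times> (complex \<times> complex)) set" where
  "proportional =
     {((\<alpha>, \<beta>), (\<alpha>', \<beta>')). (\<alpha>, \<beta>) \<noteq> (0, 0) \<and>
        (\<exists>t. t \<noteq> 0 \<and> \<alpha>' = t * \<alpha> \<and> \<beta>' = t * \<beta>)}"

definition projective_line :: "(complex \<times> complex) set set" where
  "projective_line = (UNIV - {(0, 0)}) // proportional"

definition proj_point :: "complex \<Rightarrow> complex \<Rightarrow> (complex \<times> complex) set" where
  "proj_point \<alpha> \<beta> = proportional `` {(\<alpha>, \<beta>)}"

end

theory Submission
  imports Defs "HOL-Real_Asymp.Real_Asymp"
begin

text \<open>
  At a zero of \<open>P\<close> the function \<open>g\<close>, up to a nonvanishing holomorphic factor, satisfies a Fuchsian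
  equation with indices \<open>0\<close> and \<open>m\<close>. The determinant condition is exactly the solvability of the
  Frobenius recursion at the resonance \<open>n = m\<close>, so there are two independent holomorphic solutions
  near every point, with a radius that is uniform on compact sets, and a local solution extends to
  larger and larger discs.

  Near infinity the Liouville transformation \<open>d\<zeta> = sqrt (Q / P) dz\<close>, \<open>g = sqrt (P dz / d\<zeta>) U\<close> turns
  the equation into \<open>U'' + (1 + \<psi>) U = 0\<close> with \<open>\<psi> = O(1 / \<zeta>\<^sup>2)\<close>. Around each Stokes ray this gives
  \<open>U = A e^(i \<zeta>) + B e^(- i \<zeta>)\<close> up to a small relative error. The coefficients \<open>A\<close> and \<open>B\<close> are nonzero
  linear forms in the solution, so outside a finite set of directions all of them are nonzero. Then
  \<open>g\<close> grows exponentially away from the rays, and its zeros form finitely many sequences along which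
  \<open>\<zeta>\<close> is separated. With \<open>c = P / g'\<^sup>2\<close> at the zeros, the difference \<open>P / g\<^sup>2 - \<Sum> c / (z - t)\<^sup>2\<close>
  is entire because the residues vanish, it grows at most like a polynomial, and it tends to \<open>0\<close> along
  the bisector of a Stokes sector; hence it is \<open>0\<close>.
\<close>

section \<open>Frobenius solutions and continuation\<close>

text \<open>The Liouville variable is known only as a primitive \<open>\<Phi>\<close> of a function
  close to 1, so its range is not an explicit domain. The work is therefore done on half planes
  \<open>Re (\<nu> * s) > K\<close>: they are convex, which makes \<open>\<Phi>\<close> injective
  and almost an isometry, and their images are stable under translation to the right. Such
  translations keep the moduli of e^(i zeta) and e^(-i zeta), so the coefficients A and B are limits
  along horizontal rays and all errors are small relative to |A e^(i zeta)| + |B e^(-i zeta)|. This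
  sum never drops below 2 sqrt |A B|, even where the two terms cancel; it thus controls g' at the
  zeros as well as 1 / g away from them. A half plane \<open>Re s > K\<close> would miss the
  imaginary directions, which correspond to the bisectors of the adjacent Stokes sectors. Hence each
  ray gets two half planes, with \<open>\<nu>\<close> of argument pi / 4 and - pi / 4, and two pairs
  of coefficients; all of them have to be nonzero for a generic solution.\<close>

lemma deriv_twice_eqI:
  assumes "open S" "z \<in> S"
    and "\<And>z. z \<in> S \<Longrightarrow> (g has_field_derivative g1 z) (at z)"
    and "\<And>z. z \<in> S \<Longrightarrow> (g1 has_field_derivative g2 z) (at z)"
  shows "deriv g z = g1 z" "deriv (deriv g) z = g2 z"
proof -
  show "deriv g z = g1 z"
    using assms by (simp add: DERIV_imp_deriv)
  have "(deriv g has_field_derivative g2 z) (at z)"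
    by (rule has_field_derivative_transform_within_open[OF assms(4)[OF assms(2)] assms(1,2)])
      (simp add: DERIV_imp_deriv[OF assms(3)])
  then show "deriv (deriv g) z = g2 z" by (rule DERIV_imp_deriv)
qed

text \<open>The power series coefficients for the indices 0 and m. The first m + 1 terms are
  prescribed because the indicial factor n (n - m) vanishes at n = 0 and n = m; beyond m it can be
  divided by.\<close>

fun frobenius_coeff :: "nat \<Rightarrow> (nat \<Rightarrow> complex) \<Rightarrow> (nat \<Rightarrow> complex) \<Rightarrow> nat \<Rightarrow> complex" where
  "frobenius_coeff m b y n =
     (if n \<le> m then y n
      else - (\<Sum>l<n. b (n - l) * frobenius_coeff m b y l) / (of_nat n * (of_nat n - of_nat m)))"

declare frobenius_coeff.simps [simp del]

lemma frobenius_coeff_init: "n \<le> m \<Longrightarrow> frobenius_coeff m b y n = y n"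
  by (subst frobenius_coeff.simps) simp

text \<open>At n = m the factor of \<open>y m\<close> vanishes, so the hypothesis at that index
  restricts the earlier terms only. This is the resonance condition, to be supplied by the vanishing
  determinant.\<close>

lemma frobenius_coeff_rec:
  assumes "\<And>n. n \<le> m \<Longrightarrow>
    of_nat n * (of_nat n - of_nat m) * y n + (\<Sum>l<n. b (n - l) * y l) = 0"
  shows "of_nat n * (of_nat n - of_nat m) * frobenius_coeff m b y n
    + (\<Sum>l<n. b (n - l) * frobenius_coeff m b y l) = 0"
proof (cases "n \<le> m")
  case True
  then have "(\<Sum>l<n. b (n - l) * frobenius_coeff m b y l) = (\<Sum>l<n. b (n - l) * y l)"
    by (intro sum.cong) (auto simp: frobenius_coeff_init)
  with assms[OF True] show ?thesis by (simp add: True frobenius_coeff_init)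
next
  case False
  then have "of_nat n * (of_nat n - of_nat m) \<noteq> (0::complex)"
    by (auto simp: of_nat_eq_iff)
  then show ?thesis
    by (subst frobenius_coeff.simps) (simp add: False)
qed

text \<open>The indicial factor has modulus at least 1 for n > m, and the sum of M (1 + M)^l over l
  < n is (1 + M)^n - 1, so a majorant with ratio (1 + M) / r reproduces itself under the
  recursion.\<close>

lemma frobenius_coeff_bound:
  assumes r: "r > 0" and M: "M > 0" and b: "\<And>j. norm (b j) \<le> M / r ^ j"
  shows "norm (frobenius_coeff m b y n) \<le> (\<Sum>l\<le>m. norm (y l) * (r / (1 + M)) ^ l) * ((1 + M) / r) ^ n"
proof (induction n rule: less_induct)
  case (less n)
  define C where "C = (\<Sum>l\<le>m. norm (y l) * (r / (1 + M)) ^ l)"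
  have C0: "C \<ge> 0" unfolding C_def using r M by (intro sum_nonneg) auto
  have inv: "(r / (1 + M)) ^ n * ((1 + M) / r) ^ n = 1"
    using r M by (simp add: power_mult_distrib[symmetric])
  show ?case
  proof (cases "n \<le> m")
    case True
    have "norm (y n) * (r / (1 + M)) ^ n \<le> C"
      unfolding C_def using True r M by (intro member_le_sum) auto
    then have "norm (y n) * (r / (1 + M)) ^ n * ((1 + M) / r) ^ n \<le> C * ((1 + M) / r) ^ n"
      using r M by (intro mult_right_mono) auto
    then show ?thesis using inv True by (simp add: frobenius_coeff_init C_def mult.assoc)
  next
    case False
    have ge1: "1 \<le> norm (of_nat n * (of_nat n - of_nat m) :: complex)"
    proof -
      have "of_nat n * (of_nat n - of_nat m) = (of_nat (n * (n - m)) :: complex)"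
        using False by (simp add: of_nat_diff)
      then have "norm (of_nat n * (of_nat n - of_nat m) :: complex) = real (n * (n - m))"
        by (metis norm_of_nat)
      moreover have "n * (n - m) \<ge> 1" using False by simp
      ultimately show ?thesis by linarith
    qed
    have "norm (frobenius_coeff m b y n) \<le> norm (\<Sum>l<n. b (n - l) * frobenius_coeff m b y l) / 1"
      by (subst frobenius_coeff.simps, simp only: False if_False norm_divide norm_minus_cancel)
        (intro divide_left_mono, use ge1 False in auto)
    also have "\<dots> \<le> (\<Sum>l<n. norm (b (n - l) * frobenius_coeff m b y l))"
      by (simp add: norm_sum)
    also have "\<dots> \<le> (\<Sum>l<n. M * C / r ^ n * (1 + M) ^ l)"
    proof (rule sum_mono)
      fix l assume l: "l \<in> {..<n}"
      have "norm (b (n - l) * frobenius_coeff m b y l) \<le> (M / r ^ (n - l)) * (C * ((1 + M) / r) ^ l)"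
        unfolding norm_mult using less.IH[of l] b[of "n - l"] l r M
        by (intro mult_mono) (auto simp: C_def)
      also have "\<dots> = M * C * (1 + M) ^ l / (r ^ (n - l) * r ^ l)"
        by (simp add: power_divide)
      also have "r ^ (n - l) * r ^ l = r ^ n"
        using l by (simp add: power_add[symmetric])
      finally show "norm (b (n - l) * frobenius_coeff m b y l) \<le> M * C / r ^ n * (1 + M) ^ l"
        by simp
    qed
    also have "\<dots> = M * C / r ^ n * (\<Sum>l<n. (1 + M) ^ l)"
      by (simp add: sum_distrib_left)
    also have "(\<Sum>l<n. (1 + M) ^ l) = ((1 + M) ^ n - 1) / M"
      using M geometric_sum[of "1 + M" n] by simp
    also have "M * C / r ^ n * (((1 + M) ^ n - 1) / M) \<le> C / r ^ n * (1 + M) ^ n"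
      using M C0 r by (simp add: field_simps)
    finally show ?thesis by (simp add: C_def power_divide)
  qed
qed

lemma conv_radius_frobenius_coeff_pos:
  assumes "0 < conv_radius b"
  shows "0 < conv_radius (frobenius_coeff m b y)"
proof -
  obtain r where r: "r > 0" "ereal r < conv_radius b"
    using assms by (metis ereal_dense2 less_ereal.simps(1) zero_ereal_def)
  have "summable (\<lambda>n. b n * of_real r ^ n)"
    using r by (intro summable_in_conv_radius) auto
  then have "Bseq (\<lambda>n. b n * of_real r ^ n)"
    using summable_LIMSEQ_zero convergentI convergent_imp_Bseq by blast
  then obtain M where M: "M > 0" "\<And>n. norm (b n * of_real r ^ n) \<le> M" by (auto elim: BseqE)
  then have b: "norm (b n) \<le> M / r ^ n" for n
    using r M(2)[of n] by (simp add: norm_mult norm_power field_simps)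
  define C where "C = (\<Sum>l\<le>m. norm (y l) * (r / (1 + M)) ^ l)"
  \<comment> \<open>Half of the radius r / (1 + M) that the majorant allows, so that the terms decay
    like 2^(-n).\<close>
  define z where "z = complex_of_real (r / (2 * (1 + M)))"
  have nz: "norm z = r / (2 * (1 + M))" using r M unfolding z_def by (subst norm_of_real) simp
  have "norm (frobenius_coeff m b y n * z ^ n) \<le> C * (1 / 2) ^ n" for n
  proof -
    have "norm (frobenius_coeff m b y n * z ^ n) \<le> C * ((1 + M) / r) ^ n * (r / (2 * (1 + M))) ^ n"
      unfolding norm_mult norm_power nz C_def
      using frobenius_coeff_bound[of r M b m y n, OF r(1) M(1) b] r M by (intro mult_right_mono) auto
    also have "\<dots> = C * ((1 + M) / r * (r / (2 * (1 + M)))) ^ n"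
      by (simp only: power_mult_distrib mult.assoc)
    also have "(1 + M) / r * (r / (2 * (1 + M))) = 1 / 2" using r M by (simp add: divide_simps)
    finally show ?thesis .
  qed
  moreover have "summable (\<lambda>n. C * (1 / 2) ^ n :: real)"
    by (intro summable_mult summable_geometric) auto
  ultimately have "summable (\<lambda>n. frobenius_coeff m b y n * z ^ n)"
    by (rule summable_comparison_test'[where N = 0, rotated])
  then have "ereal (norm z) \<le> conv_radius (frobenius_coeff m b y)" by (rule conv_radius_geI)
  moreover have "norm z > 0" using nz r M by simp
  ultimately show ?thesis by (metis ereal_less(2) less_le_trans)
qed

text \<open>In the application B = x^2 R and B(0) = (1 - m^2) / 4. The equation is then y'' + R y =
  0 written for Y = x^((m - 1) / 2) y; removing the power turns the indices into 0 and m, with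
  indicial polynomial n (n - m).\<close>

lemma frobenius_solution:
  fixes B :: "complex fps"
  assumes "0 < fps_conv_radius B"
    and eqs: "\<And>n. n \<le> m \<Longrightarrow>
      of_nat n * (of_nat n - of_nat m) * y n + (\<Sum>l<n. fps_nth B (n - l) * y l) = 0"
  obtains Y where "0 < fps_conv_radius Y" "\<And>n. n \<le> m \<Longrightarrow> fps_nth Y n = y n"
    "\<And>x::complex. ereal (norm x) < fps_conv_radius B \<Longrightarrow> ereal (norm x) < fps_conv_radius Y \<Longrightarrow>
       x ^ 2 * eval_fps (fps_deriv (fps_deriv Y)) x
       + (1 - of_nat m) * x * eval_fps (fps_deriv Y) x
       + (eval_fps B x - fps_nth B 0) * eval_fps Y x = 0"
proof -
  define c where "c = frobenius_coeff m (fps_nth B) y"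
  define Y where "Y = Abs_fps c"
  have nthY: "fps_nth Y = c" by (simp add: Y_def fun_eq_iff)
  have rad: "0 < fps_conv_radius Y"
    unfolding fps_conv_radius_def nthY c_def using assms(1)
    by (intro conv_radius_frobenius_coeff_pos) (simp add: fps_conv_radius_def)
  have eq: "fps_X ^ 2 * fps_deriv (fps_deriv Y) + fps_const (1 - of_nat m) * fps_X * fps_deriv Y
      + (B - fps_const (fps_nth B 0)) * Y = 0" (is "?F = 0")
  proof (rule fps_ext)
    fix n
    have 1: "fps_nth (fps_X ^ 2 * fps_deriv (fps_deriv Y)) n = of_nat n * (of_nat n - 1) * c n"
    proof (cases "n < 2")
      case True
      then have "n = 0 \<or> n = 1" by auto
      then show ?thesis by (auto simp: fps_X_power_mult_nth)
    next
      case False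
      then obtain k where "n = Suc (Suc k)" by (metis add_2_eq_Suc le_add_diff_inverse linorder_not_less)
      then show ?thesis by (simp add: fps_X_power_mult_nth nthY)
    qed
    have 2: "fps_nth (fps_const (1 - of_nat m) * fps_X * fps_deriv Y) n = (1 - of_nat m) * of_nat n * c n"
      by (cases n) (auto simp: mult.assoc nthY)
    have "fps_nth ((B - fps_const (fps_nth B 0)) * Y) n
        = (\<Sum>l = 0..n. c l * fps_nth (B - fps_const (fps_nth B 0)) (n - l))"
      by (subst mult.commute) (simp add: fps_mult_nth nthY)
    also have "{0..n} = insert n {..<n}" by auto
    also have "(\<Sum>l\<in>insert n {..<n}. c l * fps_nth (B - fps_const (fps_nth B 0)) (n - l))
        = (\<Sum>l<n. fps_nth B (n - l) * c l)"
      by (simp add: mult.commute) 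
    finally have 3: "fps_nth ((B - fps_const (fps_nth B 0)) * Y) n = (\<Sum>l<n. fps_nth B (n - l) * c l)" .
    have "of_nat n * (of_nat n - of_nat m) * c n + (\<Sum>l<n. fps_nth B (n - l) * c l) = 0"
      unfolding c_def by (rule frobenius_coeff_rec) (rule eqs)
    then show "fps_nth ?F n = fps_nth 0 n"
      by (simp only: fps_add_nth 1 2 3 fps_zero_nth) (simp add: algebra_simps)
  qed
  show ?thesis
  proof (rule that[of Y])
    show "0 < fps_conv_radius Y" by (rule rad)
    show "fps_nth Y n = y n" if "n \<le> m" for n
      using that by (simp add: nthY c_def frobenius_coeff_init)
    fix x :: complex assume x: "ereal (norm x) < fps_conv_radius B" "ereal (norm x) < fps_conv_radius Y"
    have d1: "ereal (norm x) < fps_conv_radius (fps_deriv Y)"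
      using x(2) fps_conv_radius_deriv by (metis less_le_trans)
    have d2: "ereal (norm x) < fps_conv_radius (fps_deriv (fps_deriv Y))"
      using d1 fps_conv_radius_deriv by (metis less_le_trans)
    have X: "fps_conv_radius (fps_X ^ 2 :: complex fps) = \<infinity>" by simp
    have cX: "ereal (norm x) < fps_conv_radius (fps_const (1 - of_nat m) * fps_X :: complex fps)"
      by (rule less_le_trans[OF _ fps_conv_radius_mult]) auto
    have m1: "ereal (norm x) < fps_conv_radius (fps_X ^ 2 * fps_deriv (fps_deriv Y))"
      by (rule less_le_trans[OF _ fps_conv_radius_mult]) (use d2 in auto)
    have m2: "ereal (norm x) < fps_conv_radius (fps_const (1 - of_nat m) * fps_X * fps_deriv Y)"
      by (rule less_le_trans[OF _ fps_conv_radius_mult]) (use d1 cX in auto)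
    have s3: "ereal (norm x) < fps_conv_radius (B - fps_const (fps_nth B 0))"
      by (rule less_le_trans[OF _ fps_conv_radius_diff]) (use x in auto)
    have m3: "ereal (norm x) < fps_conv_radius ((B - fps_const (fps_nth B 0)) * Y)"
      by (rule less_le_trans[OF _ fps_conv_radius_mult]) (use x s3 in auto)
    have m12: "ereal (norm x) < fps_conv_radius (fps_X ^ 2 * fps_deriv (fps_deriv Y)
        + fps_const (1 - of_nat m) * fps_X * fps_deriv Y)"
      by (rule less_le_trans[OF _ fps_conv_radius_add]) (use m1 m2 in auto)
    have "eval_fps ?F x = 0" unfolding eq by simp
    then show "x ^ 2 * eval_fps (fps_deriv (fps_deriv Y)) x
       + (1 - of_nat m) * x * eval_fps (fps_deriv Y) x
       + (eval_fps B x - fps_nth B 0) * eval_fps Y x = 0"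
      using x d1 d2 cX m1 m2 s3 m3 m12
      by (simp add: eval_fps_add eval_fps_mult eval_fps_diff)
  qed
qed

text \<open>Row j is the recursion at index j. Columns i < m carry the unknown y_i and the last
  column carries y_0; y_m does not occur, since its factor at j = m is 0. A kernel vector with y_0 =
  0 would vanish by forward substitution because j^2 - j m is nonzero for 0 < j < m, so it can be
  normalised to y_0 = 1.\<close>

lemma laine_matrix_kernel:
  assumes "Determinant.det (laine_matrix m b) = 0" "m \<ge> 1"
  obtains y where "y 0 = (1::complex)"
    "\<And>n. n \<le> m \<Longrightarrow> of_nat n * (of_nat n - of_nat m) * y n + (\<Sum>l<n. b (n - l) * y l) = 0"
proof -
  obtain m' where m': "m = Suc m'" using assms(2) by (metis Suc_le_D One_nat_def)
  have "laine_matrix m b \<in> carrier_mat m m" by (simp add: laine_matrix_def)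
  then obtain v where v: "v \<in> carrier_vec m" "v \<noteq> 0\<^sub>v m" "laine_matrix m b *\<^sub>v v = 0\<^sub>v m"
    using assms(1) det_0_iff_vec_prod_zero by blast
  \<comment> \<open>The last entry of the kernel vector is the coefficient at index 0, the others
    are shifted by one, and the free coefficient at index m is set to 0.\<close>
  define G where "G l = (case l of 0 \<Rightarrow> vec_index v m' | Suc s \<Rightarrow> if s < m' then vec_index v s else 0)" for l
  have eqs: "of_nat n * (of_nat n - of_nat m) * G n + (\<Sum>l<n. b (n - l) * G l) = 0" if "n \<le> m" for n
  proof (cases n)
    case 0 then show ?thesis by simp
  next
    case (Suc r)
    then have r: "r < m" "r \<le> m'" using that m' by auto
    have "0 = vec_index (laine_matrix m b *\<^sub>v v) r" using v r by simp
    also have "\<dots> = (\<Sum>s<m. laine_matrix m b $$ (r, s) * vec_index v s)"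
      using r v(1) by (simp add: laine_matrix_def scalar_prod_def row_def atLeast0LessThan)
    also have "\<dots> = (\<Sum>s<m'. laine_matrix m b $$ (r, s) * G (Suc s)) + b (Suc r) * G 0"
      using r by (simp add: m' laine_matrix_def G_def)
    also have "(\<Sum>s<m'. laine_matrix m b $$ (r, s) * G (Suc s))
       = (\<Sum>s<m'. (if s < r then b (r - s) else if s = r
            then of_nat (Suc r) ^ 2 - of_nat (Suc r) * of_nat m else 0) * G (Suc s))"
      using r m' by (intro sum.cong) (auto simp: laine_matrix_def Let_def)
    also have "\<dots> = (\<Sum>s<r. b (r - s) * G (Suc s)) + of_nat n * (of_nat n - of_nat m) * G n"
    proof (cases "r = m'")
      case True
      then show ?thesis by (simp add: m' Suc)
    next
      case False
      then have sub: "{..<Suc r} \<subseteq> {..<m'}" using r by auto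
      have "(\<Sum>s<m'. (if s < r then b (r - s) else if s = r
            then of_nat (Suc r) ^ 2 - of_nat (Suc r) * of_nat m else 0) * G (Suc s))
         = (\<Sum>s<Suc r. (if s < r then b (r - s) else if s = r
            then of_nat (Suc r) ^ 2 - of_nat (Suc r) * of_nat m else 0) * G (Suc s))"
        using sub by (intro sum.mono_neutral_right) auto
      also have "\<dots> = (\<Sum>s<r. b (r - s) * G (Suc s)) + of_nat n * (of_nat n - of_nat m) * G n"
        by (simp add: Suc power2_eq_square algebra_simps)
      finally show ?thesis .
    qed
    finally have "(\<Sum>s<r. b (r - s) * G (Suc s)) + of_nat n * (of_nat n - of_nat m) * G n + b n * G 0 = 0"
      using Suc by (simp only:)
    moreover have "(\<Sum>l<n. b (n - l) * G l) = b n * G 0 + (\<Sum>s<r. b (r - s) * G (Suc s))"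
      unfolding Suc by (subst sum.lessThan_Suc_shift) simp
    ultimately show ?thesis by (simp only: add_ac)
  qed
  have G0: "G 0 \<noteq> 0"
  proof
    assume z: "G 0 = 0"
    have "G n = 0" if "n < m" for n using that
    proof (induction n rule: less_induct)
      case (less n)
      have "(\<Sum>l<n. b (n - l) * G l) = 0" using less by (intro sum.neutral) auto
      then have "of_nat n * (of_nat n - of_nat m) * G n = 0" using eqs[of n] less.prems by simp
      then show ?case using z less.prems by (cases "n = 0") (auto simp: of_nat_eq_iff)
    qed
    note Gz = this
    have "vec_index v s = 0" if "s < m" for s
    proof (cases "s = m'")
      case True then show ?thesis using z by (simp add: G_def)
    next
      case False
      then have "s < m'" "Suc s < m" using that m' by auto
      then show ?thesis using Gz[of "Suc s"] by (simp add: G_def)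
    qed
    then have "v = 0\<^sub>v m" using v(1) by (intro eq_vecI) auto
    then show False using v by simp
  qed
  show ?thesis
  proof (rule that[of "\<lambda>n. G n / G 0"])
    show "G 0 / G 0 = 1" using G0 by simp
    fix n assume "n \<le> m"
    have "of_nat n * (of_nat n - of_nat m) * (G n / G 0) + (\<Sum>l<n. b (n - l) * (G l / G 0))
      = (of_nat n * (of_nat n - of_nat m) * G n + (\<Sum>l<n. b (n - l) * G l)) / G 0"
      by (simp add: add_divide_distrib sum_divide_distrib)
    then show "of_nat n * (of_nat n - of_nat m) * (G n / G 0) + (\<Sum>l<n. b (n - l) * (G l / G 0)) = 0"
      using eqs[OF \<open>n \<le> m\<close>] by simp
  qed
qed

section \<open>Local form of the equation at a point and its Frobenius basis\<close>

text \<open>The factor L keeps the exponent at k; the derivative of L^k alone would involve k - 1,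
  which truncates at k = 0.\<close>

lemma linear_times_pderiv_power:
  fixes A :: "complex poly" and w :: complex
  defines "L \<equiv> [:- w, 1:]"
  shows "L * pderiv (L ^ k * A) = L ^ k * (of_nat k * A + L * pderiv A)"
proof -
  have "pderiv L = 1" by (simp add: L_def pderiv_pCons)
  have "L * pderiv (L ^ k) = of_nat k * L ^ k"
  proof (cases k)
    case (Suc n)
    have "pderiv (L ^ Suc n) = Polynomial.smult (of_nat (Suc n)) (L ^ n)"
      by (simp only: pderiv_power_Suc \<open>pderiv L = 1\<close> mult_1_right)
    then show ?thesis by (simp add: Suc of_nat_poly)
  qed simp
  then show ?thesis by (simp add: pderiv_mult algebra_simps)
qed

lemma poly_log_derivs:
  fixes A :: "complex poly"
  assumes P: "P = [:- w, 1:] ^ k * A" and z: "z \<noteq> w" "poly A z \<noteq> 0"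
  shows "poly (pderiv P) z / poly P z = of_nat k / (z - w) + poly (pderiv A) z / poly A z" (is ?th1)
    and "poly (pderiv (pderiv P)) z / poly P z = of_nat k * (of_nat k - 1) / (z - w) ^ 2
      + 2 * of_nat k / (z - w) * (poly (pderiv A) z / poly A z) + poly (pderiv (pderiv A)) z / poly A z" (is ?th2)
proof -
  define L where "L = [:- w, 1:]"
  define A1 where "A1 = of_nat k * A + L * pderiv A"
  have dL: "pderiv L = 1" by (simp add: L_def pderiv_pCons)
  have pL: "poly L z = z - w" by (simp add: L_def)
  have e1: "L * pderiv P = L ^ k * A1"
    unfolding A1_def P L_def by (rule linear_times_pderiv_power)
  have "L * pderiv (L * pderiv P) = L ^ k * (of_nat k * A1 + L * pderiv A1)"
    unfolding e1 unfolding L_def by (rule linear_times_pderiv_power)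
  then have e2: "L * (pderiv P + L * pderiv (pderiv P)) = L ^ k * (of_nat k * A1 + L * pderiv A1)"
    by (simp add: pderiv_mult dL algebra_simps)
  have dA1: "pderiv A1 = of_nat k * pderiv A + pderiv A + L * pderiv (pderiv A)"
    by (simp add: A1_def pderiv_add pderiv_mult dL of_nat_poly pderiv_smult)
  define x where "x = z - w"
  have x: "x \<noteq> 0" using z by (simp add: x_def)
  have Pz: "poly P z = x ^ k * poly A z" by (simp add: P x_def poly_power)
  have 1: "x * poly (pderiv P) z = x ^ k * (of_nat k * poly A z + x * poly (pderiv A) z)"
    using arg_cong[OF e1, of "\<lambda>p. poly p z"]
    by (simp add: pL A1_def x_def poly_power)
  then have q1: "poly (pderiv P) z = x ^ k * (of_nat k * poly A z + x * poly (pderiv A) z) / x"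
    using x by (simp add: field_simps)
  have 2: "x * (poly (pderiv P) z + x * poly (pderiv (pderiv P)) z)
    = x ^ k * (of_nat k * (of_nat k * poly A z + x * poly (pderiv A) z)
       + x * (of_nat k * poly (pderiv A) z + poly (pderiv A) z + x * poly (pderiv (pderiv A)) z))"
    using arg_cong[OF e2, of "\<lambda>p. poly p z"]
    by (simp add: pL dA1 x_def poly_power) (simp add: A1_def pL algebra_simps)
  then have "x * x * poly (pderiv (pderiv P)) z
    = x ^ k * (of_nat k * (of_nat k - 1) * poly A z + 2 * of_nat k * x * poly (pderiv A) z
       + x * x * poly (pderiv (pderiv A)) z)"
    using 1 by (simp add: algebra_simps)
  then have q2: "poly (pderiv (pderiv P)) z
    = x ^ k * (of_nat k * (of_nat k - 1) * poly A z + 2 * of_nat k * x * poly (pderiv A) z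
       + x * x * poly (pderiv (pderiv A)) z) / (x * x)"
    using x by (simp add: field_simps)
  show ?th1
    unfolding q1 Pz x_def[symmetric] using x z by (simp add: field_simps)
  show ?th2
    unfolding q2 Pz x_def[symmetric] using x z by (simp add: field_simps power2_eq_square)
qed

lemma schwarzian_algebra:
  fixes x :: complex
  assumes "x \<noteq> 0"
  shows "1/2 * (k * (k - 1) + 2 * k * x * a1 + x^2 * a2 - 3/2 * (k + x * a1)^2) + (x^2 * h + x^2 * s)
    = x^2 * (1/2 * (k * (k - 1) / x^2 + 2 * k / x * a1 + a2 - 3/2 * (k / x + a1)^2) + (h + s))"
  using assms by (simp add: field_simps power2_eq_square)

text \<open>Simple poles of Q / P leave the coefficient of (z - w)^(-2) in the potential
  untouched.\<close>

lemma tendsto_sum_simple_poles: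
  assumes "finite S"
  shows "((\<lambda>z. (z - w) ^ 2 * (\<Sum>v\<in>S. D v / (z - v))) \<longlongrightarrow> 0) (at (w::complex))"
proof -
  have "((\<lambda>z. (z - w) ^ 2 * (D v / (z - v))) \<longlongrightarrow> 0) (at w)" for v
  proof (cases "v = w")
    case True
    have "((\<lambda>z. (z - w) * D v) \<longlongrightarrow> (w - w) * D v) (at w)" by (intro tendsto_intros)
    then have "((\<lambda>z. (z - w) * D v) \<longlongrightarrow> 0) (at w)" by simp
    moreover have "\<forall>\<^sub>F z in at w. (z - w) * D v = (z - w) ^ 2 * (D v / (z - v))"
      using eventually_at_ball[of 1 w UNIV] True by (auto simp: eventually_at power2_eq_square intro: exI[of _ 1])
    ultimately show ?thesis by (rule Lim_transform_eventually)
  next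
    case False
    have "((\<lambda>z. (z - w) ^ 2 * (D v / (z - v))) \<longlongrightarrow> (w - w) ^ 2 * (D v / (w - v))) (at w)"
      using False by (intro tendsto_intros) auto
    then show ?thesis by simp
  qed
  then have "((\<lambda>z. \<Sum>v\<in>S. (z - w) ^ 2 * (D v / (z - v))) \<longlongrightarrow> (\<Sum>v\<in>S. 0)) (at w)"
    by (intro tendsto_sum)
  then show ?thesis by (simp add: sum_distrib_left)
qed

lemma admissible_poly_nz: "admissible P Q \<Longrightarrow> P \<noteq> 0"
  unfolding admissible_def by auto

text \<open>At a zero of order k the Schwarzian part contributes (k (k - 1) - 3/2 k^2) / 2 = (1 - (k
  + 1)^2) / 4. Comparison with the Laine condition will force m = k + 1.\<close>

lemma schwarzian_potential_limit:
  assumes adm: "admissible P Q" and k: "k = order w P"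
  shows "((\<lambda>x. x ^ 2 * schwarzian_potential P Q (w + x)) \<longlongrightarrow> (1 - of_nat (Suc k) ^ 2) / 4) (at 0)"
proof -
  have P0: "P \<noteq> 0" using adm by (rule admissible_poly_nz)
  obtain A where A: "P = [:- w, 1:] ^ k * A" "\<not> [:- w, 1:] dvd A"
    using order_decomp[OF P0, of w] k by blast
  have Aw: "poly A w \<noteq> 0" using A(2) by (simp add: poly_eq_0_iff_dvd)
  obtain H D where HD: "\<And>z. poly P z \<noteq> 0 \<Longrightarrow>
       poly Q z / poly P z = poly H z + (\<Sum>v | poly P v = 0. D v / (z - v))"
    using adm unfolding admissible_def by metis
  have evA: "\<forall>\<^sub>F z in at w. z \<noteq> w \<and> poly A z \<noteq> 0"
  proof (rule eventually_conj)
    show "\<forall>\<^sub>F z in at w. z \<noteq> w" by (simp add: eventually_at_filter)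
    show "\<forall>\<^sub>F z in at w. poly A z \<noteq> 0"
      using Aw by (intro tendsto_imp_eventually_ne[of "poly A" "poly A w"] isContD) auto
  qed
  define f where "f z = 1/2 * (of_nat k * (of_nat k - 1) + 2 * of_nat k * (z - w) * (poly (pderiv A) z / poly A z)
      + (z - w)^2 * (poly (pderiv (pderiv A)) z / poly A z)
      - 3 / 2 * (of_nat k + (z - w) * (poly (pderiv A) z / poly A z)) ^ 2)
      + ((z - w)^2 * poly H z + (z - w)^2 * (\<Sum>v | poly P v = 0. D v / (z - v)))" for z
  have "(f \<longlongrightarrow> 1/2 * (of_nat k * (of_nat k - 1) + 2 * of_nat k * (w - w) * (poly (pderiv A) w / poly A w)
      + (w - w)^2 * (poly (pderiv (pderiv A)) w / poly A w)
      - 3 / 2 * (of_nat k + (w - w) * (poly (pderiv A) w / poly A w)) ^ 2)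
      + ((w - w)^2 * poly H w + 0)) (at w)"
    unfolding f_def using Aw P0
    by (intro tendsto_intros tendsto_sum_simple_poles isContD) (auto intro: poly_roots_finite)
  also have "1/2 * (of_nat k * (of_nat k - 1) + 2 * of_nat k * (w - w) * (poly (pderiv A) w / poly A w)
      + (w - w)^2 * (poly (pderiv (pderiv A)) w / poly A w)
      - 3 / 2 * (of_nat k + (w - w) * (poly (pderiv A) w / poly A w)) ^ 2)
      + ((w - w)^2 * poly H w + 0) = (1 - of_nat (Suc k) ^ 2) / 4"
    by (simp add: field_simps power2_eq_square)
  finally have lim: "(f \<longlongrightarrow> (1 - of_nat (Suc k) ^ 2) / 4) (at w)" .
  have "((\<lambda>z. (z - w) ^ 2 * schwarzian_potential P Q z) \<longlongrightarrow> (1 - of_nat (Suc k) ^ 2) / 4) (at w)"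
  proof (rule Lim_transform_eventually[OF lim])
    show "\<forall>\<^sub>F z in at w. f z = (z - w)\<^sup>2 * schwarzian_potential P Q z"
      using evA
    proof (rule eventually_mono)
      fix z assume z: "z \<noteq> w \<and> poly A z \<noteq> 0"
      then have "poly P z \<noteq> 0" by (simp add: A(1))
      note q = HD[OF this]
      define x where "x = z - w"
      have x: "x \<noteq> 0" using z by (simp add: x_def)
      show "f z = (z - w)\<^sup>2 * schwarzian_potential P Q z"
        unfolding f_def schwarzian_potential_def q poly_log_derivs(1)[OF A(1) conjunct1[OF z] conjunct2[OF z]]
          poly_log_derivs(2)[OF A(1) conjunct1[OF z] conjunct2[OF z]] x_def[symmetric]
        by (rule schwarzian_algebra[OF x])
    qed
  qed
  then show ?thesis
    by (subst (asm) LIM_offset_zero_iff) (simp_all add: add.commute)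
qed

text \<open>At a zero of P the data come from the Laine condition, with m identified through the
  double pole coefficient. At a regular point m = 1, and the resonance condition holds because x^2 R
  has no linear term.\<close>

lemma local_frobenius_data:
  assumes adm: "admissible P Q" and laine: "laine_condition (\<lambda>z. 2 * schwarzian_potential P Q z)"
    and k: "k = order w P"
  obtains B y where "0 < fps_conv_radius B"
    "\<forall>\<^sub>F x in at 0. eval_fps B x = x ^ 2 * schwarzian_potential P Q (w + x)"
    "fps_nth B 0 = (1 - of_nat (Suc k) ^ 2) / 4" "y 0 = 1"
    "\<And>n. n \<le> Suc k \<Longrightarrow>
      of_nat n * (of_nat n - of_nat (Suc k)) * y n + (\<Sum>l<n. fps_nth B (n - l) * y l) = 0"
proof (cases "k = 0")
  case True
  define R where "R = schwarzian_potential P Q"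
  have "poly P w \<noteq> 0" using True k admissible_poly_nz[OF adm] by (simp add: order_root)
  moreover have "open {z. poly P z \<noteq> 0}"
    by (intro open_Collect_neq continuous_intros)
  moreover have "R holomorphic_on {z. poly P z \<noteq> 0}"
    unfolding R_def schwarzian_potential_def by (intro holomorphic_intros) auto
  ultimately have "R analytic_on {w}" unfolding analytic_at by blast
  then have "(\<lambda>x. R (w + x)) has_fps_expansion fps_expansion R w"
    by (rule analytic_at_imp_has_fps_expansion)
  then have "(\<lambda>x. x ^ 2 * R (w + x)) has_fps_expansion fps_X ^ 2 * fps_expansion R w"
    by (intro fps_expansion_intros)
  then have e: "0 < fps_conv_radius (fps_X ^ 2 * fps_expansion R w)"
    "\<forall>\<^sub>F x in nhds 0. eval_fps (fps_X ^ 2 * fps_expansion R w) x = x ^ 2 * R (w + x)"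
    unfolding has_fps_expansion_def by auto
  show ?thesis
  proof (rule that[of "fps_X ^ 2 * fps_expansion R w" "\<lambda>n. if n = 0 then 1 else 0"])
    show "0 < fps_conv_radius (fps_X\<^sup>2 * fps_expansion R w)" by (rule e)
    show "\<forall>\<^sub>F x in at 0. eval_fps (fps_X\<^sup>2 * fps_expansion R w) x = x\<^sup>2 * schwarzian_potential P Q (w + x)"
      using e(2) unfolding R_def eventually_at_filter by (rule eventually_mono) simp
    fix n assume "n \<le> Suc k"
    then have "n = 0 \<or> n = 1" using True by auto
    then show "of_nat n * (of_nat n - of_nat (Suc k)) * (if n = 0 then 1 else 0 :: complex)
      + (\<Sum>l<n. fps_nth (fps_X\<^sup>2 * fps_expansion R w) (n - l) * (if l = 0 then 1 else 0)) = 0"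
      by (auto simp: fps_X_power_mult_nth)
  qed (use True in \<open>auto simp: fps_X_power_mult_nth\<close>)
next
  case False
  define R where "R = schwarzian_potential P Q"
  define c where "c = (1 - of_nat (Suc k) ^ 2) / (4 :: complex)"
  have lim: "((\<lambda>x. x ^ 2 * R (w + x)) \<longlongrightarrow> c) (at 0)"
    unfolding R_def c_def by (rule schwarzian_potential_limit[OF adm k])
  \<comment> \<open>A nonzero double pole coefficient makes w a genuine pole of R, which is where
    the Laine condition applies.\<close>
  have "c \<noteq> 0"
  proof
    assume "c = 0"
    then have "(of_nat (Suc k ^ 2) :: complex) = of_nat 1" by (simp add: c_def)
    then have "Suc k ^ 2 = 1" by (simp only: of_nat_eq_iff)
    then show False using False by simp
  qed
  have "((\<lambda>z. (z - w) ^ 2 * R z) \<longlongrightarrow> c) (at w)"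
    using lim by (subst LIM_offset_zero_iff) (simp_all add: add.commute)
  moreover have "filterlim (\<lambda>z. (z - w) ^ 2) (at 0) (at w)"
  proof -
    have "((\<lambda>z. (z - w) ^ 2) \<longlongrightarrow> (w - w) ^ 2) (at w)" by (intro tendsto_intros)
    then show ?thesis by (auto simp: filterlim_at eventually_at_filter)
  qed
  ultimately have "filterlim (\<lambda>z. ((z - w) ^ 2 * R z) / (z - w) ^ 2) at_infinity (at w)"
    using \<open>c \<noteq> 0\<close> by (intro filterlim_divide_at_infinity)
  then have "is_pole R w"
    unfolding is_pole_def
    by (rule filterlim_cong[THEN iffD1, rotated -1]) (auto simp: eventually_at_filter)
  then obtain L m where L: "(\<lambda>h. R (w + h)) has_laurent_expansion L" "m \<ge> 2"
    "\<And>n. n < -2 \<Longrightarrow> fls_nth L n = 0" "fls_nth L (-2) = (1 - of_nat m ^ 2) / 4"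
    "Determinant.det (laine_matrix m (\<lambda>j. fls_nth L (int j - 2))) = 0"
    using laine unfolding laine_condition_def R_def Let_def by auto
  define B where "B = Abs_fps (\<lambda>j. fls_nth L (int j - 2))"
  have BL: "fps_to_fls B = fls_X_intpow 2 * L"
  proof (rule fls_eqI)
    fix n show "fls_nth (fps_to_fls B) n = fls_nth (fls_X_intpow 2 * L) n"
      using L(3)[of "n - 2"] by (auto simp: B_def fls_X_intpow_times_conv_shift)
  qed
  have "(\<lambda>x. x powi 2 * R (w + x)) has_laurent_expansion fps_to_fls B"
    unfolding BL by (intro laurent_expansion_intros L(1))
  then have "0 < fps_conv_radius B" and evB: "\<forall>\<^sub>F x in at 0. eval_fls (fps_to_fls B) x = x powi 2 * R (w + x)"
    unfolding has_laurent_expansion_def by auto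
  have "\<forall>\<^sub>F x in at 0. x \<in> eball 0 (fps_conv_radius B)"
    using \<open>0 < fps_conv_radius B\<close> by (intro eventually_at_in_open') (auto simp: zero_ereal_def)
  with evB have ev: "\<forall>\<^sub>F x in at 0. eval_fps B x = x ^ 2 * R (w + x)"
    by eventually_elim (simp add: eval_fps_to_fls)
  have "isCont (eval_fps B) 0"
    using \<open>0 < fps_conv_radius B\<close> by (intro continuous_eval_fps) (auto simp: zero_ereal_def)
  then have "(eval_fps B \<longlongrightarrow> fps_nth B 0) (at 0)" by (simp add: isCont_def eval_fps_at_0)
  then have "((\<lambda>x. x ^ 2 * R (w + x)) \<longlongrightarrow> fps_nth B 0) (at 0)"
    by (rule Lim_transform_eventually) (use ev in auto)
  then have cB: "fps_nth B 0 = c" using lim by (metis LIM_unique)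
  \<comment> \<open>The limit and the Laurent expansion have the same leading coefficient; equal
    squares of natural numbers give m = Suc k.\<close>
  then have "(of_nat (Suc k) ^ 2 :: complex) = of_nat m ^ 2"
    using L(4) by (simp add: c_def B_def field_simps)
  then have "(of_nat (Suc k ^ 2) :: complex) = of_nat (m ^ 2)" by simp
  then have "Suc k ^ 2 = m ^ 2" by (simp only: of_nat_eq_iff)
  then have mk: "m = Suc k" by (simp add: power2_eq_iff_nonneg)
  obtain y where y: "y 0 = (1::complex)"
    "\<And>n. n \<le> m \<Longrightarrow> of_nat n * (of_nat n - of_nat m) * y n + (\<Sum>l<n. fls_nth L (int (n - l) - 2) * y l) = 0"
    using laine_matrix_kernel[OF L(5)] L(2) by auto
  show ?thesis
    using that[of B y] \<open>0 < fps_conv_radius B\<close> ev cB y by (simp add: R_def c_def mk B_def)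
qed

text \<open>The substitution g = e h, where P = (z - w)^k A and e^2 = A. Here \<open>a1\<close> and
  \<open>a2\<close> stand for A' / A and A'' / A, so that e' = e a1 / 2 and e'' = e (a2 / 2 - a1^2 /
  4); \<open>h0\<close>, \<open>h1\<close>, \<open>h2\<close> stand for h, h', h'', and
  \<open>q\<close> for Q / P.\<close>

lemma gauged_equation:
  fixes x :: complex
  assumes "x \<noteq> 0"
    and R: "R = 1/2 * (k * (k - 1) / x^2 + 2 * k / x * a1 + a2 - 3/2 * (k / x + a1)^2) + q"
    and eq: "x^2 * h2 + (1 - (k + 1)) * x * h1 + (x^2 * R - (1 - (k + 1)^2) / 4) * h0 = 0"
  shows "e * ((a2 / 2 - a1^2 / 4) * h0 + a1 * h1 + h2) - (k / x + a1) * (e * (a1 / 2 * h0 + h1))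
    + q * (e * h0) = 0"
proof -
  have "e * ((a2 / 2 - a1^2 / 4) * h0 + a1 * h1 + h2) - (k / x + a1) * (e * (a1 / 2 * h0 + h1))
    + q * (e * h0) = e / x^2 * (x^2 * h2 + (1 - (k + 1)) * x * h1 + (x^2 * R - (1 - (k + 1)^2) / 4) * h0)"
    unfolding R using \<open>x \<noteq> 0\<close> by (simp add: field_simps power2_eq_square)
  then show ?thesis unfolding eq by simp
qed

lemma eval_fps_shift_has_derivative:
  fixes Y :: "complex fps"
  assumes "ereal (norm (z - w)) < fps_conv_radius Y"
  shows "((\<lambda>z. eval_fps Y (z - w)) has_field_derivative eval_fps (fps_deriv Y) (z - w)) (at z)"
proof -
  have "((\<lambda>z. z - w) has_field_derivative 1) (at z)" by (auto intro!: derivative_eq_intros)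
  from DERIV_chain2[OF has_field_derivative_eval_fps[OF assms] this] show ?thesis by simp
qed

lemma local_solution:
  fixes Y :: "complex fps"
  assumes P: "P = [:- w, 1:] ^ k * A" and A: "\<And>z. z \<in> ball w r \<Longrightarrow> poly A z \<noteq> 0"
    and e: "e holomorphic_on ball w r" "\<And>z. z \<in> ball w r \<Longrightarrow> poly A z = e z ^ 2"
    and Y: "ereal r \<le> fps_conv_radius Y"
    and ode: "\<And>z. z \<in> ball w r \<Longrightarrow> z \<noteq> w \<Longrightarrow>
      (z - w) ^ 2 * eval_fps (fps_deriv (fps_deriv Y)) (z - w)
       + (1 - (of_nat k + 1)) * (z - w) * eval_fps (fps_deriv Y) (z - w)
       + ((z - w) ^ 2 * schwarzian_potential P Q z - (1 - (of_nat k + 1) ^ 2) / 4) * eval_fps Y (z - w) = 0"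
  shows "solution_on P Q (ball w r) (\<lambda>z. e z * eval_fps Y (z - w))"
    and "\<And>z. z \<in> ball w r \<Longrightarrow> deriv (\<lambda>z. e z * eval_fps Y (z - w)) z
      = poly (pderiv A) z / (2 * e z) * eval_fps Y (z - w) + e z * eval_fps (fps_deriv Y) (z - w)"
proof -
  define g0 where "g0 z = e z * eval_fps Y (z - w)" for z
  define e1 where "e1 z = poly (pderiv A) z / (2 * e z)" for z
  define e2 where "e2 z = poly (pderiv (pderiv A)) z / (2 * e z)
      - poly (pderiv A) z * e1 z / (2 * e z ^ 2)" for z
  define g1 where "g1 z = e1 z * eval_fps Y (z - w) + e z * eval_fps (fps_deriv Y) (z - w)" for z
  define g2 where "g2 z = e2 z * eval_fps Y (z - w) + 2 * e1 z * eval_fps (fps_deriv Y) (z - w)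
    + e z * eval_fps (fps_deriv (fps_deriv Y)) (z - w)" for z
  have enz: "e z \<noteq> 0" if "z \<in> ball w r" for z using A[OF that] e(2)[OF that] by auto
  have rad: "ereal (norm (z - w)) < fps_conv_radius Y"
    "ereal (norm (z - w)) < fps_conv_radius (fps_deriv Y)" if "z \<in> ball w r" for z
  proof -
    have "ereal (norm (z - w)) < ereal r" using that by (simp add: dist_norm norm_minus_commute)
    then show *: "ereal (norm (z - w)) < fps_conv_radius Y" using Y by (metis less_le_trans)
    then show "ereal (norm (z - w)) < fps_conv_radius (fps_deriv Y)"
      using fps_conv_radius_deriv by (metis less_le_trans)
  qed
  have de: "(e has_field_derivative e1 z) (at z)" if z: "z \<in> ball w r" for z
  proof -
    have d: "(e has_field_derivative deriv e z) (at z)"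
      using e(1) z by (simp add: holomorphic_derivI)
    have "((\<lambda>z. e z ^ 2) has_field_derivative 2 * e z * deriv e z) (at z)"
      by (auto intro!: derivative_eq_intros d)
    moreover have "((\<lambda>z. e z ^ 2) has_field_derivative poly (pderiv A) z) (at z)"
      by (rule has_field_derivative_transform_within_open[OF poly_DERIV open_ball z]) (use e(2) in auto)
    ultimately have "2 * e z * deriv e z = poly (pderiv A) z" by (rule DERIV_unique)
    then have "deriv e z = e1 z" using enz[OF z] by (simp add: e1_def field_simps)
    then show ?thesis using d by simp
  qed
  have de1: "(e1 has_field_derivative e2 z) (at z)" if z: "z \<in> ball w r" for z
    unfolding e1_def using enz[OF z]
    by (auto intro!: derivative_eq_intros de[OF z] poly_DERIV simp: e2_def field_simps power2_eq_square)
  have d0: "(g0 has_field_derivative g1 z) (at z)" if z: "z \<in> ball w r" for z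
    unfolding g0_def
    by (rule DERIV_cong[OF DERIV_mult[OF de[OF z] eval_fps_shift_has_derivative[OF rad(1)[OF z]]]])
      (simp add: g1_def algebra_simps)
  have d1: "(g1 has_field_derivative g2 z) (at z)" if z: "z \<in> ball w r" for z
    unfolding g1_def
    by (rule DERIV_cong[OF DERIV_add[OF DERIV_mult[OF de1[OF z] eval_fps_shift_has_derivative[OF rad(1)[OF z]]]
      DERIV_mult[OF de[OF z] eval_fps_shift_has_derivative[OF rad(2)[OF z]]]]])
      (simp add: g2_def algebra_simps)
  have dd: "deriv g0 z = g1 z" "deriv (deriv g0) z = g2 z" if "z \<in> ball w r" for z
    using deriv_twice_eqI[OF open_ball that d0 d1] by auto
  show "deriv (\<lambda>z. e z * eval_fps Y (z - w)) z
      = poly (pderiv A) z / (2 * e z) * eval_fps Y (z - w) + e z * eval_fps (fps_deriv Y) (z - w)"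
    if "z \<in> ball w r" for z
    using dd(1)[OF that] by (simp add: g0_def[abs_def] g1_def e1_def)
  have off: "deriv (deriv g0) z - poly (pderiv P) z / poly P z * deriv g0 z + poly Q z / poly P z * g0 z = 0"
    if z: "z \<in> ball w r" and False: "z \<noteq> w" for z
  proof -
    define x where "x = z - w"
    have x: "x \<noteq> 0" using False by (simp add: x_def)
    define a1 where "a1 = poly (pderiv A) z / poly A z"
    define a2 where "a2 = poly (pderiv (pderiv A)) z / poly A z"
    define q where "q = poly Q z / poly P z"
    note ld = poly_log_derivs[OF P False A[OF z]]
    have R: "schwarzian_potential P Q z = 1/2 * (of_nat k * (of_nat k - 1) / x^2
        + 2 * of_nat k / x * a1 + a2 - 3/2 * (of_nat k / x + a1)^2) + q"
      unfolding schwarzian_potential_def ld by (simp add: x_def a1_def a2_def q_def)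
    have Ae: "poly A z = e z ^ 2" using e(2)[OF z] .
    have E1: "e1 z = e z * (a1 / 2)"
      unfolding e1_def a1_def Ae using enz[OF z] by (simp add: field_simps power2_eq_square)
    have E2: "e2 z = e z * (a2 / 2 - a1 ^ 2 / 4)"
      unfolding e2_def E1 unfolding a1_def a2_def Ae using enz[OF z]
      by (simp add: field_simps power2_eq_square)
    have "e z * ((a2 / 2 - a1^2 / 4) * eval_fps Y x + a1 * eval_fps (fps_deriv Y) x
          + eval_fps (fps_deriv (fps_deriv Y)) x)
        - (of_nat k / x + a1) * (e z * (a1 / 2 * eval_fps Y x + eval_fps (fps_deriv Y) x))
        + q * (e z * eval_fps Y x) = 0"
      by (rule gauged_equation[OF x R]) (use ode[OF z False] in \<open>simp add: x_def\<close>)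
    then show ?thesis
      unfolding dd[OF z] ld(1) g0_def g1_def g2_def E1 E2 x_def[symmetric] q_def[symmetric] a1_def[symmetric]
      by (simp add: algebra_simps)
  qed
  have "solution_on P Q (ball w r) g0"
    unfolding solution_on_def
  proof (intro conjI ballI impI)
    show "g0 holomorphic_on ball w r" using d0 unfolding holomorphic_on_open[OF open_ball] by blast
    fix z assume z: "z \<in> ball w r" and Pz: "poly P z \<noteq> 0"
    show "deriv (deriv g0) z - poly (pderiv P) z / poly P z * deriv g0 z + poly Q z / poly P z * g0 z = 0"
    proof (cases "z = w")
      case False
      then show ?thesis using off z by blast
    next
      case True
      \<comment> \<open>The Fuchsian form degenerates at the centre; if P is nonzero there, the
        equation follows by continuity from the punctured ball.\<close>
      then have "k = 0" using Pz unfolding P by (auto simp: poly_power)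
      define F where "F z = deriv (deriv g0) z - poly (pderiv P) z / poly P z * deriv g0 z
        + poly Q z / poly P z * g0 z" for z
      have hol: "g0 holomorphic_on ball w r" using d0 unfolding holomorphic_on_open[OF open_ball] by blast
      have "F holomorphic_on ball w r"
        unfolding F_def using A by (intro holomorphic_intros hol) (auto simp: P \<open>k = 0\<close>)
      then have "(F \<longlongrightarrow> F w) (at w)"
        using z True by (metis continuous_on_eq_continuous_at holomorphic_on_imp_continuous_on isCont_def open_ball)
      moreover have "\<forall>\<^sub>F z in at w. F z = 0"
        using eventually_at_in_open[OF open_ball, of w w r]
      proof (rule eventually_mono)
        show "w \<in> ball w r" using z True by simp
        fix z assume "z \<in> ball w r - {w}"
        then show "F z = 0" unfolding F_def using off by (auto simp: P \<open>k = 0\<close> A)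
      qed
      then have "(F \<longlongrightarrow> 0) (at w)" by (rule tendsto_eventually)
      ultimately have "F w = 0" by (metis LIM_unique)
      then show ?thesis using True by (simp add: F_def)
    qed
  qed
  then show "solution_on P Q (ball w r) (\<lambda>z. e z * eval_fps Y (z - w))"
    by (simp add: g0_def[abs_def])
qed

text \<open>The two Frobenius series start with 1 and with x^(k + 1). Their Wronskian has k + 1 as
  coefficient of x^k, so it is not identically zero and has no zeros in a small punctured ball; the
  gauge factor merely multiplies it by e^2.\<close>

lemma local_basis:
  assumes adm: "admissible P Q" and laine: "laine_condition (\<lambda>z. 2 * schwarzian_potential P Q z)"
  obtains r f1 f2 where "r > 0"
    "solution_on P Q (ball w r) f1" "solution_on P Q (ball w r) f2"
    "\<And>z. z \<in> ball w r \<Longrightarrow> z \<noteq> w \<Longrightarrow> poly P z \<noteq> 0"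
    "\<And>z. z \<in> ball w r \<Longrightarrow> z \<noteq> w \<Longrightarrow> f1 z * deriv f2 z - deriv f1 z * f2 z \<noteq> 0"
proof -
  define k where "k = order w P"
  have P0: "P \<noteq> 0" using adm by (rule admissible_poly_nz)
  obtain A where A: "P = [:- w, 1:] ^ k * A" "\<not> [:- w, 1:] dvd A"
    using order_decomp[OF P0, of w] k_def by blast
  have Aw: "poly A w \<noteq> 0" using A(2) by (simp add: poly_eq_0_iff_dvd)
  obtain B y where B: "0 < fps_conv_radius B"
    "\<forall>\<^sub>F x in at 0. eval_fps B x = x ^ 2 * schwarzian_potential P Q (w + x)"
    "fps_nth B 0 = (1 - of_nat (Suc k) ^ 2) / 4" "y 0 = 1"
    "\<And>n. n \<le> Suc k \<Longrightarrow>
      of_nat n * (of_nat n - of_nat (Suc k)) * y n + (\<Sum>l<n. fps_nth B (n - l) * y l) = 0"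
    using local_frobenius_data[OF adm laine k_def] by blast
  \<comment> \<open>A sequence that vanishes below the resonance index satisfies the recursion
    trivially up to that index.\<close>
  have eq2: "of_nat n * (of_nat n - of_nat (Suc k)) * (if n = Suc k then 1 else 0)
      + (\<Sum>l<n. fps_nth B (n - l) * (if l = Suc k then 1 else 0)) = 0" if "n \<le> Suc k" for n
    using that by (auto intro!: sum.neutral)
  obtain Y1 where Y1: "0 < fps_conv_radius Y1" "\<And>n. n \<le> Suc k \<Longrightarrow> fps_nth Y1 n = y n"
    "\<And>x::complex. ereal (norm x) < fps_conv_radius B \<Longrightarrow> ereal (norm x) < fps_conv_radius Y1 \<Longrightarrow>
       x ^ 2 * eval_fps (fps_deriv (fps_deriv Y1)) x
       + (1 - of_nat (Suc k)) * x * eval_fps (fps_deriv Y1) x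
       + (eval_fps B x - fps_nth B 0) * eval_fps Y1 x = 0"
    using frobenius_solution[OF B(1,5)] by blast
  obtain Y2 where Y2: "0 < fps_conv_radius Y2"
    "\<And>n. n \<le> Suc k \<Longrightarrow> fps_nth Y2 n = (if n = Suc k then 1 else 0)"
    "\<And>x::complex. ereal (norm x) < fps_conv_radius B \<Longrightarrow> ereal (norm x) < fps_conv_radius Y2 \<Longrightarrow>
       x ^ 2 * eval_fps (fps_deriv (fps_deriv Y2)) x
       + (1 - of_nat (Suc k)) * x * eval_fps (fps_deriv Y2) x
       + (eval_fps B x - fps_nth B 0) * eval_fps Y2 x = 0"
    using frobenius_solution[OF B(1) eq2] by blast
  define W where "W = Y1 * fps_deriv Y2 - fps_deriv Y1 * Y2"
  have "fps_nth (Y1 * fps_deriv Y2) k = (\<Sum>i=0..k. if i = 0 then of_nat (Suc k) else 0)"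
    unfolding fps_mult_nth by (rule sum.cong) (auto simp: Y1(2) Y2(2) B(4))
  moreover have "fps_nth (fps_deriv Y1 * Y2) k = 0"
    unfolding fps_mult_nth by (rule sum.neutral) (auto simp: Y2(2))
  ultimately have "fps_nth W k = of_nat (Suc k)" by (simp add: W_def)
  then have "W \<noteq> 0" by (metis fps_zero_nth of_nat_neq_0)
  have r1: "0 < fps_conv_radius (fps_deriv Y1)" "0 < fps_conv_radius (fps_deriv Y2)"
    using Y1(1) Y2(1) fps_conv_radius_deriv by (metis less_le_trans)+
  have "eval_fps W has_fps_expansion W"
    unfolding has_fps_expansion_def W_def
    using Y1(1) Y2(1) r1
    by (auto intro!: less_le_trans[OF _ fps_conv_radius_diff] less_le_trans[OF _ fps_conv_radius_mult])
  then have evW: "\<forall>\<^sub>F x in at 0. eval_fps W x \<noteq> 0"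
    using \<open>W \<noteq> 0\<close> has_laurent_expansion_eventually_nonzero_iff'[OF has_laurent_expansion_fps]
    by (metis fps_to_fls_eq_0_iff)
  obtain d where d: "d > 0" "\<And>x. x \<noteq> 0 \<Longrightarrow> norm x < d \<Longrightarrow>
      eval_fps W x \<noteq> 0 \<and> eval_fps B x = x ^ 2 * schwarzian_potential P Q (w + x)"
    using eventually_conj[OF evW B(2)] unfolding eventually_at by (auto simp: dist_norm)
  have "isCont (poly A) w" by simp
  then obtain d' where d': "d' > 0" "\<And>z. dist w z < d' \<Longrightarrow> poly A z \<noteq> 0"
    using continuous_at_avoid[of w "poly A" 0] Aw by blast
  define R where "R = Min {ereal d, ereal d', fps_conv_radius B, fps_conv_radius Y1, fps_conv_radius Y2}"
  have "0 < R" using d(1) d'(1) B(1) Y1(1) Y2(1) unfolding R_def by (auto simp: zero_ereal_def)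
  then obtain r where r: "0 < r" "ereal r < R" by (metis ereal_dense2 ereal_less(2))
  have rR: "r < d" "r < d'" "ereal r < fps_conv_radius B" "ereal r < fps_conv_radius Y1"
    "ereal r < fps_conv_radius Y2"
    using r(2) unfolding R_def by auto
  have Anz: "poly A z \<noteq> 0" if "z \<in> ball w r" for z using that rR(2) d'(2) by auto
  have "contractible (ball w r)" by (simp add: convex_imp_contractible)
  moreover have "poly A holomorphic_on ball w r" by (intro holomorphic_intros)
  ultimately obtain e where e: "e holomorphic_on ball w r" "\<And>z. z \<in> ball w r \<Longrightarrow> poly A z = e z ^ 2"
    using contractible_imp_holomorphic_sqrt[of "poly A" "ball w r"] Anz by metis
  have ode: "(z - w) ^ 2 * eval_fps (fps_deriv (fps_deriv Y)) (z - w)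
       + (1 - (of_nat k + 1)) * (z - w) * eval_fps (fps_deriv Y) (z - w)
       + ((z - w) ^ 2 * schwarzian_potential P Q z - (1 - (of_nat k + 1) ^ 2) / 4) * eval_fps Y (z - w) = 0"
    if z: "z \<in> ball w r" "z \<noteq> w" and rY: "ereal r < fps_conv_radius Y"
    and Y: "\<And>x::complex. ereal (norm x) < fps_conv_radius B \<Longrightarrow> ereal (norm x) < fps_conv_radius Y \<Longrightarrow>
       x ^ 2 * eval_fps (fps_deriv (fps_deriv Y)) x
       + (1 - of_nat (Suc k)) * x * eval_fps (fps_deriv Y) x
       + (eval_fps B x - fps_nth B 0) * eval_fps Y x = 0" for z Y
  proof -
    have n: "norm (z - w) < r" using z by (simp add: dist_norm norm_minus_commute)
    then have n': "ereal (norm (z - w)) < ereal r" by simp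
    have "eval_fps B (z - w) = (z - w) ^ 2 * schwarzian_potential P Q z"
      using d(2)[of "z - w"] n rR(1) z by simp
    then show ?thesis
      using Y[of "z - w"] less_trans[OF n' rR(3)] less_trans[OF n' rY] B(3) by (simp add: add.commute)
  qed
  have sol1: "solution_on P Q (ball w r) (\<lambda>z. e z * eval_fps Y1 (z - w))"
    and der1: "\<And>z. z \<in> ball w r \<Longrightarrow> deriv (\<lambda>z. e z * eval_fps Y1 (z - w)) z
      = poly (pderiv A) z / (2 * e z) * eval_fps Y1 (z - w) + e z * eval_fps (fps_deriv Y1) (z - w)"
    using local_solution[OF A(1) Anz e less_imp_le[OF rR(4)] ode[OF _ _ rR(4) Y1(3)]] by blast+
  have sol2: "solution_on P Q (ball w r) (\<lambda>z. e z * eval_fps Y2 (z - w))"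
    and der2: "\<And>z. z \<in> ball w r \<Longrightarrow> deriv (\<lambda>z. e z * eval_fps Y2 (z - w)) z
      = poly (pderiv A) z / (2 * e z) * eval_fps Y2 (z - w) + e z * eval_fps (fps_deriv Y2) (z - w)"
    using local_solution[OF A(1) Anz e less_imp_le[OF rR(5)] ode[OF _ _ rR(5) Y2(3)]] by blast+
  show ?thesis
  proof (rule that[OF r(1) sol1 sol2])
    fix z assume z: "z \<in> ball w r" "z \<noteq> w"
    show "poly P z \<noteq> 0" unfolding A(1) using Anz z by (simp add: poly_power)
    define x where "x = z - w"
    have n': "ereal (norm x) < ereal r" using z by (simp add: x_def dist_norm norm_minus_commute)
    have rx: "ereal (norm x) < fps_conv_radius Y1" "ereal (norm x) < fps_conv_radius Y2"
      using less_trans[OF n'] rR by auto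
    then have rx': "ereal (norm x) < fps_conv_radius (fps_deriv Y1)" "ereal (norm x) < fps_conv_radius (fps_deriv Y2)"
      using fps_conv_radius_deriv by (metis less_le_trans)+
    have m: "ereal (norm x) < fps_conv_radius (Y1 * fps_deriv Y2)"
      "ereal (norm x) < fps_conv_radius (fps_deriv Y1 * Y2)"
      using rx rx' by (auto intro!: less_le_trans[OF _ fps_conv_radius_mult])
    have W: "eval_fps W x = eval_fps Y1 x * eval_fps (fps_deriv Y2) x - eval_fps (fps_deriv Y1) x * eval_fps Y2 x"
      unfolding W_def using rx rx' m by (simp add: eval_fps_diff eval_fps_mult)
    have enz: "e z \<noteq> 0" using Anz[OF z(1)] e(2)[OF z(1)] by auto
    have "e z * eval_fps Y1 (z - w) * deriv (\<lambda>z. e z * eval_fps Y2 (z - w)) z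
      - deriv (\<lambda>z. e z * eval_fps Y1 (z - w)) z * (e z * eval_fps Y2 (z - w)) = e z ^ 2 * eval_fps W x"
      unfolding der1[OF z(1)] der2[OF z(1)] W x_def[symmetric] using enz
      by (simp add: field_simps power2_eq_square)
    also have "\<dots> \<noteq> 0" using enz d(2)[of x] n' rR(1) z by (simp add: x_def)
    finally show "e z * eval_fps Y1 (z - w) * deriv (\<lambda>z. e z * eval_fps Y2 (z - w)) z
      - deriv (\<lambda>z. e z * eval_fps Y1 (z - w)) z * (e z * eval_fps Y2 (z - w)) \<noteq> 0" .
  qed
qed

section \<open>Uniqueness and continuation of solutions\<close>

lemma solution_on_subset: "solution_on P Q U f \<Longrightarrow> V \<subseteq> U \<Longrightarrow> solution_on P Q V f"
  unfolding solution_on_def using holomorphic_on_subset by blast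

lemma solution_on_cong:
  assumes "open V" "\<And>z. z \<in> V \<Longrightarrow> f z = g z" "solution_on P Q V f"
  shows "solution_on P Q V g"
proof -
  have d: "deriv f z = deriv g z" if "z \<in> V" for z
    using assms that by (intro deriv_cong_ev) (auto simp: eventually_nhds)
  moreover have "deriv (deriv f) z = deriv (deriv g) z" if "z \<in> V" for z
    using assms(1) that d by (intro deriv_cong_ev) (auto simp: eventually_nhds)
  moreover have "g holomorphic_on V"
    using assms holomorphic_cong[of V V f g] by (auto simp: solution_on_def)
  ultimately show ?thesis using assms(2,3) unfolding solution_on_def by auto
qed

lemma solution_on_lincomb:
  assumes "open V" "solution_on P Q V f" "solution_on P Q V g"
  shows "solution_on P Q V (\<lambda>z. \<alpha> * f z + \<beta> * g z)"
proof -
  have h: "f holomorphic_on V" "g holomorphic_on V" using assms by (auto simp: solution_on_def)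
  have d: "((\<lambda>z. \<alpha> * f z + \<beta> * g z) has_field_derivative \<alpha> * deriv f z + \<beta> * deriv g z) (at z)"
    if "z \<in> V" for z
    using h assms(1) that by (auto intro!: derivative_eq_intros holomorphic_derivI)
  have d2: "((\<lambda>z. \<alpha> * deriv f z + \<beta> * deriv g z) has_field_derivative
      \<alpha> * deriv (deriv f) z + \<beta> * deriv (deriv g) z) (at z)" if "z \<in> V" for z
    using h assms(1) that
    by (auto intro!: derivative_eq_intros holomorphic_derivI[OF holomorphic_deriv[OF _ assms(1)]])
  have dd: "deriv (\<lambda>z. \<alpha> * f z + \<beta> * g z) z = \<alpha> * deriv f z + \<beta> * deriv g z"
    "deriv (deriv (\<lambda>z. \<alpha> * f z + \<beta> * g z)) z = \<alpha> * deriv (deriv f) z + \<beta> * deriv (deriv g) z"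
    if "z \<in> V" for z
    using deriv_twice_eqI[OF assms(1) that d d2] by blast+
  show ?thesis
    unfolding solution_on_def
  proof (intro conjI ballI impI)
    show "(\<lambda>z. \<alpha> * f z + \<beta> * g z) holomorphic_on V" by (intro holomorphic_intros h)
    fix z assume z: "z \<in> V" "poly P z \<noteq> 0"
    define p q where "p = poly (pderiv P) z / poly P z" and "q = poly Q z / poly P z"
    have "deriv (deriv f) z - p * deriv f z + q * f z = 0" "deriv (deriv g) z - p * deriv g z + q * g z = 0"
      using assms(2,3) z unfolding solution_on_def p_def q_def by auto
    then have "\<alpha> * (deriv (deriv f) z - p * deriv f z + q * f z) + \<beta> * (deriv (deriv g) z - p * deriv g z + q * g z) = 0"
      by simp
    then show "deriv (deriv (\<lambda>z. \<alpha> * f z + \<beta> * g z)) z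
        - poly (pderiv P) z / poly P z * deriv (\<lambda>z. \<alpha> * f z + \<beta> * g z) z
        + poly Q z / poly P z * (\<alpha> * f z + \<beta> * g z) = 0"
      unfolding dd[OF z(1)] p_def[symmetric] q_def[symmetric] by (simp add: algebra_simps)
  qed
qed

text \<open>Abel's identity: the coefficient of g' is - P' / P, so a Wronskian is a constant
  multiple of P on a connected set free of zeros of P.\<close>

lemma wronskian_quotient_constant:
  assumes V: "open V" "connected V" and P: "\<And>z. z \<in> V \<Longrightarrow> poly P z \<noteq> 0"
    and f: "solution_on P Q V f" and g: "solution_on P Q V g" and z: "z \<in> V" "z' \<in> V"
  shows "(f z * deriv g z - deriv f z * g z) / poly P z = (f z' * deriv g z' - deriv f z' * g z') / poly P z'"
proof -
  have h: "f holomorphic_on V" "g holomorphic_on V" using f g by (auto simp: solution_on_def)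
  have der: "((\<lambda>z. (f z * deriv g z - deriv f z * g z) / poly P z) has_field_derivative 0) (at z)"
    if z: "z \<in> V" for z
  proof -
    define f1 f2 g1 g2 where "f1 = deriv f z" "f2 = deriv (deriv f) z" "g1 = deriv g z" "g2 = deriv (deriv g) z"
    have e: "f2 = poly (pderiv P) z / poly P z * f1 - poly Q z / poly P z * f z"
      "g2 = poly (pderiv P) z / poly P z * g1 - poly Q z / poly P z * g z"
      using f g z P[OF z] unfolding solution_on_def f1_f2_g1_g2_def by (auto simp: algebra_simps)
    have d: "(f has_field_derivative f1) (at z)" "(g has_field_derivative g1) (at z)"
      "(deriv f has_field_derivative f2) (at z)" "(deriv g has_field_derivative g2) (at z)"
      unfolding f1_f2_g1_g2_def using h V z
      by (auto intro!: holomorphic_derivI holomorphic_derivI[OF holomorphic_deriv[OF _ V(1)]])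
    show ?thesis
      using P[OF z]
      by (auto intro!: derivative_eq_intros d poly_DERIV simp: f1_f2_g1_g2_def(1,3)[symmetric])
        (simp add: e field_simps)
  qed
  have "continuous_on V (\<lambda>z. (f z * deriv g z - deriv f z * g z) / poly P z)"
    using der V(1) by (meson DERIV_isCont continuous_at_imp_continuous_on)
  then obtain c where "\<And>z. z \<in> V \<Longrightarrow> (f z * deriv g z - deriv f z * g z) / poly P z = c"
    using DERIV_zero_connected_constant[OF V(2,1) finite.emptyI, of "\<lambda>z. (f z * deriv g z - deriv f z * g z) / poly P z"]
      der by auto
  then show ?thesis using z by simp
qed

text \<open>Vanishing data at one point annihilate the Wronskians of f with both basis solutions, by
  Abel's identity on the connected set. The identity f W(f1, f2) = f1 W(f, f2) - f2 W(f, f1) then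
  gives f = 0, and continuity covers the centre.\<close>

lemma solution_zero_of_initial_data:
  assumes basis: "solution_on P Q (ball w r) f1" "solution_on P Q (ball w r) f2"
    "\<And>z. z \<in> ball w r \<Longrightarrow> z \<noteq> w \<Longrightarrow> poly P z \<noteq> 0"
    "\<And>z. z \<in> ball w r \<Longrightarrow> z \<noteq> w \<Longrightarrow> f1 z * deriv f2 z - deriv f1 z * f2 z \<noteq> 0"
    and V: "open V" "connected V" "V \<subseteq> ball w r"
    and f: "solution_on P Q V f"
    and init: "z1 \<in> V" "poly P z1 \<noteq> 0" "f z1 = 0" "deriv f z1 = 0"
    and z: "z \<in> V"
  shows "f z = 0"
proof -
  \<comment> \<open>Deleting one point keeps an open connected subset of the plane connected; after
    this P has no zeros.\<close>
  define V' where "V' = (if poly P w = 0 then V - {w} else V)"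
  have V': "open V'" "connected V'" "V' \<subseteq> V" "z1 \<in> V'"
    using V init by (auto simp: V'_def intro: connected_open_delete)
  have PV': "poly P z \<noteq> 0" if "z \<in> V'" for z
    using that basis(3)[of z] V(3) by (cases "z = w") (auto simp: V'_def split: if_splits)
  have off: "f z = 0" if z: "z \<in> V" "z \<noteq> w" for z
  proof -
    have zV': "z \<in> V'" using z by (simp add: V'_def)
    have "f z * deriv g z - deriv f z * g z = 0" if "solution_on P Q (ball w r) g" for g
    proof -
      have "solution_on P Q V' g" "solution_on P Q V' f"
        using solution_on_subset that f V' V(3) by blast+
      from wronskian_quotient_constant[OF V'(1,2) PV' this(2,1) zV' V'(4)]
      show ?thesis using init PV'[OF zV'] by simp
    qed
    note e1 = this[OF basis(1)] and e2 = this[OF basis(2)]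
    have "f z * (f1 z * deriv f2 z - deriv f1 z * f2 z)
      = f1 z * (f z * deriv f2 z - deriv f z * f2 z) - f2 z * (f z * deriv f1 z - deriv f z * f1 z)"
      by (simp add: algebra_simps)
    also have "\<dots> = 0" by (simp add: e1 e2)
    finally show ?thesis using basis(4)[of z] z V(3) by auto
  qed
  show ?thesis
  proof (cases "z = w")
    case True
    have "isCont f w"
      using f z True V(1) unfolding solution_on_def
      by (metis continuous_on_eq_continuous_at holomorphic_on_imp_continuous_on)
    then have "(f \<longlongrightarrow> f w) (at w)" by (simp add: isCont_def)
    moreover have "\<forall>\<^sub>F z in at w. f z = 0"
      using eventually_at_in_open[OF V(1), of w] z True off by (auto elim!: eventually_mono)
    then have "(f \<longlongrightarrow> 0) (at w)" by (rule tendsto_eventually)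
    ultimately show ?thesis using True by (metis LIM_unique)
  qed (use off z in auto)
qed

text \<open>This gives meaning to the coefficients P / g'^2: by uniqueness for the initial value
  problem, a multiple zero off the zeros of P forces g = 0, first locally and then by the identity
  theorem.\<close>

lemma entire_solution_simple_zero:
  assumes adm: "admissible P Q" and laine: "laine_condition (\<lambda>z. 2 * schwarzian_potential P Q z)"
    and g: "solution_on P Q UNIV g" and t: "poly P t \<noteq> 0" "g t = 0" "deriv g t = 0"
  shows "g z = 0"
proof -
  obtain r f1 f2 where b: "r > 0"
    "solution_on P Q (ball t r) f1" "solution_on P Q (ball t r) f2"
    "\<And>z. z \<in> ball t r \<Longrightarrow> z \<noteq> t \<Longrightarrow> poly P z \<noteq> 0"
    "\<And>z. z \<in> ball t r \<Longrightarrow> z \<noteq> t \<Longrightarrow> f1 z * deriv f2 z - deriv f1 z * f2 z \<noteq> 0"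
    using local_basis[OF adm laine, of t] by metis
  have zero: "g z = 0" if "z \<in> ball t r" for z
    by (rule solution_zero_of_initial_data[OF b(2-5) open_ball connected_ball subset_refl
      solution_on_subset[OF g subset_UNIV] _ t that]) (use b(1) in auto)
  have "t islimpt ball t r" using b(1) by (simp add: islimpt_ball)
  then show ?thesis
    using analytic_continuation[of g UNIV "ball t r" t z] g zero by (auto simp: solution_on_def)
qed

text \<open>The radius depends on the centre alone, not on the solution or its domain: every
  solution on a connected piece of the ball is a combination of the same two basis
  solutions.\<close>

lemma local_extension:
  assumes adm: "admissible P Q" and laine: "laine_condition (\<lambda>z. 2 * schwarzian_potential P Q z)"
  obtains r where "r > 0"
    "\<And>V f. open V \<Longrightarrow> connected V \<Longrightarrow> V \<noteq> {} \<Longrightarrow> V \<subseteq> ball w r \<Longrightarrow> solution_on P Q V f \<Longrightarrow>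
       \<exists>F. solution_on P Q (ball w r) F \<and> (\<forall>z\<in>V. F z = f z)"
proof -
  obtain r f1 f2 where b: "r > 0"
    "solution_on P Q (ball w r) f1" "solution_on P Q (ball w r) f2"
    "\<And>z. z \<in> ball w r \<Longrightarrow> z \<noteq> w \<Longrightarrow> poly P z \<noteq> 0"
    "\<And>z. z \<in> ball w r \<Longrightarrow> z \<noteq> w \<Longrightarrow> f1 z * deriv f2 z - deriv f1 z * f2 z \<noteq> 0"
    using local_basis[OF adm laine, of w] by metis
  show ?thesis
  proof (rule that[OF b(1)])
    fix V f assume V: "open V" "connected V" "V \<noteq> {}" "V \<subseteq> ball w r" and f: "solution_on P Q V f"
    obtain z1 where z1: "z1 \<in> V" "z1 \<noteq> w"
      using V(1,3) not_open_singleton[of w] by (metis insertI1 subset_singletonD subsetI singletonD)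
    then have z1b: "z1 \<in> ball w r" using V by auto
    define W where "W = f1 z1 * deriv f2 z1 - deriv f1 z1 * f2 z1"
    have W: "W \<noteq> 0" using b(5)[OF z1b z1(2)] by (simp add: W_def)
    \<comment> \<open>Cramer's rule for the value and the derivative at \<open>z1\<close>.\<close>
    define \<alpha> \<beta> where "\<alpha> = (f z1 * deriv f2 z1 - deriv f z1 * f2 z1) / W"
      and "\<beta> = (f1 z1 * deriv f z1 - deriv f1 z1 * f z1) / W"
    define F where "F = (\<lambda>z. \<alpha> * f1 z + \<beta> * f2 z)"
    have F: "solution_on P Q (ball w r) F"
      unfolding F_def by (intro solution_on_lincomb open_ball b)
    have hol: "f1 holomorphic_on ball w r" "f2 holomorphic_on ball w r" "f holomorphic_on V"
      using b f by (auto simp: solution_on_def)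
    have dF: "(F has_field_derivative \<alpha> * deriv f1 z1 + \<beta> * deriv f2 z1) (at z1)"
      unfolding F_def using hol z1b by (auto intro!: derivative_eq_intros holomorphic_derivI)
    have df: "(f has_field_derivative deriv f z1) (at z1)"
      using hol(3) V(1) z1(1) by (rule holomorphic_derivI)
    have "\<alpha> * f1 z1 + \<beta> * f2 z1 = f z1 * W / W"
      unfolding \<alpha>_def \<beta>_def by (simp add: W_def add_divide_distrib[symmetric] diff_divide_distrib[symmetric] algebra_simps)
    then have v0: "F z1 = f z1" using W by (simp add: F_def)
    have "\<alpha> * deriv f1 z1 + \<beta> * deriv f2 z1 = deriv f z1 * W / W"
      unfolding \<alpha>_def \<beta>_def by (simp add: W_def add_divide_distrib[symmetric] diff_divide_distrib[symmetric] algebra_simps)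
    then have v1: "\<alpha> * deriv f1 z1 + \<beta> * deriv f2 z1 = deriv f z1" using W by simp
    define h where "h = (\<lambda>z. 1 * f z + (-1) * F z)"
    have "solution_on P Q V h"
      unfolding h_def by (intro solution_on_lincomb V f solution_on_subset[OF F])
    moreover have "(h has_field_derivative 0) (at z1)"
      unfolding h_def using dF df v1 by (auto intro!: derivative_eq_intros)
    then have "deriv h z1 = 0" by (rule DERIV_imp_deriv)
    moreover have "h z1 = 0" by (simp add: h_def v0)
    ultimately have "h z = 0" if "z \<in> V" for z
      using solution_zero_of_initial_data[OF b(2-5) V(1,2,4) _ z1(1) b(4)[OF z1b z1(2)] _ _ that] by blast
    then have "\<forall>z\<in>V. F z = f z" by (simp add: h_def)
    then show "\<exists>F. solution_on P Q (ball w r) F \<and> (\<forall>z\<in>V. F z = f z)" using F by blast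
  qed
qed

text \<open>
  The extensions to two overlapping balls centred at points of the smaller ball agree: the two
  centres are so close that their midpoint lies in both balls, and in the smaller ball by convexity.
\<close>

lemma solution_enlarge_ball:
  assumes F: "solution_on P Q (ball z0 r) F" and r: "r > 0" and \<eta>: "\<eta> > 0"
    and ext: "\<And>x V f. x \<in> ball z0 r \<Longrightarrow> open V \<Longrightarrow> connected V \<Longrightarrow> V \<noteq> {} \<Longrightarrow> V \<subseteq> ball x \<eta> \<Longrightarrow>
       solution_on P Q V f \<Longrightarrow> \<exists>F. solution_on P Q (ball x \<eta>) F \<and> (\<forall>z\<in>V. F z = f z)"
  obtains G where "solution_on P Q (ball z0 (r + \<eta> / 2)) G" "\<And>z. z \<in> ball z0 r \<Longrightarrow> G z = F z"
proof -
  have "\<exists>E. solution_on P Q (ball x \<eta>) E \<and> (\<forall>z\<in>ball x \<eta> \<inter> ball z0 r. E z = F z)" if x: "x \<in> ball z0 r" for x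
  proof -
    have "x \<in> ball x \<eta> \<inter> ball z0 r" using x \<eta> by simp
    then show ?thesis
      using x by (intro ext solution_on_subset[OF F]) (blast intro!: convex_connected convex_Int open_Int convex_ball open_ball)+
  qed
  then obtain E where E: "\<And>x. x \<in> ball z0 r \<Longrightarrow> solution_on P Q (ball x \<eta>) (E x)"
    "\<And>x z. x \<in> ball z0 r \<Longrightarrow> z \<in> ball x \<eta> \<Longrightarrow> z \<in> ball z0 r \<Longrightarrow> E x z = F z"
    by (metis IntI)
  have agree: "E x z = E y z" if x: "x \<in> ball z0 r" and y: "y \<in> ball z0 r"
    and z: "z \<in> ball x \<eta>" "z \<in> ball y \<eta>" for x y z
  proof -
    define S where "S = ball x \<eta> \<inter> ball y \<eta>"
    define m where "m = midpoint x y"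
    have "dist x y < 2 * \<eta>" using z dist_triangle3[of x y z] by (auto simp: dist_commute)
    then have mS: "m \<in> S" by (auto simp: m_def S_def dist_midpoint dist_commute)
    have mz: "m \<in> ball z0 r"
      using closed_segment_subset[OF x y convex_ball] midpoint_in_closed_segment[of x y]
      unfolding m_def by blast
    define U where "U = S \<inter> ball z0 r"
    have U: "open U" "m \<in> U" using mS mz by (auto simp: U_def S_def)
    have "(\<lambda>z. E x z - E y z) holomorphic_on S"
      using E(1)[OF x] E(1)[OF y] unfolding solution_on_def S_def
      by (auto intro!: holomorphic_intros intro: holomorphic_on_subset)
    moreover have "open S" "connected S" by (auto simp: S_def intro!: convex_connected convex_Int)
    moreover have "m islimpt U" using U by (simp add: interior_limit_point interior_open)
    ultimately have "E x z - E y z = 0"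
      using analytic_continuation[of "\<lambda>z. E x z - E y z" S U m z] mS z E(2)[OF x] E(2)[OF y]
      by (auto simp: U_def S_def)
    then show ?thesis by simp
  qed
  have cover: "\<exists>x\<in>ball z0 r. z \<in> ball x \<eta>" if z: "z \<in> ball z0 (r + \<eta> / 2)" for z
  proof (cases "z \<in> ball z0 r")
    case True then show ?thesis using \<eta> by (intro bexI[of _ z]) auto
  next
    case False
    \<comment> \<open>The point of the segment from \<open>z0\<close> to z that lies \<eta> / 4
      inside the ball: its distance to z is less than \<eta> / 2 + \<eta> / 4. The maximum with 0
      covers the case r < \<eta> / 4.\<close>
    define s where "s = max 0 (r - \<eta> / 4)"
    define x where "x = z0 + of_real (s / dist z0 z) * (z - z0)"
    have d: "dist z0 z \<ge> r" "dist z0 z < r + \<eta> / 2" using False z by auto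
    have s: "0 \<le> s" "s < r" "r - s \<le> \<eta> / 4" using r \<eta> by (auto simp: s_def max_def)
    have "norm (z - z0) > 0" using d r by (auto simp: dist_norm norm_minus_commute)
    then have "dist z0 x = s" using s
      by (simp add: x_def dist_norm norm_mult norm_minus_commute norm_divide)
    moreover have "dist x z < \<eta>"
    proof -
      have "z - x = of_real (1 - s / dist z0 z) * (z - z0)" by (simp add: x_def algebra_simps)
      then have "norm (z - x) = \<bar>1 - s / dist z0 z\<bar> * dist z0 z"
        by (simp only: norm_mult norm_of_real) (simp add: dist_norm norm_minus_commute)
      also have "\<dots> = \<bar>dist z0 z - s\<bar>"
        using d r by (subst abs_mult_pos) (auto simp: left_diff_distrib)
      also have "\<dots> < \<eta>" using d s \<eta> by auto
      finally show ?thesis by (simp add: dist_norm norm_minus_commute)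
    qed
    ultimately show ?thesis using s by auto
  qed
  then obtain c where c: "\<And>z. z \<in> ball z0 (r + \<eta> / 2) \<Longrightarrow> c z \<in> ball z0 r \<and> z \<in> ball (c z) \<eta>" by metis
  define G where "G z = E (c z) z" for z
  have GE: "G z = E x z" if "x \<in> ball z0 r" "z \<in> ball x \<eta>" "z \<in> ball z0 (r + \<eta> / 2)" for x z
    unfolding G_def using agree c that by blast
  have loc: "solution_on P Q (ball x \<eta> \<inter> ball z0 (r + \<eta> / 2)) G" if x: "x \<in> ball z0 r" for x
    by (rule solution_on_cong[OF _ _ solution_on_subset[OF E(1)[OF x]]]) (use GE[OF x] in auto)
  show ?thesis
  proof (rule that)
    show "solution_on P Q (ball z0 (r + \<eta> / 2)) G"
      unfolding solution_on_def
    proof (intro conjI ballI impI)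
      have "G holomorphic_on (\<Union>x\<in>ball z0 r. ball x \<eta> \<inter> ball z0 (r + \<eta> / 2))"
        by (rule holomorphic_on_UN_open) (use loc in \<open>auto simp: solution_on_def\<close>)
      then show "G holomorphic_on ball z0 (r + \<eta> / 2)"
        by (rule holomorphic_on_subset) (use cover in auto)
      fix z assume z: "z \<in> ball z0 (r + \<eta> / 2)" "poly P z \<noteq> 0"
      then show "deriv (deriv G) z - poly (pderiv P) z / poly P z * deriv G z + poly Q z / poly P z * G z = 0"
        using c[OF z(1)] loc[of "c z"] by (auto simp: solution_on_def)
    qed
    show "G z = F z" if "z \<in> ball z0 r" for z
      using GE[OF that, of z] E(2)[OF that _ that] \<eta> that by auto
  qed
qed

theorem solution_extends_to_entire:
  assumes adm: "admissible P Q" and laine: "laine_condition (\<lambda>z. 2 * schwarzian_potential P Q z)"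
    and U: "open U" "connected U" "U \<noteq> {}" and g: "solution_on P Q U g"
  obtains G where "G holomorphic_on UNIV" "\<And>z. z \<in> U \<Longrightarrow> G z = g z"
proof -
  have "\<exists>r>0. \<forall>V f. open V \<longrightarrow> connected V \<longrightarrow> V \<noteq> {} \<longrightarrow> V \<subseteq> ball w r \<longrightarrow> solution_on P Q V f \<longrightarrow>
      (\<exists>F. solution_on P Q (ball w r) F \<and> (\<forall>z\<in>V. F z = f z))" for w
    by (rule local_extension[OF adm laine, of w]) blast
  then obtain \<epsilon> where eps: "\<And>w. \<epsilon> w > 0"
    "\<And>w V f. open V \<Longrightarrow> connected V \<Longrightarrow> V \<noteq> {} \<Longrightarrow> V \<subseteq> ball w (\<epsilon> w) \<Longrightarrow> solution_on P Q V f \<Longrightarrow>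
       \<exists>F. solution_on P Q (ball w (\<epsilon> w)) F \<and> (\<forall>z\<in>V. F z = f z)"
    by metis
  obtain z0 r0 where r0: "r0 > 0" "ball z0 r0 \<subseteq> U" using U open_contains_ball by blast
  have g0: "solution_on P Q (ball z0 r0) g" using solution_on_subset[OF g r0(2)] .
  have big: "\<exists>F. solution_on P Q (ball z0 R) F \<and> (\<forall>z\<in>ball z0 r0. F z = g z)" if R: "R > r0" for R
  proof -
    \<comment> \<open>A Lebesgue number of the cover of \<open>cball z0 R\<close> by the balls of
      local extension; it gives one radius for all centres in this compact disc.\<close>
    obtain \<eta> where \<eta>: "\<eta> > 0" "\<And>x. x \<in> cball z0 R \<Longrightarrow> \<exists>w. ball x \<eta> \<subseteq> ball w (\<epsilon> w)"
    proof -
      have "x \<in> ball x (\<epsilon> x)" for x using eps(1) by simp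
      then have "cball z0 R \<subseteq> \<Union>(range (\<lambda>w. ball w (\<epsilon> w)))" by blast
      then obtain e where "e > 0" "\<And>x. x \<in> cball z0 R \<Longrightarrow> \<exists>G\<in>range (\<lambda>w. ball w (\<epsilon> w)). ball x e \<subseteq> G"
        by (rule Heine_Borel_lemma[OF compact_cball]) auto
      then show ?thesis using that[of e] by (metis imageE)
    qed
    have ext: "\<exists>F. solution_on P Q (ball x \<eta>) F \<and> (\<forall>z\<in>V. F z = f z)"
      if x: "x \<in> cball z0 R" and V: "open V" "connected V" "V \<noteq> {}" "V \<subseteq> ball x \<eta>" "solution_on P Q V f" for x V f
    proof -
      obtain w where w: "ball x \<eta> \<subseteq> ball w (\<epsilon> w)" using \<eta>(2)[OF x] by blast
      from eps(2)[OF V(1-3) order_trans[OF V(4) w] V(5)] show ?thesis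
        using solution_on_subset[OF _ w] by blast
    qed
    \<comment> \<open>The radius is capped at R because \<open>\<eta>\<close> serves only centres in
      \<open>cball z0 R\<close>; finitely many steps of length \<eta> / 2 reach the cap.\<close>
    have step: "\<exists>F. solution_on P Q (ball z0 (min R (r0 + real n * (\<eta> / 2)))) F \<and> (\<forall>z\<in>ball z0 r0. F z = g z)" for n
    proof (induction n)
      case 0
      then show ?case using g0 R by (auto simp: min_def)
    next
      case (Suc n)
      define r where "r = min R (r0 + real n * (\<eta> / 2))"
      obtain F where F: "solution_on P Q (ball z0 r) F" "\<forall>z\<in>ball z0 r0. F z = g z"
        using Suc unfolding r_def by blast
      have r: "r0 \<le> r" "r \<le> R" using R \<eta>(1) by (auto simp: r_def)
      have inc: "x \<in> cball z0 R" if "x \<in> ball z0 r" for x using that r by auto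
      have "r > 0" using r r0 by linarith
      obtain G where G: "solution_on P Q (ball z0 (r + \<eta> / 2)) G" "\<And>z. z \<in> ball z0 r \<Longrightarrow> G z = F z"
        using solution_enlarge_ball[OF F(1) \<open>r > 0\<close> \<eta>(1) ext[OF inc]] by blast
      have "ball z0 (min R (r0 + real (Suc n) * (\<eta> / 2))) \<subseteq> ball z0 (r + \<eta> / 2)"
        unfolding r_def using \<eta>(1) by (intro subset_ball) (auto simp: min_def algebra_simps add_divide_distrib)
      then show ?case using solution_on_subset[OF G(1)] G(2) F(2) r by (metis (no_types, lifting) subset_ball subsetD)
    qed
    obtain n :: nat where "real n > (R - r0) / (\<eta> / 2)" using reals_Archimedean2 by blast
    then have "min R (r0 + real n * (\<eta> / 2)) = R" using \<eta>(1) by (simp add: field_simps min_def)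
    then show ?thesis using step[of n] by simp
  qed
  obtain F where F: "\<And>R. R > r0 \<Longrightarrow> F R holomorphic_on ball z0 R"
    "\<And>R z. R > r0 \<Longrightarrow> z \<in> ball z0 r0 \<Longrightarrow> F R z = g z"
    using big unfolding solution_on_def by metis
  have z0: "z0 islimpt ball z0 r0" using r0 by (simp add: islimpt_ball)
  have agree: "F R z = F R' z" if R: "R > r0" "R' > r0" "z \<in> ball z0 R" "z \<in> ball z0 R'" for R R' z
  proof -
    have "ball z0 (min R R') \<subseteq> ball z0 R" "ball z0 (min R R') \<subseteq> ball z0 R'" by auto
    then have "(\<lambda>z. F R z - F R' z) holomorphic_on ball z0 (min R R')"
      using F(1)[OF R(1)] F(1)[OF R(2)] by (intro holomorphic_intros) (auto intro: holomorphic_on_subset)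
    then have "F R z - F R' z = 0"
      using analytic_continuation[of "\<lambda>z. F R z - F R' z" "ball z0 (min R R')" "ball z0 r0" z0 z]
        z0 R r0 F(2) subset_ball[of r0 "min R R'" z0] by auto
    then show ?thesis by simp
  qed
  \<comment> \<open>Each point uses a disc adapted to its own distance; by \<open>agree\<close> any
    other disc that contains it gives the same value.\<close>
  define G where "G z = F (r0 + 1 + dist z0 z) z" for z
  have GF: "G z = F R z" if "R > r0" "z \<in> ball z0 R" for R z
    unfolding G_def using r0 that by (intro agree) (auto intro: add_pos_nonneg)
  have "G holomorphic_on (\<Union>n::nat. ball z0 (r0 + 1 + real n))"
  proof (rule holomorphic_on_UN_open)
    fix n :: nat
    show "G holomorphic_on ball z0 (r0 + 1 + real n)"
      using F(1)[of "r0 + 1 + real n"] GF[of "r0 + 1 + real n"]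
      by (subst holomorphic_cong[OF refl, of _ G "F (r0 + 1 + real n)"]) auto
  qed auto
  moreover have "(\<Union>n::nat. ball z0 (r0 + 1 + real n)) = UNIV"
  proof -
    have "\<exists>n::nat. dist z0 z < r0 + 1 + real n" for z
    proof -
      obtain n :: nat where "dist z0 z < real n" using reals_Archimedean2 by blast
      then show ?thesis using r0(1) by (intro exI[of _ n]) linarith
    qed
    then show ?thesis by auto
  qed
  ultimately have G: "G holomorphic_on UNIV" by simp
  have "z0 \<in> U" using r0 by (meson centre_in_ball subsetD)
  have "G z = g z" if "z \<in> U" for z
  proof -
    have "(\<lambda>z. G z - g z) holomorphic_on U"
      using G g unfolding solution_on_def by (intro holomorphic_intros) (auto intro: holomorphic_on_subset)
    moreover have "G z - g z = 0" if "z \<in> ball z0 r0" for z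
      using GF[of "r0 + 1" z] F(2)[of "r0 + 1" z] that r0 by auto
    ultimately have "G z - g z = 0"
      using analytic_continuation[of "\<lambda>z. G z - g z" U "ball z0 r0" z0 z] U r0 z0 that \<open>z0 \<in> U\<close> by auto
    then show ?thesis by simp
  qed
  with G that show ?thesis by blast
qed

section \<open>Perturbed oscillators\<close>

lemma near_identity_lipschitz:
  fixes \<Phi> :: "complex \<Rightarrow> complex"
  assumes "convex H" "open H"
    and d: "\<And>s. s \<in> H \<Longrightarrow> (\<Phi> has_field_derivative \<phi> s) (at s)"
    and e: "\<And>s. s \<in> H \<Longrightarrow> norm (\<phi> s - 1) \<le> \<epsilon>"
    and s: "s \<in> H" "s' \<in> H"
  shows "norm ((\<Phi> s - \<Phi> s') - (s - s')) \<le> \<epsilon> * norm (s - s')"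
proof -
  have "norm ((\<Phi> s - s) - (\<Phi> s' - s')) \<le> \<epsilon> * norm (s - s')"
  proof (rule field_differentiable_bound[OF assms(1), where f' = "\<lambda>s. \<phi> s - 1"])
    fix z assume "z \<in> H"
    then show "((\<lambda>s. \<Phi> s - s) has_field_derivative \<phi> z - 1) (at z within H)"
      by (rule DERIV_cong[OF DERIV_diff[OF has_field_derivative_at_within[OF d] DERIV_ident]]) auto
  qed (use e s in auto)
  then show ?thesis by (simp add: algebra_simps)
qed

text \<open>A quantitative inverse function theorem by Banach's fixed point: the map T contracts
  distances by 1/10, and points at distance at most 3/2 |w| from s are sent within 3/20 |w| of s +
  w. Besides solvability it locates the preimage, which an open mapping argument would not.\<close>

lemma near_identity_shift:
  fixes \<Phi> :: "complex \<Rightarrow> complex"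
  assumes "convex H" "open H"
    and d: "\<And>s. s \<in> H \<Longrightarrow> (\<Phi> has_field_derivative \<phi> s) (at s)"
    and e: "\<And>s. s \<in> H \<Longrightarrow> norm (\<phi> s - 1) \<le> 1 / 10"
    and s: "s \<in> H" and w: "cball (s + w) (norm w / 2) \<subseteq> H"
  obtains s' where "s' \<in> cball (s + w) (norm w / 2)" "\<Phi> s' = \<Phi> s + w"
proof -
  define T where "T x = x - (\<Phi> x - \<Phi> s - w)" for x
  define B where "B = cball (s + w) (norm w / 2)"
  have lip: "norm (T x - T y) \<le> 1 / 10 * norm (x - y)" if "x \<in> H" "y \<in> H" for x y
  proof -
    have "T x - T y = - ((\<Phi> x - \<Phi> y) - (x - y))" by (simp add: T_def)
    then have "norm (T x - T y) = norm ((\<Phi> x - \<Phi> y) - (x - y))" by (simp only: norm_minus_cancel)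
    then show ?thesis using near_identity_lipschitz[OF assms(1-4) that] by simp
  qed
  have "T ` B \<subseteq> B"
  proof clarify
    fix x assume x: "x \<in> B"
    then have "norm (T x - T s) \<le> 1 / 10 * norm (x - s)" using lip s w unfolding B_def by blast
    then have "norm (T x - (s + w)) \<le> 1 / 10 * norm (x - s)" by (simp add: T_def)
    moreover have "norm (x - s) \<le> norm (x - (s + w)) + norm w"
      using norm_triangle_ineq[of "x - (s + w)" w] by simp
    moreover have "norm (x - (s + w)) \<le> norm w / 2"
      using x by (simp add: B_def dist_norm norm_minus_commute)
    ultimately have "norm (T x - (s + w)) \<le> norm w / 2" using norm_ge_zero[of w] by linarith
    then show "T x \<in> B" by (simp add: B_def dist_norm norm_minus_commute)
  qed
  moreover have "\<forall>x\<in>B. \<forall>y\<in>B. dist (T x) (T y) \<le> 1 / 10 * dist x y"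
    using lip w unfolding B_def dist_norm by blast
  moreover have "complete B" "B \<noteq> {}" unfolding B_def by (auto intro: compact_imp_complete)
  ultimately obtain x where x: "x \<in> B" "T x = x"
    using Banach_fix[of B "1/10" T] by auto
  show ?thesis using that[of x] x by (simp add: T_def B_def)
qed

lemma near_identity_inj:
  fixes \<Phi> :: "complex \<Rightarrow> complex"
  assumes "convex H" "open H"
    and d: "\<And>s. s \<in> H \<Longrightarrow> (\<Phi> has_field_derivative \<phi> s) (at s)"
    and e: "\<And>s. s \<in> H \<Longrightarrow> norm (\<phi> s - 1) \<le> 1 / 10"
  shows "inj_on \<Phi> H"
proof (rule inj_onI)
  fix s s' assume "s \<in> H" "s' \<in> H" "\<Phi> s = \<Phi> s'"
  then have "norm (s - s') \<le> 1 / 10 * norm (s - s')"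
    using near_identity_lipschitz[OF assms(1,2) d e, of s s'] by (simp add: norm_minus_commute)
  then show "s = s'" by simp
qed

text \<open>
  Since the integral of the bound \<open>C / (K + t / 2)\<^sup>2\<close> over \<open>t \<ge> 0\<close> is at most \<open>1 / 2\<close>, comparing
  the maximum of \<open>norm p + norm q\<close> on an interval with its value at an endpoint replaces
  Gronwall's inequality.
\<close>

lemma perturbed_constant_limit:
  fixes p q :: "real \<Rightarrow> complex"
  assumes C: "C \<ge> 0" and K: "K > 0" and \<delta>: "2 * C / K \<le> \<delta>" "\<delta> \<le> 1 / 2"
    and dp: "\<And>t. t \<ge> 0 \<Longrightarrow> (p has_vector_derivative p' t) (at t)"
    and dq: "\<And>t. t \<ge> 0 \<Longrightarrow> (q has_vector_derivative q' t) (at t)"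
    and bp: "\<And>t. t \<ge> 0 \<Longrightarrow> norm (p' t) \<le> C / (K + t / 2) ^ 2 / 2 * (norm (p t) + norm (q t))"
    and bq: "\<And>t. t \<ge> 0 \<Longrightarrow> norm (q' t) \<le> C / (K + t / 2) ^ 2 / 2 * (norm (p t) + norm (q t))"
  obtains A B where "(p \<longlongrightarrow> A) at_top" "(q \<longlongrightarrow> B) at_top"
    "norm (p 0 - A) + norm (q 0 - B) \<le> 2 * \<delta> * (norm A + norm B)"
    "\<And>t. t \<ge> 0 \<Longrightarrow> norm (p t) + norm (q t) \<le> 2 * (norm (p 0) + norm (q 0))"
proof -
  define n where "n t = norm (p t) + norm (q t)" for t
  \<comment> \<open>A primitive of the bound that increases to 0, so its total increase over t \<ge>
    0 is 2 C / K \<le> \<delta>.\<close>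
  define b where "b t = - (2 * C / (K + t / 2))" for t
  have db: "(b has_real_derivative C / (K + t / 2) ^ 2) (at t)" if "t \<ge> 0" for t
    unfolding b_def using that K
    by (auto intro!: derivative_eq_intros simp: power2_eq_square)
  have bmono: "b t - b s \<le> 2 * C / (K + s / 2)" if "0 \<le> s" "s \<le> t" for s t
    using that C K by (simp add: b_def)
  have bd: "b t - b s \<le> \<delta>" if "0 \<le> s" "s \<le> t" for s t
  proof -
    have "2 * C / (K + s / 2) \<le> 2 * C / K" using that C K by (intro divide_left_mono) auto
    then show ?thesis using bmono[OF that] \<delta> by linarith
  qed
  have b0: "0 \<le> b t - b s" if "0 \<le> s" "s \<le> t" for s t
    using that C K by (simp add: b_def frac_le)
  have cont: "continuous_on S p" "continuous_on S q" if "S \<subseteq> {0..}" for S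
    using dp dq that by (auto intro!: continuous_at_imp_continuous_on has_vector_derivative_continuous)
  have inc: "norm (p t - p s) + norm (q t - q s) \<le> S * (b t - b s)"
    if st: "0 \<le> s" "s \<le> t" and S: "\<And>u. s \<le> u \<Longrightarrow> u \<le> t \<Longrightarrow> n u \<le> S" for s t S
  proof (cases "s = t")
    case False
    then have "s < t" using st by simp
    have dphi: "((\<lambda>u. S / 2 * b u) has_vector_derivative S / 2 * (C / (K + u / 2) ^ 2)) (at u)" if "s < u" for u
      using DERIV_cmult[OF db[of u], of "S / 2"] that st
      by (simp add: has_real_derivative_iff_has_vector_derivative)
    have cphi: "continuous_on {s..t} (\<lambda>u. S / 2 * b u)"
      using K st unfolding b_def by (intro continuous_intros) auto
    have le: "C / (K + u / 2) ^ 2 / 2 * n u \<le> S / 2 * (C / (K + u / 2) ^ 2)" if "s < u" "u < t" for u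
    proof -
      have "C / (K + u / 2) ^ 2 / 2 * n u \<le> C / (K + u / 2) ^ 2 / 2 * S"
        using S[of u] that C by (intro mult_left_mono) auto
      then show ?thesis by (simp add: mult_ac)
    qed
    have "norm (p t - p s) \<le> S / 2 * b t - S / 2 * b s"
    proof (rule differentiable_bound_general[OF \<open>s < t\<close> _ cphi _ dphi])
      show "continuous_on {s..t} p" using st by (intro cont) auto
      show "(p has_vector_derivative p' u) (at u)" if "s < u" "u < t" for u using that st by (intro dp) auto
      show "norm (p' u) \<le> S / 2 * (C / (K + u / 2)\<^sup>2)" if "s < u" "u < t" for u
        using bp[of u] le[OF that] that st unfolding n_def by linarith
    qed
    moreover have "norm (q t - q s) \<le> S / 2 * b t - S / 2 * b s"
    proof (rule differentiable_bound_general[OF \<open>s < t\<close> _ cphi _ dphi])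
      show "continuous_on {s..t} q" using st by (intro cont) auto
      show "(q has_vector_derivative q' u) (at u)" if "s < u" "u < t" for u using that st by (intro dq) auto
      show "norm (q' u) \<le> S / 2 * (C / (K + u / 2)\<^sup>2)" if "s < u" "u < t" for u
        using bq[of u] le[OF that] that st unfolding n_def by linarith
    qed
    ultimately show ?thesis by (simp add: algebra_simps)
  qed simp
  have ndiff: "\<bar>n t - n s\<bar> \<le> norm (p t - p s) + norm (q t - q s)" for s t
    unfolding n_def using norm_triangle_ineq3[of "p t" "p s"] norm_triangle_ineq3[of "q t" "q s"] by linarith
  have sup: "n u \<le> 2 * n 0 \<and> n u \<le> 2 * n T" if u: "0 \<le> u" "u \<le> T" for u T
  proof -
    have "continuous_on {0..T} n" unfolding n_def by (intro continuous_intros cont) auto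
    then obtain \<tau> where \<tau>: "\<tau> \<in> {0..T}" "\<And>u. u \<in> {0..T} \<Longrightarrow> n u \<le> n \<tau>"
      using continuous_attains_sup[of "{0..T}" n] u by auto
    have n0: "n \<tau> \<ge> 0" by (simp add: n_def)
    have "n \<tau> - n 0 \<le> n \<tau> * (b \<tau> - b 0)"
      using inc[of 0 \<tau> "n \<tau>"] ndiff[of \<tau> 0] \<tau> by auto
    also have "\<dots> \<le> n \<tau> * (1 / 2)" using bd[of 0 \<tau>] \<delta> \<tau> n0 by (intro mult_left_mono) auto
    finally have 1: "n \<tau> \<le> 2 * n 0" by simp
    have "n \<tau> - n T \<le> n \<tau> * (b T - b \<tau>)"
      using inc[of \<tau> T "n \<tau>"] ndiff[of T \<tau>] \<tau> by auto
    also have "\<dots> \<le> n \<tau> * (1 / 2)" using bd[of \<tau> T] \<delta> \<tau> n0 by (intro mult_left_mono) auto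
    finally have 2: "n \<tau> \<le> 2 * n T" by simp
    show ?thesis using \<tau>(2)[of u] u 1 2 by auto
  qed
  have inc0: "norm (p t - p s) + norm (q t - q s) \<le> 2 * n 0 * (b t - b s)" if "0 \<le> s" "s \<le> t" for s t
    using that sup by (intro inc) auto
  have "n 0 \<ge> 0" by (simp add: n_def)
  have tail: "norm (p t - p s) + norm (q t - q s) \<le> 4 * n 0 * C / (K + s / 2)" if "0 \<le> s" "s \<le> t" for s t
  proof -
    have "2 * n 0 * (b t - b s) \<le> 2 * n 0 * (2 * C / (K + s / 2))"
      using bmono[OF that] \<open>n 0 \<ge> 0\<close> by (intro mult_left_mono) auto
    then show ?thesis using inc0[OF that] by simp
  qed
  have tail0: "((\<lambda>s. 4 * n 0 * C / (K + s / 2)) \<longlongrightarrow> 0) at_top"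
    by real_asymp
  have conv: "\<exists>L. (f \<longlongrightarrow> L) at_top"
    if f: "\<And>s t. 0 \<le> s \<Longrightarrow> s \<le> t \<Longrightarrow> norm (f t - f s) \<le> 4 * n 0 * C / (K + s / 2)" for f :: "real \<Rightarrow> complex"
  proof -
    have "Cauchy (\<lambda>k. f (real k))"
    proof (rule metric_CauchyI)
      fix e :: real assume "e > 0"
      then have "\<forall>\<^sub>F s in at_top. 4 * n 0 * C / (K + s / 2) < e" using tail0 order_tendstoD(2) by blast
      then obtain M where M: "\<And>s. s \<ge> M \<Longrightarrow> 4 * n 0 * C / (K + s / 2) < e"
        by (auto simp: eventually_at_top_linorder)
      obtain k :: nat where k: "real k \<ge> max M 0" using real_arch_simple by blast
      show "\<exists>M. \<forall>m\<ge>M. \<forall>n\<ge>M. dist (f (real m)) (f (real n)) < e"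
      proof (intro exI allI impI)
        fix i j :: nat assume "i \<ge> k" "j \<ge> k"
        then have *: "real i \<ge> max M 0" "real j \<ge> max M 0" using k by linarith+
        show "dist (f (real i)) (f (real j)) < e"
        proof (cases "i \<le> j")
          case True
          then show ?thesis using f[of "real i" "real j"] M[of "real i"] * by (auto simp: dist_norm norm_minus_commute)
        next
          case False
          then show ?thesis using f[of "real j" "real i"] M[of "real j"] * by (auto simp: dist_norm norm_minus_commute)
        qed
      qed
    qed
    then obtain L where L: "(\<lambda>k. f (real k)) \<longlonglongrightarrow> L" using Cauchy_convergent convergent_def by blast
    have "norm (f s - L) \<le> 4 * n 0 * C / (K + s / 2)" if s: "s \<ge> 0" for s
    proof (rule LIMSEQ_le_const2)
      show "(\<lambda>k. norm (f s - f (real k))) \<longlonglongrightarrow> norm (f s - L)" by (intro tendsto_intros L)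
      obtain k :: nat where k: "real k \<ge> s" using real_arch_simple by blast
      show "\<exists>N. \<forall>m\<ge>N. norm (f s - f (real m)) \<le> 4 * n 0 * C / (K + s / 2)"
      proof (intro exI allI impI)
        fix m :: nat assume "m \<ge> k"
        then have "real m \<ge> s" using k by linarith
        then show "norm (f s - f (real m)) \<le> 4 * n 0 * C / (K + s / 2)"
          using f[of s "real m"] s by (simp add: norm_minus_commute)
      qed
    qed
    then have "((\<lambda>s. f s - L) \<longlongrightarrow> 0) at_top"
      by (intro Lim_null_comparison[OF _ tail0]) (auto simp: eventually_at_top_linorder)
    then show ?thesis by (metis LIM_zero_iff)
  qed
  obtain A where A: "(p \<longlongrightarrow> A) at_top"
    using conv[of p] tail by (smt (verit) norm_ge_zero)
  obtain B where B: "(q \<longlongrightarrow> B) at_top"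
    using conv[of q] tail by (smt (verit) norm_ge_zero)
  \<comment> \<open>The increment is compared with the value at T, and then T tends to infinity: the
    error must be relative to A and B, not to the initial values.\<close>
  have "norm (p 0 - A) + norm (q 0 - B) \<le> 2 * \<delta> * (norm A + norm B)"
  proof (rule tendsto_le[OF trivial_limit_at_top_linorder])
    show "((\<lambda>T. 2 * \<delta> * (norm (p T) + norm (q T))) \<longlongrightarrow> 2 * \<delta> * (norm A + norm B)) at_top"
      by (intro tendsto_intros A B)
    show "((\<lambda>T. norm (p 0 - p T) + norm (q 0 - q T)) \<longlongrightarrow> norm (p 0 - A) + norm (q 0 - B)) at_top"
      by (intro tendsto_intros A B)
    show "\<forall>\<^sub>F T in at_top. norm (p 0 - p T) + norm (q 0 - q T) \<le> 2 * \<delta> * (norm (p T) + norm (q T))"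
      using eventually_ge_at_top[of 0]
    proof eventually_elim
      case (elim T)
      have "norm (p T - p 0) + norm (q T - q 0) \<le> 2 * n T * (b T - b 0)"
        using elim sup by (intro inc) auto
      also have "\<dots> \<le> 2 * n T * \<delta>" using bd[of 0 T] elim by (intro mult_left_mono) (auto simp: n_def)
      finally show ?case by (simp add: n_def norm_minus_commute algebra_simps)
    qed
  qed
  moreover have "norm (p t) + norm (q t) \<le> 2 * (norm (p 0) + norm (q 0))" if "t \<ge> 0" for t
    using sup[of t t] that by (simp add: n_def)
  ultimately show ?thesis using that A B by blast
qed

text \<open>Variation of constants: without \<open>\<psi>\<close> the functions (U - i V) / 2 e^(- i
  zeta) and (U + i V) / 2 e^(i zeta) would be constant. Their limits along a horizontal ray exist by
  the preceding lemma. Nearby rays have the same limits, since the derivative in the starting point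
  tends to 0 locally uniformly; as D is connected, A and B are global constants.\<close>

lemma perturbed_oscillator_asymptotics:
  fixes D :: "complex set"
  assumes D: "open D" "connected D" "\<And>\<zeta> t. \<zeta> \<in> D \<Longrightarrow> t \<ge> 0 \<Longrightarrow> \<zeta> + of_real t \<in> D"
    and dU: "\<And>\<zeta>. \<zeta> \<in> D \<Longrightarrow> (U has_field_derivative V \<zeta>) (at \<zeta>)"
    and dV: "\<And>\<zeta>. \<zeta> \<in> D \<Longrightarrow> (V has_field_derivative - (1 + \<psi> \<zeta>) * U \<zeta>) (at \<zeta>)"
    and \<psi>: "\<And>\<zeta> t. \<zeta> \<in> D \<Longrightarrow> t \<ge> 0 \<Longrightarrow> norm (\<psi> (\<zeta> + of_real t)) \<le> C / (K + t / 2) ^ 2"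
    and C: "C \<ge> 0" and K: "K > 0" and \<delta>: "2 * C / K \<le> \<delta>" "\<delta> \<le> 1 / 2"
  obtains A B where
    "\<And>\<zeta>. \<zeta> \<in> D \<Longrightarrow> ((\<lambda>t. (U (\<zeta> + of_real t) - \<i> * V (\<zeta> + of_real t)) / 2 * exp (- \<i> * (\<zeta> + of_real t))) \<longlongrightarrow> A) at_top"
    "\<And>\<zeta>. \<zeta> \<in> D \<Longrightarrow> ((\<lambda>t. (U (\<zeta> + of_real t) + \<i> * V (\<zeta> + of_real t)) / 2 * exp (\<i> * (\<zeta> + of_real t))) \<longlongrightarrow> B) at_top"
    "\<And>\<zeta>. \<zeta> \<in> D \<Longrightarrow> norm ((U \<zeta> - \<i> * V \<zeta>) / 2 - A * exp (\<i> * \<zeta>)) + norm ((U \<zeta> + \<i> * V \<zeta>) / 2 - B * exp (- \<i> * \<zeta>))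
       \<le> 2 * \<delta> * (norm (A * exp (\<i> * \<zeta>)) + norm (B * exp (- \<i> * \<zeta>)))"
proof -
  define a where "a \<zeta> = (U \<zeta> - \<i> * V \<zeta>) / 2 * exp (- \<i> * \<zeta>)" for \<zeta>
  define b where "b \<zeta> = (U \<zeta> + \<i> * V \<zeta>) / 2 * exp (\<i> * \<zeta>)" for \<zeta>
  have ee: "exp (\<i> * \<zeta>) * exp (- \<i> * \<zeta>) = 1" for \<zeta> :: complex by (simp add: exp_add[symmetric])
  have Uab: "U \<zeta> = a \<zeta> * exp (\<i> * \<zeta>) + b \<zeta> * exp (- \<i> * \<zeta>)" for \<zeta>
  proof -
    have "a \<zeta> * exp (\<i> * \<zeta>) + b \<zeta> * exp (- \<i> * \<zeta>)
      = ((U \<zeta> - \<i> * V \<zeta>) / 2 + (U \<zeta> + \<i> * V \<zeta>) / 2) * (exp (\<i> * \<zeta>) * exp (- \<i> * \<zeta>))"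
      by (simp add: a_def b_def algebra_simps)
    then show ?thesis unfolding ee by (simp add: field_simps)
  qed
  have de: "((\<lambda>\<zeta>. exp (c * \<zeta>)) has_field_derivative c * exp (c * \<zeta>)) (at \<zeta>)" for c \<zeta> :: complex
    by (auto intro!: derivative_eq_intros)
  have da: "(a has_field_derivative \<i> / 2 * \<psi> \<zeta> * U \<zeta> * exp (- \<i> * \<zeta>)) (at \<zeta>)" if "\<zeta> \<in> D" for \<zeta>
    unfolding a_def
    by (rule DERIV_cong[OF DERIV_mult[OF DERIV_cdivide[OF DERIV_diff[OF dU[OF that] DERIV_cmult[OF dV[OF that]]]] de]])
      (simp add: field_simps)
  have db: "(b has_field_derivative - (\<i> / 2) * \<psi> \<zeta> * U \<zeta> * exp (\<i> * \<zeta>)) (at \<zeta>)" if "\<zeta> \<in> D" for \<zeta>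
    unfolding b_def
    by (rule DERIV_cong[OF DERIV_mult[OF DERIV_cdivide[OF DERIV_add[OF dU[OF that] DERIV_cmult[OF dV[OF that]]]] de]])
      (simp add: field_simps)
  define n where "n \<zeta> = norm (a \<zeta> * exp (\<i> * \<zeta>)) + norm (b \<zeta> * exp (- \<i> * \<zeta>))" for \<zeta>
  have Un: "norm (U \<zeta>) \<le> n \<zeta>" for \<zeta>
    unfolding n_def by (subst Uab) (rule norm_triangle_ineq)
  have nshift: "norm (exp (\<i> * (\<zeta> + of_real t))) = norm (exp (\<i> * \<zeta>))"
    "norm (exp (- \<i> * (\<zeta> + of_real t))) = norm (exp (- \<i> * \<zeta>))" for \<zeta> and t :: real
    by simp_all
  have main: "\<exists>A B. ((\<lambda>t. a (\<zeta> + of_real t)) \<longlongrightarrow> A) at_top \<and> ((\<lambda>t. b (\<zeta> + of_real t)) \<longlongrightarrow> B) at_top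
     \<and> norm (a \<zeta> * exp (\<i> * \<zeta>) - A * exp (\<i> * \<zeta>)) + norm (b \<zeta> * exp (- \<i> * \<zeta>) - B * exp (- \<i> * \<zeta>))
       \<le> 2 * \<delta> * (norm (A * exp (\<i> * \<zeta>)) + norm (B * exp (- \<i> * \<zeta>)))
     \<and> (\<forall>t\<ge>0. n (\<zeta> + of_real t) \<le> 2 * n \<zeta>)" if \<zeta>: "\<zeta> \<in> D" for \<zeta>
  proof -
    \<comment> \<open>Weighting by the exponentials at the starting point, whose moduli do not
      change along the ray, makes |p| + |q| a bound for |U|.\<close>
    define p where "p t = a (\<zeta> + of_real t) * exp (\<i> * \<zeta>)" for t :: real
    define q where "q t = b (\<zeta> + of_real t) * exp (- \<i> * \<zeta>)" for t :: real
    have npq: "norm (p t) + norm (q t) = n (\<zeta> + of_real t)" for t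
      unfolding n_def p_def q_def norm_mult nshift ..
    have dsh: "((\<lambda>t. f (\<zeta> + of_real t)) has_vector_derivative f') (at t)"
      if "(f has_field_derivative f') (at (\<zeta> + of_real t))" for f f' and t :: real
    proof -
      have "((\<lambda>t. \<zeta> + of_real t) has_vector_derivative 1) (at t)"
        by (auto intro!: derivative_eq_intros simp: has_vector_derivative_of_real)
      from field_vector_diff_chain_at[OF this that] show ?thesis by (simp add: o_def)
    qed
    have dp: "(p has_vector_derivative \<i> / 2 * \<psi> (\<zeta> + of_real t) * U (\<zeta> + of_real t) * exp (- \<i> * (\<zeta> + of_real t)) * exp (\<i> * \<zeta>)) (at t)"
      if "t \<ge> 0" for t
      unfolding p_def by (rule has_vector_derivative_mult_left[OF dsh[OF da[OF D(3)[OF \<zeta> that]]]])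
    have dq: "(q has_vector_derivative - (\<i> / 2) * \<psi> (\<zeta> + of_real t) * U (\<zeta> + of_real t) * exp (\<i> * (\<zeta> + of_real t)) * exp (- \<i> * \<zeta>)) (at t)"
      if "t \<ge> 0" for t
      unfolding q_def by (rule has_vector_derivative_mult_left[OF dsh[OF db[OF D(3)[OF \<zeta> that]]]])
    have ne: "norm (exp (\<i> * \<zeta>)) * norm (exp (- \<i> * \<zeta>)) = 1"
      unfolding norm_mult[symmetric] ee by simp
    have est: "norm (\<psi> (\<zeta> + of_real t)) / 2 * norm (U (\<zeta> + of_real t)) \<le> C / (K + t / 2) ^ 2 / 2 * (norm (p t) + norm (q t))"
      if "t \<ge> 0" for t
      unfolding npq using \<psi>[OF \<zeta> that] Un C by (intro mult_mono) auto
    have bp: "norm (\<i> / 2 * \<psi> (\<zeta> + of_real t) * U (\<zeta> + of_real t) * exp (- \<i> * (\<zeta> + of_real t)) * exp (\<i> * \<zeta>))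
        \<le> C / (K + t / 2) ^ 2 / 2 * (norm (p t) + norm (q t))" if "t \<ge> 0" for t
    proof -
      have "norm (\<i> / 2 * \<psi> (\<zeta> + of_real t) * U (\<zeta> + of_real t) * exp (- \<i> * (\<zeta> + of_real t)) * exp (\<i> * \<zeta>))
        = norm (\<psi> (\<zeta> + of_real t)) / 2 * norm (U (\<zeta> + of_real t)) * (norm (exp (\<i> * \<zeta>)) * norm (exp (- \<i> * \<zeta>)))"
        unfolding norm_mult nshift by (simp add: norm_divide)
      then show ?thesis unfolding ne using est[OF that] by simp
    qed
    have bq: "norm (- (\<i> / 2) * \<psi> (\<zeta> + of_real t) * U (\<zeta> + of_real t) * exp (\<i> * (\<zeta> + of_real t)) * exp (- \<i> * \<zeta>))
        \<le> C / (K + t / 2) ^ 2 / 2 * (norm (p t) + norm (q t))" if "t \<ge> 0" for t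
    proof -
      have "norm (- (\<i> / 2) * \<psi> (\<zeta> + of_real t) * U (\<zeta> + of_real t) * exp (\<i> * (\<zeta> + of_real t)) * exp (- \<i> * \<zeta>))
        = norm (\<psi> (\<zeta> + of_real t)) / 2 * norm (U (\<zeta> + of_real t)) * (norm (exp (\<i> * \<zeta>)) * norm (exp (- \<i> * \<zeta>)))"
        unfolding norm_mult nshift by (simp add: norm_divide)
      then show ?thesis unfolding ne using est[OF that] by simp
    qed
    obtain A B where AB: "(p \<longlongrightarrow> A) at_top" "(q \<longlongrightarrow> B) at_top"
      "norm (p 0 - A) + norm (q 0 - B) \<le> 2 * \<delta> * (norm A + norm B)"
      "\<And>t. t \<ge> 0 \<Longrightarrow> norm (p t) + norm (q t) \<le> 2 * (norm (p 0) + norm (q 0))"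
      using perturbed_constant_limit[OF C K \<delta> dp dq bp bq] by blast
    have a: "(\<lambda>t. a (\<zeta> + of_real t)) = (\<lambda>t. p t * exp (- \<i> * \<zeta>))"
      using ee[of \<zeta>] by (simp add: p_def mult.assoc)
    have b: "(\<lambda>t. b (\<zeta> + of_real t)) = (\<lambda>t. q t * exp (\<i> * \<zeta>))"
      using ee[of \<zeta>] by (simp add: q_def mult.assoc mult.commute[of "exp (- (\<i> * \<zeta>))"])
    show ?thesis
    proof (rule exI[of _ "A * exp (- \<i> * \<zeta>)"], rule exI[of _ "B * exp (\<i> * \<zeta>)"], intro conjI allI impI)
      show "((\<lambda>t. a (\<zeta> + of_real t)) \<longlongrightarrow> A * exp (- \<i> * \<zeta>)) at_top"
        unfolding a by (intro tendsto_intros AB)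
      show "((\<lambda>t. b (\<zeta> + of_real t)) \<longlongrightarrow> B * exp (\<i> * \<zeta>)) at_top"
        unfolding b by (intro tendsto_intros AB)
      have 1: "A * exp (- \<i> * \<zeta>) * exp (\<i> * \<zeta>) = A" "B * exp (\<i> * \<zeta>) * exp (- \<i> * \<zeta>) = B"
        using ee[of \<zeta>] by (simp_all add: mult.assoc mult.commute[of "exp (- (\<i> * \<zeta>))"])
      show "norm (a \<zeta> * exp (\<i> * \<zeta>) - A * exp (- \<i> * \<zeta>) * exp (\<i> * \<zeta>))
          + norm (b \<zeta> * exp (- \<i> * \<zeta>) - B * exp (\<i> * \<zeta>) * exp (- \<i> * \<zeta>))
        \<le> 2 * \<delta> * (norm (A * exp (- \<i> * \<zeta>) * exp (\<i> * \<zeta>)) + norm (B * exp (\<i> * \<zeta>) * exp (- \<i> * \<zeta>)))"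
        unfolding 1 using AB(3) by (simp add: p_def q_def)
      show "n (\<zeta> + of_real t) \<le> 2 * n \<zeta>" if "t \<ge> 0" for t
        using AB(4)[OF that] unfolding npq by simp
    qed
  qed
  then obtain A B where AB: "\<And>\<zeta>. \<zeta> \<in> D \<Longrightarrow> ((\<lambda>t. a (\<zeta> + of_real t)) \<longlongrightarrow> A \<zeta>) at_top"
    "\<And>\<zeta>. \<zeta> \<in> D \<Longrightarrow> ((\<lambda>t. b (\<zeta> + of_real t)) \<longlongrightarrow> B \<zeta>) at_top"
    "\<And>\<zeta>. \<zeta> \<in> D \<Longrightarrow> norm (a \<zeta> * exp (\<i> * \<zeta>) - A \<zeta> * exp (\<i> * \<zeta>)) + norm (b \<zeta> * exp (- \<i> * \<zeta>) - B \<zeta> * exp (- \<i> * \<zeta>))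
       \<le> 2 * \<delta> * (norm (A \<zeta> * exp (\<i> * \<zeta>)) + norm (B \<zeta> * exp (- \<i> * \<zeta>)))"
    "\<And>\<zeta> t. \<zeta> \<in> D \<Longrightarrow> t \<ge> 0 \<Longrightarrow> n (\<zeta> + of_real t) \<le> 2 * n \<zeta>" by metis
  \<comment> \<open>Serves a and b at once. The condition \<open>Re c' = 0\<close> makes the modulus
    of the exponential invariant under real shifts, so one maximum over a small disc controls all
    shifted derivatives.\<close>
  have locconst: "L constant_on D"
    if L: "\<And>\<zeta>. \<zeta> \<in> D \<Longrightarrow> ((\<lambda>t. f (\<zeta> + of_real t)) \<longlongrightarrow> L \<zeta>) at_top"
      and df: "\<And>\<zeta>. \<zeta> \<in> D \<Longrightarrow> (f has_field_derivative c * \<psi> \<zeta> * U \<zeta> * exp (c' * \<zeta>)) (at \<zeta>)"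
      and c: "norm c \<le> 1" "Re c' = 0" for f L c c'
  proof (rule locally_constant_imp_constant[OF D(2)])
    fix \<zeta>0 assume "\<zeta>0 \<in> D"
    then obtain r where r: "r > 0" "cball \<zeta>0 r \<subseteq> D" using D(1) open_contains_cball by blast
    have cn: "continuous_on (cball \<zeta>0 r) (\<lambda>\<zeta>. 2 * n \<zeta> * norm (exp (c' * \<zeta>)))"
      unfolding n_def using r(2) da db
      by (intro continuous_intros continuous_at_imp_continuous_on ballI) (blast intro: DERIV_isCont)+
    obtain x where x: "x \<in> cball \<zeta>0 r"
      "\<And>\<zeta>. \<zeta> \<in> cball \<zeta>0 r \<Longrightarrow> 2 * n \<zeta> * norm (exp (c' * \<zeta>)) \<le> 2 * n x * norm (exp (c' * x))"
      using continuous_attains_sup[OF compact_cball _ cn] r(1) by auto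
    define M where "M = 2 * n x * norm (exp (c' * x))"
    have M0: "M \<ge> 0" by (simp add: M_def n_def)
    have eq: "L \<zeta> = L \<zeta>0" if z: "\<zeta> \<in> ball \<zeta>0 r" for \<zeta>
    proof -
      have bound: "norm (f (\<zeta> + of_real t) - f (\<zeta>0 + of_real t)) \<le> C / (K + t / 2) ^ 2 * M * norm (\<zeta> - \<zeta>0)" if t: "t \<ge> 0" for t
      proof (rule field_differentiable_bound[where f = "\<lambda>\<zeta>. f (\<zeta> + of_real t)" and S = "cball \<zeta>0 r"
          and f' = "\<lambda>\<zeta>. c * \<psi> (\<zeta> + of_real t) * U (\<zeta> + of_real t) * exp (c' * (\<zeta> + of_real t))"])
        fix y assume y: "y \<in> cball \<zeta>0 r"
        then have yD: "y \<in> D" using r(2) by blast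
        have "((\<lambda>\<zeta>. \<zeta> + of_real t) has_field_derivative 1) (at y)" by (auto intro!: derivative_eq_intros)
        from DERIV_chain2[OF df[OF D(3)[OF yD t]] this]
        show "((\<lambda>\<zeta>. f (\<zeta> + of_real t)) has_field_derivative
          c * \<psi> (y + of_real t) * U (y + of_real t) * exp (c' * (y + of_real t))) (at y within cball \<zeta>0 r)"
          by (simp add: has_field_derivative_at_within)
        have e: "norm (exp (c' * (y + of_real t))) = norm (exp (c' * y))" using c(2) by simp
        have "norm (U (y + of_real t)) * norm (exp (c' * y)) \<le> 2 * n y * norm (exp (c' * y))"
          using order_trans[OF Un AB(4)[OF yD t]] by (rule mult_right_mono) simp
        also have "\<dots> \<le> M" unfolding M_def by (rule x(2)[OF y])
        finally have 1: "norm (U (y + of_real t)) * norm (exp (c' * y)) \<le> M" .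
        have 2: "norm c * norm (\<psi> (y + of_real t)) \<le> 1 * (C / (K + t / 2) ^ 2)"
          using c(1) \<psi>[OF yD t] by (intro mult_mono) auto
        have "(norm c * norm (\<psi> (y + of_real t))) * (norm (U (y + of_real t)) * norm (exp (c' * y)))
          \<le> (1 * (C / (K + t / 2) ^ 2)) * M"
          by (rule mult_mono[OF 2 1]) (use C in auto)
        then show "norm (c * \<psi> (y + of_real t) * U (y + of_real t) * exp (c' * (y + of_real t))) \<le> C / (K + t / 2) ^ 2 * M"
          unfolding norm_mult e by (simp add: mult.assoc)
      qed (use z r in auto)
      have "((\<lambda>t. f (\<zeta> + of_real t) - f (\<zeta>0 + of_real t)) \<longlongrightarrow> 0) at_top"
      proof (rule Lim_null_comparison)
        show "\<forall>\<^sub>F t in at_top. norm (f (\<zeta> + of_real t) - f (\<zeta>0 + of_real t)) \<le> C / (K + t / 2) ^ 2 * M * norm (\<zeta> - \<zeta>0)"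
          using eventually_ge_at_top[of "0::real"] by (rule eventually_mono) (rule bound)
        have "((\<lambda>t. C / (K + t / 2) ^ 2) \<longlongrightarrow> 0) at_top" by real_asymp
        then have "((\<lambda>t. C / (K + t / 2) ^ 2 * (M * norm (\<zeta> - \<zeta>0))) \<longlongrightarrow> 0) at_top"
          by (rule tendsto_mult_left_zero)
        then show "((\<lambda>t. C / (K + t / 2) ^ 2 * M * norm (\<zeta> - \<zeta>0)) \<longlongrightarrow> 0) at_top" by (simp add: mult.assoc)
      qed
      moreover have "((\<lambda>t. f (\<zeta> + of_real t) - f (\<zeta>0 + of_real t)) \<longlongrightarrow> L \<zeta> - L \<zeta>0) at_top"
        using z r by (intro tendsto_diff L) auto
      ultimately have "L \<zeta> - L \<zeta>0 = 0" using tendsto_unique[OF trivial_limit_at_top_linorder] by blast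
      then show ?thesis by simp
    qed
    have "openin (top_of_set D) (ball \<zeta>0 r)" using r(2) by (intro open_subset) auto
    then show "\<exists>T. openin (top_of_set D) T \<and> \<zeta>0 \<in> T \<and> (\<forall>x\<in>T. L x = L \<zeta>0)"
      by (intro exI[of _ "ball \<zeta>0 r"] conjI ballI eq) (use r(1) in auto)
  qed
  have "A constant_on D" by (rule locconst[of a A "\<i> / 2" "- \<i>"]) (use AB da in auto)
  then obtain A0 where A0: "\<And>\<zeta>. \<zeta> \<in> D \<Longrightarrow> A \<zeta> = A0" unfolding constant_on_def by blast
  have "B constant_on D" by (rule locconst[of b B "- (\<i> / 2)" "\<i>"]) (use AB db in auto)
  then obtain B0 where B0: "\<And>\<zeta>. \<zeta> \<in> D \<Longrightarrow> B \<zeta> = B0" unfolding constant_on_def by blast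
  have ae: "a \<zeta> * exp (\<i> * \<zeta>) = (U \<zeta> - \<i> * V \<zeta>) / 2" "b \<zeta> * exp (- \<i> * \<zeta>) = (U \<zeta> + \<i> * V \<zeta>) / 2" for \<zeta>
    using ee[of \<zeta>] by (simp_all add: a_def b_def mult.assoc mult.commute[of "exp (- (\<i> * \<zeta>))"])
  show ?thesis
  proof (rule that[of A0 B0])
    fix \<zeta> assume z: "\<zeta> \<in> D"
    show "((\<lambda>t. (U (\<zeta> + of_real t) - \<i> * V (\<zeta> + of_real t)) / 2 * exp (- \<i> * (\<zeta> + of_real t))) \<longlongrightarrow> A0) at_top"
      using AB(1)[OF z] A0[OF z] unfolding a_def by simp
    show "((\<lambda>t. (U (\<zeta> + of_real t) + \<i> * V (\<zeta> + of_real t)) / 2 * exp (\<i> * (\<zeta> + of_real t))) \<longlongrightarrow> B0) at_top"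
      using AB(2)[OF z] B0[OF z] unfolding b_def by simp
    show "norm ((U \<zeta> - \<i> * V \<zeta>) / 2 - A0 * exp (\<i> * \<zeta>)) + norm ((U \<zeta> + \<i> * V \<zeta>) / 2 - B0 * exp (- \<i> * \<zeta>))
       \<le> 2 * \<delta> * (norm (A0 * exp (\<i> * \<zeta>)) + norm (B0 * exp (- \<i> * \<zeta>)))"
      using AB(3)[OF z] unfolding ae A0[OF z] B0[OF z] .
  qed
qed

section \<open>The Liouville transformation around a Stokes ray\<close>

definition log_deriv :: "complex poly \<Rightarrow> complex \<Rightarrow> complex" where
  "log_deriv A z = poly (pderiv A) z / poly A z"

definition log_deriv' :: "complex poly \<Rightarrow> complex \<Rightarrow> complex" where
  "log_deriv' A z = poly (pderiv (pderiv A)) z / poly A z - log_deriv A z ^ 2"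

text \<open>Let Z1 be the derivative of z in the Liouville variable and \<Lambda> = Z1 L / 4 the
  logarithmic derivative of the amplitude. Then this is (\<Lambda>' - \<Lambda>^2) / Z1^2; it is
  rational in z and O(z^(-2)) at infinity.\<close>

definition liouville_error :: "complex poly \<Rightarrow> complex poly \<Rightarrow> complex \<Rightarrow> complex" where
  "liouville_error P Q z =
     (let L = 3 * log_deriv P z - log_deriv Q z in
      ((log_deriv P z - log_deriv Q z) / 2 * L + (3 * log_deriv' P z - log_deriv' Q z)) / 4 - L ^ 2 / 16)"

text \<open>The square of d zeta / d s, where s is the leading part of the Liouville variable zeta;
  it tends to 1 at infinity.\<close>

definition leading_ratio :: "complex poly \<Rightarrow> complex poly \<Rightarrow> complex \<Rightarrow> complex" where
  "leading_ratio P Q z = poly Q z /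
     (poly P z * lead_coeff Q * (z - stokes_center P Q) ^ (degree Q - degree P))"

text \<open>The amplitude is normalised by l^2 = P Z1 because this choice removes the first
  derivative: with l' = \<Lambda> l the transformed equation is U'' = - (1 + \<Lambda>' -
  \<Lambda>^2) U, and V is U'.\<close>

lemma liouville_transform:
  assumes "open D" and dZ: "\<And>\<zeta>. \<zeta> \<in> D \<Longrightarrow> (Z has_field_derivative Z1 \<zeta>) (at \<zeta>)"
    and Z1: "\<And>\<zeta>. \<zeta> \<in> D \<Longrightarrow> Z1 \<zeta> ^ 2 = poly P (Z \<zeta>) / poly Q (Z \<zeta>)"
    and nz: "\<And>\<zeta>. \<zeta> \<in> D \<Longrightarrow> poly P (Z \<zeta>) \<noteq> 0" "\<And>\<zeta>. \<zeta> \<in> D \<Longrightarrow> poly Q (Z \<zeta>) \<noteq> 0"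
    and l: "l holomorphic_on D" "\<And>\<zeta>. \<zeta> \<in> D \<Longrightarrow> l \<zeta> ^ 2 = poly P (Z \<zeta>) * Z1 \<zeta>"
    and g: "solution_on P Q UNIV g"
  defines "\<Lambda> \<equiv> \<lambda>\<zeta>. Z1 \<zeta> * (3 * log_deriv P (Z \<zeta>) - log_deriv Q (Z \<zeta>)) / 4"
  defines "U \<equiv> \<lambda>\<zeta>. g (Z \<zeta>) / l \<zeta>"
  defines "V \<equiv> \<lambda>\<zeta>. (deriv g (Z \<zeta>) * Z1 \<zeta> - \<Lambda> \<zeta> * g (Z \<zeta>)) / l \<zeta>"
  assumes \<zeta>: "\<zeta> \<in> D"
  shows "(Z1 has_field_derivative Z1 \<zeta> ^ 2 * (log_deriv P (Z \<zeta>) - log_deriv Q (Z \<zeta>)) / 2) (at \<zeta>)"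
    and "(U has_field_derivative V \<zeta>) (at \<zeta>)"
    and "(V has_field_derivative - (1 + Z1 \<zeta> ^ 2 * liouville_error P Q (Z \<zeta>)) * U \<zeta>) (at \<zeta>)"
proof -
  define p1 q1 where "p1 = log_deriv P (Z \<zeta>)" "q1 = log_deriv Q (Z \<zeta>)"
  have Z1nz: "Z1 \<zeta> \<noteq> 0" using Z1[OF \<zeta>] nz[OF \<zeta>] by auto
  have lnz: "l \<zeta> \<noteq> 0" using l(2)[OF \<zeta>] Z1nz nz[OF \<zeta>] by auto
  have dpoly: "((\<lambda>\<zeta>. poly A (Z \<zeta>)) has_field_derivative poly (pderiv A) (Z \<zeta>) * Z1 \<zeta>) (at \<zeta>)" for A
    by (rule DERIV_chain2[OF poly_DERIV dZ[OF \<zeta>]])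
  have dlog: "((\<lambda>\<zeta>. log_deriv A (Z \<zeta>)) has_field_derivative log_deriv' A (Z \<zeta>) * Z1 \<zeta>) (at \<zeta>)"
    if "poly A (Z \<zeta>) \<noteq> 0" for A
    unfolding log_deriv_def
    by (rule DERIV_cong[OF DERIV_divide[OF dpoly dpoly that]])
      (use that in \<open>simp add: log_deriv'_def log_deriv_def field_simps power2_eq_square\<close>)
  have "Z1 \<xi> = deriv Z \<xi>" if "\<xi> \<in> D" for \<xi> using dZ[OF that] by (simp add: DERIV_imp_deriv)
  moreover have "deriv Z holomorphic_on D"
    using assms(1) dZ by (intro holomorphic_deriv) (auto simp: holomorphic_on_open)
  ultimately have "Z1 holomorphic_on D" using holomorphic_cong[of D D Z1 "deriv Z"] by auto
  then have d0: "(Z1 has_field_derivative deriv Z1 \<zeta>) (at \<zeta>)" using assms(1) \<zeta> by (rule holomorphic_derivI)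
  \<comment> \<open>Differentiating Z1^2 = P / Q in two ways gives Z1' without naming a branch of
    the root.\<close>
  have "((\<lambda>\<zeta>. Z1 \<zeta> ^ 2) has_field_derivative 2 * Z1 \<zeta> * deriv Z1 \<zeta>) (at \<zeta>)"
    by (auto intro!: derivative_eq_intros d0)
  moreover have "((\<lambda>\<zeta>. Z1 \<zeta> ^ 2) has_field_derivative poly P (Z \<zeta>) / poly Q (Z \<zeta>) * (p1 - q1) * Z1 \<zeta>) (at \<zeta>)"
  proof (rule has_field_derivative_transform_within_open[OF _ assms(1) \<zeta>])
    show "((\<lambda>\<zeta>. poly P (Z \<zeta>) / poly Q (Z \<zeta>)) has_field_derivative poly P (Z \<zeta>) / poly Q (Z \<zeta>) * (p1 - q1) * Z1 \<zeta>) (at \<zeta>)"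
      by (rule DERIV_cong[OF DERIV_divide[OF dpoly dpoly nz(2)[OF \<zeta>]]])
        (use nz[OF \<zeta>] in \<open>simp add: p1_q1_def log_deriv_def field_simps power2_eq_square\<close>)
  qed (use Z1 in auto)
  ultimately have "2 * Z1 \<zeta> * deriv Z1 \<zeta> = poly P (Z \<zeta>) / poly Q (Z \<zeta>) * (p1 - q1) * Z1 \<zeta>" by (rule DERIV_unique)
  then have "Z1 \<zeta> * (2 * deriv Z1 \<zeta>) = Z1 \<zeta> * (Z1 \<zeta> ^ 2 * (p1 - q1))"
    unfolding Z1[OF \<zeta>, symmetric] by (simp only: mult_ac)
  then have "2 * deriv Z1 \<zeta> = Z1 \<zeta> ^ 2 * (p1 - q1)" using Z1nz mult_left_cancel by blast
  then have "deriv Z1 \<zeta> = Z1 \<zeta> ^ 2 * (p1 - q1) / 2" by (simp add: field_simps)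
  then have dZ1: "(Z1 has_field_derivative Z1 \<zeta> ^ 2 * (p1 - q1) / 2) (at \<zeta>)" using d0 by (simp only:)
  then show "(Z1 has_field_derivative Z1 \<zeta> ^ 2 * (log_deriv P (Z \<zeta>) - log_deriv Q (Z \<zeta>)) / 2) (at \<zeta>)"
    by (simp add: p1_q1_def)
  have dl0: "(l has_field_derivative deriv l \<zeta>) (at \<zeta>)" using l(1) assms(1) \<zeta> by (rule holomorphic_derivI)
  have "((\<lambda>\<zeta>. l \<zeta> ^ 2) has_field_derivative 2 * l \<zeta> * deriv l \<zeta>) (at \<zeta>)"
    by (auto intro!: derivative_eq_intros dl0)
  moreover have "((\<lambda>\<zeta>. l \<zeta> ^ 2) has_field_derivative l \<zeta> ^ 2 * (2 * \<Lambda> \<zeta>)) (at \<zeta>)"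
  proof (rule has_field_derivative_transform_within_open[OF _ assms(1) \<zeta>])
    show "((\<lambda>\<zeta>. poly P (Z \<zeta>) * Z1 \<zeta>) has_field_derivative l \<zeta> ^ 2 * (2 * \<Lambda> \<zeta>)) (at \<zeta>)"
      unfolding l(2)[OF \<zeta>]
      by (rule DERIV_cong[OF DERIV_mult[OF dpoly dZ1]])
        (use nz[OF \<zeta>] in \<open>simp add: p1_q1_def \<Lambda>_def log_deriv_def field_simps power2_eq_square\<close>)
  qed (use l(2) in auto)
  ultimately have "2 * l \<zeta> * deriv l \<zeta> = l \<zeta> ^ 2 * (2 * \<Lambda> \<zeta>)" by (rule DERIV_unique)
  then have "deriv l \<zeta> = l \<zeta> * \<Lambda> \<zeta>" using lnz by (simp add: field_simps power2_eq_square)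
  then have dl: "(l has_field_derivative l \<zeta> * \<Lambda> \<zeta>) (at \<zeta>)" using dl0 by simp
  define E where "E = ((p1 - q1) / 2 * (3 * p1 - q1) + (3 * log_deriv' P (Z \<zeta>) - log_deriv' Q (Z \<zeta>))) / 4"
  have d\<Lambda>: "(\<Lambda> has_field_derivative Z1 \<zeta> ^ 2 * E) (at \<zeta>)"
    unfolding \<Lambda>_def
    by (rule DERIV_cong[OF DERIV_cdivide[OF DERIV_mult[OF dZ1 DERIV_diff[OF DERIV_cmult[OF dlog[OF nz(1)[OF \<zeta>]]] dlog[OF nz(2)[OF \<zeta>]]]]]])
      (simp add: E_def p1_q1_def[symmetric] field_simps power2_eq_square)
  have gh: "g holomorphic_on UNIV" using g by (simp add: solution_on_def)
  have dg: "((\<lambda>\<zeta>. g (Z \<zeta>)) has_field_derivative deriv g (Z \<zeta>) * Z1 \<zeta>) (at \<zeta>)"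
    by (rule DERIV_chain2[OF holomorphic_derivI[OF gh open_UNIV UNIV_I] dZ[OF \<zeta>]])
  have dg1: "((\<lambda>\<zeta>. deriv g (Z \<zeta>)) has_field_derivative deriv (deriv g) (Z \<zeta>) * Z1 \<zeta>) (at \<zeta>)"
    by (rule DERIV_chain2[OF holomorphic_derivI[OF holomorphic_deriv[OF gh open_UNIV] open_UNIV UNIV_I] dZ[OF \<zeta>]])
  have ode: "deriv (deriv g) (Z \<zeta>) = p1 * deriv g (Z \<zeta>) - poly Q (Z \<zeta>) / poly P (Z \<zeta>) * g (Z \<zeta>)"
    using g nz(1)[OF \<zeta>] unfolding solution_on_def p1_q1_def log_deriv_def by (auto simp: algebra_simps)
  show "(U has_field_derivative V \<zeta>) (at \<zeta>)"
    unfolding U_def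
    by (rule DERIV_cong[OF DERIV_divide[OF dg dl lnz]])
      (use lnz in \<open>simp add: V_def field_simps power2_eq_square\<close>)
  have QP: "poly Q (Z \<zeta>) / poly P (Z \<zeta>) * Z1 \<zeta> ^ 2 = 1" using Z1[OF \<zeta>] nz[OF \<zeta>] by simp
  have err: "Z1 \<zeta> ^ 2 * liouville_error P Q (Z \<zeta>) = Z1 \<zeta> ^ 2 * E - \<Lambda> \<zeta> ^ 2"
    by (simp add: liouville_error_def Let_def E_def \<Lambda>_def p1_q1_def[symmetric]) (simp add: field_simps power2_eq_square)
  \<comment> \<open>This identity cancels the coefficient of g'; it is the reason for the
    normalisation of l.\<close>
  have \<Lambda>: "2 * \<Lambda> \<zeta> * Z1 \<zeta> = p1 * Z1 \<zeta> ^ 2 + Z1 \<zeta> ^ 2 * (p1 - q1) / 2"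
    by (simp add: \<Lambda>_def p1_q1_def power2_eq_square field_simps)
  have "deriv (deriv g) (Z \<zeta>) * Z1 \<zeta> * Z1 \<zeta> + Z1 \<zeta> ^ 2 * (p1 - q1) / 2 * deriv g (Z \<zeta>)
      - (Z1 \<zeta> ^ 2 * E * g (Z \<zeta>) + deriv g (Z \<zeta>) * Z1 \<zeta> * \<Lambda> \<zeta>)
      - \<Lambda> \<zeta> * (deriv g (Z \<zeta>) * Z1 \<zeta> - \<Lambda> \<zeta> * g (Z \<zeta>))
    = (p1 * Z1 \<zeta> ^ 2 + Z1 \<zeta> ^ 2 * (p1 - q1) / 2 - 2 * \<Lambda> \<zeta> * Z1 \<zeta>) * deriv g (Z \<zeta>)
      - (poly Q (Z \<zeta>) / poly P (Z \<zeta>) * Z1 \<zeta> ^ 2 + (Z1 \<zeta> ^ 2 * E - \<Lambda> \<zeta> ^ 2)) * g (Z \<zeta>)"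
    unfolding ode by (simp add: algebra_simps power2_eq_square)
  also have "\<dots> = - (1 + Z1 \<zeta> ^ 2 * liouville_error P Q (Z \<zeta>)) * g (Z \<zeta>)"
    unfolding \<Lambda> QP err by (simp add: algebra_simps)
  finally have key: "deriv (deriv g) (Z \<zeta>) * Z1 \<zeta> * Z1 \<zeta> + Z1 \<zeta> ^ 2 * (p1 - q1) / 2 * deriv g (Z \<zeta>)
      - (Z1 \<zeta> ^ 2 * E * g (Z \<zeta>) + deriv g (Z \<zeta>) * Z1 \<zeta> * \<Lambda> \<zeta>)
      - \<Lambda> \<zeta> * (deriv g (Z \<zeta>) * Z1 \<zeta> - \<Lambda> \<zeta> * g (Z \<zeta>))
    = - (1 + Z1 \<zeta> ^ 2 * liouville_error P Q (Z \<zeta>)) * g (Z \<zeta>)" .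
  have quot: "(X * l \<zeta> - Y * (l \<zeta> * \<Lambda> \<zeta>)) / (l \<zeta> * l \<zeta>) = (X - \<Lambda> \<zeta> * Y) / l \<zeta>" for X Y
    using lnz by (simp add: field_simps)
  show "(V has_field_derivative - (1 + Z1 \<zeta> ^ 2 * liouville_error P Q (Z \<zeta>)) * U \<zeta>) (at \<zeta>)"
    unfolding V_def
    by (rule DERIV_cong[OF DERIV_divide[OF DERIV_diff[OF DERIV_mult[OF dg1 dZ1] DERIV_mult[OF d\<Lambda> dg]] dl lnz]])
      (simp only: quot key U_def times_divide_eq_right)
qed

section \<open>Estimates of the coefficients near infinity\<close>

lemma poly_growth_bound:
  fixes A B :: "complex poly"
  assumes "degree A + k \<le> degree B" "B \<noteq> 0"
  obtains C where "C \<ge> 0" "\<forall>\<^sub>F z in at_infinity. norm (z ^ k * poly A z) \<le> C * norm (poly B z)"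
proof -
  have a: "((\<lambda>x. poly A x / x ^ degree A) \<longlongrightarrow> lead_coeff A) at_infinity"
    and b: "((\<lambda>x. poly B x / x ^ degree B) \<longlongrightarrow> lead_coeff B) at_infinity"
    by (rule poly_divide_tendsto_aux)+
  have "lead_coeff B \<noteq> 0" using assms by simp
  then have q: "((\<lambda>x. norm ((poly A x / x ^ degree A) / (poly B x / x ^ degree B))) \<longlongrightarrow> norm (lead_coeff A / lead_coeff B)) at_infinity"
    by (intro tendsto_intros a b)
  define C where "C = norm (lead_coeff A / lead_coeff B) + 1"
  have "\<forall>\<^sub>F x in at_infinity. norm ((poly A x / x ^ degree A) / (poly B x / x ^ degree B)) < C"
    by (rule order_tendstoD(2)[OF q]) (simp add: C_def)
  moreover have "\<forall>\<^sub>F x in at_infinity. poly B x / x ^ degree B \<noteq> 0"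
    by (rule tendsto_imp_eventually_ne[OF b \<open>lead_coeff B \<noteq> 0\<close>])
  moreover have "\<forall>\<^sub>F x::complex in at_infinity. norm x \<ge> 1"
    by (auto simp: eventually_at_infinity)
  ultimately have "\<forall>\<^sub>F z in at_infinity. norm (z ^ k * poly A z) \<le> C * norm (poly B z)"
  proof eventually_elim
    case (elim z)
    then have z: "z \<noteq> 0" "poly B z \<noteq> 0" by auto
    have "norm (z ^ k * poly A z) = norm ((poly A z / z ^ degree A) / (poly B z / z ^ degree B)) * norm (poly B z)
        * (norm z ^ (k + degree A) / norm z ^ degree B)"
      using z by (simp add: norm_mult norm_divide norm_power power_add field_simps)
    also have "\<dots> \<le> C * norm (poly B z) * 1"
    proof (intro mult_mono)
      have "norm z ^ (k + degree A) \<le> norm z ^ degree B"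
        using elim(3) assms(1) by (intro power_increasing) auto
      then show "norm z ^ (k + degree A) / norm z ^ degree B \<le> 1" using z by simp
    qed (use elim in \<open>auto simp: C_def\<close>)
    finally show ?case by simp
  qed
  then show ?thesis using that[of C] by (simp add: C_def)
qed

lemma log_deriv_bounds:
  assumes "A \<noteq> 0"
  obtains C where "C \<ge> 0" "\<forall>\<^sub>F z in at_infinity. norm (log_deriv A z) \<le> C / norm z \<and> norm (log_deriv' A z) \<le> C / norm z ^ 2"
proof -
  obtain C1 where C1: "C1 \<ge> 0" "\<forall>\<^sub>F z in at_infinity. norm (z * poly (pderiv A) z) \<le> C1 * norm (poly A z)"
  proof (cases "degree A = 0")
    \<comment> \<open>The derivative of a constant has degree 0, not - 1, so constants are treated
      apart.\<close>
    case True
    then have "pderiv A = 0" by (simp add: pderiv_eq_0_iff)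
    then show ?thesis using that[of 0] by simp
  next
    case False
    then have "degree (pderiv A) + 1 \<le> degree A" by (simp add: degree_pderiv)
    from poly_growth_bound[OF this assms] show ?thesis using that by auto
  qed
  obtain C2 where C2: "C2 \<ge> 0" "\<forall>\<^sub>F z in at_infinity. norm (z ^ 2 * poly (pderiv (pderiv A)) z) \<le> C2 * norm (poly A z)"
  proof (cases "degree A \<le> 1")
    case True
    then have "pderiv (pderiv A) = 0" by (simp add: pderiv_eq_0_iff degree_pderiv)
    then show ?thesis using that[of 0] by simp
  next
    case False
    then have "degree (pderiv (pderiv A)) + 2 \<le> degree A" by (simp add: degree_pderiv)
    from poly_growth_bound[OF this assms] show ?thesis using that by auto
  qed
  have "\<forall>\<^sub>F z::complex in at_infinity. poly A z \<noteq> 0"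
  proof -
    have "finite {z. poly A z = 0}" using assms by (rule poly_roots_finite)
    from finite_imp_bounded[OF this] obtain r where "\<forall>z\<in>{z. poly A z = 0}. norm z \<le> r"
      unfolding bounded_iff by blast
    then show ?thesis unfolding eventually_at_infinity by (intro exI[of _ "r + 1"]) force
  qed
  moreover have "\<forall>\<^sub>F x::complex in at_infinity. norm x \<ge> 1"
    by (auto simp: eventually_at_infinity)
  ultimately have "\<forall>\<^sub>F z in at_infinity. norm (log_deriv A z) \<le> (C1 + C2 + C1 ^ 2) / norm z \<and> norm (log_deriv' A z) \<le> (C1 + C2 + C1 ^ 2) / norm z ^ 2"
    using C1(2) C2(2)
  proof eventually_elim
    case (elim z)
    then have z: "z \<noteq> 0" "norm z > 0" by auto
    have 1: "norm (log_deriv A z) \<le> C1 / norm z"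
      using elim z by (simp add: log_deriv_def norm_divide norm_mult field_simps)
    have 2: "norm (poly (pderiv (pderiv A)) z / poly A z) \<le> C2 / norm z ^ 2"
      using elim z by (simp add: norm_divide norm_mult norm_power field_simps)
    have "norm (log_deriv' A z) \<le> C2 / norm z ^ 2 + (C1 / norm z) ^ 2"
      unfolding log_deriv'_def using 2 power_mono[OF 1, of 2]
      by (intro order_trans[OF norm_triangle_ineq4] add_mono) (auto simp: norm_power)
    also have "\<dots> = (C2 + C1 ^ 2) / norm z ^ 2" by (simp add: power_divide add_divide_distrib)
    also have "\<dots> \<le> (C1 + C2 + C1 ^ 2) / norm z ^ 2"
      using C1(1) by (intro divide_right_mono) auto
    finally have 3: "norm (log_deriv' A z) \<le> (C1 + C2 + C1 ^ 2) / norm z ^ 2" .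
    have "C1 / norm z \<le> (C1 + C2 + C1 ^ 2) / norm z"
      using C2(1) by (intro divide_right_mono) auto
    then show ?case using 1 3 by linarith
  qed
  then show ?thesis using that[of "C1 + C2 + C1 ^ 2"] C1(1) C2(1) by auto
qed

lemma liouville_error_bound:
  assumes "norm (log_deriv P z) \<le> C / r" "norm (log_deriv Q z) \<le> C / r"
    "norm (log_deriv' P z) \<le> C / r ^ 2" "norm (log_deriv' Q z) \<le> C / r ^ 2" "C \<ge> 0" "r > 0"
  shows "norm (liouville_error P Q z) \<le> (C + 2 * C ^ 2) / r ^ 2"
proof -
  define p q p' q' where "p = log_deriv P z" "q = log_deriv Q z" "p' = log_deriv' P z" "q' = log_deriv' Q z"
  have a: "norm p \<le> C / r" "norm q \<le> C / r" "norm p' \<le> C / r ^ 2" "norm q' \<le> C / r ^ 2"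
    using assms by (auto simp: p_q_p'_q'_def)
  have L: "norm (3 * p - q) \<le> 4 * (C / r)"
  proof -
    have "norm (3 * p - q) \<le> norm (3 * p) + norm q" by (rule norm_triangle_ineq4)
    also have "norm (3 * p) = 3 * norm p" by (simp add: norm_mult)
    finally show ?thesis using a by linarith
  qed
  have m: "norm ((p - q) / 2) \<le> C / r"
  proof -
    have "norm (p - q) \<le> norm p + norm q" by (rule norm_triangle_ineq4)
    moreover have "norm ((p - q) / 2) = norm (p - q) / 2" by (simp add: norm_divide)
    ultimately show ?thesis using a by linarith
  qed
  have d: "norm (3 * p' - q') \<le> 4 * (C / r ^ 2)"
  proof -
    have "norm (3 * p' - q') \<le> norm (3 * p') + norm q'" by (rule norm_triangle_ineq4)
    also have "norm (3 * p') = 3 * norm p'" by (simp add: norm_mult)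
    finally show ?thesis using a by linarith
  qed
  have Cr: "C / r \<ge> 0" using assms by simp
  have "liouville_error P Q z = ((p - q) / 2 * (3 * p - q) + (3 * p' - q')) / 4 - (3 * p - q) ^ 2 / 16"
    by (simp add: liouville_error_def Let_def p_q_p'_q'_def)
  also have "norm \<dots> \<le> (norm ((p - q) / 2) * norm (3 * p - q) + norm (3 * p' - q')) / 4 + norm (3 * p - q) ^ 2 / 16"
    by (rule order_trans[OF norm_triangle_ineq4])
      (auto simp: norm_divide norm_mult norm_power intro!: divide_right_mono order_trans[OF norm_triangle_ineq])
  also have "\<dots> \<le> ((C / r) * (4 * (C / r)) + 4 * (C / r ^ 2)) / 4 + (4 * (C / r)) ^ 2 / 16"
    using L m d Cr by (intro add_mono divide_right_mono mult_mono power_mono) auto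
  also have "\<dots> = (C + 2 * C ^ 2) / r ^ 2"
    using assms by (simp add: field_simps power2_eq_square)
  finally show ?thesis .
qed

lemma leading_ratio_tendsto:
  assumes "lead_coeff P = 1" "Q \<noteq> 0" "degree P \<le> degree Q"
  shows "(leading_ratio P Q \<longlongrightarrow> 1) at_infinity"
proof -
  define L where "L = [:- stokes_center P Q, 1:]"
  define B where "B = Polynomial.smult (lead_coeff Q) (P * L ^ (degree Q - degree P))"
  have P0: "P \<noteq> 0" using assms(1) by auto
  have L0: "L \<noteq> 0" "degree L = 1" "lead_coeff L = 1" by (auto simp: L_def)
  have dL: "degree (L ^ n) = n" "lead_coeff (L ^ n) = 1" "L ^ n \<noteq> 0" for n
    using L0 degree_power_eq[OF L0(1), of n] lead_coeff_power[of L n] by simp_all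
  have "degree (P * L ^ (degree Q - degree P)) = degree Q"
    using degree_mult_eq[OF P0 dL(3), of "degree Q - degree P"] dL(1) assms(3) by simp
  moreover have "lead_coeff (P * L ^ (degree Q - degree P)) = 1"
    unfolding lead_coeff_mult assms(1) dL(2) by simp
  ultimately have dB: "degree B = degree Q" "Polynomial.coeff B (degree Q) = lead_coeff Q"
    using assms(2) by (simp_all add: B_def)
  have lq: "lead_coeff Q \<noteq> 0" using assms by simp
  have a: "((\<lambda>x. poly Q x / x ^ degree Q) \<longlongrightarrow> lead_coeff Q) at_infinity"
    by (rule poly_divide_tendsto_aux)
  have b: "((\<lambda>x. poly B x / x ^ degree Q) \<longlongrightarrow> lead_coeff Q) at_infinity"
    using poly_divide_tendsto_aux[of B] by (simp only: dB)
  have "((\<lambda>x. (poly Q x / x ^ degree Q) / (poly B x / x ^ degree Q)) \<longlongrightarrow> lead_coeff Q / lead_coeff Q) at_infinity"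
    by (intro tendsto_intros a b lq)
  then have "((\<lambda>x. (poly Q x / x ^ degree Q) / (poly B x / x ^ degree Q)) \<longlongrightarrow> 1) at_infinity"
    using lq by simp
  moreover have "\<forall>\<^sub>F x in at_infinity. (poly Q x / x ^ degree Q) / (poly B x / x ^ degree Q) = leading_ratio P Q x"
  proof -
    have "\<forall>\<^sub>F x::complex in at_infinity. norm x \<ge> 1" by (auto simp: eventually_at_infinity)
    then show ?thesis
    proof eventually_elim
      case (elim x)
      then have "x \<noteq> 0" by auto
      then show ?case
        by (simp add: leading_ratio_def B_def L_def poly_power mult_ac)
    qed
  qed
  ultimately show ?thesis by (rule Lim_transform_eventually)
qed

text \<open>From (sqrt x - 1) (sqrt x + 1) = x - 1, as the principal root has nonnegative real
  part.\<close>

lemma norm_csqrt_minus_one_le: "norm (csqrt x - 1) \<le> norm (x - 1)"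
proof -
  have "(csqrt x - 1) * (csqrt x + 1) = csqrt x ^ 2 - 1" by (simp add: power2_eq_square algebra_simps)
  then have "norm (csqrt x - 1) * norm (csqrt x + 1) = norm (x - 1)" by (metis norm_mult power2_csqrt)
  moreover have "norm (csqrt x + 1) \<ge> 1"
  proof -
    have "0 \<le> Re (csqrt x)" using csqrt_principal[of x] by auto
    then have "1 \<le> Re (csqrt x + 1)" by simp
    then show ?thesis using complex_Re_le_cmod order_trans by blast
  qed
  then have "norm (csqrt x - 1) * 1 \<le> norm (csqrt x - 1) * norm (csqrt x + 1)"
    by (intro mult_left_mono) auto
  ultimately show ?thesis by linarith
qed

lemma norm_csqrt_minus_one:
  assumes "norm (x - 1) \<le> 1 / 10"
  shows "norm (csqrt x - 1) \<le> 1 / 10" "x \<notin> \<real>\<^sub>\<le>\<^sub>0"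
proof -
  show "norm (csqrt x - 1) \<le> 1 / 10" using norm_csqrt_minus_one_le assms by (rule order_trans)
  have "\<bar>Re (x - 1)\<bar> \<le> 1 / 10" using abs_Re_le_cmod[of "x - 1"] assms by linarith
  then show "x \<notin> \<real>\<^sub>\<le>\<^sub>0" by (auto simp: complex_nonpos_Reals_iff)
qed

text \<open>One radius \<open>r0\<close> and one constant \<open>C\<close> collect the asymptotic
  estimates, so that beyond \<open>r0\<close> they hold without exception. The bound on the centre
  makes |z| and |z - d| comparable there.\<close>

locale stokes_setup =
  fixes P Q :: "complex poly" and r0 C :: real
  assumes lcP: "lead_coeff P = 1" and Q0: "Q \<noteq> 0" and deg: "degree P \<le> degree Q"
    and r0: "r0 \<ge> 1" "norm (stokes_center P Q) \<le> r0 / 2" and C: "C \<ge> 1"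
    and farP: "norm (z - stokes_center P Q) \<ge> r0 \<Longrightarrow> poly P z \<noteq> 0"
    and farQ: "norm (z - stokes_center P Q) \<ge> r0 \<Longrightarrow> poly Q z \<noteq> 0"
    and far_ratio: "norm (z - stokes_center P Q) \<ge> r0 \<Longrightarrow> norm (leading_ratio P Q z - 1) \<le> 1 / 10"
    and far_error: "norm (z - stokes_center P Q) \<ge> r0 \<Longrightarrow>
      norm (liouville_error P Q z) \<le> C / norm (z - stokes_center P Q) ^ 2"
    and far_log: "norm (z - stokes_center P Q) \<ge> r0 \<Longrightarrow>
      norm (log_deriv P z - log_deriv Q z) \<le> C / norm (z - stokes_center P Q)"
begin

abbreviation "d \<equiv> stokes_center P Q"
text \<open>
  The map \<open>zmap j\<close> is the inverse of the leading part \<open>s = (z - d)^(M / 2) / \<kappa>\<close> of the Liouville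
  variable, rotated so that the \<open>j\<close>-th Stokes ray corresponds to the positive reals. The constant in
  \<open>K\<close> makes the relative error of the asymptotics at most \<open>1 / 1000\<close>.
\<close>

definition "N = degree Q - degree P"
definition "M = real N + 2"
definition "b = lead_coeff Q"
definition "\<kappa> = M / (2 * sqrt (norm b))"
definition "K = r0 powr (M / 2) / \<kappa> + 60000 * C"
definition "W s = exp (of_real (2 / M) * Ln (of_real \<kappa> * s))"
definition "zmap j s = d + cis (stokes_angle P Q j) * W s"
definition "zmap' j s = cis (stokes_angle P Q j) * (of_real (2 / M) * W s / s)"

lemma P0: "P \<noteq> 0" using lcP by auto
lemma b0: "b \<noteq> 0" using Q0 by (simp add: b_def)
lemma M2: "M \<ge> 2" by (simp add: M_def)
lemma real_N2: "real (N + 2) = M" by (simp add: M_def)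
lemma \<kappa>0: "\<kappa> > 0" using M2 b0 by (simp add: \<kappa>_def)
lemma \<kappa>b: "norm b * \<kappa> ^ 2 = M ^ 2 / 4" using b0 by (simp add: \<kappa>_def power_divide power_mult_distrib)
lemma K_large: "K \<ge> 60000 * C" "K > 0" "K \<ge> 60000"
  using \<kappa>0 C by (auto simp: K_def add_nonneg_pos add_increasing)

lemma W_nonzero: "W s \<noteq> 0" by (simp add: W_def)

lemma norm_W: "s \<noteq> 0 \<Longrightarrow> norm (W s) = (\<kappa> * norm s) powr (2 / M)"
  using \<kappa>0 by (simp add: W_def powr_def norm_mult)

lemma W_power: assumes "s \<noteq> 0" shows "W s ^ (N + 2) = (of_real \<kappa> * s) ^ 2"
proof -
  have "W s ^ (N + 2) = exp (of_nat (N + 2) * (of_real (2 / M) * Ln (of_real \<kappa> * s)))"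
    unfolding W_def by (rule exp_of_nat_mult[symmetric])
  also have "of_nat (N + 2) * (of_real (2 / M) * Ln (of_real \<kappa> * s)) = of_real (real (N + 2) * (2 / M)) * Ln (of_real \<kappa> * s)"
    by (simp only: of_real_mult of_real_of_nat_eq mult.assoc)
  also have "real (N + 2) * (2 / M) = real 2" unfolding real_N2 using M2 by simp
  also have "exp (of_real (real 2) * Ln (of_real \<kappa> * s)) = exp (Ln (of_real \<kappa> * s)) ^ 2"
    by (metis exp_of_nat_mult of_real_of_nat_eq)
  also have "exp (Ln (of_real \<kappa> * s)) = of_real \<kappa> * s" using assms \<kappa>0 by simp
  finally show ?thesis .
qed

lemma W_derivative:
  assumes "s \<notin> \<real>\<^sub>\<le>\<^sub>0"
  shows "(W has_field_derivative of_real (2 / M) * W s / s) (at s)"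
proof -
  have s0: "s \<noteq> 0" using assms by auto
  have ns: "of_real \<kappa> * s \<notin> \<real>\<^sub>\<le>\<^sub>0"
    using assms \<kappa>0 by (auto simp: complex_nonpos_Reals_iff zero_less_mult_iff mult_le_0_iff)
  have "((\<lambda>s. Ln (of_real \<kappa> * s)) has_field_derivative inverse (of_real \<kappa> * s) * of_real \<kappa>) (at s)"
    by (rule DERIV_chain2[where g = "\<lambda>s. of_real \<kappa> * s", OF has_field_derivative_Ln[OF ns]]) (auto intro!: derivative_eq_intros)
  then have L: "((\<lambda>s. of_real (2 / M) * Ln (of_real \<kappa> * s)) has_field_derivative of_real (2 / M) * (inverse (of_real \<kappa> * s) * of_real \<kappa>)) (at s)"
    by (rule DERIV_cmult)
  show ?thesis
    unfolding W_def
    by (rule DERIV_cong[OF DERIV_chain2[OF DERIV_exp L]]) (use s0 \<kappa>0 in \<open>simp add: field_simps\<close>)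
qed

lemma zmap_derivative: "s \<notin> \<real>\<^sub>\<le>\<^sub>0 \<Longrightarrow> (zmap j has_field_derivative zmap' j s) (at s)"
  unfolding zmap_def zmap'_def by (auto intro!: derivative_eq_intros W_derivative)

text \<open>Along this direction the leading term of (Q / P) dz^2 is positive, so the Liouville
  variable is real to leading order and both exponentials oscillate.\<close>

lemma stokes_direction: "b * cis (stokes_angle P Q j) ^ (N + 2) = of_real (norm b)"
proof -
  have a: "real (N + 2) * stokes_angle P Q j = 2 * pi * real j - Arg b"
    unfolding stokes_angle_def N_def[symmetric] b_def[symmetric] M_def[symmetric] real_N2 using M2 by simp
  have "cis (stokes_angle P Q j) ^ (N + 2) = cis (2 * pi * real j - Arg b)"
    by (subst Complex.DeMoivre) (simp only: a)
  also have "\<dots> = cis (2 * pi * real j) * cis (- Arg b)" by (simp only: cis_mult) simp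
  also have "cis (2 * pi * real j) = 1" by (rule cis_multiple_2pi) simp
  finally have "b * cis (stokes_angle P Q j) ^ (N + 2) = rcis (norm b) (Arg b) * cis (- Arg b)"
    by (simp add: rcis_cmod_Arg)
  also have "\<dots> = of_real (norm b)" by (simp add: rcis_def mult.assoc cis_mult)
  finally show ?thesis .
qed

lemma norm_zmap: "norm (zmap j s - d) = norm (W s)"
  by (simp add: zmap_def norm_mult)

text \<open>The first summand of \<open>K\<close> is the modulus of s that corresponds to |z - d| =
  r0.\<close>

lemma W_far:
  assumes "norm s \<ge> K"
  shows "norm (W s) \<ge> r0"
proof -
  have s0: "s \<noteq> 0" using assms K_large by auto
  have "r0 powr (M / 2) / \<kappa> \<le> norm s" using assms C unfolding K_def by simp
  then have "r0 powr (M / 2) \<le> \<kappa> * norm s" using \<kappa>0 by (simp add: field_simps)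
  then have "(r0 powr (M / 2)) powr (2 / M) \<le> (\<kappa> * norm s) powr (2 / M)"
    using M2 by (intro powr_mono2) auto
  moreover have "(r0 powr (M / 2)) powr (2 / M) = r0" using r0 M2 by (simp add: powr_powr)
  ultimately show ?thesis using norm_W[OF s0] by simp
qed

text \<open>The factor \<open>\<kappa>\<close> is fixed by this identity: after division by the
  derivative of the Liouville variable in s, the derivative of z has square P / Q, as the Liouville
  transformation requires.\<close>

lemma zmap'_square:
  assumes "norm s \<ge> K"
  shows "zmap' j s ^ 2 / leading_ratio P Q (zmap j s) = poly P (zmap j s) / poly Q (zmap j s)"
proof -
  define w where "w = cis (stokes_angle P Q j) * W s"
  have far: "norm (zmap j s - d) \<ge> r0" using W_far[OF assms] norm_zmap by simp
  note nz = farP[OF far] farQ[OF far]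
  have s0: "s \<noteq> 0" using assms K_large by auto
  have w0: "w \<noteq> 0" by (simp add: w_def W_nonzero)
  have "b * w ^ (N + 2) = (b * cis (stokes_angle P Q j) ^ (N + 2)) * W s ^ (N + 2)"
    by (simp add: w_def power_mult_distrib mult.assoc)
  also have "\<dots> = of_real (norm b * \<kappa> ^ 2) * s ^ 2"
    unfolding stokes_direction W_power[OF s0] by (simp add: power_mult_distrib)
  finally have bw: "b * w ^ N * w ^ 2 = of_real (M ^ 2 / 4) * s ^ 2" unfolding \<kappa>b by (simp add: power_add mult_ac power2_eq_square)
  have lr: "leading_ratio P Q (zmap j s) = poly Q (zmap j s) / (poly P (zmap j s) * (b * w ^ N))"
    by (simp add: leading_ratio_def zmap_def w_def b_def N_def mult.assoc)
  have z1: "zmap' j s = of_real (2 / M) * w / s" by (simp add: zmap'_def w_def)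
  have "zmap' j s ^ 2 / leading_ratio P Q (zmap j s)
     = of_real (4 / M ^ 2) / s ^ 2 * (b * w ^ N * w ^ 2) * (poly P (zmap j s) / poly Q (zmap j s))"
    unfolding lr z1 by (simp add: power_divide power_mult_distrib)
  also have "of_real (4 / M ^ 2) / s ^ 2 * (b * w ^ N * w ^ 2) = 1"
    unfolding bw using s0 M2 by simp
  finally show ?thesis by simp
qed

lemma norm_P_div_Q:
  assumes "norm (z - d) \<ge> r0"
  shows "norm (poly P z / poly Q z) \<le> 2 / (norm b * norm (z - d) ^ N)"
    "norm (poly Q z / poly P z) \<le> 2 * norm b * norm (z - d) ^ N"
    "norm (poly P z / poly Q z) \<ge> 1 / (2 * norm b * norm (z - d) ^ N)"
proof -
  note nz = farP[OF assms] farQ[OF assms]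
  have zd: "z - d \<noteq> 0" using assms r0 by auto
  define q where "q = leading_ratio P Q z"
  have "\<bar>norm q - 1\<bar> \<le> norm (q - 1)" using norm_triangle_ineq3[of q 1] by simp
  also have "\<dots> \<le> 1 / 10" using far_ratio[OF assms] by (simp add: q_def)
  finally have q: "norm q \<le> 2" "norm q \<ge> 1 / 2" by linarith+
  have QP: "poly Q z / poly P z = q * (b * (z - d) ^ N)"
    using nz zd b0 by (simp add: q_def leading_ratio_def b_def N_def field_simps)
  have B: "norm b * norm (z - d) ^ N > 0" "norm (z - d) ^ N > 0" using b0 zd by simp_all
  show 2: "norm (poly Q z / poly P z) \<le> 2 * norm b * norm (z - d) ^ N"
    unfolding QP norm_mult norm_power using q B by (simp add: mult.assoc mult_right_mono)
  have PQ: "norm (poly P z / poly Q z) = 1 / (norm q * (norm b * norm (z - d) ^ N))"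
  proof -
    have "poly P z / poly Q z = 1 / (q * (b * (z - d) ^ N))" unfolding QP[symmetric] by simp
    then show ?thesis by (simp add: norm_divide norm_mult norm_power)
  qed
  have "1 / (norm q * (norm b * norm (z - d) ^ N)) \<le> 1 / (1 / 2 * (norm b * norm (z - d) ^ N))"
    using q B b0 by (intro divide_left_mono mult_right_mono mult_pos_pos) auto
  then show "norm (poly P z / poly Q z) \<le> 2 / (norm b * norm (z - d) ^ N)" unfolding PQ by simp
  have "1 / (2 * (norm b * norm (z - d) ^ N)) \<le> 1 / (norm q * (norm b * norm (z - d) ^ N))"
    using q B b0 by (intro divide_left_mono mult_right_mono mult_pos_pos) auto
  then show "norm (poly P z / poly Q z) \<ge> 1 / (2 * norm b * norm (z - d) ^ N)" unfolding PQ by (simp add: mult.assoc)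
qed

end

lemma stokes_setup_exists:
  assumes "lead_coeff P = 1" "Q \<noteq> 0" "degree P \<le> degree Q"
  obtains r0 C where "stokes_setup P Q r0 C"
proof -
  define d where "d = stokes_center P Q"
  have P0: "P \<noteq> 0" using assms(1) by auto
  obtain CP where CP: "CP \<ge> 0" "\<forall>\<^sub>F z in at_infinity. norm (log_deriv P z) \<le> CP / norm z \<and> norm (log_deriv' P z) \<le> CP / norm z ^ 2"
    using log_deriv_bounds[OF P0] by blast
  obtain CQ where CQ: "CQ \<ge> 0" "\<forall>\<^sub>F z in at_infinity. norm (log_deriv Q z) \<le> CQ / norm z \<and> norm (log_deriv' Q z) \<le> CQ / norm z ^ 2"
    using log_deriv_bounds[OF assms(2)] by blast
  define B where "B = CP + CQ"
  have B0: "B \<ge> 0" using CP CQ by (simp add: B_def)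
  have rat: "\<forall>\<^sub>F z in at_infinity. dist (leading_ratio P Q z) 1 < 1 / 10"
    by (rule tendstoD[OF leading_ratio_tendsto[OF assms]]) simp
  have nzA: "\<forall>\<^sub>F z::complex in at_infinity. poly A z \<noteq> 0" if "A \<noteq> 0" for A :: "complex poly"
  proof -
    have "finite {z. poly A z = 0}" using that by (rule poly_roots_finite)
    from finite_imp_bounded[OF this] obtain r where "\<forall>z\<in>{z. poly A z = 0}. norm z \<le> r"
      unfolding bounded_iff by blast
    then show ?thesis unfolding eventually_at_infinity by (intro exI[of _ "r + 1"]) force
  qed
  have "\<forall>\<^sub>F z in at_infinity. poly P z \<noteq> 0 \<and> poly Q z \<noteq> 0 \<and> dist (leading_ratio P Q z) 1 < 1 / 10 \<and>
      norm (log_deriv P z) \<le> CP / norm z \<and> norm (log_deriv' P z) \<le> CP / norm z ^ 2 \<and>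
      norm (log_deriv Q z) \<le> CQ / norm z \<and> norm (log_deriv' Q z) \<le> CQ / norm z ^ 2"
    using nzA[OF P0] nzA[OF assms(2)] rat CP(2) CQ(2) by eventually_elim auto
  then obtain r where r: "\<And>z. norm z \<ge> r \<Longrightarrow> poly P z \<noteq> 0 \<and> poly Q z \<noteq> 0 \<and> dist (leading_ratio P Q z) 1 < 1 / 10 \<and>
      norm (log_deriv P z) \<le> CP / norm z \<and> norm (log_deriv' P z) \<le> CP / norm z ^ 2 \<and>
      norm (log_deriv Q z) \<le> CQ / norm z \<and> norm (log_deriv' Q z) \<le> CQ / norm z ^ 2"
    unfolding eventually_at_infinity by blast
  define r0 where "r0 = max 1 (max (2 * norm d) (2 * r))"
  \<comment> \<open>The factors 4 absorb the passage from |z| to |z - d| \<le> 2 |z| and the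
    difference of two logarithmic derivatives.\<close>
  define C where "C = 1 + 4 * (B + 2 * B ^ 2) + 4 * B"
  show ?thesis
  proof (rule that[of r0 C], unfold_locales)
    show "lead_coeff P = 1" "Q \<noteq> 0" "degree P \<le> degree Q" by fact+
    show "1 \<le> r0" "cmod (stokes_center P Q) \<le> r0 / 2" by (auto simp: r0_def d_def)
    show "1 \<le> C" using B0 by (simp add: C_def)
    fix z assume z: "r0 \<le> cmod (z - stokes_center P Q)"
    define x where "x = norm (z - d)"
    have x: "x \<ge> 1" "x \<ge> 2 * norm d" "x \<ge> 2 * r" using z by (auto simp: r0_def x_def d_def)
    have zx: "norm z \<ge> x / 2" using x norm_triangle_ineq4[of z d] by (simp add: x_def)
    then have rz: "norm z \<ge> r" "norm z > 0" using x by linarith+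
    note far = r[OF rz(1)]
    show "poly P z \<noteq> 0" "poly Q z \<noteq> 0" using far by auto
    show "cmod (leading_ratio P Q z - 1) \<le> 1 / 10" using far by (simp add: dist_norm)
    have le: "CP / norm z \<le> B / norm z" "CQ / norm z \<le> B / norm z"
      "CP / norm z ^ 2 \<le> B / norm z ^ 2" "CQ / norm z ^ 2 \<le> B / norm z ^ 2"
      using CP(1) CQ(1) by (auto simp: B_def intro!: divide_right_mono)
    have b: "norm (log_deriv P z) \<le> B / norm z" "norm (log_deriv Q z) \<le> B / norm z"
      "norm (log_deriv' P z) \<le> B / norm z ^ 2" "norm (log_deriv' Q z) \<le> B / norm z ^ 2"
      using far le by auto
    have "cmod (liouville_error P Q z) \<le> (B + 2 * B ^ 2) / norm z ^ 2"
      by (rule liouville_error_bound[OF b B0 rz(2)])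
    also have "\<dots> \<le> (B + 2 * B ^ 2) / (x / 2) ^ 2"
      using zx x B0 by (intro divide_left_mono power_mono mult_pos_pos) auto
    also have "\<dots> = 4 * (B + 2 * B ^ 2) / x ^ 2" by (simp add: power_divide)
    also have "\<dots> \<le> C / x ^ 2" using B0 by (intro divide_right_mono) (auto simp: C_def)
    finally show "cmod (liouville_error P Q z) \<le> C / cmod (z - stokes_center P Q) ^ 2" by (simp add: x_def d_def)
    have "norm (log_deriv P z - log_deriv Q z) \<le> 2 * B / norm z"
      using norm_triangle_ineq4[of "log_deriv P z" "log_deriv Q z"] b by linarith
    also have "\<dots> \<le> 2 * B / (x / 2)" using zx x B0 by (intro divide_left_mono mult_pos_pos) auto
    also have "\<dots> = 4 * B / x" by simp
    also have "\<dots> \<le> C / x" using B0 x by (intro divide_right_mono) (auto simp: C_def)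
    finally show "cmod (log_deriv P z - log_deriv Q z) \<le> C / cmod (z - stokes_center P Q)" by (simp add: x_def d_def)
  qed
qed

text \<open>
  The half plane of the variable \<open>s\<close> with \<open>Re (\<nu> * s) > K\<close> is mapped by \<open>zmap j\<close> into a sector
  around the Stokes ray of angle \<open>stokes_angle P Q j\<close>; in the variable \<open>\<zeta> = \<Phi> s\<close> the equation
  becomes a small perturbation of \<open>U'' + U = 0\<close>.
\<close>

locale stokes_region = stokes_setup +
  fixes j :: nat and \<nu> :: complex and \<Phi> l :: "complex \<Rightarrow> complex"
  assumes \<nu>: "norm \<nu> = 1" "Re \<nu> \<ge> 7 / 10"
    and \<Phi>: "K < Re (\<nu> * s) \<Longrightarrow> (\<Phi> has_field_derivative csqrt (leading_ratio P Q (zmap j s))) (at s)"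
    and l_hol: "l holomorphic_on {s. K < Re (\<nu> * s)}"
    and l_square: "K < Re (\<nu> * s) \<Longrightarrow>
      l s ^ 2 = poly P (zmap j s) * (zmap' j s / csqrt (leading_ratio P Q (zmap j s)))"

lemma half_plane_convex_open:
  fixes \<nu> :: complex
  shows "convex {s. K < Re (\<nu> * s)}" "open {s. K < Re (\<nu> * s)}"
proof -
  have "{s. K < Re (\<nu> * s)} = {s. cnj \<nu> \<bullet> s > K}" by (auto simp: inner_complex_def)
  then show "convex {s. K < Re (\<nu> * s)}" by (simp only: convex_halfspace_gt)
  show "open {s. K < Re (\<nu> * s)}" by (intro open_Collect_less continuous_intros)
qed

context stokes_setup
begin

text \<open>Since \<open>Re \<nu>\<close> is positive, the half plane misses the nonpositive reals,
  where \<open>Ln\<close> has its cut, and \<open>zmap j\<close> is holomorphic on it.\<close>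

lemma half_plane_far:
  assumes "norm \<nu> = 1" "Re \<nu> \<ge> 7 / 10" "K < Re (\<nu> * s)"
  shows "norm s > K" "s \<notin> \<real>\<^sub>\<le>\<^sub>0" "norm (zmap j s - d) \<ge> r0"
proof -
  have "Re (\<nu> * s) \<le> norm (\<nu> * s)" by (rule complex_Re_le_cmod)
  then show s: "norm s > K" using assms by (simp add: norm_mult)
  show "s \<notin> \<real>\<^sub>\<le>\<^sub>0"
  proof
    assume "s \<in> \<real>\<^sub>\<le>\<^sub>0"
    then have "Im s = 0" "Re s \<le> 0" by (auto simp: complex_nonpos_Reals_iff)
    then have "Re (\<nu> * s) \<le> 0" using assms by (simp add: mult_nonneg_nonpos)
    then show False using assms K_large by linarith
  qed
  show "norm (zmap j s - d) \<ge> r0" unfolding norm_zmap using s by (intro W_far) simp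
qed

text \<open>The half plane is convex: this provides the primitive \<open>\<Phi>\<close> and, since
  the function under the root has no zeros, a holomorphic square root.\<close>

lemma stokes_region_exists:
  assumes \<nu>: "norm \<nu> = 1" "Re \<nu> \<ge> 7 / 10"
  obtains \<Phi> l where "stokes_region P Q r0 C j \<nu> \<Phi> l"
proof -
  define H where "H = {s. K < Re (\<nu> * s)}"
  have H: "convex H" "open H" unfolding H_def by (rule half_plane_convex_open)+
  define \<phi> where "\<phi> s = csqrt (leading_ratio P Q (zmap j s))" for s
  have far: "norm s > K" "s \<notin> \<real>\<^sub>\<le>\<^sub>0" "norm (zmap j s - d) \<ge> r0" if "s \<in> H" for s
    using half_plane_far[OF \<nu>] that by (auto simp: H_def)
  have zh: "zmap j holomorphic_on H"
    unfolding holomorphic_on_open[OF H(2)] using zmap_derivative far(2) by blast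
  have zdnz: "zmap j s - d \<noteq> 0" if "s \<in> H" for s using far(3)[OF that] r0 by auto
  have "leading_ratio P Q (zmap j s) = poly Q (zmap j s) / (poly P (zmap j s) * b * (zmap j s - d) ^ N)" for s
    by (simp add: leading_ratio_def b_def N_def)
  then have rh: "(\<lambda>s. leading_ratio P Q (zmap j s)) holomorphic_on H"
    using farP[OF far(3)] b0 zdnz by (simp) (intro holomorphic_intros zh, auto)
  have r1: "norm (leading_ratio P Q (zmap j s) - 1) \<le> 1 / 10" if "s \<in> H" for s
    by (rule far_ratio[OF far(3)[OF that]])
  have ph: "\<phi> holomorphic_on H"
    unfolding \<phi>_def by (intro holomorphic_on_csqrt' rh norm_csqrt_minus_one(2) r1)
  obtain \<Phi> where \<Phi>: "\<And>s. s \<in> H \<Longrightarrow> (\<Phi> has_field_derivative \<phi> s) (at s within H)"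
    using holomorphic_convex_primitive'[OF H ph] by blast
  have pnz: "\<phi> s \<noteq> 0" if "s \<in> H" for s
    using norm_csqrt_minus_one(1)[OF r1[OF that]] by (auto simp: \<phi>_def)
  have hol: "(\<lambda>s. poly P (zmap j s) * (zmap' j s / \<phi> s)) holomorphic_on H"
  proof -
    have "zmap' j s = deriv (zmap j) s" if "s \<in> H" for s
      by (rule DERIV_imp_deriv[symmetric, OF zmap_derivative[OF far(2)[OF that]]])
    then have "(\<lambda>s. zmap' j s) holomorphic_on H"
      using holomorphic_deriv[OF zh H(2)] holomorphic_cong[of H H "zmap' j" "deriv (zmap j)"] by auto
    then show ?thesis using pnz by (intro holomorphic_intros zh ph) auto
  qed
  have contr: "contractible H" using H by (simp add: convex_imp_contractible)
  have nz: "\<And>s. s \<in> H \<Longrightarrow> poly P (zmap j s) * (zmap' j s / \<phi> s) \<noteq> 0"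
  proof -
    fix s assume s: "s \<in> H"
    show "poly P (zmap j s) * (zmap' j s / \<phi> s) \<noteq> 0"
      using farP[OF far(3)[OF s]] pnz[OF s] far(1)[OF s] K_large M2
      by (auto simp: zmap'_def W_nonzero)
  qed
  obtain l where l: "l holomorphic_on H" "\<And>s. s \<in> H \<Longrightarrow> poly P (zmap j s) * (zmap' j s / \<phi> s) = l s ^ 2"
    by (rule contractible_imp_holomorphic_sqrt[OF hol contr nz]) (assumption, rule that, assumption, blast)
  have "stokes_region P Q r0 C j \<nu> \<Phi> l"
  proof unfold_locales
    show "cmod \<nu> = 1" "7 / 10 \<le> Re \<nu>" by fact+
    show "l holomorphic_on {s. K < Re (\<nu> * s)}" using l(1) by (simp add: H_def)
    fix s assume "K < Re (\<nu> * s)"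
    then have s: "s \<in> H" by (simp add: H_def)
    show "(\<Phi> has_field_derivative csqrt (leading_ratio P Q (zmap j s))) (at s)"
      using \<Phi>[OF s] H(2) s at_within_open[of s H] by (simp add: \<phi>_def)
    show "l s ^ 2 = poly P (zmap j s) * (zmap' j s / csqrt (leading_ratio P Q (zmap j s)))"
      using l(2)[OF s] by (simp add: \<phi>_def)
  qed
  then show ?thesis by (rule that)
qed

end

context stokes_region
begin

definition "H = {s. K < Re (\<nu> * s)}"
definition "D = \<Phi> ` H"
definition "\<phi> s = csqrt (leading_ratio P Q (zmap j s))"
definition "\<Psi> = inv_into H \<Phi>"
text \<open>The original variable as a function of the Liouville variable; \<open>Z1\<close> below
  is its derivative.\<close>

definition "Z \<zeta> = zmap j (\<Psi> \<zeta>)"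
definition "Z1 \<zeta> = zmap' j (\<Psi> \<zeta>) / \<phi> (\<Psi> \<zeta>)"

lemma H_convex: "convex H" and H_open: "open H"
  unfolding H_def by (rule half_plane_convex_open)+

lemma H_far: assumes "s \<in> H" shows "norm s > K" "s \<notin> \<real>\<^sub>\<le>\<^sub>0" "norm (zmap j s - d) \<ge> r0" "s \<noteq> 0"
  using half_plane_far[OF \<nu>] assms K_large by (auto simp: H_def)

lemma \<Phi>_derivative: "s \<in> H \<Longrightarrow> (\<Phi> has_field_derivative \<phi> s) (at s)"
  using \<Phi> by (simp add: H_def \<phi>_def)

lemma \<phi>_near: "s \<in> H \<Longrightarrow> norm (\<phi> s - 1) \<le> 1 / 10"
  unfolding \<phi>_def by (intro norm_csqrt_minus_one(1) far_ratio H_far)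

lemma \<phi>_bounds: assumes "s \<in> H" shows "norm (\<phi> s) \<ge> 9 / 10" "norm (\<phi> s) \<le> 11 / 10" "\<phi> s \<noteq> 0"
proof -
  have "\<bar>norm (\<phi> s) - 1\<bar> \<le> norm (\<phi> s - 1)" using norm_triangle_ineq3[of "\<phi> s" 1] by simp
  then show *: "norm (\<phi> s) \<ge> 9 / 10" "norm (\<phi> s) \<le> 11 / 10" using \<phi>_near[OF assms] by linarith+
  then show "\<phi> s \<noteq> 0" by auto
qed

lemmas near_identity = H_convex H_open \<Phi>_derivative \<phi>_near

lemma \<Phi>_inj: "inj_on \<Phi> H"
  by (rule near_identity_inj[OF near_identity])

lemma \<Psi>_\<Phi>: "s \<in> H \<Longrightarrow> \<Psi> (\<Phi> s) = s"
  unfolding \<Psi>_def by (rule inv_into_f_f[OF \<Phi>_inj])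

lemma \<Phi>_\<Psi>: "\<zeta> \<in> D \<Longrightarrow> \<Phi> (\<Psi> \<zeta>) = \<zeta>" and \<Psi>_in: "\<zeta> \<in> D \<Longrightarrow> \<Psi> \<zeta> \<in> H"
  by (auto simp: D_def \<Psi>_\<Phi>)

lemma \<Phi>_in: "s \<in> H \<Longrightarrow> \<Phi> s \<in> D" by (simp add: D_def)

lemma \<Phi>_lipschitz: "s \<in> H \<Longrightarrow> s' \<in> H \<Longrightarrow> norm ((\<Phi> s - \<Phi> s') - (s - s')) \<le> 1 / 10 * norm (s - s')"
  by (rule near_identity_lipschitz[OF near_identity])

lemma \<Phi>_holomorphic: "\<Phi> holomorphic_on H"
  unfolding holomorphic_on_open[OF H_open] using \<Phi>_derivative by blast

lemma D_open: "open D"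
proof -
  have "\<not> \<Phi> constant_on H" if "H \<noteq> {}"
  proof
    assume "\<Phi> constant_on H"
    moreover obtain s where "s \<in> H" using \<open>H \<noteq> {}\<close> by blast
    ultimately obtain c where c: "\<And>s. s \<in> H \<Longrightarrow> \<Phi> s = c" unfolding constant_on_def by blast
    have "((\<lambda>_. c) has_field_derivative \<phi> s) (at s)"
      by (rule has_field_derivative_transform_within_open[OF \<Phi>_derivative H_open]) (use \<open>s \<in> H\<close> c in auto)
    then have "\<phi> s = 0" using DERIV_const DERIV_unique by blast
    then show False using \<phi>_bounds(3)[OF \<open>s \<in> H\<close>] by simp
  qed
  then show ?thesis
    unfolding D_def using open_mapping_thm[OF \<Phi>_holomorphic H_open convex_connected[OF H_convex] H_open subset_refl]
    by (cases "H = {}") auto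
qed

lemma D_connected: "connected D"
  unfolding D_def
  by (intro connected_continuous_image holomorphic_on_imp_continuous_on \<Phi>_holomorphic convex_connected H_convex)

lemma \<Psi>_derivative: assumes "\<zeta> \<in> D" shows "(\<Psi> has_field_derivative 1 / \<phi> (\<Psi> \<zeta>)) (at \<zeta>)"
proof -
  obtain g where g: "g holomorphic_on \<Phi> ` H" "\<And>z. z \<in> H \<Longrightarrow> deriv \<Phi> z * deriv g (\<Phi> z) = 1"
    "\<And>z. z \<in> H \<Longrightarrow> g (\<Phi> z) = z"
    using holomorphic_has_inverse[OF \<Phi>_holomorphic H_open \<Phi>_inj] by blast
  define s where "s = \<Psi> \<zeta>"
  have s: "s \<in> H" "\<zeta> = \<Phi> s" using assms \<Psi>_in \<Phi>_\<Psi> by (auto simp: s_def)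
  have "deriv \<Phi> s = \<phi> s" using \<Phi>_derivative[OF s(1)] by (rule DERIV_imp_deriv)
  then have "deriv g \<zeta> = 1 / \<phi> s" using g(2)[OF s(1)] s(2) \<phi>_bounds(3)[OF s(1)] by (simp add: field_simps)
  moreover have "(g has_field_derivative deriv g \<zeta>) (at \<zeta>)"
    using g(1) D_open assms unfolding D_def by (rule holomorphic_derivI)
  ultimately have dg: "(g has_field_derivative 1 / \<phi> s) (at \<zeta>)" by simp
  show ?thesis unfolding s_def[symmetric]
    by (rule has_field_derivative_transform_within_open[OF dg D_open assms])
      (auto simp: D_def g(3) \<Psi>_\<Phi>)
qed

lemma Z_derivative: assumes "\<zeta> \<in> D" shows "(Z has_field_derivative Z1 \<zeta>) (at \<zeta>)"
  unfolding Z_def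
  by (rule DERIV_cong[OF DERIV_chain2[OF zmap_derivative[OF H_far(2)[OF \<Psi>_in[OF assms]]] \<Psi>_derivative[OF assms]]])
    (simp add: Z1_def)

lemma Z1_square: assumes "\<zeta> \<in> D" shows "Z1 \<zeta> ^ 2 = poly P (Z \<zeta>) / poly Q (Z \<zeta>)"
  using zmap'_square[of "\<Psi> \<zeta>" j] H_far[OF \<Psi>_in[OF assms]]
  by (simp add: Z1_def Z_def \<phi>_def power_divide)

lemma Z_far: assumes "\<zeta> \<in> D" shows "norm (Z \<zeta> - d) \<ge> r0" "poly P (Z \<zeta>) \<noteq> 0" "poly Q (Z \<zeta>) \<noteq> 0"
  using H_far(3)[OF \<Psi>_in[OF assms]] farP farQ by (auto simp: Z_def)

lemma Z1_nonzero: "\<zeta> \<in> D \<Longrightarrow> Z1 \<zeta> \<noteq> 0"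
  using Z1_square Z_far by (metis divide_eq_0_iff power_zero_numeral)

lemma shift_in_D:
  assumes "s \<in> H" "cball (s + w) (norm w / 2) \<subseteq> H"
  shows "\<Phi> s + w \<in> D" "norm (\<Psi> (\<Phi> s + w) - (s + w)) \<le> norm w / 2"
proof -
  obtain s' where s': "s' \<in> cball (s + w) (norm w / 2)" "\<Phi> s' = \<Phi> s + w"
    using near_identity_shift[OF near_identity assms] by blast
  then have "s' \<in> H" using assms by blast
  then show "\<Phi> s + w \<in> D" using s'(2) \<Phi>_in by metis
  have "\<Psi> (\<Phi> s + w) = s'" using \<Psi>_\<Phi>[OF \<open>s' \<in> H\<close>] s'(2) by simp
  then show "norm (\<Psi> (\<Phi> s + w) - (s + w)) \<le> norm w / 2"
    using s'(1) by (simp add: dist_norm norm_minus_commute)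
qed

lemma Re_\<nu>_cball:
  assumes "x \<in> cball y r" shows "Re (\<nu> * x) \<ge> Re (\<nu> * y) - r"
proof -
  have "\<bar>Re (\<nu> * (x - y))\<bar> \<le> norm (\<nu> * (x - y))" by (rule abs_Re_le_cmod)
  also have "\<dots> \<le> r" using assms \<nu> by (simp add: norm_mult dist_norm norm_minus_commute)
  finally show ?thesis by (simp add: algebra_simps)
qed

text \<open>A real shift t raises \<open>Re (\<nu> * s)\<close> by at least 7/10 t, while the
  preimage is located only up to t / 2; the difference t / 5 remains. This is what lets the
  oscillator asymptotics run on \<open>D\<close>.\<close>

lemma shift_right:
  assumes "\<zeta> \<in> D" "t \<ge> 0"
  shows "\<zeta> + of_real t \<in> D" "Re (\<nu> * \<Psi> (\<zeta> + of_real t)) \<ge> K + t / 5"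
proof -
  define s where "s = \<Psi> \<zeta>"
  have s: "s \<in> H" "\<Phi> s = \<zeta>" using assms \<Psi>_in \<Phi>_\<Psi> by (auto simp: s_def)
  have "Re (\<nu> * (s + of_real t)) = Re (\<nu> * s) + t * Re \<nu>" by (simp add: algebra_simps)
  moreover have "t * (7 / 10) \<le> t * Re \<nu>" by (rule mult_left_mono[OF \<nu>(2) assms(2)])
  ultimately have re: "Re (\<nu> * (s + of_real t)) \<ge> K + 7 / 10 * t" using s(1) by (simp add: H_def)
  have lo: "Re (\<nu> * x) \<ge> K + t / 5" if "x \<in> cball (s + of_real t) (norm (of_real t :: complex) / 2)" for x
  proof -
    have "Re (\<nu> * x) \<ge> Re (\<nu> * (s + of_real t)) - norm (of_real t :: complex) / 2" by (rule Re_\<nu>_cball[OF that])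
    moreover have "norm (of_real t :: complex) = t" using assms(2) by simp
    ultimately show ?thesis using re by linarith
  qed
  show "\<zeta> + of_real t \<in> D" "Re (\<nu> * \<Psi> (\<zeta> + of_real t)) \<ge> K + t / 5"
  proof -
    have 1: "\<zeta> + of_real t \<in> D \<and> Re (\<nu> * \<Psi> (\<zeta> + of_real t)) \<ge> K + t / 5"
    proof (cases "t = 0")
      case True
      then show ?thesis using assms s by (simp add: H_def s_def[symmetric])
    next
      case False
      then have "cball (s + of_real t) (norm (of_real t :: complex) / 2) \<subseteq> H"
        using lo assms(2) unfolding H_def by force
      note sh = shift_in_D[OF s(1) this]
      have "\<Psi> (\<Phi> s + of_real t) \<in> cball (s + of_real t) (norm (of_real t :: complex) / 2)"
        using sh(2) by (simp add: dist_norm norm_minus_commute)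
      then show ?thesis using sh(1) lo s(2) by auto
    qed
    then show "\<zeta> + of_real t \<in> D" "Re (\<nu> * \<Psi> (\<zeta> + of_real t)) \<ge> K + t / 5" by auto
  qed
qed

lemma norm_Z_power: assumes "\<zeta> \<in> D" shows "norm (Z \<zeta> - d) ^ (N + 2) = \<kappa> ^ 2 * norm (\<Psi> \<zeta>) ^ 2"
proof -
  have "norm (Z \<zeta> - d) ^ (N + 2) = norm (W (\<Psi> \<zeta>) ^ (N + 2))" by (simp only: Z_def norm_zmap norm_power)
  then show ?thesis unfolding W_power[OF H_far(4)[OF \<Psi>_in[OF assms]]] using \<kappa>0
    by (simp add: norm_power norm_mult power_mult_distrib)
qed

definition "\<psi> \<zeta> = Z1 \<zeta> ^ 2 * liouville_error P Q (Z \<zeta>)"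

text \<open>The decay z^(-2) of the error and z^(-N) of P / Q combine to the exponent N + 2, and |z
  - d|^(N + 2) is exactly a constant times |s|^2.\<close>

lemma \<psi>_bound: assumes "\<zeta> \<in> D" shows "norm (\<psi> \<zeta>) \<le> 2 * C / norm (\<Psi> \<zeta>) ^ 2"
proof -
  define x where "x = norm (Z \<zeta> - d)"
  have far: "norm (Z \<zeta> - d) \<ge> r0" by (rule Z_far[OF assms])
  have x: "x > 0" using far r0(1) unfolding x_def by linarith
  have s: "norm (\<Psi> \<zeta>) > 0" using H_far(4)[OF \<Psi>_in[OF assms]] by simp
  have "norm (\<psi> \<zeta>) = norm (poly P (Z \<zeta>) / poly Q (Z \<zeta>)) * norm (liouville_error P Q (Z \<zeta>))"
    unfolding \<psi>_def Z1_square[OF assms] norm_mult ..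
  also have "\<dots> \<le> 2 / (norm b * x ^ N) * (C / x ^ 2)"
    using norm_P_div_Q(1)[OF far] far_error[OF far] x unfolding x_def by (intro mult_mono) auto
  also have "\<dots> = 2 * C / (norm b * x ^ (N + 2))" by (simp add: power_add power2_eq_square)
  also have "norm b * x ^ (N + 2) = M ^ 2 / 4 * norm (\<Psi> \<zeta>) ^ 2"
    unfolding x_def norm_Z_power[OF assms] using \<kappa>b by (simp add: mult.assoc[symmetric])
  also have "2 * C / (M ^ 2 / 4 * norm (\<Psi> \<zeta>) ^ 2) \<le> 2 * C / (1 * norm (\<Psi> \<zeta>) ^ 2)"
  proof (intro divide_left_mono mult_right_mono mult_pos_pos)
    have "2 ^ 2 \<le> M ^ 2" using M2 by (intro power_mono) auto
    then show "1 \<le> M ^ 2 / 4" by simp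
  qed (use s C M2 in auto)
  finally show ?thesis by simp
qed

text \<open>Here |s| \<ge> K + t / 5 \<ge> 2/5 (K + t / 2), and 2 C / (2/5)^2 = 25/2 C is rounded up
  to 13 C.\<close>

lemma \<psi>_tail: assumes "\<zeta> \<in> D" "t \<ge> 0" shows "norm (\<psi> (\<zeta> + of_real t)) \<le> (13 * C) / (K + t / 2) ^ 2"
proof -
  define s where "s = \<Psi> (\<zeta> + of_real t)"
  have "K + t / 5 \<le> Re (\<nu> * s)" unfolding s_def by (rule shift_right[OF assms])
  also have "\<dots> \<le> norm s" using complex_Re_le_cmod[of "\<nu> * s"] \<nu> by (simp add: norm_mult)
  finally have "2 / 5 * (K + t / 2) \<le> norm s" using K_large assms(2) by (simp add: field_simps)
  then have sq: "(2 / 5 * (K + t / 2)) ^ 2 \<le> norm s ^ 2" using K_large assms(2) by (intro power_mono) auto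
  have e: "2 * C / (2 / 5 * y) ^ 2 = (25 / 2 * C) / y ^ 2" for y :: real
    by (simp add: power_divide power_mult_distrib)
  have p: "(2 / 5 * (K + t / 2)) ^ 2 > 0" using K_large assms(2) by (intro zero_less_power) auto
  have "norm (\<psi> (\<zeta> + of_real t)) \<le> 2 * C / norm s ^ 2"
    unfolding s_def by (rule \<psi>_bound[OF shift_right(1)[OF assms]])
  also have "\<dots> \<le> 2 * C / (2 / 5 * (K + t / 2)) ^ 2"
    using sq p C by (intro divide_left_mono mult_pos_pos) auto
  also have "\<dots> = (25 / 2 * C) / (K + t / 2) ^ 2" by (rule e)
  also have "\<dots> \<le> (13 * C) / (K + t / 2) ^ 2" using C by (intro divide_right_mono) auto
  finally show ?thesis .
qed

definition "U g \<zeta> = g (Z \<zeta>) / l (\<Psi> \<zeta>)"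
definition "V g \<zeta> = (deriv g (Z \<zeta>) * Z1 \<zeta>
  - Z1 \<zeta> * (3 * log_deriv P (Z \<zeta>) - log_deriv Q (Z \<zeta>)) / 4 * g (Z \<zeta>)) / l (\<Psi> \<zeta>)"

lemma l_holomorphic: "(\<lambda>\<zeta>. l (\<Psi> \<zeta>)) holomorphic_on D"
proof -
  have "\<Psi> holomorphic_on D" unfolding holomorphic_on_open[OF D_open] using \<Psi>_derivative by blast
  then have "l \<circ> \<Psi> holomorphic_on D"
    by (rule holomorphic_on_compose_gen[OF _ l_hol]) (use \<Psi>_in in \<open>auto simp: H_def\<close>)
  then show ?thesis by (simp add: o_def)
qed

lemma l_\<Psi>_square: "\<zeta> \<in> D \<Longrightarrow> l (\<Psi> \<zeta>) ^ 2 = poly P (Z \<zeta>) * Z1 \<zeta>"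
  using l_square \<Psi>_in by (simp add: H_def Z_def Z1_def \<phi>_def)

lemma l_\<Psi>_nonzero: "\<zeta> \<in> D \<Longrightarrow> l (\<Psi> \<zeta>) \<noteq> 0"
  using l_\<Psi>_square Z1_nonzero Z_far by (metis mult_eq_0_iff power_zero_numeral)

lemmas liouville = liouville_transform[OF D_open Z_derivative Z1_square Z_far(2,3) l_holomorphic l_\<Psi>_square,
  folded U_def V_def]

lemma U_derivative: "solution_on P Q UNIV g \<Longrightarrow> \<zeta> \<in> D \<Longrightarrow> (U g has_field_derivative V g \<zeta>) (at \<zeta>)"
  using liouville(2) unfolding U_def[abs_def] V_def[abs_def] by blast

lemma V_derivative: "solution_on P Q UNIV g \<Longrightarrow> \<zeta> \<in> D \<Longrightarrow> (V g has_field_derivative - (1 + \<psi> \<zeta>) * U g \<zeta>) (at \<zeta>)"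
  using liouville(3) unfolding U_def[abs_def] V_def[abs_def] \<psi>_def by blast

end

section \<open>Size and polar form of the sector map\<close>

context stokes_setup
begin

lemma W_filterlim: "filterlim (\<lambda>s. norm (W s)) at_top at_infinity"
proof -
  have "filterlim (\<lambda>x::real. (\<kappa> * x) powr (2 / M)) at_top at_top"
  proof -
    have "2 / M > 0" using M2 by simp
    then show ?thesis using \<kappa>0 by real_asymp
  qed
  then have "filterlim (\<lambda>s. (\<kappa> * norm s) powr (2 / M)) at_top (at_infinity :: complex filter)"
    by (rule filterlim_compose[OF _ filterlim_norm_at_top])
  moreover have "\<forall>\<^sub>F s in at_infinity. (\<kappa> * norm s) powr (2 / M) = norm (W s)"
  proof -
    have "\<forall>\<^sub>F s::complex in at_infinity. norm s \<ge> 1" by (auto simp: eventually_at_infinity)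
    then show ?thesis
    proof eventually_elim
      case (elim s)
      then have "s \<noteq> 0" by auto
      then show ?case by (rule norm_W[symmetric])
    qed
  qed
  ultimately show ?thesis by (rule filterlim_mono_eventually[OF _ order_refl order_refl])
qed

lemma zmap_filterlim: "filterlim (zmap j) at_infinity at_infinity"
proof -
  have f: "filterlim (\<lambda>s. - norm d + norm (W s)) at_top at_infinity"
    by (rule filterlim_tendsto_add_at_top[OF tendsto_const W_filterlim])
  have "- norm d + norm (W s) \<le> norm (zmap j s)" for s
    using norm_triangle_ineq4[of "zmap j s" d] norm_zmap[of j s] by simp
  then have "filterlim (\<lambda>s. norm (zmap j s)) at_top at_infinity"
    by (intro filterlim_at_top_mono[OF f] always_eventually) blast
  then show ?thesis by (simp add: filterlim_at_infinity_conv_norm_at_top)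
qed

text \<open>As |W| \<ge> 1, smaller exponents may be raised to N + 2, where W^(N + 2) = (\<kappa>
  s)^2.\<close>

lemma norm_W_le: assumes "norm s \<ge> K" shows "norm (W s) ^ N \<le> \<kappa> ^ 2 * norm s ^ 2" "norm (W s) \<le> \<kappa> * norm s"
proof -
  have s0: "s \<noteq> 0" using assms K_large by auto
  have w1: "norm (W s) \<ge> 1" using W_far[OF assms] r0 by linarith
  have "norm (W s) ^ (N + 2) = norm ((of_real \<kappa> * s) ^ 2)" unfolding W_power[OF s0, symmetric] norm_power ..
  then have e: "norm (W s) ^ (N + 2) = \<kappa> ^ 2 * norm s ^ 2"
    using \<kappa>0 by (simp add: norm_mult norm_power power_mult_distrib)
  show "norm (W s) ^ N \<le> \<kappa> ^ 2 * norm s ^ 2" unfolding e[symmetric] using w1 by (intro power_increasing) auto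
  have "norm (W s) ^ 2 \<le> (\<kappa> * norm s) ^ 2" unfolding power_mult_distrib e[symmetric] using w1 by (intro power_increasing) auto
  then show "norm (W s) \<le> \<kappa> * norm s" by (rule power2_le_imp_le) (use \<kappa>0 in simp)
qed

text \<open>The range of a is that of the principal argument. It turns into angles within 2 pi / M
  of the ray, that is, into the two Stokes sectors adjacent to it.\<close>

lemma zmap_rcis:
  assumes "r > 0" "- pi < a" "a \<le> pi"
  shows "zmap j (rcis (r powr (M / 2) / \<kappa>) a) = d + rcis r (stokes_angle P Q j + 2 / M * a)"
proof -
  have "Ln (of_real \<kappa> * rcis (r powr (M / 2) / \<kappa>) a) = of_real (M / 2 * ln r) + \<i> * a"
  proof (rule Ln_unique)
    have "exp (of_real (M / 2 * ln r) + \<i> * of_real a) = of_real (exp (M / 2 * ln r)) * cis a"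
      by (simp only: exp_add exp_of_real cis_conv_exp)
    also have "exp (M / 2 * ln r) = r powr (M / 2)" using assms(1) by (simp add: powr_def)
    finally show "exp (of_real (M / 2 * ln r) + \<i> * of_real a) = of_real \<kappa> * rcis (r powr (M / 2) / \<kappa>) a"
      using \<kappa>0 by (simp add: rcis_def)
  qed (use assms in auto)
  then have "W (rcis (r powr (M / 2) / \<kappa>) a) = exp (of_real (2 / M) * (of_real (M / 2 * ln r) + \<i> * of_real a))"
    by (simp add: W_def)
  also have "of_real (2 / M) * (of_real (M / 2 * ln r) + \<i> * of_real a) = of_real (ln r) + \<i> * of_real (2 / M * a)"
    using M2 by (simp add: distrib_left)
  also have "exp \<dots> = rcis r (2 / M * a)"
    using assms(1) by (simp only: exp_add exp_of_real exp_ln cis_conv_exp rcis_def)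
  finally have "W (rcis (r powr (M / 2) / \<kappa>) a) = rcis r (2 / M * a)" .
  then show ?thesis by (simp add: zmap_def rcis_def cis_mult[symmetric])
qed

lemma stokes_angle_Suc: "stokes_angle P Q (Suc k) = stokes_angle P Q k + 2 / M * pi"
  unfolding stokes_angle_def N_def[symmetric] M_def[symmetric] by (simp add: add_divide_distrib diff_divide_distrib distrib_left)

end

text \<open>A rational lower bound for sqrt 2 / 2, used for the directions \<open>\<nu>\<close> and
  for the cones around them.\<close>

lemma cos_pi4_bound:
  assumes "\<bar>a\<bar> \<le> pi / 4" shows "cos a \<ge> 7 / 10"
proof -
  have "cos \<bar>a\<bar> \<ge> cos (pi / 4)" using assms by (intro cos_monotone_0_pi_le) auto
  moreover have "sqrt 2 \<ge> 14 / 10" by (rule real_le_rsqrt) (simp add: power2_eq_square)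
  ultimately show ?thesis by (simp add: cos_45)
qed

lemma power_le_exp_eventually:
  fixes c A :: real
  assumes "c > 0"
  shows "\<forall>\<^sub>F x in at_top. A * x ^ k \<le> exp (c * x)"
proof -
  have "((\<lambda>x. (c * x) ^ k / exp (c * x)) \<longlongrightarrow> 0) at_top"
    by (rule filterlim_compose[OF tendsto_power_div_exp_0])
      (rule filterlim_tendsto_pos_mult_at_top[OF tendsto_const assms filterlim_ident])
  then have "((\<lambda>x. \<bar>A\<bar> / c ^ k * ((c * x) ^ k / exp (c * x))) \<longlongrightarrow> \<bar>A\<bar> / c ^ k * 0) at_top"
    by (intro tendsto_intros)
  then have "\<forall>\<^sub>F x in at_top. \<bar>A\<bar> / c ^ k * ((c * x) ^ k / exp (c * x)) < 1"
    by (intro order_tendstoD(2)) auto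
  with eventually_gt_at_top[of 0] show ?thesis
  proof eventually_elim
    case (elim x)
    then have "\<bar>A\<bar> * x ^ k < exp (c * x)" using assms by (simp add: power_mult_distrib field_simps)
    moreover have "A * x ^ k \<le> \<bar>A\<bar> * x ^ k" using elim by (intro mult_right_mono) auto
    ultimately show ?case by linarith
  qed
qed

section \<open>The coefficients A and B, and exponential growth\<close>

context stokes_region
begin

text \<open>A limit along one horizontal ray; by the oscillator asymptotics every starting point in
  \<open>D\<close> gives the same value. Being an explicit limit, it is linear in g. The base point
  2 K lies in the half plane because 2 K times 7/10 exceeds K.\<close>

definition "coefA g = Lim at_top (\<lambda>t. (U g (\<Phi> (of_real (2 * K)) + of_real t)
  - \<i> * V g (\<Phi> (of_real (2 * K)) + of_real t)) / 2 * exp (- \<i> * (\<Phi> (of_real (2 * K)) + of_real t)))"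

definition "coefB g = Lim at_top (\<lambda>t. (U g (\<Phi> (of_real (2 * K)) + of_real t)
  + \<i> * V g (\<Phi> (of_real (2 * K)) + of_real t)) / 2 * exp (\<i> * (\<Phi> (of_real (2 * K)) + of_real t)))"

lemma base_in_H: "of_real (2 * K) \<in> H"
proof -
  have "2 * K * (7 / 10) \<le> 2 * K * Re \<nu>" using \<nu> K_large by (intro mult_left_mono) auto
  then show ?thesis using K_large by (simp add: H_def)
qed

lemma coef_limits:
  assumes g: "solution_on P Q UNIV g"
  shows "\<zeta> \<in> D \<Longrightarrow> ((\<lambda>t. (U g (\<zeta> + of_real t) - \<i> * V g (\<zeta> + of_real t)) / 2 * exp (- \<i> * (\<zeta> + of_real t))) \<longlongrightarrow> coefA g) at_top"
    and "\<zeta> \<in> D \<Longrightarrow> ((\<lambda>t. (U g (\<zeta> + of_real t) + \<i> * V g (\<zeta> + of_real t)) / 2 * exp (\<i> * (\<zeta> + of_real t))) \<longlongrightarrow> coefB g) at_top"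
    and "\<zeta> \<in> D \<Longrightarrow> norm ((U g \<zeta> - \<i> * V g \<zeta>) / 2 - coefA g * exp (\<i> * \<zeta>)) + norm ((U g \<zeta> + \<i> * V g \<zeta>) / 2 - coefB g * exp (- \<i> * \<zeta>))
       \<le> 1 / 1000 * (norm (coefA g * exp (\<i> * \<zeta>)) + norm (coefB g * exp (- \<i> * \<zeta>)))"
proof -
  \<comment> \<open>26 C / K is at most 26 / 60000 < 1 / 2000; the oscillator asymptotics double it
    to the relative error 1 / 1000.\<close>
  have d: "2 * (13 * C) / K \<le> 1 / 2000" using K_large C by (simp add: field_simps)
  obtain A B where AB:
    "\<And>\<zeta>. \<zeta> \<in> D \<Longrightarrow> ((\<lambda>t. (U g (\<zeta> + of_real t) - \<i> * V g (\<zeta> + of_real t)) / 2 * exp (- \<i> * (\<zeta> + of_real t))) \<longlongrightarrow> A) at_top"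
    "\<And>\<zeta>. \<zeta> \<in> D \<Longrightarrow> ((\<lambda>t. (U g (\<zeta> + of_real t) + \<i> * V g (\<zeta> + of_real t)) / 2 * exp (\<i> * (\<zeta> + of_real t))) \<longlongrightarrow> B) at_top"
    "\<And>\<zeta>. \<zeta> \<in> D \<Longrightarrow> norm ((U g \<zeta> - \<i> * V g \<zeta>) / 2 - A * exp (\<i> * \<zeta>)) + norm ((U g \<zeta> + \<i> * V g \<zeta>) / 2 - B * exp (- \<i> * \<zeta>))
       \<le> 2 * (1 / 2000) * (norm (A * exp (\<i> * \<zeta>)) + norm (B * exp (- \<i> * \<zeta>)))"
    by (rule perturbed_oscillator_asymptotics[OF D_open D_connected shift_right(1) U_derivative[OF g] V_derivative[OF g] \<psi>_tail _ K_large(2) d])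
      (use C in auto)
  have b: "\<Phi> (of_real (2 * K)) \<in> D" using base_in_H by (rule \<Phi>_in)
  have "coefA g = A" unfolding coefA_def by (rule tendsto_Lim[OF trivial_limit_at_top_linorder AB(1)[OF b]])
  moreover have "coefB g = B" unfolding coefB_def by (rule tendsto_Lim[OF trivial_limit_at_top_linorder AB(2)[OF b]])
  ultimately show
    "\<zeta> \<in> D \<Longrightarrow> ((\<lambda>t. (U g (\<zeta> + of_real t) - \<i> * V g (\<zeta> + of_real t)) / 2 * exp (- \<i> * (\<zeta> + of_real t))) \<longlongrightarrow> coefA g) at_top"
    "\<zeta> \<in> D \<Longrightarrow> ((\<lambda>t. (U g (\<zeta> + of_real t) + \<i> * V g (\<zeta> + of_real t)) / 2 * exp (\<i> * (\<zeta> + of_real t))) \<longlongrightarrow> coefB g) at_top"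
    "\<zeta> \<in> D \<Longrightarrow> norm ((U g \<zeta> - \<i> * V g \<zeta>) / 2 - coefA g * exp (\<i> * \<zeta>)) + norm ((U g \<zeta> + \<i> * V g \<zeta>) / 2 - coefB g * exp (- \<i> * \<zeta>))
       \<le> 1 / 1000 * (norm (coefA g * exp (\<i> * \<zeta>)) + norm (coefB g * exp (- \<i> * \<zeta>)))"
    using AB by auto
qed

text \<open>The functions \<open>Z\<close>, \<open>Z1\<close> and \<open>l\<close> do not depend on
  g, so U and V, and with them the limits, are linear in g.\<close>

lemma coef_linear:
  assumes g: "solution_on P Q UNIV g1" "solution_on P Q UNIV g2"
  shows "coefA (\<lambda>z. \<alpha> * g1 z + \<beta> * g2 z) = \<alpha> * coefA g1 + \<beta> * coefA g2"
    and "coefB (\<lambda>z. \<alpha> * g1 z + \<beta> * g2 z) = \<alpha> * coefB g1 + \<beta> * coefB g2"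
proof -
  let ?g = "\<lambda>z. \<alpha> * g1 z + \<beta> * g2 z"
  have sol: "solution_on P Q UNIV ?g" by (intro solution_on_lincomb open_UNIV g)
  have h: "g1 holomorphic_on UNIV" "g2 holomorphic_on UNIV" using g by (auto simp: solution_on_def)
  have dg: "deriv ?g z = \<alpha> * deriv g1 z + \<beta> * deriv g2 z" for z
    by (rule DERIV_imp_deriv) (auto intro!: derivative_eq_intros holomorphic_derivI[OF h(1) open_UNIV] holomorphic_derivI[OF h(2) open_UNIV])
  have U: "U ?g \<zeta> = \<alpha> * U g1 \<zeta> + \<beta> * U g2 \<zeta>" for \<zeta>
    by (simp add: U_def add_divide_distrib)
  have V: "V ?g \<zeta> = \<alpha> * V g1 \<zeta> + \<beta> * V g2 \<zeta>" for \<zeta>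
    by (simp add: V_def dg add_divide_distrib[symmetric] diff_divide_distrib[symmetric] algebra_simps)
  define \<zeta> where "\<zeta> = \<Phi> (of_real (2 * K))"
  have b: "\<zeta> \<in> D" unfolding \<zeta>_def using base_in_H by (rule \<Phi>_in)
  have "((\<lambda>t. \<alpha> * ((U g1 (\<zeta> + of_real t) - \<i> * V g1 (\<zeta> + of_real t)) / 2 * exp (- \<i> * (\<zeta> + of_real t)))
     + \<beta> * ((U g2 (\<zeta> + of_real t) - \<i> * V g2 (\<zeta> + of_real t)) / 2 * exp (- \<i> * (\<zeta> + of_real t)))) \<longlongrightarrow> \<alpha> * coefA g1 + \<beta> * coefA g2) at_top"
    by (intro tendsto_intros coef_limits g b)
  then have "((\<lambda>t. (U ?g (\<zeta> + of_real t) - \<i> * V ?g (\<zeta> + of_real t)) / 2 * exp (- \<i> * (\<zeta> + of_real t))) \<longlongrightarrow> \<alpha> * coefA g1 + \<beta> * coefA g2) at_top"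
    unfolding U V by (simp add: algebra_simps add_divide_distrib diff_divide_distrib)
  then show "coefA ?g = \<alpha> * coefA g1 + \<beta> * coefA g2"
    using coef_limits(1)[OF sol b] tendsto_unique trivial_limit_at_top_linorder by blast
  have "((\<lambda>t. \<alpha> * ((U g1 (\<zeta> + of_real t) + \<i> * V g1 (\<zeta> + of_real t)) / 2 * exp (\<i> * (\<zeta> + of_real t)))
     + \<beta> * ((U g2 (\<zeta> + of_real t) + \<i> * V g2 (\<zeta> + of_real t)) / 2 * exp (\<i> * (\<zeta> + of_real t)))) \<longlongrightarrow> \<alpha> * coefB g1 + \<beta> * coefB g2) at_top"
    by (intro tendsto_intros coef_limits g b)
  then have "((\<lambda>t. (U ?g (\<zeta> + of_real t) + \<i> * V ?g (\<zeta> + of_real t)) / 2 * exp (\<i> * (\<zeta> + of_real t))) \<longlongrightarrow> \<alpha> * coefB g1 + \<beta> * coefB g2) at_top"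
    unfolding U V by (simp add: algebra_simps add_divide_distrib diff_divide_distrib)
  then show "coefB ?g = \<alpha> * coefB g1 + \<beta> * coefB g2"
    using coef_limits(2)[OF sol b] tendsto_unique trivial_limit_at_top_linorder by blast
qed

lemma U_V_bounds:
  assumes g: "solution_on P Q UNIV g" and \<zeta>: "\<zeta> \<in> D"
  defines "X \<equiv> coefA g * exp (\<i> * \<zeta>)" and "Y \<equiv> coefB g * exp (- \<i> * \<zeta>)"
  shows "norm (U g \<zeta> - (X + Y)) \<le> (norm X + norm Y) / 1000"
    and "norm (V g \<zeta> - \<i> * (X - Y)) \<le> (norm X + norm Y) / 1000"
proof -
  define x y where "x = (U g \<zeta> - \<i> * V g \<zeta>) / 2 - X" "y = (U g \<zeta> + \<i> * V g \<zeta>) / 2 - Y"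
  have b: "norm x + norm y \<le> (norm X + norm Y) / 1000"
    using coef_limits(3)[OF g \<zeta>] by (simp add: x_y_def X_def Y_def)
  have "U g \<zeta> - (X + Y) = x + y" by (simp add: x_y_def field_simps)
  then show "norm (U g \<zeta> - (X + Y)) \<le> (norm X + norm Y) / 1000"
    using norm_triangle_ineq[of x y] b by simp
  have "V g \<zeta> - \<i> * (X - Y) = \<i> * (x - y)" by (simp add: x_y_def field_simps)
  then have "norm (V g \<zeta> - \<i> * (X - Y)) = norm (x - y)" by (simp add: norm_mult)
  then show "norm (V g \<zeta> - \<i> * (X - Y)) \<le> (norm X + norm Y) / 1000"
    using norm_triangle_ineq4[of x y] b by simp
qed

text \<open>The error is relative to A and B, so A = B = 0 gives U = 0 exactly. Then g vanishes on
  the image of \<open>Z\<close>, which is open, hence everywhere.\<close>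

lemma coef_zero:
  assumes g: "solution_on P Q UNIV g" and "coefA g = 0" "coefB g = 0"
  shows "g z = 0"
proof -
  have gh: "g holomorphic_on UNIV" using g by (simp add: solution_on_def)
  have gZ: "g (Z \<zeta>) = 0" if "\<zeta> \<in> D" for \<zeta>
    using U_V_bounds(1)[OF g that] assms(2,3) l_\<Psi>_nonzero[OF that] by (simp add: U_def)
  have Zh: "Z holomorphic_on D" unfolding holomorphic_on_open[OF D_open] using Z_derivative by blast
  obtain \<zeta>0 where z0: "\<zeta>0 \<in> D" using base_in_H \<Phi>_in by blast
  have "\<not> Z constant_on D"
  proof
    assume "Z constant_on D"
    then obtain c where c: "\<And>\<zeta>. \<zeta> \<in> D \<Longrightarrow> Z \<zeta> = c" unfolding constant_on_def by blast
    have "((\<lambda>_. c) has_field_derivative Z1 \<zeta>0) (at \<zeta>0)"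
      by (rule has_field_derivative_transform_within_open[OF Z_derivative[OF z0] D_open z0]) (use c in auto)
    then have "Z1 \<zeta>0 = 0" using DERIV_const DERIV_unique by blast
    then show False using Z1_nonzero[OF z0] by simp
  qed
  then have "open (Z ` D)"
    using open_mapping_thm[OF Zh D_open D_connected D_open subset_refl] by blast
  then have "Z \<zeta>0 islimpt Z ` D" using z0 by (simp add: interior_limit_point interior_open)
  then show ?thesis
    using analytic_continuation[OF gh open_UNIV connected_UNIV, of "Z ` D" "Z \<zeta>0" z] gZ by auto
qed

text \<open>The bound 1/10 on \<open>\<phi>\<close> - 1 does not decide the sign of
  \<open>Im (\<Phi> s)\<close> for s close to the Stokes ray. Since \<open>\<phi>\<close> tends to
  1, the relative error of \<open>\<Phi>\<close> becomes arbitrarily small in the cone; the constant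
  from the base point \<open>s1\<close> is absorbed for large s.\<close>

lemma \<Phi>_asymptotic:
  assumes \<eta>: "\<eta> > 0"
  obtains R where "R > 0" "\<And>s. norm s \<ge> R \<Longrightarrow> Re (\<nu> * s) \<ge> 7 / 10 * norm s \<Longrightarrow> s \<in> H \<and> norm (\<Phi> s - s) \<le> \<eta> * norm s"
proof -
  have "\<forall>\<^sub>F s in at_infinity. dist (leading_ratio P Q (zmap j s)) 1 < \<eta> / 2"
    using tendstoD[OF filterlim_compose[OF leading_ratio_tendsto[OF lcP Q0 deg] zmap_filterlim], of "\<eta> / 2"] \<eta> by auto
  then obtain R1 where R1: "\<And>s. norm s \<ge> R1 \<Longrightarrow> norm (leading_ratio P Q (zmap j s) - 1) < \<eta> / 2"
    unfolding eventually_at_infinity dist_norm by blast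
  define K' where "K' = max K R1"
  define H' where "H' = {s. K' < Re (\<nu> * s)}"
  have H': "convex H'" "open H'" unfolding H'_def by (rule half_plane_convex_open)+
  have sub: "s \<in> H" "norm (\<phi> s - 1) \<le> \<eta> / 2" if "s \<in> H'" for s
  proof -
    show s: "s \<in> H" using that by (auto simp: H'_def H_def K'_def)
    have "K' < norm s" using that complex_Re_le_cmod[of "\<nu> * s"] \<nu> by (simp add: H'_def norm_mult)
    then have "norm s \<ge> R1" by (simp add: K'_def)
    then show "norm (\<phi> s - 1) \<le> \<eta> / 2"
      unfolding \<phi>_def using R1 norm_csqrt_minus_one_le order_trans less_imp_le by meson
  qed
  have K'0: "K' > 0" using K_large by (simp add: K'_def)
  define s1 :: complex where "s1 = of_real (2 * K')"
  have s1: "s1 \<in> H'"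
  proof -
    have "2 * K' * (7 / 10) \<le> 2 * K' * Re \<nu>" using \<nu> K'0 by (intro mult_left_mono) auto
    then show ?thesis using K'0 by (simp add: H'_def s1_def)
  qed
  define c where "c = norm (\<Phi> s1 - s1) + \<eta> / 2 * norm s1"
  define R where "R = 2 * K' + 2 * c / \<eta>"
  have c0: "c \<ge> 0" using \<eta> by (simp add: c_def)
  show ?thesis
  proof (rule that[of R])
    show "R > 0" using K'0 c0 \<eta> by (simp add: R_def add_pos_nonneg)
    fix s assume s: "norm s \<ge> R" "Re (\<nu> * s) \<ge> 7 / 10 * norm s"
    have "norm s \<ge> 2 * K'" using s(1) c0 \<eta> by (simp add: R_def) (smt (verit) divide_nonneg_pos)
    then have sH': "s \<in> H'" using s(2) K'0 by (simp add: H'_def)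
    have "norm ((\<Phi> s - \<Phi> s1) - (s - s1)) \<le> \<eta> / 2 * norm (s - s1)"
      by (rule near_identity_lipschitz[OF H' \<Phi>_derivative[OF sub(1)] sub(2) sH' s1])
    also have "\<dots> \<le> \<eta> / 2 * (norm s + norm s1)" using \<eta> by (intro mult_left_mono norm_triangle_ineq4) auto
    finally have 1: "norm ((\<Phi> s - \<Phi> s1) - (s - s1)) \<le> \<eta> / 2 * norm s + \<eta> / 2 * norm s1" by (simp add: distrib_left)
    have "\<Phi> s - s = ((\<Phi> s - \<Phi> s1) - (s - s1)) + (\<Phi> s1 - s1)" by simp
    then have "norm (\<Phi> s - s) \<le> norm ((\<Phi> s - \<Phi> s1) - (s - s1)) + norm (\<Phi> s1 - s1)"
      by (metis norm_triangle_ineq)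
    then have "norm (\<Phi> s - s) \<le> \<eta> / 2 * norm s + c" using 1 by (simp add: c_def)
    moreover have "2 * c / \<eta> \<le> norm s" using s(1) K'0 by (simp add: R_def)
    then have "c \<le> \<eta> / 2 * norm s" using \<eta> by (simp add: field_simps)
    ultimately have "norm (\<Phi> s - s) \<le> \<eta> * norm s" by simp
    then show "s \<in> H \<and> norm (\<Phi> s - s) \<le> \<eta> * norm s" using sub(1)[OF sH'] by simp
  qed
qed

text \<open>The amplitude involves roots, but l^4 = P^2 (P / Q) is rational. Comparing fourth powers
  gives a power bound for 1 / l, which exponential growth of U outweighs together with |z -
  d|^n.\<close>

lemma growth_from_U:
  assumes c: "c > 0" and D0: "D0 > 0"
  obtains R where "R > 0" "\<And>s. norm s \<ge> R \<Longrightarrow> s \<in> H \<Longrightarrow> D0 * exp (c * norm s) \<le> norm (U g (\<Phi> s)) \<Longrightarrow>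
    norm (zmap j s - d) ^ n \<le> norm (g (zmap j s))"
proof -
  have "degree (1 :: complex poly) + 0 \<le> degree P" by simp
  from poly_growth_bound[OF this P0] obtain c1 where c1: "c1 \<ge> 0"
    "\<forall>\<^sub>F z in at_infinity. norm (z ^ 0 * poly 1 z) \<le> c1 * norm (poly P z)" by blast
  have "\<forall>\<^sub>F s in at_infinity. 1 \<le> c1 * norm (poly P (zmap j s))"
    using eventually_compose_filterlim[OF c1(2) zmap_filterlim] by simp
  then obtain R1 where R1: "\<And>s. norm s \<ge> R1 \<Longrightarrow> 1 \<le> c1 * norm (poly P (zmap j s))"
    unfolding eventually_at_infinity by blast
  \<comment> \<open>Collects the constants of |z - d|^(4 n), of 1 / P^2 and of Q / P; in powers of
    |s| they amount to the exponent 4 n + 2.\<close>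
  define A where "A = \<kappa> ^ (4 * n + 2) * c1 ^ 2 * (2 * norm b) / D0 ^ 4"
  have "\<forall>\<^sub>F x in at_top. A * x ^ (4 * n + 2) \<le> exp (4 * c * x)"
    using c by (intro power_le_exp_eventually) auto
  then obtain R2 where R2: "\<And>x. x \<ge> R2 \<Longrightarrow> A * x ^ (4 * n + 2) \<le> exp (4 * c * x)"
    unfolding eventually_at_top_linorder by blast
  define R where "R = max K (max R1 R2)"
  show ?thesis
  proof (rule that[of R])
    show "R > 0" using K_large by (simp add: R_def)
    fix s assume s: "norm s \<ge> R" "s \<in> H" "D0 * exp (c * norm s) \<le> norm (U g (\<Phi> s))"
    define z where "z = zmap j s"
    define x where "x = norm s"
    have x: "x \<ge> K" "x \<ge> R1" "x \<ge> R2" "x > 0" using s(1) K_large by (auto simp: R_def x_def)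
    have \<zeta>: "\<Phi> s \<in> D" using s(2) by (rule \<Phi>_in)
    have Zz: "Z (\<Phi> s) = z" by (simp add: Z_def \<Psi>_\<Phi>[OF s(2)] z_def)
    have far: "norm (z - d) \<ge> r0" using Z_far(1)[OF \<zeta>] Zz by simp
    have l2: "l s ^ 2 = poly P z * Z1 (\<Phi> s)" using l_\<Psi>_square[OF \<zeta>] Zz \<Psi>_\<Phi>[OF s(2)] by simp
    have "l s ^ 4 = (l s ^ 2) ^ 2" by (simp add: power_mult[symmetric])
    also have "\<dots> = poly P z ^ 2 * (poly P z / poly Q z)"
      unfolding l2 power_mult_distrib Z1_square[OF \<zeta>] Zz ..
    finally have l4: "norm (l s) ^ 4 = norm (poly P z) ^ 2 * norm (poly P z / poly Q z)"
      by (metis norm_mult norm_power)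
    have w: "norm (z - d) = norm (W s)" by (simp add: z_def norm_zmap)
    have wN: "norm (W s) ^ N \<le> \<kappa> ^ 2 * x ^ 2" "norm (W s) \<le> \<kappa> * x"
      using norm_W_le[of s] x by (auto simp: x_def)
    have wpos: "norm (W s) > 0" by (simp add: W_nonzero)
    have b0': "norm b > 0" using b0 by simp
    have c1P: "1 \<le> c1 * norm (poly P z)" using R1[of s] x by (simp add: x_def z_def)
    have "1 \<le> (c1 * norm (poly P z)) ^ 2" using c1P by (simp add: one_le_power)
    then have c1P2: "1 \<le> c1 ^ 2 * norm (poly P z) ^ 2" by (simp add: power_mult_distrib)
    have PQ: "1 / (2 * norm b * norm (W s) ^ N) \<le> norm (poly P z / poly Q z)"
      using norm_P_div_Q(3)[OF far] w by simp
    have "1 \<le> norm (poly P z / poly Q z) * (2 * norm b * norm (W s) ^ N)"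
      using PQ wpos b0' by (simp add: pos_divide_le_eq)
    also have "\<dots> \<le> norm (poly P z / poly Q z) * (2 * norm b * (\<kappa> ^ 2 * x ^ 2))"
      using wN(1) b0' by (intro mult_left_mono) auto
    finally have "1 * 1 \<le> (c1 ^ 2 * norm (poly P z) ^ 2) * (norm (poly P z / poly Q z) * (2 * norm b * (\<kappa> ^ 2 * x ^ 2)))"
      using c1P2 by (intro mult_mono) auto
    then have L: "1 \<le> norm (l s) ^ 4 * (c1 ^ 2 * (2 * norm b) * \<kappa> ^ 2 * x ^ 2)"
      unfolding l4 by (simp add: mult_ac)
    have "A * x ^ (4 * n + 2) \<le> exp (4 * c * x)" by (rule R2[OF x(3)])
    then have "\<kappa> ^ (4 * n + 2) * c1 ^ 2 * (2 * norm b) * x ^ (4 * n + 2) \<le> D0 ^ 4 * exp (4 * c * x)"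
      using D0 by (simp add: A_def field_simps)
    also have "D0 ^ 4 * exp (4 * c * x) = (D0 * exp (c * x)) ^ 4"
      by (simp add: power_mult_distrib exp_of_nat_mult[symmetric] mult.assoc)
    also have "\<dots> \<le> norm (U g (\<Phi> s)) ^ 4" using s(3) D0 by (intro power_mono) (auto simp: x_def)
    finally have U4: "\<kappa> ^ (4 * n + 2) * c1 ^ 2 * (2 * norm b) * x ^ (4 * n + 2) \<le> norm (U g (\<Phi> s)) ^ 4" .
    have "(norm (z - d) ^ n) ^ 4 \<le> ((\<kappa> * x) ^ n) ^ 4"
      unfolding w using wN(2) by (intro power_mono) auto
    also have "\<dots> = (\<kappa> * x) ^ (4 * n)" by (simp add: power_mult[symmetric] mult.commute)
    also have "\<dots> = (\<kappa> * x) ^ (4 * n) * 1" by simp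
    also have "\<dots> \<le> (\<kappa> * x) ^ (4 * n) * (norm (l s) ^ 4 * (c1 ^ 2 * (2 * norm b) * \<kappa> ^ 2 * x ^ 2))"
      using L \<kappa>0 x by (intro mult_left_mono) auto
    also have "\<dots> = norm (l s) ^ 4 * (\<kappa> ^ (4 * n + 2) * c1 ^ 2 * (2 * norm b) * x ^ (4 * n + 2))"
      by (simp add: power_add power_mult_distrib mult_ac power2_eq_square)
    also have "\<dots> \<le> norm (l s) ^ 4 * norm (U g (\<Phi> s)) ^ 4" using U4 by (intro mult_left_mono) auto
    also have "\<dots> = norm (l s * U g (\<Phi> s)) ^ 4" by (simp add: norm_mult power_mult_distrib)
    also have "l s * U g (\<Phi> s) = g z"
      using l_\<Psi>_nonzero[OF \<zeta>] by (simp add: U_def Zz \<Psi>_\<Phi>[OF s(2)])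
    finally show "norm (zmap j s - d) ^ n \<le> norm (g (zmap j s))"
      unfolding z_def by (rule power_le_imp_le_base[of _ 3, simplified]) auto
  qed
qed

lemma dominated_sum_bound:
  fixes X Y u :: complex
  assumes "norm (u - (X + Y)) \<le> (norm X + norm Y) / 1000" "4 * norm X \<le> norm Y"
  shows "norm u \<ge> norm Y / 2"
proof -
  have "norm Y \<le> norm (X + Y) + norm X" using norm_triangle_ineq4[of "X + Y" X] by simp
  moreover have "norm (X + Y) \<le> norm u + norm (u - (X + Y))"
    using norm_triangle_ineq4[of u "u - (X + Y)"] by simp
  moreover have "y / 2 \<le> n" if "y \<le> s + x" "s \<le> n + e" "e \<le> (x + y) / 1000" "4 * x \<le> y" "0 \<le> y"
    for x y s n e :: real
    using that by simp
  ultimately show ?thesis using assms norm_ge_zero by blast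
qed

text \<open>In the upper part of the cone e^(- i zeta) grows, so only \<open>coefB g\<close> has to
  be nonzero. Replacing s by \<open>\<Phi> s\<close> costs half of the imaginary part, whence c /
  2.\<close>

lemma growth_upper:
  assumes g: "solution_on P Q UNIV g" and B: "coefB g \<noteq> 0" and c: "c > 0"
  obtains R where "\<And>s. norm s \<ge> R \<Longrightarrow> Re (\<nu> * s) \<ge> 7 / 10 * norm s \<Longrightarrow> Im s \<ge> c * norm s \<Longrightarrow>
    norm (zmap j s - d) ^ n \<le> norm (g (zmap j s))"
proof -
  have c2: "c / 2 > 0" using c by simp
  obtain R1 where R1: "\<And>s. norm s \<ge> R1 \<Longrightarrow> Re (\<nu> * s) \<ge> 7 / 10 * norm s \<Longrightarrow> s \<in> H \<and> norm (\<Phi> s - s) \<le> c / 2 * norm s"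
    using \<Phi>_asymptotic[OF c2] by blast
  have "norm (coefB g) / 2 > 0" using B by simp
  from growth_from_U[OF c2 this, where n = n and g = g] obtain R2 where R2: "\<And>s. norm s \<ge> R2 \<Longrightarrow> s \<in> H \<Longrightarrow> norm (coefB g) / 2 * exp (c / 2 * norm s) \<le> norm (U g (\<Phi> s)) \<Longrightarrow>
    norm (zmap j s - d) ^ n \<le> norm (g (zmap j s))" by blast
  have "\<forall>\<^sub>F x in at_top. (4 * norm (coefA g) / norm (coefB g)) * x ^ 0 \<le> exp (c * x)"
    using c by (rule power_le_exp_eventually)
  then obtain R3 where R3: "\<And>x. x \<ge> R3 \<Longrightarrow> 4 * norm (coefA g) / norm (coefB g) \<le> exp (c * x)"
    unfolding eventually_at_top_linorder by auto
  show ?thesis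
  proof (rule that[of "max R1 (max R2 R3)"])
    fix s assume s: "norm s \<ge> max R1 (max R2 R3)" "Re (\<nu> * s) \<ge> 7 / 10 * norm s" "Im s \<ge> c * norm s"
    have sH: "s \<in> H" "norm (\<Phi> s - s) \<le> c / 2 * norm s" using R1[of s] s by auto
    define h where "h = Im (\<Phi> s)"
    have "\<bar>Im (\<Phi> s - s)\<bar> \<le> c / 2 * norm s" using abs_Im_le_cmod order_trans sH(2) by blast
    then have h: "h \<ge> c / 2 * norm s" using s(3) unfolding h_def minus_complex.simps by linarith
    have X: "norm (coefA g * exp (\<i> * \<Phi> s)) = norm (coefA g) * exp (- h)"
      and Y: "norm (coefB g * exp (- \<i> * \<Phi> s)) = norm (coefB g) * exp h"
      by (simp_all add: norm_mult h_def)
    have "4 * norm (coefA g) \<le> norm (coefB g) * exp (c * norm s)"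
      using R3[of "norm s"] s(1) B by (simp add: field_simps)
    also have "\<dots> \<le> norm (coefB g) * exp (2 * h)" using h by (intro mult_left_mono) auto
    finally have "4 * norm (coefA g) * exp (- h) \<le> norm (coefB g) * exp (2 * h) * exp (- h)"
      by (intro mult_right_mono) auto
    also have "\<dots> = norm (coefB g) * exp h" by (simp add: mult.assoc exp_add[symmetric])
    finally have dom: "4 * norm (coefA g * exp (\<i> * \<Phi> s)) \<le> norm (coefB g * exp (- \<i> * \<Phi> s))"
      unfolding X Y by simp
    have "norm (coefB g * exp (- \<i> * \<Phi> s)) / 2 \<le> norm (U g (\<Phi> s))"
      by (rule dominated_sum_bound[OF U_V_bounds(1)[OF g \<Phi>_in[OF sH(1)]] dom])
    moreover have "norm (coefB g) / 2 * exp (c / 2 * norm s) \<le> norm (coefB g * exp (- \<i> * \<Phi> s)) / 2"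
      unfolding Y using h by (simp add: mult_left_mono)
    ultimately have "norm (coefB g) / 2 * exp (c / 2 * norm s) \<le> norm (U g (\<Phi> s))" by linarith
    then show "norm (zmap j s - d) ^ n \<le> norm (g (zmap j s))" using R2[of s] s(1) sH(1) by simp
  qed
qed

text \<open>The mirror image: below the ray e^(i zeta) dominates, and \<open>coefA g\<close> has to
  be nonzero.\<close>

lemma growth_lower:
  assumes g: "solution_on P Q UNIV g" and A: "coefA g \<noteq> 0" and c: "c > 0"
  obtains R where "\<And>s. norm s \<ge> R \<Longrightarrow> Re (\<nu> * s) \<ge> 7 / 10 * norm s \<Longrightarrow> Im s \<le> - (c * norm s) \<Longrightarrow>
    norm (zmap j s - d) ^ n \<le> norm (g (zmap j s))"
proof -
  have c2: "c / 2 > 0" using c by simp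
  obtain R1 where R1: "\<And>s. norm s \<ge> R1 \<Longrightarrow> Re (\<nu> * s) \<ge> 7 / 10 * norm s \<Longrightarrow> s \<in> H \<and> norm (\<Phi> s - s) \<le> c / 2 * norm s"
    using \<Phi>_asymptotic[OF c2] by blast
  have "norm (coefA g) / 2 > 0" using A by simp
  from growth_from_U[OF c2 this, where n = n and g = g] obtain R2 where R2: "\<And>s. norm s \<ge> R2 \<Longrightarrow> s \<in> H \<Longrightarrow> norm (coefA g) / 2 * exp (c / 2 * norm s) \<le> norm (U g (\<Phi> s)) \<Longrightarrow>
    norm (zmap j s - d) ^ n \<le> norm (g (zmap j s))" by blast
  have "\<forall>\<^sub>F x in at_top. (4 * norm (coefB g) / norm (coefA g)) * x ^ 0 \<le> exp (c * x)"
    using c by (rule power_le_exp_eventually)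
  then obtain R3 where R3: "\<And>x. x \<ge> R3 \<Longrightarrow> 4 * norm (coefB g) / norm (coefA g) \<le> exp (c * x)"
    unfolding eventually_at_top_linorder by auto
  show ?thesis
  proof (rule that[of "max R1 (max R2 R3)"])
    fix s assume s: "norm s \<ge> max R1 (max R2 R3)" "Re (\<nu> * s) \<ge> 7 / 10 * norm s" "Im s \<le> - (c * norm s)"
    have sH: "s \<in> H" "norm (\<Phi> s - s) \<le> c / 2 * norm s" using R1[of s] s by auto
    define h where "h = - Im (\<Phi> s)"
    have "\<bar>Im (\<Phi> s - s)\<bar> \<le> c / 2 * norm s" using abs_Im_le_cmod order_trans sH(2) by blast
    then have h: "h \<ge> c / 2 * norm s" using s(3) unfolding h_def minus_complex.simps by linarith
    have X: "norm (coefB g * exp (- \<i> * \<Phi> s)) = norm (coefB g) * exp (- h)"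
      and Y: "norm (coefA g * exp (\<i> * \<Phi> s)) = norm (coefA g) * exp h"
      by (simp_all add: norm_mult h_def)
    have "4 * norm (coefB g) \<le> norm (coefA g) * exp (c * norm s)"
      using R3[of "norm s"] s(1) A by (simp add: field_simps)
    also have "\<dots> \<le> norm (coefA g) * exp (2 * h)" using h by (intro mult_left_mono) auto
    finally have "4 * norm (coefB g) * exp (- h) \<le> norm (coefA g) * exp (2 * h) * exp (- h)"
      by (intro mult_right_mono) auto
    also have "\<dots> = norm (coefA g) * exp h" by (simp add: mult.assoc exp_add[symmetric])
    finally have dom: "4 * norm (coefB g * exp (- \<i> * \<Phi> s)) \<le> norm (coefA g * exp (\<i> * \<Phi> s))"
      unfolding X Y by simp
    have "norm (coefA g * exp (\<i> * \<Phi> s)) / 2 \<le> norm (U g (\<Phi> s))"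
      by (rule dominated_sum_bound[OF _ dom]) (use U_V_bounds(1)[OF g \<Phi>_in[OF sH(1)]] in \<open>simp only: add.commute\<close>)
    moreover have "norm (coefA g) / 2 * exp (c / 2 * norm s) \<le> norm (coefA g * exp (\<i> * \<Phi> s)) / 2"
      unfolding Y using h by (simp add: mult_left_mono)
    ultimately have "norm (coefA g) / 2 * exp (c / 2 * norm s) \<le> norm (U g (\<Phi> s))" by linarith
    then show "norm (zmap j s - d) ^ n \<le> norm (g (zmap j s))" using R2[of s] s(1) sH(1) by simp
  qed
qed

end

section \<open>Growth and exceptional solutions\<close>

lemma rcis_pi4_cone:
  assumes "r \<ge> 0" "\<bar>a + b\<bar> \<le> pi / 4"
  shows "Re (cis a * rcis r b) \<ge> 7 / 10 * norm (rcis r b)"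
proof -
  have "cis a * rcis r b = rcis r (a + b)"
    by (simp add: rcis_def mult.left_commute[of "cis a"] cis_mult)
  then have "Re (cis a * rcis r b) = r * cos (a + b)" by (simp only: Re_rcis)
  moreover have "r * (7 / 10) \<le> r * cos (a + b)"
    by (rule mult_left_mono[OF cos_pi4_bound[OF assms(2)] assms(1)])
  ultimately show ?thesis using assms(1) by simp
qed

lemma sin_interval_bound:
  assumes "0 \<le> x" "x \<le> a" "a \<le> pi - x"
  shows "sin x \<le> sin a"
proof (cases "a \<le> pi / 2")
  case True
  then show ?thesis using assms by (intro sin_monotone_2pi_le) auto
next
  case False
  have "sin x \<le> sin (pi - a)" using assms False by (intro sin_monotone_2pi_le) auto
  then show ?thesis by simp
qed

context stokes_setup
begin

text \<open>The functions \<open>\<Phi>\<close> and \<open>l\<close> are not canonical, so some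
  admissible choice is asked for. The index j = N + 2 has the same direction as j = 0 and serves as
  the upper boundary of the last sector.\<close>

definition "generic_solution g \<longleftrightarrow> (\<forall>j\<le>N + 2. \<forall>\<nu>\<in>{cis (pi / 4), cis (- (pi / 4))}.
  \<exists>\<Phi> l. stokes_region P Q r0 C j \<nu> \<Phi> l \<and> stokes_region.coefA P Q r0 C j \<nu> \<Phi> l g \<noteq> 0
    \<and> stokes_region.coefB P Q r0 C j \<nu> \<Phi> l g \<noteq> 0)"

text \<open>In the variable s of ray k the sector fills the angles from 0 to pi, in that of ray k +
  1 the angles from - pi to 0. Each half of the sector lies in the cone of one half plane of the
  nearer ray. At a = 0 the angle a - pi = - pi is not a principal argument, hence the
  alternative.\<close>

lemma sector_parametrization:
  assumes r: "r > 0" and a: "a = M / 2 * (\<phi> - stokes_angle P Q k)" "0 \<le> a" "a \<le> pi"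
  defines "\<rho> \<equiv> r powr (M / 2) / \<kappa>"
  shows "zmap k (rcis \<rho> a) = d + rcis r \<phi>" "zmap (Suc k) (rcis \<rho> (a - pi)) = d + rcis r \<phi> \<or> a = 0"
    "a \<le> pi / 2 \<Longrightarrow> Re (cis (- (pi / 4)) * rcis \<rho> a) \<ge> 7 / 10 * norm (rcis \<rho> a)"
    "a \<ge> pi / 2 \<Longrightarrow> Re (cis (pi / 4) * rcis \<rho> (a - pi)) \<ge> 7 / 10 * norm (rcis \<rho> (a - pi))"
    "\<rho> > 0"
proof -
  show \<rho>: "\<rho> > 0" using r \<kappa>0 by (simp add: \<rho>_def)
  have m: "2 / M * (M / 2 * x) = x" for x using M2 by simp
  have e: "stokes_angle P Q k + 2 / M * a = \<phi>" unfolding a(1) m by simp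
  have "- pi < a" using a(2) pi_gt_zero by linarith
  from zmap_rcis[OF r this a(3), of k] show "zmap k (rcis \<rho> a) = d + rcis r \<phi>"
    unfolding \<rho>_def e .
  show "zmap (Suc k) (rcis \<rho> (a - pi)) = d + rcis r \<phi> \<or> a = 0"
  proof (cases "a = 0")
    case False
    have e': "stokes_angle P Q (Suc k) + 2 / M * (a - pi) = \<phi>"
      unfolding stokes_angle_Suc right_diff_distrib using e by linarith
    have "- pi < a - pi" "a - pi \<le> pi" using a(2,3) False pi_gt_zero by linarith+
    from zmap_rcis[OF r this, of "Suc k"] show ?thesis unfolding \<rho>_def e' by blast
  qed simp
  show "Re (cis (- (pi / 4)) * rcis \<rho> a) \<ge> 7 / 10 * norm (rcis \<rho> a)" if "a \<le> pi / 2"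
  proof (rule rcis_pi4_cone)
    show "\<bar>- (pi / 4) + a\<bar> \<le> pi / 4" using that a(2) unfolding abs_le_iff by linarith
  qed (use \<rho> in simp)
  show "Re (cis (pi / 4) * rcis \<rho> (a - pi)) \<ge> 7 / 10 * norm (rcis \<rho> (a - pi))" if "a \<ge> pi / 2"
  proof (rule rcis_pi4_cone)
    show "\<bar>pi / 4 + (a - pi)\<bar> \<le> pi / 4" using that a(3) unfolding abs_le_iff by linarith
  qed (use \<rho> in simp)
qed

lemma radius_large: assumes "r \<ge> 1" "r \<ge> \<kappa> * R" shows "r powr (M / 2) / \<kappa> \<ge> R"
proof -
  have "r powr 1 \<le> r powr (M / 2)" using assms M2 by (intro powr_mono) auto
  then have "\<kappa> * R \<le> r powr (M / 2)" using assms by simp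
  then show ?thesis using \<kappa>0 by (simp add: field_simps)
qed

text \<open>The lower half of the sector is seen from ray k, where e^(- i zeta) dominates, the upper
  half from ray k + 1, where e^(i zeta) dominates. The power n is arbitrary, so that g can later be
  compared with polynomials.\<close>

lemma sector_growth:
  assumes g: "solution_on P Q UNIV g" and gen: "generic_solution g"
    and k: "k \<le> N + 1" and \<delta>: "0 < \<delta>" "\<delta> < pi / M"
  obtains R where "\<And>r \<phi>. r \<ge> R \<Longrightarrow> stokes_angle P Q k + \<delta> \<le> \<phi> \<Longrightarrow> \<phi> \<le> stokes_angle P Q (Suc k) - \<delta> \<Longrightarrow>
    r ^ n \<le> norm (g (d + rcis r \<phi>))"
proof -
  obtain \<Phi>1 l1 where 1: "stokes_region P Q r0 C k (cis (- (pi / 4))) \<Phi>1 l1"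
    "stokes_region.coefB P Q r0 C k (cis (- (pi / 4))) \<Phi>1 l1 g \<noteq> 0"
  proof -
    have "k \<le> N + 2" using k by simp
    then show ?thesis using gen that unfolding generic_solution_def by blast
  qed
  obtain \<Phi>2 l2 where 2: "stokes_region P Q r0 C (Suc k) (cis (pi / 4)) \<Phi>2 l2"
    "stokes_region.coefA P Q r0 C (Suc k) (cis (pi / 4)) \<Phi>2 l2 g \<noteq> 0"
  proof -
    have "Suc k \<le> N + 2" using k by simp
    then show ?thesis using gen that unfolding generic_solution_def by blast
  qed
  \<comment> \<open>The sine of the smallest angle to a ray in the s plane that remains after
    \<delta> is removed on both sides.\<close>
  define c where "c = sin (M / 2 * \<delta>)"
  have md: "0 < M / 2 * \<delta>" "M / 2 * \<delta> < pi / 2" using \<delta> M2 by (auto simp: field_simps)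
  have c: "c > 0" unfolding c_def using md by (intro sin_gt_zero) auto
  obtain R1 where R1: "\<And>s. norm s \<ge> R1 \<Longrightarrow> Re (cis (- (pi / 4)) * s) \<ge> 7 / 10 * norm s \<Longrightarrow> Im s \<ge> c * norm s \<Longrightarrow>
    norm (zmap k s - d) ^ n \<le> norm (g (zmap k s))"
    using stokes_region.growth_upper[OF 1(1) g 1(2) c, of n] by blast
  obtain R2 where R2: "\<And>s. norm s \<ge> R2 \<Longrightarrow> Re (cis (pi / 4) * s) \<ge> 7 / 10 * norm s \<Longrightarrow> Im s \<le> - (c * norm s) \<Longrightarrow>
    norm (zmap (Suc k) s - d) ^ n \<le> norm (g (zmap (Suc k) s))"
    using stokes_region.growth_lower[OF 2(1) g 2(2) c, of n] by blast
  show ?thesis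
  proof (rule that[of "max 1 (max (\<kappa> * R1) (\<kappa> * R2))"])
    fix r \<phi> assume r: "r \<ge> max 1 (max (\<kappa> * R1) (\<kappa> * R2))"
      and \<phi>: "stokes_angle P Q k + \<delta> \<le> \<phi>" "\<phi> \<le> stokes_angle P Q (Suc k) - \<delta>"
    define a where "a = M / 2 * (\<phi> - stokes_angle P Q k)"
    define \<rho> where "\<rho> = r powr (M / 2) / \<kappa>"
    have "M / 2 * \<delta> \<le> a" unfolding a_def using \<phi> M2 by (intro mult_left_mono) auto
    moreover have "a \<le> M / 2 * (2 / M * pi - \<delta>)" unfolding a_def using \<phi> M2 stokes_angle_Suc[of k]
      by (intro mult_left_mono) auto
    then have "a \<le> pi - M / 2 * \<delta>" using M2 by (simp add: right_diff_distrib)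
    ultimately have a: "M / 2 * \<delta> \<le> a" "a \<le> pi - M / 2 * \<delta>" "0 \<le> a" "a \<le> pi" "a \<noteq> 0" using md by auto
    have r0': "r > 0" using r by simp
    note sp = sector_parametrization[OF r0' a_def a(3,4), folded \<rho>_def]
    have sin: "c \<le> sin a" unfolding c_def using a md by (intro sin_interval_bound) auto
    have \<rho>: "\<rho> \<ge> R1" "\<rho> \<ge> R2" unfolding \<rho>_def using r by (auto intro!: radius_large)
    have nr: "norm (d + rcis r \<phi> - d) = r" using r0' by simp
    show "r ^ n \<le> norm (g (d + rcis r \<phi>))"
    proof (cases "a \<le> pi / 2")
      case True
      have "Im (rcis \<rho> a) \<ge> c * norm (rcis \<rho> a)" unfolding complex_mod_rcis Im_rcis
        using sp(5) mult_left_mono[OF sin, of \<rho>] by (simp add: mult.commute)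
      from R1[OF _ sp(3)[OF True] this] show ?thesis unfolding sp(1) nr using \<rho> sp(5) by simp
    next
      case False
      have "Im (rcis \<rho> (a - pi)) \<le> - (c * norm (rcis \<rho> (a - pi)))"
        unfolding complex_mod_rcis Im_rcis using sp(5) mult_left_mono[OF sin, of \<rho>] by (simp add: mult.commute sin_diff)
      moreover have "zmap (Suc k) (rcis \<rho> (a - pi)) = d + rcis r \<phi>" using sp(2) a(5) by simp
      ultimately show ?thesis using R2[of "rcis \<rho> (a - pi)"] sp(4) False nr \<rho> sp(5) by simp
    qed
  qed
qed

lemma generic_tends_to_infinity:
  assumes g: "solution_on P Q UNIV g" and gen: "generic_solution g" and k: "k \<le> N + 1"
  shows "tends_to_infinity_in_stokes_sector P Q k g"
proof -
  have "\<forall>\<^sub>F \<delta> in at_right 0. \<delta> \<in> {0<..<pi / M}" using M2 by (intro eventually_at_right_real) auto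
  then show ?thesis unfolding tends_to_infinity_in_stokes_sector_def
  proof eventually_elim
    case (elim \<delta>)
    then have \<delta>: "0 < \<delta>" "\<delta> < pi / M" by auto
    obtain R where R: "\<And>r \<phi>. r \<ge> R \<Longrightarrow> stokes_angle P Q k + \<delta> \<le> \<phi> \<Longrightarrow> \<phi> \<le> stokes_angle P Q (Suc k) - \<delta> \<Longrightarrow>
      r ^ 1 \<le> norm (g (d + rcis r \<phi>))"
      using sector_growth[OF g gen k \<delta>, of 1] by blast
    show ?case
    proof (subst filterlim_at_infinity[OF order_refl], intro allI impI)
      fix c :: real
      show "\<forall>\<^sub>F x in inf at_infinity (principal (open_sector d (stokes_angle P Q k + \<delta>) (stokes_angle P Q (Suc k) - \<delta>))). c \<le> norm (g x)"
        unfolding eventually_inf_principal eventually_at_infinity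
      proof (intro exI[of _ "max R c + norm d"] allI impI)
        fix x assume x: "max R c + norm d \<le> norm x" "x \<in> open_sector d (stokes_angle P Q k + \<delta>) (stokes_angle P Q (Suc k) - \<delta>)"
        then obtain r \<phi> where rp: "x = d + rcis r \<phi>" "r > 0" "stokes_angle P Q k + \<delta> < \<phi>" "\<phi> < stokes_angle P Q (Suc k) - \<delta>"
          unfolding open_sector_def by blast
        have "norm x \<le> norm d + r" unfolding rp(1) using norm_triangle_ineq[of d "rcis r \<phi>"] rp(2) by simp
        then have "r \<ge> R" "r \<ge> c" using x(1) by auto
        then show "c \<le> norm (g x)" using R[of r \<phi>] rp by simp
      qed
    qed
  qed
qed

lemma sector_cover:
  assumes "z \<noteq> d"
  obtains k \<phi> where "k \<le> N + 1" "z = d + rcis (norm (z - d)) \<phi>" "stokes_angle P Q k \<le> \<phi>" "\<phi> \<le> stokes_angle P Q (Suc k)"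
proof -
  define t0 where "t0 = stokes_angle P Q 0"
  \<comment> \<open>Moves the argument into the interval of length 2 pi that starts at the first
    Stokes angle.\<close>
  define m where "m = \<lfloor>(Arg (z - d) - t0) / (2 * pi)\<rfloor>"
  define \<phi> where "\<phi> = Arg (z - d) - 2 * pi * of_int m"
  define x where "x = (\<phi> - t0) * M / (2 * pi)"
  have "of_int m \<le> (Arg (z - d) - t0) / (2 * pi)" "(Arg (z - d) - t0) / (2 * pi) < of_int m + 1"
    unfolding m_def by linarith+
  then have p: "0 \<le> \<phi> - t0" "\<phi> - t0 < 2 * pi" by (auto simp: \<phi>_def field_simps)
  have "(\<phi> - t0) * M < 2 * pi * M" using p(2) M2 by (intro mult_strict_right_mono) auto
  then have x: "0 \<le> x" "x < M" using p(1) M2 by (auto simp: x_def pos_divide_less_eq mult.commute)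
  define k where "k = nat \<lfloor>x\<rfloor>"
  have k: "real k \<le> x" "x < real k + 1" unfolding k_def using x by linarith+
  have ang: "stokes_angle P Q i = t0 + 2 * pi * real i / M" for i
    unfolding t0_def stokes_angle_def N_def[symmetric] M_def[symmetric] by (simp add: diff_divide_distrib)
  have \<phi>x: "\<phi> = t0 + 2 * pi * x / M" using M2 by (simp add: x_def)
  show ?thesis
  proof (rule that[of k \<phi>])
    have "real k < real (N + 2)" using k(1) x(2) real_N2 by linarith
    then show "k \<le> N + 1" by linarith
    have "cis \<phi> = cis (Arg (z - d)) * cis (2 * pi * of_int (- m))" by (simp add: \<phi>_def cis_mult)
    also have "cis (2 * pi * of_int (- m)) = 1" by (rule cis_multiple_2pi) simp
    finally have "rcis (norm (z - d)) \<phi> = z - d" by (simp add: rcis_def rcis_cmod_Arg[unfolded rcis_def])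
    then show "z = d + rcis (norm (z - d)) \<phi>" by simp
    show "stokes_angle P Q k \<le> \<phi>" unfolding ang \<phi>x using k M2 by (auto intro!: divide_right_mono mult_left_mono)
    have "2 * pi * x / M \<le> 2 * pi * real (Suc k) / M" using k M2 by (intro divide_right_mono mult_left_mono) auto
    then show "\<phi> \<le> stokes_angle P Q (Suc k)" unfolding ang \<phi>x by simp
  qed
qed

text \<open>Every far point lies in a closed half of some sector. The Stokes rays and the bisectors
  are included, so no direction is lost.\<close>

lemma region_cover:
  assumes "norm (z - d) \<ge> 1" "norm (z - d) \<ge> \<kappa> * R"
  obtains j \<nu> s where "j \<le> N + 2" "\<nu> \<in> {cis (pi / 4), cis (- (pi / 4))}" "z = zmap j s"
    "Re (\<nu> * s) \<ge> 7 / 10 * norm s" "norm s \<ge> R"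
proof -
  define r where "r = norm (z - d)"
  have r: "r > 0" "r \<ge> 1" "r \<ge> \<kappa> * R" using assms by (auto simp: r_def)
  then have "z \<noteq> d" by (auto simp: r_def)
  obtain k \<phi> where k: "k \<le> N + 1" "z = d + rcis r \<phi>" "stokes_angle P Q k \<le> \<phi>" "\<phi> \<le> stokes_angle P Q (Suc k)"
    using sector_cover[OF \<open>z \<noteq> d\<close>] unfolding r_def by blast
  define a where "a = M / 2 * (\<phi> - stokes_angle P Q k)"
  define \<rho> where "\<rho> = r powr (M / 2) / \<kappa>"
  have "0 \<le> a" unfolding a_def using k M2 by auto
  moreover have "a \<le> M / 2 * (2 / M * pi)" unfolding a_def using k M2 stokes_angle_Suc[of k]
    by (intro mult_left_mono) auto
  then have "a \<le> pi" using M2 by simp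
  ultimately have a: "0 \<le> a" "a \<le> pi" .
  note sp = sector_parametrization[OF r(1) a_def a, folded \<rho>_def]
  have \<rho>: "\<rho> \<ge> R" unfolding \<rho>_def by (rule radius_large[OF r(2,3)])
  show ?thesis
  proof (cases "a \<le> pi / 2")
    case True
    show ?thesis
      by (rule that[of k "cis (- (pi / 4))" "rcis \<rho> a"]) (use k sp True \<rho> in auto)
  next
    case False
    then have "a \<noteq> 0" using pi_gt_zero by auto
    show ?thesis
      by (rule that[of "Suc k" "cis (pi / 4)" "rcis \<rho> (a - pi)"]) (use k sp False \<rho> \<open>a \<noteq> 0\<close> in auto)
  qed
qed

lemma cis_pi4: "norm (cis (pi / 4)) = 1" "Re (cis (pi / 4)) \<ge> 7 / 10"
  "norm (cis (- (pi / 4))) = 1" "Re (cis (- (pi / 4))) \<ge> 7 / 10"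
  using cos_pi4_bound[of "pi / 4"] by auto

end

section \<open>Exceptional points of the projective line\<close>

lemma proj_point_eq:
  assumes "(\<alpha>, \<beta>) \<noteq> (0, 0)"
  shows "proj_point \<alpha> \<beta> = {(t * \<alpha>, t * \<beta>) | t. t \<noteq> 0}"
  using assms unfolding proj_point_def proportional_def by auto

text \<open>A nonzero linear form in two variables vanishes on a single line, so each coefficient
  contributes one exceptional point.\<close>

lemma proj_point_of_linear_equation:
  assumes ab: "(\<alpha>, \<beta>) \<noteq> (0, 0)" and c: "(c1, c2) \<noteq> (0, 0)" and eq: "\<alpha> * c1 + \<beta> * c2 = 0"
  shows "proj_point \<alpha> \<beta> = proj_point c2 (- c1)"
proof -
  have "\<exists>t. t \<noteq> 0 \<and> \<alpha> = t * c2 \<and> \<beta> = t * (- c1)"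
  proof (cases "c2 = 0")
    case True
    then have "c1 \<noteq> 0" "\<alpha> = 0" "\<beta> \<noteq> 0" using c eq ab by auto
    then show ?thesis using True by (intro exI[of _ "\<beta> / (- c1)"]) auto
  next
    case False
    have "\<beta> = - (\<alpha> * c1) / c2" using eq False by (simp add: field_simps add_eq_0_iff)
    moreover from this have "\<alpha> \<noteq> 0" using ab by auto
    ultimately show ?thesis using False by (intro exI[of _ "\<alpha> / c2"]) auto
  qed
  then obtain t where t: "t \<noteq> 0" "\<alpha> = t * c2" "\<beta> = t * (- c1)" by blast
  have c': "(c2, - c1) \<noteq> (0, 0)" using c by auto
  show ?thesis
    unfolding proj_point_eq[OF ab] proj_point_eq[OF c']
  proof (intro equalityI subsetI)
    fix p assume "p \<in> {(u * \<alpha>, u * \<beta>) | u. u \<noteq> 0}"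
    then obtain u where "u \<noteq> 0" "p = (u * \<alpha>, u * \<beta>)" by blast
    then show "p \<in> {(u * c2, u * - c1) | u. u \<noteq> 0}"
      using t by (intro CollectI exI[of _ "u * t"]) (simp add: mult.assoc)
  next
    fix p assume "p \<in> {(u * c2, u * - c1) | u. u \<noteq> 0}"
    then obtain u where "u \<noteq> 0" "p = (u * c2, u * - c1)" by blast
    then show "p \<in> {(u * \<alpha>, u * \<beta>) | u. u \<noteq> 0}"
      using t by (intro CollectI exI[of _ "u / t"]) simp
  qed
qed

context stokes_region
begin

text \<open>If A vanished on both solutions, a nontrivial combination that annihilates B would have
  A = B = 0 and be zero, against independence; likewise with A and B exchanged.\<close>

lemma coef_pair_nonzero:
  assumes fs: "fundamental_system P Q g1 g2"
  shows "(coefA g1, coefA g2) \<noteq> (0, 0)" "(coefB g1, coefB g2) \<noteq> (0, 0)"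
proof -
  have sol: "solution_on P Q UNIV g1" "solution_on P Q UNIV g2"
    and ind: "\<And>\<alpha> \<beta>. (\<forall>z. \<alpha> * g1 z + \<beta> * g2 z = 0) \<Longrightarrow> \<alpha> = 0 \<and> \<beta> = 0"
    using fs unfolding fundamental_system_def by blast+
  have kernel: "\<exists>\<alpha> \<beta>. (\<alpha>, \<beta>) \<noteq> (0, 0) \<and> \<alpha> * c1 + \<beta> * c2 = 0" for c1 c2 :: complex
  proof (cases "c1 = 0 \<and> c2 = 0")
    case True then show ?thesis by (intro exI[of _ 1]) auto
  next
    case False then show ?thesis by (intro exI[of _ c2] exI[of _ "- c1"]) auto
  qed
  have z: "\<alpha> = 0 \<and> \<beta> = 0" if "\<alpha> * coefA g1 + \<beta> * coefA g2 = 0" "\<alpha> * coefB g1 + \<beta> * coefB g2 = 0" for \<alpha> \<beta>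
    using coef_zero[OF solution_on_lincomb[OF open_UNIV sol], of \<alpha> \<beta>] coef_linear[OF sol, of \<alpha> \<beta>] that ind[of \<alpha> \<beta>] by simp
  show "(coefA g1, coefA g2) \<noteq> (0, 0)"
  proof
    assume "(coefA g1, coefA g2) = (0, 0)"
    moreover obtain \<alpha> \<beta> where "(\<alpha>, \<beta>) \<noteq> (0, 0)" "\<alpha> * coefB g1 + \<beta> * coefB g2 = 0" using kernel by blast
    ultimately show False using z[of \<alpha> \<beta>] by simp
  qed
  show "(coefB g1, coefB g2) \<noteq> (0, 0)"
  proof
    assume "(coefB g1, coefB g2) = (0, 0)"
    moreover obtain \<alpha> \<beta> where "(\<alpha>, \<beta>) \<noteq> (0, 0)" "\<alpha> * coefA g1 + \<beta> * coefA g2 = 0" using kernel by blast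
    ultimately show False using z[of \<alpha> \<beta>] by simp
  qed
qed

end

context stokes_setup
begin

lemma generic_exceptional_set:
  assumes fs: "fundamental_system P Q g1 g2"
  obtains E where "E \<subseteq> projective_line" "finite E"
    "\<And>\<alpha> \<beta>. (\<alpha>, \<beta>) \<noteq> (0, 0) \<Longrightarrow> proj_point \<alpha> \<beta> \<notin> E \<Longrightarrow> generic_solution (\<lambda>z. \<alpha> * g1 z + \<beta> * g2 z)"
proof -
  have sol: "solution_on P Q UNIV g1" "solution_on P Q UNIV g2"
    using fs unfolding fundamental_system_def by blast+
  define I where "I = {..N + 2} \<times> {cis (pi / 4), cis (- (pi / 4))}"
  have "\<exists>p. stokes_region P Q r0 C (fst i) (snd i) (fst p) (snd p)" if "i \<in> I" for i
  proof -
    have "norm (snd i) = 1" "Re (snd i) \<ge> 7 / 10" using that cis_pi4 by (auto simp: I_def)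
    from stokes_region_exists[OF this, of "fst i"] show ?thesis by (metis fst_conv snd_conv)
  qed
  then obtain p where p: "\<And>i. i \<in> I \<Longrightarrow> stokes_region P Q r0 C (fst i) (snd i) (fst (p i)) (snd (p i))" by metis
  define cA where "cA i g = stokes_region.coefA P Q r0 C (fst i) (snd i) (fst (p i)) (snd (p i)) g" for i g
  define cB where "cB i g = stokes_region.coefB P Q r0 C (fst i) (snd i) (fst (p i)) (snd (p i)) g" for i g
  define E where "E = (\<lambda>i. proj_point (cA i g2) (- cA i g1)) ` I \<union> (\<lambda>i. proj_point (cB i g2) (- cB i g1)) ` I"
  have nz: "(cA i g1, cA i g2) \<noteq> (0, 0)" "(cB i g1, cB i g2) \<noteq> (0, 0)" if "i \<in> I" for i
    unfolding cA_def cB_def by (rule stokes_region.coef_pair_nonzero[OF p[OF that] fs])+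
  show ?thesis
  proof (rule that[of E])
    have "proj_point x y \<in> projective_line" if "(x, y) \<noteq> (0, 0)" for x y
      using that unfolding proj_point_def projective_line_def by (intro quotientI) auto
    then have "proj_point (cA i g2) (- cA i g1) \<in> projective_line"
      "proj_point (cB i g2) (- cB i g1) \<in> projective_line" if "i \<in> I" for i
      using nz[OF that] by auto
    then show "E \<subseteq> projective_line" unfolding E_def by blast
    show "finite E" unfolding E_def I_def by auto
    fix \<alpha> \<beta> assume ab: "(\<alpha>, \<beta>) \<noteq> (0, 0)" "proj_point \<alpha> \<beta> \<notin> E"
    show "generic_solution (\<lambda>z. \<alpha> * g1 z + \<beta> * g2 z)"
      unfolding generic_solution_def
    proof (intro allI impI ballI)
      fix j \<nu> assume "j \<le> N + 2" "\<nu> \<in> {cis (pi / 4), cis (- (pi / 4))}"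
      then have i: "(j, \<nu>) \<in> I" by (simp add: I_def)
      define i where "i = (j, \<nu>)"
      have iI: "i \<in> I" using i by (simp add: i_def)
      have "cA i (\<lambda>z. \<alpha> * g1 z + \<beta> * g2 z) = \<alpha> * cA i g1 + \<beta> * cA i g2"
        "cB i (\<lambda>z. \<alpha> * g1 z + \<beta> * g2 z) = \<alpha> * cB i g1 + \<beta> * cB i g2"
        unfolding cA_def cB_def by (rule stokes_region.coef_linear[OF p[OF iI] sol])+
      moreover have "\<alpha> * cA i g1 + \<beta> * cA i g2 \<noteq> 0"
        using proj_point_of_linear_equation[OF ab(1) nz(1)[OF iI]] ab(2) iI unfolding E_def by blast
      moreover have "\<alpha> * cB i g1 + \<beta> * cB i g2 \<noteq> 0"
        using proj_point_of_linear_equation[OF ab(1) nz(2)[OF iI]] ab(2) iI unfolding E_def by blast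
      ultimately have "cA i (\<lambda>z. \<alpha> * g1 z + \<beta> * g2 z) \<noteq> 0" "cB i (\<lambda>z. \<alpha> * g1 z + \<beta> * g2 z) \<noteq> 0" by simp_all
      then show "\<exists>\<Phi> l. stokes_region P Q r0 C j \<nu> \<Phi> l \<and>
          stokes_region.coefA P Q r0 C j \<nu> \<Phi> l (\<lambda>z. \<alpha> * g1 z + \<beta> * g2 z) \<noteq> 0 \<and>
          stokes_region.coefB P Q r0 C j \<nu> \<Phi> l (\<lambda>z. \<alpha> * g1 z + \<beta> * g2 z) \<noteq> 0"
        using p[OF iI] unfolding cA_def cB_def i_def by auto
    qed
  qed
qed

end

section \<open>Zeros near the Stokes rays\<close>

text \<open>This spares an enumeration of the zeros: an injective integer label, a power of which
  dominates the weights, is enough.\<close>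

lemma summable_on_via_int_injection:
  fixes w :: "'a \<Rightarrow> real" and f :: "'a \<Rightarrow> int"
  assumes inj: "inj_on f S" and p: "p > 1" and w: "\<And>x. x \<in> S \<Longrightarrow> 0 \<le> w x"
    and le: "\<And>x. x \<in> S \<Longrightarrow> w x \<le> c * (1 + \<bar>of_int (f x)\<bar>) powr (- p)"
  shows "w summable_on S"
proof -
  define h :: "int \<Rightarrow> real" where "h k = c * (1 + \<bar>of_int k\<bar>) powr (- p)" for k
  have "summable (\<lambda>n. real n powr (- p))" using p by (simp add: summable_real_powr_iff)
  then have "summable (\<lambda>n. real (Suc n) powr (- p))" by (subst summable_Suc_iff)
  then have "(\<lambda>n. real (Suc n) powr (- p)) summable_on UNIV" by (subst summable_on_UNIV_nonneg_real_iff) auto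
  then have "(\<lambda>n. c * real (Suc n) powr (- p)) summable_on UNIV" by (rule summable_on_cmult_right)
  then have n: "(\<lambda>n. c * (1 + real n) powr (- p)) summable_on UNIV" by (simp add: add.commute)
  have "h summable_on range int"
    using n by (subst summable_on_reindex) (auto simp: o_def h_def)
  moreover have "h summable_on range (\<lambda>n. - int n)"
    using n by (subst summable_on_reindex) (auto simp: o_def h_def inj_on_def)
  ultimately have "h summable_on (range int \<union> range (\<lambda>n. - int n))" by (rule summable_on_union)
  moreover have "range int \<union> range (\<lambda>n. - int n) = UNIV"
  proof -
    have "k \<in> range int \<union> range (\<lambda>n. - int n)" for k :: int
      by (cases k rule: int_cases2) auto
    then show ?thesis by blast
  qed
  ultimately have "h summable_on UNIV" by simp
  then have "h summable_on f ` S" by (rule summable_on_subset_banach) simp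
  then have "(h \<circ> f) summable_on S" using inj by (simp add: summable_on_reindex)
  then show ?thesis
    by (rule summable_on_comparison_test) (use w le in \<open>auto simp: h_def\<close>)
qed

lemma summable_on_finite_UN:
  fixes w :: "'a \<Rightarrow> real"
  assumes "finite I" "\<And>i. i \<in> I \<Longrightarrow> w summable_on A i"
  shows "w summable_on (\<Union>i\<in>I. A i)"
  using assms by (induction I rule: finite_induct) (auto intro: summable_on_union)

context stokes_region
begin

definition "principal_part g \<zeta> = coefA g * exp (\<i> * \<zeta>) + coefB g * exp (- \<i> * \<zeta>)"
definition "amplitude g \<zeta> = norm (coefA g * exp (\<i> * \<zeta>)) + norm (coefB g * exp (- \<i> * \<zeta>))"

text \<open>The two terms have the constant product |A B|, so the inequality of arithmetic and
  geometric means bounds their sum below, independently of \<zeta>.\<close>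

lemma amplitude_square: "amplitude g \<zeta> ^ 2 \<ge> 4 * (norm (coefA g) * norm (coefB g))"
proof -
  define x y where "x = norm (coefA g * exp (\<i> * \<zeta>))" "y = norm (coefB g * exp (- \<i> * \<zeta>))"
  have "norm (exp (\<i> * \<zeta>)) * norm (exp (- \<i> * \<zeta>)) = 1"
    unfolding norm_mult[symmetric] by (simp add: exp_add[symmetric])
  then have "x * y = norm (coefA g) * norm (coefB g)" by (simp add: x_y_def norm_mult mult_ac)
  moreover have "0 \<le> (x - y) ^ 2" by simp
  then have "4 * (x * y) \<le> (x + y) ^ 2" by (simp add: power2_eq_square algebra_simps)
  ultimately show ?thesis by (simp add: amplitude_def x_y_def)
qed

lemma amplitude_nonneg: "amplitude g \<zeta> \<ge> 0" by (simp add: amplitude_def)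

lemma amplitude_pos: "coefA g \<noteq> 0 \<Longrightarrow> amplitude g \<zeta> > 0"
  by (simp add: amplitude_def add_pos_nonneg)

lemma exp_shift_bounds:
  fixes u :: complex
  assumes "norm u \<le> 1 / 2"
  shows "norm (exp (\<i> * u) - 1) \<le> 3 / 2 * norm u" "norm (exp (- \<i> * u) - 1) \<le> 3 / 2 * norm u"
    "norm (exp (\<i> * u)) \<le> 1 + 3 / 2 * norm u" "norm (exp (- \<i> * u)) \<le> 1 + 3 / 2 * norm u"
    "norm (exp (- \<i> * u)) \<ge> 1 - 3 / 2 * norm u"
proof -
  show 1: "norm (exp (\<i> * u) - 1) \<le> 3 / 2 * norm u" and 2: "norm (exp (- \<i> * u) - 1) \<le> 3 / 2 * norm u"
    using norm_exp_bounds(2)[of "\<i> * u"] norm_exp_bounds(2)[of "- \<i> * u"] assms by (simp_all add: norm_mult)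
  show "norm (exp (\<i> * u)) \<le> 1 + 3 / 2 * norm u"
    using norm_triangle_ineq2[of "exp (\<i> * u)" 1] 1 by simp
  show "norm (exp (- \<i> * u)) \<le> 1 + 3 / 2 * norm u"
    using norm_triangle_ineq2[of "exp (- \<i> * u)" 1] 2 by simp
  show "norm (exp (- \<i> * u)) \<ge> 1 - 3 / 2 * norm u"
    using norm_triangle_ineq2[of 1 "exp (- \<i> * u)"] 2 by (simp add: norm_minus_commute)
qed

lemma amplitude_shift:
  assumes "norm u \<le> 1 / 2"
  shows "amplitude g (\<zeta> + u) \<le> (1 + 3 / 2 * norm u) * amplitude g \<zeta>"
    and "norm (principal_part g (\<zeta> + u)) \<le> norm (principal_part g \<zeta>) + 3 / 2 * norm u * amplitude g \<zeta>"
proof -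
  define X Y where "X = coefA g * exp (\<i> * \<zeta>)" "Y = coefB g * exp (- \<i> * \<zeta>)"
  have X: "coefA g * exp (\<i> * (\<zeta> + u)) = X * exp (\<i> * u)"
    and Y: "coefB g * exp (- \<i> * (\<zeta> + u)) = Y * exp (- \<i> * u)"
    by (simp_all add: X_Y_def distrib_left exp_add exp_diff exp_minus field_simps)
  note e = exp_shift_bounds[OF assms]
  have "norm X * norm (exp (\<i> * u)) \<le> norm X * (1 + 3 / 2 * norm u)"
    "norm Y * norm (exp (- \<i> * u)) \<le> norm Y * (1 + 3 / 2 * norm u)"
    using e by (auto intro!: mult_left_mono simp del: norm_exp_eq_Re)
  then show "amplitude g (\<zeta> + u) \<le> (1 + 3 / 2 * norm u) * amplitude g \<zeta>"
    unfolding amplitude_def X Y norm_mult[of X] norm_mult[of Y] X_Y_def[symmetric] by (simp only: algebra_simps)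
  have "principal_part g (\<zeta> + u) = principal_part g \<zeta> + (X * (exp (\<i> * u) - 1) + Y * (exp (- \<i> * u) - 1))"
    unfolding principal_part_def X Y X_Y_def[symmetric] by (simp add: algebra_simps)
  also have "norm \<dots> \<le> norm (principal_part g \<zeta>) + (norm X * norm (exp (\<i> * u) - 1) + norm Y * norm (exp (- \<i> * u) - 1))"
    unfolding norm_mult[symmetric] by (intro order_trans[OF norm_triangle_ineq] add_left_mono norm_triangle_ineq)
  also have "\<dots> \<le> norm (principal_part g \<zeta>) + (norm X * (3 / 2 * norm u) + norm Y * (3 / 2 * norm u))"
    using e by (intro add_mono mult_left_mono order_refl) auto
  also have "\<dots> = norm (principal_part g \<zeta>) + 3 / 2 * norm u * amplitude g \<zeta>"
    unfolding amplitude_def X_Y_def by (simp add: algebra_simps)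
  finally show "norm (principal_part g (\<zeta> + u)) \<le> norm (principal_part g \<zeta>) + 3 / 2 * norm u * amplitude g \<zeta>" .
qed

lemma U_near_principal: "solution_on P Q UNIV g \<Longrightarrow> \<zeta> \<in> D \<Longrightarrow> norm (U g \<zeta> - principal_part g \<zeta>) \<le> amplitude g \<zeta> / 1000"
  unfolding principal_part_def amplitude_def by (rule U_V_bounds(1))

lemma principal_part_at_zero:
  assumes "solution_on P Q UNIV g" "\<zeta> \<in> D" "U g \<zeta> = 0"
  shows "norm (principal_part g \<zeta>) \<le> amplitude g \<zeta> / 1000"
  using U_near_principal[OF assms(1,2)] assms(3) by simp

text \<open>A zero at distance at most 1/200 would make the principal part at \<open>\<zeta>\<close>
  at most 1/1000 + 3/400 times the amplitude at the zero, which is below 1/100 of the amplitude at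
  \<open>\<zeta>\<close>.\<close>

lemma no_zero_near_good:
  assumes g: "solution_on P Q UNIV g" and A: "coefA g \<noteq> 0"
    and good: "norm (principal_part g \<zeta>) \<ge> amplitude g \<zeta> / 100"
    and \<xi>: "\<xi> \<in> D" "norm (\<xi> - \<zeta>) \<le> 1 / 200"
  shows "U g \<xi> \<noteq> 0"
proof
  assume z: "U g \<xi> = 0"
  define u where "u = \<zeta> - \<xi>"
  have u: "norm u \<le> 1 / 200" using \<xi> by (simp add: u_def norm_minus_commute)
  have a1: "amplitude g \<xi> \<le> (1 + 3 / 2 * norm (- u)) * amplitude g \<zeta>"
    using amplitude_shift(1)[of "- u" g \<zeta>] u \<xi>(2) by (simp add: u_def)
  also have "\<dots> \<le> 403 / 400 * amplitude g \<zeta>"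
    using u amplitude_nonneg by (intro mult_right_mono) auto
  finally have a: "amplitude g \<xi> \<le> 403 / 400 * amplitude g \<zeta>" .
  have "norm (principal_part g \<zeta>) \<le> norm (principal_part g \<xi>) + 3 / 2 * norm u * amplitude g \<xi>"
    using amplitude_shift(2)[of u g \<xi>] u by (simp add: u_def)
  also have "\<dots> \<le> amplitude g \<xi> / 1000 + 3 / 400 * amplitude g \<xi>"
    using principal_part_at_zero[OF g \<xi>(1) z] u amplitude_nonneg by (intro add_mono mult_right_mono) auto
  finally have "amplitude g \<zeta> / 100 \<le> amplitude g \<xi> / 1000 + 3 / 400 * amplitude g \<xi>" using good by linarith
  then show False using a amplitude_pos[OF A, of \<zeta>] by linarith
qed

text \<open>At a bad point X and Y nearly cancel, so |X| is about half the amplitude. Shifting by u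
  yields e^(- i u) (X (e^(2 i u) - 1) + X + Y), and |e^(2 i u) - 1| \<ge> 1/10 on the circle |u| =
  1/10. Thus every bad point is surrounded by a circle of good ones.\<close>

lemma good_on_circle:
  assumes bad: "norm (principal_part g \<zeta>) < amplitude g \<zeta> / 100" and u: "norm u = 1 / 10"
  shows "norm (principal_part g (\<zeta> + u)) \<ge> amplitude g (\<zeta> + u) / 100"
proof -
  define X Y where "X = coefA g * exp (\<i> * \<zeta>)" "Y = coefB g * exp (- \<i> * \<zeta>)"
  have amp: "amplitude g \<zeta> = norm X + norm Y" by (simp add: amplitude_def X_Y_def)
  have pp: "principal_part g \<zeta> = X + Y" by (simp add: principal_part_def X_Y_def)
  have "norm Y \<le> norm (X + Y) + norm X" using norm_triangle_ineq4[of "X + Y" X] by simp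
  then have X: "norm X \<ge> 99 / 200 * amplitude g \<zeta>" using bad[unfolded pp] amp by linarith
  have "principal_part g (\<zeta> + u) = exp (- \<i> * u) * (X * (exp (2 * (\<i> * u)) - 1) + (X + Y))"
  proof -
    have "exp (- \<i> * u) * exp (2 * (\<i> * u)) = exp (\<i> * u)" by (simp add: exp_add[symmetric])
    moreover have "exp (- \<i> * u) * (X * (exp (2 * (\<i> * u)) - 1) + (X + Y))
      = X * (exp (- \<i> * u) * exp (2 * (\<i> * u))) + Y * exp (- \<i> * u)"
      by (simp add: algebra_simps)
    moreover have "coefA g * exp (\<i> * (\<zeta> + u)) = X * exp (\<i> * u)" "coefB g * exp (- \<i> * (\<zeta> + u)) = Y * exp (- \<i> * u)"
      by (simp_all add: X_Y_def distrib_left exp_add exp_diff exp_minus field_simps)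
    ultimately show ?thesis unfolding principal_part_def by simp
  qed
  then have n: "norm (principal_part g (\<zeta> + u)) = norm (exp (- \<i> * u)) * norm (X * (exp (2 * (\<i> * u)) - 1) + (X + Y))"
    by (simp only: norm_mult)
  have "norm (exp (2 * (\<i> * u)) - 1) \<ge> 1 / 10"
    using norm_exp_bounds(1)[of "2 * (\<i> * u)"] u by (simp add: norm_mult)
  then have "norm X * norm (exp (2 * (\<i> * u)) - 1) \<ge> norm X * (1 / 10)" by (intro mult_left_mono) auto
  then have "norm (X * (exp (2 * (\<i> * u)) - 1)) \<ge> norm X / 10" by (simp add: norm_mult)
  moreover have "norm (X * (exp (2 * (\<i> * u)) - 1) + (X + Y)) \<ge> norm (X * (exp (2 * (\<i> * u)) - 1)) - norm (X + Y)"
    by (rule norm_diff_ineq)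
  ultimately have "norm (X * (exp (2 * (\<i> * u)) - 1) + (X + Y)) \<ge> 79 / 2000 * amplitude g \<zeta>"
    using X bad unfolding pp by linarith
  moreover have "norm (exp (- \<i> * u)) \<ge> 17 / 20" using exp_shift_bounds(5)[of u] u by simp
  ultimately have "norm (principal_part g (\<zeta> + u)) \<ge> 17 / 20 * (79 / 2000 * amplitude g \<zeta>)"
    unfolding n using amplitude_nonneg by (intro mult_mono) auto
  then have "norm (principal_part g (\<zeta> + u)) \<ge> 1343 / 40000 * amplitude g \<zeta>" by simp
  moreover have "amplitude g (\<zeta> + u) \<le> 23 / 20 * amplitude g \<zeta>" using amplitude_shift(1)[of u g \<zeta>] u by simp
  ultimately show ?thesis using amplitude_nonneg[of g \<zeta>] by linarith
qed

text \<open>At a zero X is close to - Y, hence X - Y, and with it V, is comparable to the whole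
  amplitude.\<close>

lemma V_at_zero:
  assumes g: "solution_on P Q UNIV g" and \<zeta>: "\<zeta> \<in> D" and z: "U g \<zeta> = 0"
  shows "norm (V g \<zeta>) ^ 2 \<ge> norm (coefA g) * norm (coefB g)"
proof -
  define X Y where "X = coefA g * exp (\<i> * \<zeta>)" "Y = coefB g * exp (- \<i> * \<zeta>)"
  have amp: "amplitude g \<zeta> = norm X + norm Y" by (simp add: amplitude_def X_Y_def)
  have 1: "norm (X + Y) \<le> (norm X + norm Y) / 1000"
    using principal_part_at_zero[OF assms] amp by (simp add: principal_part_def X_Y_def)
  have 2: "norm (V g \<zeta> - \<i> * (X - Y)) \<le> (norm X + norm Y) / 1000"
    using U_V_bounds(2)[OF g \<zeta>] by (simp add: X_Y_def)
  have "2 * norm X \<le> norm (X - Y) + norm (X + Y)"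
    using norm_triangle_ineq[of "X - Y" "X + Y"] by (simp add: norm_mult[of 2 X, simplified] mult_2[symmetric] del: mult_2)
  moreover have "2 * norm Y \<le> norm (X - Y) + norm (X + Y)"
    using norm_triangle_ineq4[of "X + Y" "X - Y"] by (simp add: norm_mult[of 2 Y, simplified] mult_2[symmetric] del: mult_2)
  ultimately have 3: "norm X + norm Y \<le> norm (X - Y) + norm (X + Y)" by linarith
  have "norm (X - Y) = norm (\<i> * (X - Y))" by (simp add: norm_mult)
  also have "\<dots> \<le> norm (V g \<zeta>) + norm (V g \<zeta> - \<i> * (X - Y))"
    using norm_triangle_ineq4[of "V g \<zeta>" "V g \<zeta> - \<i> * (X - Y)"] by simp
  finally have "amplitude g \<zeta> / 2 \<le> norm (V g \<zeta>)" using 1 2 3 norm_ge_zero[of X] norm_ge_zero[of Y] unfolding amp by argo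
  then have "(amplitude g \<zeta> / 2) ^ 2 \<le> norm (V g \<zeta>) ^ 2" using amplitude_nonneg by (intro power_mono) auto
  then show ?thesis using amplitude_square[of g \<zeta>] by (simp add: power_divide)
qed

text \<open>Near a zero the derivative V is close to i (X - Y), hence to - 2 i Y. Divided by this
  constant, U differs from the identity by a contraction, so it takes the value 0 only once on the
  disc.\<close>

lemma close_zeros_equal:
  assumes g: "solution_on P Q UNIV g" and B: "coefB g \<noteq> 0"
    and z: "U g \<zeta> = 0" "U g \<xi> = 0" and ball: "cball \<zeta> (1 / 10) \<subseteq> D" and \<xi>: "norm (\<xi> - \<zeta>) \<le> 1 / 10"
  shows "\<xi> = \<zeta>"
proof -
  have \<zeta>D: "\<zeta> \<in> D" using ball by auto
  define X Y where "X = coefA g * exp (\<i> * \<zeta>)" "Y = coefB g * exp (- \<i> * \<zeta>)"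
  have Y0: "norm Y > 0" using B by (simp add: X_Y_def)
  have amp: "amplitude g \<zeta> = norm X + norm Y" by (simp add: amplitude_def X_Y_def)
  have 1: "norm (X + Y) \<le> amplitude g \<zeta> / 1000"
    using principal_part_at_zero[OF g \<zeta>D z(1)] by (simp add: principal_part_def X_Y_def)
  have "norm X \<le> norm (X + Y) + norm Y" using norm_triangle_ineq4[of "X + Y" Y] by simp
  then have aY: "amplitude g \<zeta> \<le> 3 * norm Y" using 1 amp Y0 by linarith
  define c where "c = - 2 * \<i> * Y"
  have c: "norm c = 2 * norm Y" "c \<noteq> 0" using Y0 by (auto simp: c_def norm_mult)
  have "norm ((U g \<xi> / c - \<xi>) - (U g \<zeta> / c - \<zeta>)) \<le> 1 / 2 * norm (\<xi> - \<zeta>)"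
  proof (rule field_differentiable_bound[where S = "cball \<zeta> (1 / 10)" and f' = "\<lambda>y. V g y / c - 1"])
    fix y assume y: "y \<in> cball \<zeta> (1 / 10)"
    then have yD: "y \<in> D" using ball by blast
    show "((\<lambda>\<xi>. U g \<xi> / c - \<xi>) has_field_derivative V g y / c - 1) (at y within cball \<zeta> (1 / 10))"
      by (rule has_field_derivative_at_within[OF DERIV_diff[OF DERIV_cdivide[OF U_derivative[OF g yD]] DERIV_ident]])
    define u where "u = y - \<zeta>"
    have u: "norm u \<le> 1 / 10" using y by (simp add: u_def dist_norm norm_minus_commute)
    then have u': "norm u \<le> 1 / 2" by simp
    note e = exp_shift_bounds[OF u']
    have y': "y = \<zeta> + u" by (simp add: u_def)
    have X: "coefA g * exp (\<i> * y) = X * exp (\<i> * u)" and Y: "coefB g * exp (- \<i> * y) = Y * exp (- \<i> * u)"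
      by (simp_all add: y' X_Y_def distrib_left exp_add exp_diff exp_minus field_simps)
    have "norm (V g y - \<i> * (X * exp (\<i> * u) - Y * exp (- \<i> * u))) \<le> amplitude g y / 1000"
      using U_V_bounds(2)[OF g yD] unfolding X Y amplitude_def by simp
    also have "\<dots> \<le> 1 / 500 * amplitude g \<zeta>"
    proof -
      have "amplitude g y \<le> (1 + 3 / 2 * norm u) * amplitude g \<zeta>" unfolding y' by (rule amplitude_shift(1)[OF u'])
      also have "\<dots> \<le> 2 * amplitude g \<zeta>" using u amplitude_nonneg by (intro mult_right_mono) auto
      finally show ?thesis by simp
    qed
    finally have V: "norm (V g y - \<i> * (X * exp (\<i> * u) - Y * exp (- \<i> * u))) \<le> 1 / 500 * amplitude g \<zeta>" .
    have "\<i> * (X * exp (\<i> * u) - Y * exp (- \<i> * u)) - c = \<i> * ((X + Y) * exp (\<i> * u) - (Y * (exp (\<i> * u) - 1) + Y * (exp (- \<i> * u) - 1)))"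
      by (simp add: c_def algebra_simps)
    then have "norm (\<i> * (X * exp (\<i> * u) - Y * exp (- \<i> * u)) - c)
      = norm ((X + Y) * exp (\<i> * u) - (Y * (exp (\<i> * u) - 1) + Y * (exp (- \<i> * u) - 1)))"
      by (simp add: norm_mult)
    also have "\<dots> \<le> norm (X + Y) * norm (exp (\<i> * u)) + (norm Y * norm (exp (\<i> * u) - 1) + norm Y * norm (exp (- \<i> * u) - 1))"
      unfolding norm_mult[symmetric] by (intro order_trans[OF norm_triangle_ineq4] add_left_mono norm_triangle_ineq)
    also have "\<dots> \<le> (amplitude g \<zeta> / 1000) * 2 + (norm Y * (3 / 20) + norm Y * (3 / 20))"
      using e u 1 by (intro add_mono mult_mono order_refl) (auto simp: amplitude_nonneg simp del: norm_exp_eq_Re)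
    finally have "norm (\<i> * (X * exp (\<i> * u) - Y * exp (- \<i> * u)) - c) \<le> 1 / 500 * amplitude g \<zeta> + 3 / 10 * norm Y" by simp
    moreover have "norm (V g y - c) \<le> norm (V g y - \<i> * (X * exp (\<i> * u) - Y * exp (- \<i> * u))) + norm (\<i> * (X * exp (\<i> * u) - Y * exp (- \<i> * u)) - c)"
      using norm_triangle_ineq[of "V g y - \<i> * (X * exp (\<i> * u) - Y * exp (- \<i> * u))" "\<i> * (X * exp (\<i> * u) - Y * exp (- \<i> * u)) - c"] by simp
    ultimately have "norm (V g y - c) \<le> norm Y" using V aY Y0 by linarith
    moreover have "V g y / c - 1 = (V g y - c) / c" using c by (simp add: diff_divide_distrib)
    ultimately show "norm (V g y / c - 1) \<le> 1 / 2" using c Y0 by (simp add: norm_divide)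
  qed (use \<xi> in \<open>auto simp: dist_norm norm_minus_commute\<close>)
  then have "norm (\<xi> - \<zeta>) \<le> 1 / 2 * norm (\<xi> - \<zeta>)" using z by (simp add: norm_minus_commute)
  then show ?thesis by simp
qed

text \<open>At a zero e^(2 i zeta) is nearly - B / A. For two zeros e^(2 i (\<xi> - \<zeta>)) is
  therefore nearly 1, and the difference is close to an integral multiple of pi; real parts less
  than 1 apart exclude all multiples but 0.\<close>

lemma zeros_close_or_apart:
  assumes g: "solution_on P Q UNIV g" and AB: "coefA g \<noteq> 0" "coefB g \<noteq> 0"
    and \<zeta>: "\<zeta> \<in> D" "\<xi> \<in> D" and z: "U g \<zeta> = 0" "U g \<xi> = 0" and re: "\<bar>Re \<xi> - Re \<zeta>\<bar> < 1"
  shows "norm (\<xi> - \<zeta>) \<le> 1 / 10"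
proof -
  define X1 Y1 X2 Y2 where "X1 = coefA g * exp (\<i> * \<xi>)" "Y1 = coefB g * exp (- \<i> * \<xi>)"
    "X2 = coefA g * exp (\<i> * \<zeta>)" "Y2 = coefB g * exp (- \<i> * \<zeta>)"
  note defs = X1_Y1_X2_Y2_def
  have nz: "X1 \<noteq> 0" "Y1 \<noteq> 0" "X2 \<noteq> 0" "Y2 \<noteq> 0" using AB by (auto simp: defs)
  have h1: "norm (X1 + Y1) \<le> (norm X1 + norm Y1) / 1000" and h2: "norm (X2 + Y2) \<le> (norm X2 + norm Y2) / 1000"
    using principal_part_at_zero[OF g \<zeta>(2) z(2)] principal_part_at_zero[OF g \<zeta>(1) z(1)]
    by (simp_all add: principal_part_def amplitude_def defs)
  have t: "norm X1 \<le> norm (X1 + Y1) + norm Y1" "norm Y2 \<le> norm (X2 + Y2) + norm X2"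
    using norm_triangle_ineq4[of "X1 + Y1" Y1] norm_triangle_ineq4[of "X2 + Y2" X2] by simp_all
  have pos: "norm Y1 > 0" "norm X2 > 0" using nz by auto
  have b: "norm (X1 + Y1) \<le> 3 / 1000 * norm Y1" "norm (X2 + Y2) \<le> 3 / 1000 * norm X2" "norm Y2 \<le> 2 * norm X2"
    using h1 h2 t pos unfolding add_divide_distrib by linarith+
  define E where "E = exp (2 * \<i> * (\<xi> - \<zeta>))"
  have "X2 * Y1 * E = X1 * Y2 * (exp (\<i> * \<zeta>) * exp (- \<i> * \<zeta>)) * (exp (- \<i> * \<xi>) * exp (\<i> * \<xi>)) "
  proof -
    have "exp (\<i> * \<zeta>) * exp (- \<i> * \<xi>) * E = exp (\<i> * \<xi>) * exp (- \<i> * \<zeta>)"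
      unfolding E_def exp_add[symmetric] by (simp add: algebra_simps)
    then have "X2 * Y1 * E = coefA g * coefB g * (exp (\<i> * \<xi>) * exp (- \<i> * \<zeta>))"
      by (simp add: defs mult_ac)
    then show ?thesis by (simp add: defs exp_add[symmetric] mult_ac)
  qed
  then have XE: "X2 * Y1 * E = X1 * Y2" by (simp add: exp_add[symmetric])
  have "X2 * Y1 * (E - 1) = (X1 + Y1) * Y2 - (X2 + Y2) * Y1"
    unfolding right_diff_distrib XE by (simp add: algebra_simps)
  then have "norm X2 * norm Y1 * norm (E - 1) = norm ((X1 + Y1) * Y2 - (X2 + Y2) * Y1)"
    by (metis norm_mult)
  also have "\<dots> \<le> norm (X1 + Y1) * norm Y2 + norm (X2 + Y2) * norm Y1"
    unfolding norm_mult[symmetric] by (rule norm_triangle_ineq4)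
  also have "\<dots> \<le> (3 / 1000 * norm Y1) * (2 * norm X2) + (3 / 1000 * norm X2) * norm Y1"
    using b by (intro add_mono mult_mono) auto
  also have "\<dots> = norm X2 * norm Y1 * (9 / 1000)" by simp
  finally have E1: "norm (E - 1) \<le> 9 / 1000" using pos by (simp add: mult_le_cancel_left)
  have L: "norm (Ln E) \<le> 2 * norm (E - 1)" using norm_Ln_le[of "E - 1"] E1 by simp
  have "exp (2 * \<i> * (\<xi> - \<zeta>)) = exp (Ln E)" by (simp add: E_def)
  then obtain n :: int where n: "2 * \<i> * (\<xi> - \<zeta>) = Ln E + of_real (of_int (2 * n) * pi) * \<i>"
    unfolding exp_eq by blast
  define y where "y = of_int (2 * n) * pi"
  define a where "a = Re \<xi> - Re \<zeta>"
  have "2 * a = Im (Ln E) + y" using arg_cong[OF n, of Im] by (simp add: y_def a_def)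
  moreover have "\<bar>a\<bar> < 1" using re by (simp add: a_def)
  moreover have "\<bar>Im (Ln E)\<bar> \<le> 18 / 1000" using abs_Im_le_cmod[of "Ln E"] L E1 by linarith
  ultimately have "\<bar>y\<bar> < 3" by linarith
  moreover have "\<bar>y\<bar> = \<bar>real_of_int (2 * n)\<bar> * pi" unfolding y_def abs_mult by simp
  ultimately have "\<bar>real_of_int (2 * n)\<bar> * pi < 1 * pi" using pi_gt3 by linarith
  then have "\<bar>real_of_int (2 * n)\<bar> < 1" using pi_gt_zero mult_less_cancel_right_pos by blast
  then have "n = 0" by linarith
  then have "2 * \<i> * (\<xi> - \<zeta>) = Ln E" using n by simp
  then have "norm (2 * \<i> * (\<xi> - \<zeta>)) = norm (Ln E)" by simp
  then have "2 * norm (\<xi> - \<zeta>) = norm (Ln E)" by (simp add: norm_mult)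
  then show ?thesis using L E1 by linarith
qed

text \<open>The margin 2 leaves room for a shift by a vector of length at most 1 and an error of
  half its length.\<close>

lemma deep_cball:
  assumes "Re (\<nu> * s) > K + 2"
  shows "s \<in> H" "cball (\<Phi> s) 1 \<subseteq> D" "\<And>u. norm u \<le> 1 \<Longrightarrow> norm (\<Psi> (\<Phi> s + u) - (s + u)) \<le> norm u / 2"
proof -
  show s: "s \<in> H" using assms by (simp add: H_def)
  have sub: "cball (s + u) (norm u / 2) \<subseteq> H" if u: "norm u \<le> 1" for u
  proof
    fix x assume x: "x \<in> cball (s + u) (norm u / 2)"
    have "norm (x - s) \<le> norm (x - (s + u)) + norm u" using norm_triangle_ineq[of "x - (s + u)" u] by simp
    then have "norm (x - s) \<le> 2" using x u by (simp add: dist_norm norm_minus_commute)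
    then have "Re (\<nu> * x) \<ge> Re (\<nu> * s) - 2" by (intro Re_\<nu>_cball) (simp add: dist_norm norm_minus_commute)
    then show "x \<in> H" using assms by (simp add: H_def)
  qed
  show "norm (\<Psi> (\<Phi> s + u) - (s + u)) \<le> norm u / 2" if "norm u \<le> 1" for u
    by (rule shift_in_D(2)[OF s sub[OF that]])
  show "cball (\<Phi> s) 1 \<subseteq> D"
  proof
    fix x assume "x \<in> cball (\<Phi> s) 1"
    then have "norm (x - \<Phi> s) \<le> 1" by (simp add: dist_norm norm_minus_commute)
    from shift_in_D(1)[OF s sub[OF this]] show "x \<in> D" by simp
  qed
qed

lemma norm_Z1_bound:
  assumes "s \<in> H"
  shows "norm (Z1 (\<Phi> s)) \<le> 2 * norm (W s) / norm s"
proof -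
  have "norm (Z1 (\<Phi> s)) = 2 / M * norm (W s) / norm s / norm (\<phi> s)"
    using M2 by (simp add: Z1_def \<Psi>_\<Phi>[OF assms] zmap'_def norm_mult norm_divide)
  also have "\<dots> \<le> 1 * norm (W s) / norm s / (9 / 10)"
    using \<phi>_bounds(1)[OF assms] M2 by (intro frac_le divide_right_mono mult_right_mono) auto
  also have "\<dots> = 10 / 9 * (norm (W s) / norm s)" by simp
  also have "\<dots> \<le> 2 * (norm (W s) / norm s)" by (intro mult_right_mono) auto
  finally show ?thesis by simp
qed

definition "deep_zeros g = {s. Re (\<nu> * s) > K + 2 \<and> g (zmap j s) = 0}"

text \<open>From l^2 = P Z1 one gets P / g'^2 = Z1 / V^2 at a zero, which is O(|W| / |s|). Division
  by |t|^2, of order |W|^2, leaves |s|^(- 1 - 2 / M). The integer part of Re zeta, of order at most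
  |s|, labels the zeros injectively: two zeros with the same label are close and therefore
  equal.\<close>

lemma deep_zeros_summable:
  assumes g: "solution_on P Q UNIV g" and AB: "coefA g \<noteq> 0" "coefB g \<noteq> 0"
  shows "(\<lambda>t. norm (poly P t / deriv g t ^ 2) / (1 + norm t ^ 2)) summable_on (zmap j ` deep_zeros g)"
proof -
  define T where "T = deep_zeros g"
  have T: "s \<in> H" "\<Phi> s \<in> D" "U g (\<Phi> s) = 0" "cball (\<Phi> s) 1 \<subseteq> D" if "s \<in> T" for s
    using that deep_cball[of s] \<Phi>_in by (auto simp: T_def deep_zeros_def U_def Z_def \<Psi>_\<Phi>)
  define f where "f t = \<lfloor>Re (\<Phi> (inv_into T (zmap j) t))\<rfloor>" for t
  have pre: "inv_into T (zmap j) t \<in> T" "zmap j (inv_into T (zmap j) t) = t" if "t \<in> zmap j ` T" for t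
    using that by (auto intro: inv_into_into f_inv_into_f)
  have inj: "inj_on f (zmap j ` T)"
  proof (rule inj_onI)
    fix t t' assume t: "t \<in> zmap j ` T" "t' \<in> zmap j ` T" "f t = f t'"
    define s s' where "s = inv_into T (zmap j) t" "s' = inv_into T (zmap j) t'"
    have s: "s \<in> T" "zmap j s = t" "s' \<in> T" "zmap j s' = t'" using pre t by (auto simp: s_s'_def)
    have fl: "\<lfloor>Re (\<Phi> s)\<rfloor> = \<lfloor>Re (\<Phi> s')\<rfloor>" using t(3) by (simp add: f_def s_s'_def)
    have "\<bar>Re (\<Phi> s') - Re (\<Phi> s)\<bar> < 1" using fl by linarith
    then have "norm (\<Phi> s' - \<Phi> s) \<le> 1 / 10"
      by (rule zeros_close_or_apart[OF g AB T(2)[OF s(1)] T(2)[OF s(3)] T(3)[OF s(1)] T(3)[OF s(3)]])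
    moreover have "cball (\<Phi> s) (1 / 10) \<subseteq> D" using T(4)[OF s(1)] by (rule order_trans[rotated]) (simp add: cball_subset_cball_iff)
    ultimately have "\<Phi> s' = \<Phi> s" by (intro close_zeros_equal[OF g AB(2) T(3)[OF s(1)] T(3)[OF s(3)]])
    then have "s' = s" using \<Phi>_inj T(1) s by (metis inj_on_eq_iff)
    then show "t = t'" using s by simp
  qed
  define s1 :: complex where "s1 = of_real (2 * K)"
  \<comment> \<open>\<open>C0\<close> and \<open>C2\<close> turn the linear growth of
    \<open>\<Phi>\<close> into 1 + |label| \<le> C2 |s|.\<close>
  define C0 where "C0 = norm (\<Phi> s1) + 11 / 10 * norm s1"
  define C2 where "C2 = 2 + (C0 + 2) / K"
  have C2: "C2 > 0" using K_large by (auto simp: C2_def C0_def intro!: add_pos_nonneg)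
  define p where "p = 1 + 2 / M"
  have p: "p > 1" using M2 by (simp add: p_def)
  define ab where "ab = norm (coefA g) * norm (coefB g)"
  have ab: "ab > 0" using AB by (simp add: ab_def)
  define c where "c = 8 / ab / \<kappa> powr (2 / M) * C2 powr p"
  show ?thesis
    unfolding T_def[symmetric]
  proof (rule summable_on_via_int_injection[OF inj p, where c = c])
    fix t assume t: "t \<in> zmap j ` T"
    define s where "s = inv_into T (zmap j) t"
    have s: "s \<in> T" "zmap j s = t" using pre[OF t] by (auto simp: s_def)
    note Ts = T[OF s(1)]
    have Zt: "Z (\<Phi> s) = t" by (simp add: Z_def \<Psi>_\<Phi>[OF Ts(1)] s)
    have gt: "g t = 0" using s by (auto simp: T_def deep_zeros_def)
    have spos: "norm s > K" "norm s > 0" using H_far[OF Ts(1)] K_large by auto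
    have W: "norm (W s) \<ge> r0" "norm (W s) > 0" using W_far[of s] spos by (auto simp: W_nonzero)
    have "V g (\<Phi> s) ^ 2 = deriv g t ^ 2 * Z1 (\<Phi> s) ^ 2 / l s ^ 2"
      by (simp add: V_def Zt gt \<Psi>_\<Phi>[OF Ts(1)] power_divide power_mult_distrib)
    also have "l s ^ 2 = poly P t * Z1 (\<Phi> s)" using l_\<Psi>_square[OF Ts(2)] by (simp add: Zt \<Psi>_\<Phi>[OF Ts(1)])
    finally have V2: "V g (\<Phi> s) ^ 2 = deriv g t ^ 2 * Z1 (\<Phi> s) / poly P t"
      using Z1_nonzero[OF Ts(2)] by (simp add: power2_eq_square)
    have Vb: "norm (V g (\<Phi> s)) ^ 2 \<ge> ab" unfolding ab_def by (rule V_at_zero[OF g Ts(2,3)])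
    then have V0: "V g (\<Phi> s) \<noteq> 0" using ab by auto
    then have d0: "deriv g t \<noteq> 0" using V2 by auto
    have Pt: "poly P t \<noteq> 0" using Z_far(2)[OF Ts(2)] Zt by simp
    have "poly P t / deriv g t ^ 2 = Z1 (\<Phi> s) / V g (\<Phi> s) ^ 2"
      unfolding V2 using d0 Pt Z1_nonzero[OF Ts(2)] by (simp add: field_simps)
    then have "norm (poly P t / deriv g t ^ 2) = norm (Z1 (\<Phi> s)) / norm (V g (\<Phi> s)) ^ 2" by (simp add: norm_divide norm_power)
    also have "\<dots> \<le> (2 * norm (W s) / norm s) / ab"
      using norm_Z1_bound[OF Ts(1)] Vb ab by (intro frac_le) auto
    finally have c1: "norm (poly P t / deriv g t ^ 2) \<le> (2 * norm (W s) / norm s) / ab" .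
    have "norm (t - d) = norm (W s)" using norm_zmap[of j s] s by simp
    then have "norm (W s) \<le> norm t + norm d" using norm_triangle_ineq4[of t d] by simp
    then have "norm (W s) / 2 \<le> norm t" using r0 W by linarith
    then have "(norm (W s) / 2) ^ 2 \<le> norm t ^ 2" using W by (intro power_mono) auto
    then have t2: "norm (W s) ^ 2 / 4 \<le> 1 + norm t ^ 2" by (simp add: power_divide)
    have "norm (poly P t / deriv g t ^ 2) / (1 + norm t ^ 2) \<le> ((2 * norm (W s) / norm s) / ab) / (norm (W s) ^ 2 / 4)"
      using c1 t2 W spos ab by (intro frac_le) auto
    also have "\<dots> = 8 / ab * (1 / (norm (W s) * norm s))" using W spos by (simp add: field_simps power2_eq_square)
    also have "norm (W s) * norm s = \<kappa> powr (2 / M) * norm s powr p"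
      using norm_W[of s] spos \<kappa>0 by (simp add: powr_mult p_def powr_add)
    finally have w1: "norm (poly P t / deriv g t ^ 2) / (1 + norm t ^ 2) \<le> 8 / ab / \<kappa> powr (2 / M) * (1 / norm s powr p)" by simp
    have "norm (\<Phi> s) \<le> norm (\<Phi> s1) + 11 / 10 * norm (s - s1)"
    proof -
      have "norm ((\<Phi> s - \<Phi> s1) - (s - s1)) \<le> 1 / 10 * norm (s - s1)"
        by (rule \<Phi>_lipschitz[OF Ts(1)]) (simp add: s1_def base_in_H del: of_real_mult)
      moreover have "norm (\<Phi> s) \<le> norm (\<Phi> s1) + (norm ((\<Phi> s - \<Phi> s1) - (s - s1)) + norm (s - s1))"
        using norm_triangle_ineq[of "\<Phi> s1" "\<Phi> s - \<Phi> s1"] norm_triangle_ineq[of "(\<Phi> s - \<Phi> s1) - (s - s1)" "s - s1"] by simp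
      ultimately show ?thesis by linarith
    qed
    also have "\<dots> \<le> C0 + 11 / 10 * norm s" using norm_triangle_ineq4[of s s1] by (simp add: C0_def)
    finally have "norm (\<Phi> s) \<le> C0 + 11 / 10 * norm s" .
    then have "\<bar>Re (\<Phi> s)\<bar> \<le> C0 + 11 / 10 * norm s" using abs_Re_le_cmod order_trans by blast
    then have "1 + \<bar>of_int (f t)\<bar> \<le> C0 + 2 + 2 * norm s" unfolding f_def s_def[symmetric] using norm_ge_zero[of s] by linarith
    also have "C0 + 2 = (C0 + 2) / K * K" using K_large by simp
    also have "(C0 + 2) / K * K + 2 * norm s \<le> C2 * norm s"
    proof -
      have "(C0 + 2) / K * K \<le> (C0 + 2) / K * norm s" using spos K_large by (intro mult_left_mono) (auto simp: C0_def)
      then show ?thesis by (simp add: C2_def distrib_right)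
    qed
    finally have "(1 + \<bar>of_int (f t)\<bar>) powr p \<le> (C2 * norm s) powr p" using p by (intro powr_mono2) auto
    also have "\<dots> = C2 powr p * norm s powr p" using C2 by (simp add: powr_mult)
    finally have "1 / norm s powr p \<le> C2 powr p * (1 + \<bar>of_int (f t)\<bar>) powr (- p)"
      using spos by (simp add: powr_minus field_simps)
    then have "8 / ab / \<kappa> powr (2 / M) * (1 / norm s powr p) \<le> 8 / ab / \<kappa> powr (2 / M) * (C2 powr p * (1 + \<bar>of_int (f t)\<bar>) powr (- p))"
      using ab by (intro mult_left_mono) auto
    then show "norm (poly P t / deriv g t ^ 2) / (1 + norm t ^ 2) \<le> c * (1 + \<bar>real_of_int (f t)\<bar>) powr - p"
      using w1 by (simp add: c_def mult.assoc)
  qed auto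
qed

end

section \<open>Partial fractions\<close>

text \<open>The weight 1 + |t|^2 instead of |t|^2 keeps a zero at the origin harmless. Since 1 +
  |t|^2 is at most 1 + 2 |z|^2 + 2 |z - t|^2, one factor depending on z and \<rho> serves all
  t.\<close>

lemma pole_term_bound:
  fixes c t z :: complex
  assumes "\<rho> > 0" "\<rho> \<le> norm (z - t) ^ 2"
  shows "norm (c / (z - t) ^ 2) \<le> norm c / (1 + norm t ^ 2) * (2 + (1 + 2 * norm z ^ 2) / \<rho>)"
proof -
  define y where "y = norm (z - t)"
  have y: "y ^ 2 > 0" "\<rho> \<le> y ^ 2" using assms by (auto simp: y_def)
  have "norm t \<le> norm z + y" using norm_triangle_ineq4[of z "z - t"] by (simp add: y_def)
  then have "norm t ^ 2 \<le> (norm z + y) ^ 2" by (intro power_mono) auto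
  also have "\<dots> \<le> 2 * norm z ^ 2 + 2 * y ^ 2"
    using sum_squares_bound[of "norm z" y] by (simp add: power2_sum)
  finally have t: "1 + norm t ^ 2 \<le> (1 + 2 * norm z ^ 2) + 2 * y ^ 2" by simp
  have "(1 + norm t ^ 2) / y ^ 2 \<le> ((1 + 2 * norm z ^ 2) + 2 * y ^ 2) / y ^ 2"
    using t y by (intro divide_right_mono) auto
  also have "\<dots> = (1 + 2 * norm z ^ 2) / y ^ 2 + 2" using y by (simp add: add_divide_distrib)
  also have "\<dots> \<le> (1 + 2 * norm z ^ 2) / \<rho> + 2"
    using y assms(1) by (intro add_right_mono divide_left_mono mult_pos_pos) auto
  finally have q: "(1 + norm t ^ 2) / y ^ 2 \<le> 2 + (1 + 2 * norm z ^ 2) / \<rho>" by simp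
  have p: "1 + norm t ^ 2 > 0" by (simp add: add_pos_nonneg)
  have "norm (c / (z - t) ^ 2) = norm c / (1 + norm t ^ 2) * ((1 + norm t ^ 2) / y ^ 2)"
    using p y by (simp add: y_def norm_divide norm_power)
  also have "\<dots> \<le> norm c / (1 + norm t ^ 2) * (2 + (1 + 2 * norm z ^ 2) / \<rho>)"
    using q p by (intro mult_left_mono) auto
  finally show ?thesis .
qed

lemma pole_series_summable:
  fixes c :: "complex \<Rightarrow> complex"
  assumes w: "(\<lambda>t. norm (c t) / (1 + norm t ^ 2)) summable_on A"
    and \<rho>: "\<rho> > 0" "\<And>t. t \<in> A \<Longrightarrow> \<rho> \<le> norm (z - t) ^ 2"
  shows "(\<lambda>t. norm (c t / (z - t) ^ 2)) summable_on A" "(\<lambda>t. c t / (z - t) ^ 2) summable_on A"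
    "norm (\<Sum>\<^sub>\<infinity>t\<in>A. c t / (z - t) ^ 2)
      \<le> (\<Sum>\<^sub>\<infinity>t\<in>A. norm (c t) / (1 + norm t ^ 2)) * (2 + (1 + 2 * norm z ^ 2) / \<rho>)"
proof -
  have b: "norm (c t / (z - t) ^ 2) \<le> norm (c t) / (1 + norm t ^ 2) * (2 + (1 + 2 * norm z ^ 2) / \<rho>)" if "t \<in> A" for t
    by (rule pole_term_bound[OF \<rho>(1) \<rho>(2)[OF that]])
  have s: "(\<lambda>t. norm (c t) / (1 + norm t ^ 2) * (2 + (1 + 2 * norm z ^ 2) / \<rho>)) summable_on A"
    by (rule summable_on_cmult_left[OF w])
  show a: "(\<lambda>t. norm (c t / (z - t) ^ 2)) summable_on A"
    by (rule summable_on_comparison_test[OF s b]) auto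
  then show "(\<lambda>t. c t / (z - t) ^ 2) summable_on A" by (rule abs_summable_summable)
  have "norm (\<Sum>\<^sub>\<infinity>t\<in>A. c t / (z - t) ^ 2) \<le> (\<Sum>\<^sub>\<infinity>t\<in>A. norm (c t / (z - t) ^ 2))"
    by (rule norm_infsum_bound[OF a])
  also have "\<dots> \<le> (\<Sum>\<^sub>\<infinity>t\<in>A. norm (c t) / (1 + norm t ^ 2) * (2 + (1 + 2 * norm z ^ 2) / \<rho>))"
    by (rule infsum_mono[OF a s b])
  also have "\<dots> = (\<Sum>\<^sub>\<infinity>t\<in>A. norm (c t) / (1 + norm t ^ 2)) * (2 + (1 + 2 * norm z ^ 2) / \<rho>)"
    by (rule infsum_cmult_left) (use w in auto)
  finally show "norm (\<Sum>\<^sub>\<infinity>t\<in>A. c t / (z - t) ^ 2)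
      \<le> (\<Sum>\<^sub>\<infinity>t\<in>A. norm (c t) / (1 + norm t ^ 2)) * (2 + (1 + 2 * norm z ^ 2) / \<rho>)" .
qed

lemma pole_series_holomorphic:
  fixes c :: "complex \<Rightarrow> complex"
  assumes w: "(\<lambda>t. norm (c t) / (1 + norm t ^ 2)) summable_on A"
    and r: "r > 0" "\<And>t. t \<in> A \<Longrightarrow> r \<le> dist z0 t"
  shows "(\<lambda>z. \<Sum>\<^sub>\<infinity>t\<in>A. c t / (z - t) ^ 2) holomorphic_on ball z0 (r / 2)"
proof -
  define B where "B = 2 + (1 + 2 * (norm z0 + r) ^ 2) / (r / 2) ^ 2"
  have far: "(r / 2) ^ 2 \<le> norm (z - t) ^ 2" "z \<noteq> t" if "t \<in> A" "z \<in> cball z0 (r / 2)" for z t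
  proof -
    have "dist z0 t \<le> dist z0 z + dist z t" by (rule dist_triangle)
    then have "r / 2 \<le> norm (z - t)" using r(2)[OF that(1)] that(2) by (simp add: dist_norm)
    then show "(r / 2) ^ 2 \<le> norm (z - t) ^ 2" "z \<noteq> t" using r(1) by (auto intro!: power_mono)
  qed
  have ul: "uniform_limit (cball z0 (r / 2)) (\<lambda>X z. \<Sum>t\<in>X. c t / (z - t) ^ 2)
      (\<lambda>z. \<Sum>\<^sub>\<infinity>t\<in>A. c t / (z - t) ^ 2) (finite_subsets_at_top A)"
  proof (rule Weierstrass_m_test_general[where M = "\<lambda>t. norm (c t) / (1 + norm t ^ 2) * B"])
    fix t z assume t: "t \<in> A" and z: "z \<in> cball z0 (r / 2)"
    have "norm (c t / (z - t) ^ 2) \<le> norm (c t) / (1 + norm t ^ 2) * (2 + (1 + 2 * norm z ^ 2) / (r / 2) ^ 2)"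
      using r(1) far(1)[OF t z] by (intro pole_term_bound) auto
    also have "\<dots> \<le> norm (c t) / (1 + norm t ^ 2) * B"
    proof -
      have "norm z \<le> norm z0 + r"
        using z r(1) norm_triangle_ineq2[of z z0] by (simp add: dist_norm norm_minus_commute)
      then have "norm z ^ 2 \<le> (norm z0 + r) ^ 2" by (intro power_mono) auto
      then show ?thesis unfolding B_def
        by (intro mult_left_mono add_left_mono divide_right_mono) auto
    qed
    finally show "norm (c t / (z - t) ^ 2) \<le> norm (c t) / (1 + norm t ^ 2) * B" .
  qed (rule summable_on_cmult_left[OF w])
  have ev: "\<forall>\<^sub>F X in finite_subsets_at_top A. continuous_on (cball z0 (r / 2)) (\<lambda>z. \<Sum>t\<in>X. c t / (z - t) ^ 2)
      \<and> (\<lambda>z. \<Sum>t\<in>X. c t / (z - t) ^ 2) holomorphic_on ball z0 (r / 2)"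
  proof (rule eventually_finite_subsets_at_top_weakI)
    fix X assume X: "finite X" "X \<subseteq> A"
    have h: "(\<lambda>z. \<Sum>t\<in>X. c t / (z - t) ^ 2) holomorphic_on cball z0 (r / 2)"
    proof (intro holomorphic_intros)
      fix t z assume "t \<in> X" "z \<in> cball z0 (r / 2)"
      then show "(z - t) ^ 2 \<noteq> 0" using far(2)[of t z] X(2) by auto
    qed
    then show "continuous_on (cball z0 (r / 2)) (\<lambda>z. \<Sum>t\<in>X. c t / (z - t) ^ 2)
      \<and> (\<lambda>z. \<Sum>t\<in>X. c t / (z - t) ^ 2) holomorphic_on ball z0 (r / 2)"
      using holomorphic_on_imp_continuous_on holomorphic_on_subset[OF h ball_subset_cball] by blast
  qed
  show ?thesis
    by (rule holomorphic_uniform_limit[OF ev ul finite_subsets_at_top_neq_bot])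
qed

text \<open>The condition on the second derivative makes the residue at the double pole vanish.\<close>

lemma double_pole_removable:
  assumes g: "g holomorphic_on UNIV" "g t = 0" "deriv g t \<noteq> 0" and P: "poly P t \<noteq> 0"
    and g2: "deriv (deriv g) t = poly (pderiv P) t / poly P t * deriv g t"
  shows "\<exists>L. ((\<lambda>z. poly P z / g z ^ 2 - (poly P t / deriv g t ^ 2) / (z - t) ^ 2) \<longlongrightarrow> L) (at t)"
proof -
  \<comment> \<open>The quotient g / (z - t) with its value at t filled in; then g''(t) = 2
    k'(t).\<close>
  define k where "k z = (if z = t then deriv g t else (g z - g t) / (z - t))" for z
  have k: "k holomorphic_on UNIV" unfolding k_def[abs_def] by (rule pole_lemma[OF g(1)]) simp
  have gk: "g z = (z - t) * k z" for z using g(2) by (simp add: k_def)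
  have kt: "k t = deriv g t" by (simp add: k_def)
  have dk: "(k has_field_derivative deriv k z) (at z)" for z
    by (rule holomorphic_derivI[OF k open_UNIV UNIV_I])
  have dk2: "(deriv k has_field_derivative deriv (deriv k) z) (at z)" for z
    by (rule holomorphic_derivI[OF holomorphic_deriv[OF k open_UNIV] open_UNIV UNIV_I])
  have "((\<lambda>z. (z - t) * k z) has_field_derivative k z + (z - t) * deriv k z) (at z)" for z
    by (auto intro!: derivative_eq_intros dk)
  moreover have "g = (\<lambda>z. (z - t) * k z)" using gk by auto
  ultimately have "deriv g = (\<lambda>z. k z + (z - t) * deriv k z)"
    by (metis DERIV_imp_deriv)
  moreover have "((\<lambda>z. k z + (z - t) * deriv k z) has_field_derivative 2 * deriv k t) (at t)"
    by (auto intro!: derivative_eq_intros dk dk2)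
  ultimately have "deriv (deriv g) t = 2 * deriv k t" by (metis DERIV_imp_deriv)
  then have dkt: "2 * deriv k t = poly (pderiv P) t / poly P t * k t" using g2 kt by simp
  have "continuous_on UNIV k" by (rule holomorphic_on_imp_continuous_on[OF k])
  then have "open {z. k z \<noteq> 0}" by (intro open_Collect_neq continuous_intros)
  moreover have "t \<in> {z. k z \<noteq> 0}" using kt g(3) by simp
  ultimately obtain r where r: "r > 0" "ball t r \<subseteq> {z. k z \<noteq> 0}" using open_contains_ball by blast
  define f where "f z = poly P z / k z ^ 2" for z
  have f: "f holomorphic_on ball t r"
    unfolding f_def using r(2) by (intro holomorphic_intros holomorphic_on_subset[OF k]) auto
  have "(f has_field_derivative 0) (at t)"
  proof -
    have "k t \<noteq> 0" using kt g(3) by simp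
    have "(f has_field_derivative (poly (pderiv P) t * k t ^ 2 - poly P t * (2 * k t * deriv k t)) / (k t ^ 2 * k t ^ 2)) (at t)"
      unfolding f_def by (rule derivative_eq_intros refl dk poly_DERIV)+ (use \<open>k t \<noteq> 0\<close> in simp_all)
    moreover have "poly (pderiv P) t * k t ^ 2 - poly P t * (2 * k t * deriv k t)
        = k t * (poly (pderiv P) t * k t - poly P t * (2 * deriv k t))"
      by (simp add: power2_eq_square algebra_simps)
    ultimately show ?thesis using dkt P by simp
  qed
  then have df: "deriv f t = 0" by (rule DERIV_imp_deriv)
  have int: "t \<in> interior (ball t r)" using r(1) by simp
  \<comment> \<open>Since f has derivative 0 at t, two difference quotients in a row give (f - f(t))
    / (z - t)^2 with its removable value.\<close>
  define f1 where "f1 z = (if z = t then deriv f t else (f z - f t) / (z - t))" for z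
  have f1: "f1 holomorphic_on ball t r" unfolding f1_def[abs_def] by (rule pole_lemma[OF f int])
  define f2 where "f2 z = (if z = t then deriv f1 t else (f1 z - f1 t) / (z - t))" for z
  have f2: "f2 holomorphic_on ball t r" unfolding f2_def[abs_def] by (rule pole_lemma[OF f1 int])
  have "isCont f2 t" using f2 r(1)
    by (metis centre_in_ball continuous_on_eq_continuous_at holomorphic_on_imp_continuous_on open_ball)
  then have "(f2 \<longlongrightarrow> f2 t) (at t)" by (simp add: isCont_def)
  moreover have "\<forall>\<^sub>F z in at t. f2 z = poly P z / g z ^ 2 - (poly P t / deriv g t ^ 2) / (z - t) ^ 2"
  proof -
    have "\<forall>\<^sub>F z in at t. z \<in> ball t r - {t}" using r(1) by (intro eventually_at_in_open) auto
    then show ?thesis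
    proof (rule eventually_mono)
      fix z assume z: "z \<in> ball t r - {t}"
      then have kz: "k z \<noteq> 0" "z - t \<noteq> 0" using r(2) by auto
      have "f2 z = (f z - f t) / (z - t) ^ 2"
        using z df by (simp add: f2_def f1_def power2_eq_square)
      also have "\<dots> = poly P z / ((z - t) * k z) ^ 2 - poly P t / k t ^ 2 / (z - t) ^ 2"
        using kz by (simp add: f_def diff_divide_distrib power_mult_distrib)
      finally show "f2 z = poly P z / g z ^ 2 - (poly P t / deriv g t ^ 2) / (z - t) ^ 2"
        by (simp add: gk[of z] kt)
    qed
  qed
  ultimately have "((\<lambda>z. poly P z / g z ^ 2 - (poly P t / deriv g t ^ 2) / (z - t) ^ 2) \<longlongrightarrow> f2 t) (at t)"
    by (rule Lim_transform_eventually)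
  then show ?thesis by blast
qed

section \<open>Polynomial bound for the remainder in one half plane\<close>

context stokes_region
begin

text \<open>The logarithmic derivative of \<open>Z1\<close> is Z1 (P' / P - Q' / Q) / 2, bounded by
  C / |s| \<le> C / K \<le> 1 / 60000; here the size of \<open>K\<close> enters again.\<close>

lemma Z1_derivative:
  assumes g: "solution_on P Q UNIV g" and \<zeta>: "\<zeta> \<in> D"
  obtains Z2 where "(Z1 has_field_derivative Z2) (at \<zeta>)" "norm Z2 \<le> norm (Z1 \<zeta>) / 60000"
proof -
  define s where "s = \<Psi> \<zeta>"
  have s: "s \<in> H" "\<Phi> s = \<zeta>" using \<zeta> \<Psi>_in \<Phi>_\<Psi> by (auto simp: s_def)
  have spos: "norm s > K" using H_far[OF s(1)] by simp
  have Zs: "norm (Z \<zeta> - d) = norm (W s)" by (simp add: Z_def norm_zmap s_def)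
  have Wpos: "norm (W s) > 0" by (simp add: W_nonzero)
  define \<mu> where "\<mu> = log_deriv P (Z \<zeta>) - log_deriv Q (Z \<zeta>)"
  have \<mu>: "norm \<mu> \<le> C / norm (W s)" unfolding \<mu>_def using far_log[OF Z_far(1)[OF \<zeta>]] Zs by simp
  have "norm (Z1 \<zeta>) \<le> 2 * norm (W s) / norm s" using norm_Z1_bound[OF s(1)] s(2) by simp
  then have "norm (Z1 \<zeta>) * norm \<mu> \<le> (2 * norm (W s) / norm s) * (C / norm (W s))"
    using \<mu> by (intro mult_mono) auto
  also have "\<dots> = 2 * C / norm s" using Wpos by simp
  also have "\<dots> \<le> 2 * C / K" using spos K_large C by (intro divide_left_mono mult_pos_pos) auto
  also have "\<dots> \<le> 2 * (1 / 60000)" using K_large C by (simp add: field_simps)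
  finally have e: "norm (Z1 \<zeta>) * norm \<mu> \<le> 2 * (1 / 60000)" .
  have "norm (Z1 \<zeta> ^ 2 * \<mu> / 2) = norm (Z1 \<zeta>) * (norm (Z1 \<zeta>) * norm \<mu>) / 2"
    by (simp add: norm_divide norm_mult norm_power power2_eq_square)
  also have "\<dots> \<le> norm (Z1 \<zeta>) * (2 * (1 / 60000)) / 2"
    using e by (intro divide_right_mono mult_left_mono) auto
  finally have "norm (Z1 \<zeta> ^ 2 * \<mu> / 2) \<le> norm (Z1 \<zeta>) / 60000" by simp
  moreover have "(Z1 has_field_derivative Z1 \<zeta> ^ 2 * \<mu> / 2) (at \<zeta>)"
  proof -
    have "(Z1 has_field_derivative Z1 \<zeta> ^ 2 * (log_deriv P (Z \<zeta>) - log_deriv Q (Z \<zeta>)) / 2) (at \<zeta>)"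
      using liouville(1) g \<zeta> by blast
    then show ?thesis by (simp add: \<mu>_def)
  qed
  ultimately show ?thesis by (rule that[rotated])
qed

lemma Z1_nearly_constant:
  assumes g: "solution_on P Q UNIV g" and ball: "cball \<zeta> 1 \<subseteq> D" and \<xi>: "\<xi> \<in> cball \<zeta> 1"
  shows "norm (Z1 \<xi> / Z1 \<zeta> - 1) \<le> 1 / 10"
proof -
  have \<zeta>: "\<zeta> \<in> D" using ball by auto
  have "\<exists>Z2. (Z1 has_field_derivative Z2) (at y) \<and> norm Z2 \<le> norm (Z1 y) / 60000" if "y \<in> D" for y
    using Z1_derivative[OF g that] by blast
  then obtain Z2 where Z2: "\<And>y. y \<in> D \<Longrightarrow> (Z1 has_field_derivative Z2 y) (at y)"
    "\<And>y. y \<in> D \<Longrightarrow> norm (Z2 y) \<le> norm (Z1 y) / 60000" by metis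
  have "continuous_on (cball \<zeta> 1) (\<lambda>y. norm (Z1 y))"
    using ball Z2(1) by (intro continuous_intros continuous_at_imp_continuous_on ballI) (blast intro: DERIV_isCont)
  \<comment> \<open>The maximum of |Z1| on the disc bounds its oscillation there and is in turn at
    most twice the value at the centre.\<close>
  then obtain x where x: "x \<in> cball \<zeta> 1" "\<And>y. y \<in> cball \<zeta> 1 \<Longrightarrow> norm (Z1 y) \<le> norm (Z1 x)"
    using continuous_attains_sup[OF compact_cball, of \<zeta> 1 "\<lambda>y. norm (Z1 y)"] by auto
  have lip: "norm (Z1 y - Z1 \<zeta>) \<le> norm (Z1 x) / 60000" if y: "y \<in> cball \<zeta> 1" for y
  proof -
    have "norm (Z1 y - Z1 \<zeta>) \<le> norm (Z1 x) / 60000 * norm (y - \<zeta>)"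
    proof (rule field_differentiable_bound[where S = "cball \<zeta> 1" and f' = Z2])
      fix u assume u: "u \<in> cball \<zeta> 1"
      then have uD: "u \<in> D" using ball by blast
      show "(Z1 has_field_derivative Z2 u) (at u within cball \<zeta> 1)" by (rule has_field_derivative_at_within[OF Z2(1)[OF uD]])
      show "norm (Z2 u) \<le> norm (Z1 x) / 60000" using Z2(2)[OF uD] x(2)[OF u] by linarith
    qed (use y in auto)
    also have "\<dots> \<le> norm (Z1 x) / 60000 * 1"
      using y by (intro mult_left_mono) (auto simp: dist_norm norm_minus_commute)
    finally show ?thesis by simp
  qed
  have "norm (Z1 x) \<le> norm (Z1 \<zeta>) + norm (Z1 x - Z1 \<zeta>)" using norm_triangle_ineq[of "Z1 \<zeta>" "Z1 x - Z1 \<zeta>"] by simp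
  then have "norm (Z1 x) \<le> 2 * norm (Z1 \<zeta>)" using lip[OF x(1)] norm_ge_zero[of "Z1 x"] by linarith
  then have n: "norm (Z1 \<xi> - Z1 \<zeta>) \<le> 1 / 10 * norm (Z1 \<zeta>)" using lip[OF \<xi>] norm_ge_zero[of "Z1 \<zeta>"] by linarith
  have "Z1 \<xi> / Z1 \<zeta> - 1 = (Z1 \<xi> - Z1 \<zeta>) / Z1 \<zeta>" using Z1_nonzero[OF \<zeta>] by (simp add: diff_divide_distrib)
  then have "norm (Z1 \<xi> / Z1 \<zeta> - 1) = norm (Z1 \<xi> - Z1 \<zeta>) / norm (Z1 \<zeta>)" by (simp only: norm_divide)
  also have "\<dots> \<le> 1 / 10" using n Z1_nonzero[OF \<zeta>] by (simp add: pos_divide_le_eq)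
  finally show ?thesis .
qed

text \<open>The shift lemma applied to Z / Z1(\<zeta>), whose derivative is close to 1 on the unit
  disc: a displacement of relative size 1/400 is reached within 3/2 of that size, which is below
  1/200.\<close>

lemma Z_surj_near:
  assumes g: "solution_on P Q UNIV g" and ball: "cball \<zeta> 1 \<subseteq> D" and z: "norm (z - Z \<zeta>) \<le> norm (Z1 \<zeta>) / 400"
  obtains \<xi> where "\<xi> \<in> D" "norm (\<xi> - \<zeta>) \<le> 1 / 200" "Z \<xi> = z"
proof -
  have \<zeta>: "\<zeta> \<in> D" using ball by auto
  have nz: "Z1 \<zeta> \<noteq> 0" by (rule Z1_nonzero[OF \<zeta>])
  define w where "w = (z - Z \<zeta>) / Z1 \<zeta>"
  have w: "norm w \<le> 1 / 400" using z nz by (simp add: w_def norm_divide field_simps)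
  have sub: "cball (\<zeta> + w) (norm w / 2) \<subseteq> ball \<zeta> 1"
  proof
    fix x assume "x \<in> cball (\<zeta> + w) (norm w / 2)"
    then have "norm (x - (\<zeta> + w)) \<le> norm w / 2" by (simp add: dist_norm norm_minus_commute)
    moreover have "norm (x - \<zeta>) \<le> norm (x - (\<zeta> + w)) + norm w" using norm_triangle_ineq[of "x - (\<zeta> + w)" w] by simp
    ultimately have "norm (x - \<zeta>) < 1" using w by linarith
    then show "x \<in> ball \<zeta> 1" by (simp add: dist_norm norm_minus_commute)
  qed
  have "\<And>y. y \<in> ball \<zeta> 1 \<Longrightarrow> ((\<lambda>y. Z y / Z1 \<zeta>) has_field_derivative Z1 y / Z1 \<zeta>) (at y)"
    using ball by (intro DERIV_cdivide Z_derivative) auto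
  moreover have "\<And>y. y \<in> ball \<zeta> 1 \<Longrightarrow> norm (Z1 y / Z1 \<zeta> - 1) \<le> 1 / 10"
    by (intro Z1_nearly_constant[OF g ball]) auto
  ultimately obtain \<xi> where \<xi>: "\<xi> \<in> cball (\<zeta> + w) (norm w / 2)" "Z \<xi> / Z1 \<zeta> = Z \<zeta> / Z1 \<zeta> + w"
    using near_identity_shift[OF convex_ball open_ball _ _ _ sub, of "\<lambda>y. Z y / Z1 \<zeta>" "\<lambda>y. Z1 y / Z1 \<zeta>"] by auto
  show ?thesis
  proof (rule that)
    show "\<xi> \<in> D" using \<xi>(1) sub ball ball_subset_cball by blast
    have "norm (\<xi> - \<zeta>) \<le> norm (\<xi> - (\<zeta> + w)) + norm w" using norm_triangle_ineq[of "\<xi> - (\<zeta> + w)" w] by simp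
    moreover have "norm (\<xi> - (\<zeta> + w)) \<le> norm w / 2" using \<xi>(1) by (simp add: dist_norm norm_minus_commute)
    ultimately show "norm (\<xi> - \<zeta>) \<le> 1 / 200" using w by linarith
    have "Z \<zeta> / Z1 \<zeta> + w = z / Z1 \<zeta>" by (simp add: w_def diff_divide_distrib)
    then show "Z \<xi> = z" using \<xi>(2) nz by simp
  qed
qed

text \<open>By l^2 = P Z1 the quotient P / g^2 equals 1 / (U^2 Z1), and at a good point |U|^2 is
  bounded below by a multiple of |A B|.\<close>

lemma good_value_bound:
  assumes g: "solution_on P Q UNIV g" and AB: "coefA g \<noteq> 0" "coefB g \<noteq> 0" and \<zeta>: "\<zeta> \<in> D"
    and good: "norm (principal_part g \<zeta>) \<ge> amplitude g \<zeta> / 100"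
  shows "g (Z \<zeta>) \<noteq> 0"
    "norm (poly P (Z \<zeta>) / g (Z \<zeta>) ^ 2)
      \<le> 10000 / (norm (coefA g) * norm (coefB g)) * (1 + 2 * norm b) * norm (Z \<zeta> - d) ^ N"
proof -
  define ab where "ab = norm (coefA g) * norm (coefB g)"
  have ab: "ab > 0" using AB by (simp add: ab_def)
  have amp: "amplitude g \<zeta> > 0" by (rule amplitude_pos[OF AB(1)])
  have "norm (principal_part g \<zeta>) \<le> norm (U g \<zeta>) + norm (U g \<zeta> - principal_part g \<zeta>)"
    using norm_triangle_ineq4[of "U g \<zeta>" "U g \<zeta> - principal_part g \<zeta>"] by simp
  then have U: "norm (U g \<zeta>) \<ge> amplitude g \<zeta> / 200"
    using U_near_principal[OF g \<zeta>] good amp by linarith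
  then have U0: "U g \<zeta> \<noteq> 0" using amp by auto
  have "(amplitude g \<zeta> / 200) ^ 2 \<le> norm (U g \<zeta>) ^ 2" using U amp by (intro power_mono) auto
  then have U2: "ab / 10000 \<le> norm (U g \<zeta>) ^ 2"
    using amplitude_square[of g \<zeta>] by (simp add: ab_def power_divide)
  have gU: "g (Z \<zeta>) = U g \<zeta> * l (\<Psi> \<zeta>)" using l_\<Psi>_nonzero[OF \<zeta>] by (simp add: U_def)
  then show "g (Z \<zeta>) \<noteq> 0" using U0 l_\<Psi>_nonzero[OF \<zeta>] by simp
  note far = Z_far[OF \<zeta>]
  have x: "norm (Z \<zeta> - d) ^ N \<ge> 1" using far(1) r0(1) by (intro one_le_power) linarith
  have Q: "norm (1 / Z1 \<zeta>) ^ 2 \<le> 2 * norm b * norm (Z \<zeta> - d) ^ N"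
  proof -
    have "(1 / Z1 \<zeta>) ^ 2 = poly Q (Z \<zeta>) / poly P (Z \<zeta>)" using Z1_square[OF \<zeta>] by (simp add: power_divide)
    then show ?thesis using norm_P_div_Q(2)[OF far(1)] by (metis norm_power)
  qed
  \<comment> \<open>Replaces the square root of Q / P by a polynomial bound, through a \<le> 1 +
    a^2.\<close>
  have "norm (1 / Z1 \<zeta>) \<le> 1 + norm (1 / Z1 \<zeta>) ^ 2"
  proof -
    have "a \<le> 1 + a ^ 2" if "a \<ge> 0" for a :: real using sum_squares_bound[of a 1] that by simp
    then show ?thesis by simp
  qed
  also have "\<dots> \<le> (1 + 2 * norm b) * norm (Z \<zeta> - d) ^ N" using Q x by (simp add: distrib_right)
  finally have Zi: "norm (1 / Z1 \<zeta>) \<le> (1 + 2 * norm b) * norm (Z \<zeta> - d) ^ N" .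
  have "poly P (Z \<zeta>) / g (Z \<zeta>) ^ 2 = 1 / U g \<zeta> ^ 2 * (1 / Z1 \<zeta>)"
    unfolding gU power_mult_distrib l_\<Psi>_square[OF \<zeta>] using far(2) by simp
  then have "norm (poly P (Z \<zeta>) / g (Z \<zeta>) ^ 2) = 1 / norm (U g \<zeta>) ^ 2 * norm (1 / Z1 \<zeta>)"
    by (simp add: norm_mult norm_divide norm_power)
  also have "\<dots> \<le> 1 / (ab / 10000) * ((1 + 2 * norm b) * norm (Z \<zeta> - d) ^ N)"
    using U2 ab Zi by (intro mult_mono divide_left_mono mult_pos_pos) auto
  also have "\<dots> = 10000 / ab * (1 + 2 * norm b) * norm (Z \<zeta> - d) ^ N" by simp
  finally show "norm (poly P (Z \<zeta>) / g (Z \<zeta>) ^ 2)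
      \<le> 10000 / (norm (coefA g) * norm (coefB g)) * (1 + 2 * norm b) * norm (Z \<zeta> - d) ^ N"
    unfolding ab_def .
qed

text \<open>A closer zero would have a preimage within 1/200 of the good point, where zeros are
  excluded. The constant 320000 is twice the square of 400.\<close>

lemma good_distance:
  assumes g: "solution_on P Q UNIV g" and A: "coefA g \<noteq> 0" and ball: "cball \<zeta> 1 \<subseteq> D"
    and good: "norm (principal_part g \<zeta>) \<ge> amplitude g \<zeta> / 100" and t: "g t = 0"
  shows "1 / (320000 * norm b * norm (Z \<zeta> - d) ^ N) \<le> norm (Z \<zeta> - t) ^ 2"
proof -
  have \<zeta>: "\<zeta> \<in> D" using ball by auto
  have "\<not> norm (t - Z \<zeta>) \<le> norm (Z1 \<zeta>) / 400"
  proof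
    assume "norm (t - Z \<zeta>) \<le> norm (Z1 \<zeta>) / 400"
    from Z_surj_near[OF g ball this] obtain \<xi> where \<xi>: "\<xi> \<in> D" "norm (\<xi> - \<zeta>) \<le> 1 / 200" "Z \<xi> = t" by blast
    then have "U g \<xi> = 0" using t by (simp add: U_def)
    then show False using no_zero_near_good[OF g A good \<xi>(1,2)] by simp
  qed
  then have "norm (Z1 \<zeta>) / 400 \<le> norm (Z \<zeta> - t)" by (simp add: norm_minus_commute)
  then have "(norm (Z1 \<zeta>) / 400) ^ 2 \<le> norm (Z \<zeta> - t) ^ 2" by (intro power_mono) auto
  then have 1: "norm (Z1 \<zeta>) ^ 2 / 160000 \<le> norm (Z \<zeta> - t) ^ 2" by (simp add: power_divide)
  have "norm (Z1 \<zeta>) ^ 2 = norm (poly P (Z \<zeta>) / poly Q (Z \<zeta>))" by (metis Z1_square[OF \<zeta>] norm_power)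
  then have "1 / (2 * norm b * norm (Z \<zeta> - d) ^ N) / 160000 \<le> norm (Z1 \<zeta>) ^ 2 / 160000"
    using norm_P_div_Q(3)[OF Z_far(1)[OF \<zeta>]] by (intro divide_right_mono) auto
  then show ?thesis using 1 by simp
qed

text \<open>At good points both P / g^2 and the series are polynomially bounded. At a bad point a
  pole may be near, but the remainder is entire, and the maximum principle on the disc of radius
  1/10 carries over the bound from its circle, all of whose points are good. The exponent N + 2
  comes from |z|^2 in the weights and from the power N in the reciprocal squared distance to the
  zeros.\<close>

lemma remainder_bound:
  assumes g: "solution_on P Q UNIV g" and AB: "coefA g \<noteq> 0" "coefB g \<noteq> 0"
    and w: "(\<lambda>t. norm (c t) / (1 + norm t ^ 2)) summable_on {t. g t = 0}"
    and R: "R holomorphic_on UNIV"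
    and eq: "\<And>z. g z \<noteq> 0 \<Longrightarrow> R z = poly P z / g z ^ 2 - (\<Sum>\<^sub>\<infinity>t\<in>{t. g t = 0}. c t / (z - t) ^ 2)"
  obtains B where "B \<ge> 0" "\<And>s. Re (\<nu> * s) > K + 4 \<Longrightarrow> norm (R (zmap j s)) \<le> B * norm (zmap j s - d) ^ (N + 2)"
proof -
  define S where "S = (\<Sum>\<^sub>\<infinity>t\<in>{t. g t = 0}. norm (c t) / (1 + norm t ^ 2))"
  have S0: "S \<ge> 0" unfolding S_def by (intro infsum_nonneg) auto
  define C1 where "C1 = 10000 / (norm (coefA g) * norm (coefB g)) * (1 + 2 * norm b)"
  define C2 where "C2 = S * (2 + 11 / 2 * (320000 * norm b))"
  have C1: "C1 \<ge> 0" by (simp add: C1_def)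
  have C2: "C2 \<ge> 0" using S0 by (simp add: C2_def)
  have goodR: "norm (R (Z \<zeta>)) \<le> (C1 + C2) * norm (Z \<zeta> - d) ^ (N + 2)"
    if ball: "cball \<zeta> 1 \<subseteq> D" and good: "norm (principal_part g \<zeta>) \<ge> amplitude g \<zeta> / 100" for \<zeta>
  proof -
    have \<zeta>: "\<zeta> \<in> D" using ball by auto
    note gv = good_value_bound[OF g AB \<zeta> good]
    define x where "x = norm (Z \<zeta> - d)"
    have far: "x \<ge> r0" unfolding x_def by (rule Z_far(1)[OF \<zeta>])
    have x1: "x \<ge> 1" using far r0(1) by linarith
    define \<rho> where "\<rho> = 1 / (320000 * norm b * x ^ N)"
    have b': "norm b > 0" using b0 by simp
    have \<rho>: "\<rho> > 0" using b' x1 by (simp add: \<rho>_def)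
    have d: "\<rho> \<le> norm (Z \<zeta> - t) ^ 2" if "t \<in> {t. g t = 0}" for t
      unfolding \<rho>_def x_def using that by (intro good_distance[OF g AB(1) ball good]) auto
    have "norm (Z \<zeta>) \<le> x + norm d" unfolding x_def using norm_triangle_ineq[of "Z \<zeta> - d" d] by simp
    then have "norm (Z \<zeta>) \<le> 3 / 2 * x" using far r0(2) by linarith
    then have "norm (Z \<zeta>) ^ 2 \<le> (3 / 2 * x) ^ 2" by (intro power_mono) auto
    then have "1 + 2 * norm (Z \<zeta>) ^ 2 \<le> 1 + 9 / 2 * x ^ 2" by (simp add: power_mult_distrib power_divide)
    also have "\<dots> \<le> 11 / 2 * x ^ 2" using x1 by (simp add: one_le_power)
    finally have z2: "1 + 2 * norm (Z \<zeta>) ^ 2 \<le> 11 / 2 * x ^ 2" .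
    have "(1 + 2 * norm (Z \<zeta>) ^ 2) / \<rho> \<le> 11 / 2 * x ^ 2 / \<rho>" using z2 \<rho> by (intro divide_right_mono) auto
    also have "\<dots> = 11 / 2 * (320000 * norm b) * x ^ (N + 2)" by (simp add: \<rho>_def power_add power2_eq_square)
    finally have "2 + (1 + 2 * norm (Z \<zeta>) ^ 2) / \<rho> \<le> 2 * x ^ (N + 2) + 11 / 2 * (320000 * norm b) * x ^ (N + 2)"
      using one_le_power[OF x1, of "N + 2"] by linarith
    then have m: "2 + (1 + 2 * norm (Z \<zeta>) ^ 2) / \<rho> \<le> (2 + 11 / 2 * (320000 * norm b)) * x ^ (N + 2)"
      by (simp only: distrib_right)
    have "norm (\<Sum>\<^sub>\<infinity>t\<in>{t. g t = 0}. c t / (Z \<zeta> - t) ^ 2) \<le> S * (2 + (1 + 2 * norm (Z \<zeta>) ^ 2) / \<rho>)"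
      unfolding S_def by (rule pole_series_summable(3)[OF w \<rho> d])
    also have "\<dots> \<le> S * ((2 + 11 / 2 * (320000 * norm b)) * x ^ (N + 2))" using m S0 by (intro mult_left_mono) auto
    finally have s: "norm (\<Sum>\<^sub>\<infinity>t\<in>{t. g t = 0}. c t / (Z \<zeta> - t) ^ 2) \<le> C2 * x ^ (N + 2)" by (simp add: C2_def mult.assoc)
    have "norm (poly P (Z \<zeta>) / g (Z \<zeta>) ^ 2) \<le> C1 * x ^ N" using gv(2) by (simp add: C1_def x_def)
    also have "\<dots> \<le> C1 * x ^ (N + 2)" using x1 C1 by (intro mult_left_mono power_increasing) auto
    finally have p: "norm (poly P (Z \<zeta>) / g (Z \<zeta>) ^ 2) \<le> C1 * x ^ (N + 2)" .
    have "norm (R (Z \<zeta>)) \<le> norm (poly P (Z \<zeta>) / g (Z \<zeta>) ^ 2) + norm (\<Sum>\<^sub>\<infinity>t\<in>{t. g t = 0}. c t / (Z \<zeta> - t) ^ 2)"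
      unfolding eq[OF gv(1)] by (rule norm_triangle_ineq4)
    then show ?thesis using p s unfolding x_def[symmetric] distrib_right by linarith
  qed
  have Zc: "Z holomorphic_on D" unfolding holomorphic_on_open[OF D_open] using Z_derivative by blast
  show ?thesis
  proof (rule that[of "(C1 + C2) * 2 ^ (N + 2)"])
    show "(C1 + C2) * 2 ^ (N + 2) \<ge> 0" using C1 C2 by simp
    fix s assume s: "Re (\<nu> * s) > K + 4"
    define \<zeta> where "\<zeta> = \<Phi> s"
    have deep: "Re (\<nu> * s) > K + 2" using s by linarith
    note dc = deep_cball[OF deep, folded \<zeta>_def]
    have Zz: "Z \<zeta> = zmap j s" by (simp add: Z_def \<zeta>_def \<Psi>_\<Phi>[OF dc(1)])
    have s0: "s \<noteq> 0" "norm s > K" using H_far[OF dc(1)] by auto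
    define x where "x = norm (zmap j s - d)"
    have xW: "x = norm (W s)" by (simp add: x_def norm_zmap)
    show "norm (R (zmap j s)) \<le> (C1 + C2) * 2 ^ (N + 2) * norm (zmap j s - d) ^ (N + 2)"
    proof (cases "norm (principal_part g \<zeta>) \<ge> amplitude g \<zeta> / 100")
      case True
      have "norm (R (Z \<zeta>)) \<le> (C1 + C2) * norm (Z \<zeta> - d) ^ (N + 2)" by (rule goodR[OF dc(2) True])
      also have "\<dots> \<le> (C1 + C2) * (2 ^ (N + 2) * norm (Z \<zeta> - d) ^ (N + 2))"
      proof (rule mult_left_mono)
        have "1 * norm (Z \<zeta> - d) ^ (N + 2) \<le> 2 ^ (N + 2) * norm (Z \<zeta> - d) ^ (N + 2)"
          by (intro mult_right_mono one_le_power) auto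
        then show "norm (Z \<zeta> - d) ^ (N + 2) \<le> 2 ^ (N + 2) * norm (Z \<zeta> - d) ^ (N + 2)" by simp
      qed (use C1 C2 in simp)
      finally show ?thesis unfolding Zz by (simp add: mult.assoc)
    next
      case False
      have circ: "norm (R (Z \<xi>)) \<le> (C1 + C2) * (2 * x) ^ (N + 2)" if \<xi>: "\<xi> \<in> sphere \<zeta> (1 / 10)" for \<xi>
      proof -
        define u where "u = \<xi> - \<zeta>"
        have u: "norm u = 1 / 10" using \<xi> by (simp add: u_def dist_norm norm_minus_commute)
        have xu: "\<xi> = \<zeta> + u" by (simp add: u_def)
        define s' where "s' = \<Psi> \<xi>"
        have "\<xi> \<in> D" using dc(2) \<xi> by auto
        then have s': "s' \<in> H" "\<Phi> s' = \<xi>" using \<Psi>_in \<Phi>_\<Psi> by (auto simp: s'_def)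
        have "norm (s' - (s + u)) \<le> 1 / 20" using dc(3)[of u] u by (simp add: s'_def xu)
        moreover have "norm (s' - s) \<le> norm (s' - (s + u)) + norm u" using norm_triangle_ineq[of "s' - (s + u)" u] by simp
        ultimately have ss: "norm (s' - s) \<le> 1" using u by linarith
        \<comment> \<open>The circle moves s by at most 1, so the margin 4 of the claim leaves more
          than the margin 2 that unit discs need.\<close>
        then have "Re (\<nu> * s') \<ge> Re (\<nu> * s) - 1" by (intro Re_\<nu>_cball) (simp add: dist_norm norm_minus_commute)
        then have deep': "Re (\<nu> * s') > K + 2" using s by linarith
        have good: "norm (principal_part g \<xi>) \<ge> amplitude g \<xi> / 100"
          unfolding xu by (rule good_on_circle[OF _ u]) (use False in simp)
        have "norm (R (Z \<xi>)) \<le> (C1 + C2) * norm (Z \<xi> - d) ^ (N + 2)"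
          by (rule goodR[OF _ good]) (use deep_cball(2)[OF deep'] s'(2) in simp)
        moreover have "norm (Z \<xi> - d) \<le> 2 * x"
        proof -
          have "norm s' \<le> 2 * norm s" using ss s0 K_large norm_triangle_ineq2[of s' s] by linarith
          then have "(\<kappa> * norm s') powr (2 / M) \<le> (2 * (\<kappa> * norm s)) powr (2 / M)"
            using \<kappa>0 M2 by (intro powr_mono2) auto
          also have "\<dots> = 2 powr (2 / M) * (\<kappa> * norm s) powr (2 / M)" using \<kappa>0 by (simp add: powr_mult)
          also have "\<dots> \<le> 2 powr 1 * (\<kappa> * norm s) powr (2 / M)" using M2 by (intro mult_right_mono powr_mono) auto
          finally have "norm (W s') \<le> 2 * norm (W s)" using norm_W[of s'] norm_W[of s] H_far[OF s'(1)] s0 by simp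
          then show ?thesis unfolding xW Z_def s'_def[symmetric] norm_zmap .
        qed
        then have "(C1 + C2) * norm (Z \<xi> - d) ^ (N + 2) \<le> (C1 + C2) * (2 * x) ^ (N + 2)"
          using C1 C2 by (intro mult_left_mono power_mono) auto
        ultimately show ?thesis by linarith
      qed
      have sub: "cball \<zeta> (1 / 10) \<subseteq> D" using dc(2) by (rule order_trans[rotated]) (simp add: cball_subset_cball_iff)
      have hol: "(\<lambda>\<xi>. R (Z \<xi>)) holomorphic_on D"
        using holomorphic_on_compose_gen[OF Zc R] by (simp add: o_def)
      have "norm (R (Z \<zeta>)) \<le> (C1 + C2) * (2 * x) ^ (N + 2)"
      proof (rule maximum_modulus_frontier[where f = "\<lambda>\<xi>. R (Z \<xi>)" and S = "cball \<zeta> (1 / 10)"])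
        show "(\<lambda>\<xi>. R (Z \<xi>)) holomorphic_on interior (cball \<zeta> (1 / 10))"
          using hol sub by (rule holomorphic_on_subset[OF _ order_trans[OF interior_subset]])
        show "continuous_on (closure (cball \<zeta> (1 / 10))) (\<lambda>\<xi>. R (Z \<xi>))"
          using holomorphic_on_imp_continuous_on[OF holomorphic_on_subset[OF hol sub]] by simp
      qed (use circ in \<open>auto simp: frontier_cball\<close>)
      then show ?thesis unfolding Zz x_def power_mult_distrib by (simp add: mult.assoc)
    qed
  qed
qed

end

lemma ray_filterlim: "filterlim (\<lambda>r. d + rcis r \<phi>) at_infinity at_top"
proof -
  have "filterlim (\<lambda>r::real. - norm d + r) at_top at_top"
    by (rule filterlim_tendsto_add_at_top[OF tendsto_const filterlim_ident])
  moreover have "\<forall>\<^sub>F r in at_top. - norm d + r \<le> norm (d + rcis r \<phi>)"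
    using eventually_ge_at_top[of 0]
  proof eventually_elim
    case (elim r)
    then show ?case using norm_triangle_ineq4[of "d + rcis r \<phi>" d] by simp
  qed
  ultimately have "filterlim (\<lambda>r. norm (d + rcis r \<phi>)) at_top at_top"
    by (rule filterlim_at_top_mono)
  then show ?thesis by (simp add: filterlim_at_infinity_conv_norm_at_top)
qed

text \<open>Division by z^(degree p) identifies the leading coefficient as a limit along the ray,
  and that limit is 0.\<close>

lemma poly_zero_of_ray_limit:
  assumes "((\<lambda>r. poly p (d + rcis r \<phi>)) \<longlongrightarrow> 0) at_top"
  shows "p = 0"
proof -
  let ?z = "\<lambda>r. d + rcis r \<phi>"
  have l: "((\<lambda>r. poly p (?z r) / ?z r ^ degree p) \<longlongrightarrow> lead_coeff p) at_top"
    by (rule filterlim_compose[OF poly_divide_tendsto_aux ray_filterlim])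
  have "\<forall>\<^sub>F z::complex in at_infinity. norm z \<ge> 1" by (auto simp: eventually_at_infinity)
  from eventually_compose_filterlim[OF this ray_filterlim]
  have "\<forall>\<^sub>F r in at_top. norm (?z r) \<ge> 1" .
  then have "\<forall>\<^sub>F r in at_top. norm (poly p (?z r) / ?z r ^ degree p) \<le> norm (poly p (?z r))"
  proof eventually_elim
    case (elim r)
    have "norm (poly p (?z r)) / norm (?z r) ^ degree p \<le> norm (poly p (?z r)) / 1"
      using one_le_power[OF elim, of "degree p"] by (intro divide_left_mono mult_pos_pos norm_ge_zero) linarith+
    then show ?case by (simp add: norm_divide norm_power)
  qed
  then have "((\<lambda>r. poly p (?z r) / ?z r ^ degree p) \<longlongrightarrow> 0) at_top"
    by (rule Lim_null_comparison[OF _ tendsto_norm_zero[OF assms]])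
  from tendsto_unique[OF trivial_limit_at_top_linorder l this] have "lead_coeff p = 0" .
  then show ?thesis by simp
qed

context stokes_region
begin

lemmas deep_zeros_summable_image = deep_zeros_summable[unfolded deep_zeros_def]

end

section \<open>Passage from the half planes to the whole plane\<close>

context stokes_setup
begin

definition "region_indices = {..N + 2} \<times> {cis (pi / 4), cis (- (pi / 4))}"

lemma region_indices_finite: "finite region_indices" by (simp add: region_indices_def)

lemma region_cover_indices:
  assumes "norm (z - d) \<ge> max 1 (\<kappa> * (2 * K + 10))"
  obtains i s where "i \<in> region_indices" "z = zmap (fst i) s" "Re (snd i * s) > K + 4"
proof -
  obtain j \<nu> s where s: "j \<le> N + 2" "\<nu> \<in> {cis (pi / 4), cis (- (pi / 4))}" "z = zmap j s"
    "Re (\<nu> * s) \<ge> 7 / 10 * norm s" "norm s \<ge> 2 * K + 10"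
    using region_cover[of z "2 * K + 10"] assms by auto
  \<comment> \<open>The bound 2 K + 10 is chosen so that 7/10 of it exceeds K + 4.\<close>
  have "Re (\<nu> * s) > K + 4" using s(4,5) K_large by linarith
  then show ?thesis using that[of "(j, \<nu>)" s] s by (simp add: region_indices_def)
qed

lemma generic_region:
  assumes "generic_solution g" "i \<in> region_indices"
  obtains \<Phi> l where "stokes_region P Q r0 C (fst i) (snd i) \<Phi> l"
    "stokes_region.coefA P Q r0 C (fst i) (snd i) \<Phi> l g \<noteq> 0"
    "stokes_region.coefB P Q r0 C (fst i) (snd i) \<Phi> l g \<noteq> 0"
proof -
  have i: "fst i \<le> N + 2" "snd i \<in> {cis (pi / 4), cis (- (pi / 4))}"
    using assms(2) by (auto simp: region_indices_def)
  from assms(1)[unfolded generic_solution_def, rule_format, OF i] show ?thesis using that by blast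
qed

lemma generic_not_constant:
  assumes g: "solution_on P Q UNIV g" and gen: "generic_solution g"
  shows "\<not> g constant_on UNIV"
proof
  assume "g constant_on UNIV"
  then obtain c where c: "\<And>z. g z = c" unfolding constant_on_def by auto
  have \<delta>: "0 < pi / (2 * M)" "pi / (2 * M) < pi / M" using M2 by (auto simp: field_simps)
  obtain R where R: "\<And>r \<phi>. r \<ge> R \<Longrightarrow> stokes_angle P Q 0 + pi / (2 * M) \<le> \<phi> \<Longrightarrow>
      \<phi> \<le> stokes_angle P Q (Suc 0) - pi / (2 * M) \<Longrightarrow> r ^ 1 \<le> norm (g (d + rcis r \<phi>))"
    using sector_growth[OF g gen _ \<delta>, of 0 1] by auto
  have "stokes_angle P Q 0 + pi / (2 * M) \<le> stokes_angle P Q (Suc 0) - pi / (2 * M)"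
    using M2 unfolding stokes_angle_Suc by (simp add: field_simps)
  from R[OF _ order_refl this, of "max R (norm c + 1)"] show False by (simp add: c)
qed

lemma zero_set_discrete:
  assumes g: "solution_on P Q UNIV g" and gen: "generic_solution g"
  shows "finite ({t. g t = 0} \<inter> cball a r)"
proof -
  have "finite {z \<in> cball a r. g z = 0}"
    using g generic_not_constant[OF g gen]
    by (intro holomorphic_compact_finite_zeros[of g UNIV]) (auto simp: solution_on_def)
  moreover have "{z \<in> cball a r. g z = 0} = {t. g t = 0} \<inter> cball a r" by auto
  ultimately show ?thesis by simp
qed

text \<open>Far zeros lie in the finitely many images of deep half planes; the remaining ones lie in
  a disc, which contains only finitely many.\<close>

lemma generic_zeros_summable:
  assumes g: "solution_on P Q UNIV g" and gen: "generic_solution g"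
  shows "(\<lambda>t. norm (poly P t / deriv g t ^ 2) / (1 + norm t ^ 2)) summable_on {t. g t = 0}"
proof -
  let ?w = "\<lambda>t. norm (poly P t / deriv g t ^ 2) / (1 + norm t ^ 2)"
  let ?A = "\<lambda>i. zmap (fst i) ` {s. K + 2 < Re (snd i * s) \<and> g (zmap (fst i) s) = 0}"
  define R where "R = max 1 (\<kappa> * (2 * K + 10))"
  have "?w summable_on ?A i" if i: "i \<in> region_indices" for i
  proof -
    obtain \<Phi> l where r: "stokes_region P Q r0 C (fst i) (snd i) \<Phi> l"
      "stokes_region.coefA P Q r0 C (fst i) (snd i) \<Phi> l g \<noteq> 0"
      "stokes_region.coefB P Q r0 C (fst i) (snd i) \<Phi> l g \<noteq> 0"
      using generic_region[OF gen i] by blast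
    show ?thesis by (rule stokes_region.deep_zeros_summable_image[OF r(1) g r(2,3)])
  qed
  then have "?w summable_on (\<Union>i\<in>region_indices. ?A i)"
    by (rule summable_on_finite_UN[OF region_indices_finite])
  moreover have "?w summable_on ({t. g t = 0} \<inter> cball d R)"
    by (rule summable_on_finite[OF zero_set_discrete[OF g gen]])
  ultimately have "?w summable_on ((\<Union>i\<in>region_indices. ?A i) \<union> ({t. g t = 0} \<inter> cball d R))"
    by (rule summable_on_union)
  moreover have "{t. g t = 0} \<subseteq> (\<Union>i\<in>region_indices. ?A i) \<union> ({t. g t = 0} \<inter> cball d R)"
  proof
    fix t assume t: "t \<in> {t. g t = 0}"
    show "t \<in> (\<Union>i\<in>region_indices. ?A i) \<union> ({t. g t = 0} \<inter> cball d R)"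
    proof (cases "t \<in> cball d R")
      case False
      then have "norm (t - d) \<ge> R" by (simp add: dist_norm norm_minus_commute)
      then obtain i s where i: "i \<in> region_indices" "t = zmap (fst i) s" "Re (snd i * s) > K + 4"
        using region_cover_indices unfolding R_def by blast
      then have "t \<in> ?A i" using t by (intro image_eqI[of _ _ s]) auto
      then show ?thesis using i(1) by blast
    qed (use t in simp)
  qed
  ultimately show ?thesis by (rule summable_on_subset_banach)
qed

text \<open>On the bisector |g| exceeds every power of r, so g^2 outgrows any polynomial.\<close>

lemma generic_ray_quotient:
  assumes g: "solution_on P Q UNIV g" and gen: "generic_solution g"
    and \<phi>: "\<phi> = stokes_angle P Q 0 + pi / M"
  shows "((\<lambda>r. poly A (d + rcis r \<phi>) / g (d + rcis r \<phi>) ^ 2) \<longlongrightarrow> 0) at_top"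
proof -
  define n where "n = degree A + 1"
  have \<delta>: "0 < pi / (2 * M)" "pi / (2 * M) < pi / M" using M2 by (auto simp: field_simps)
  obtain R where R: "\<And>r \<phi>. r \<ge> R \<Longrightarrow> stokes_angle P Q 0 + pi / (2 * M) \<le> \<phi> \<Longrightarrow>
      \<phi> \<le> stokes_angle P Q (Suc 0) - pi / (2 * M) \<Longrightarrow> r ^ n \<le> norm (g (d + rcis r \<phi>))"
    using sector_growth[OF g gen _ \<delta>, of 0 n] by auto
  have ang: "stokes_angle P Q 0 + pi / (2 * M) \<le> \<phi>" "\<phi> \<le> stokes_angle P Q (Suc 0) - pi / (2 * M)"
    using M2 unfolding stokes_angle_Suc \<phi> by (auto simp: field_simps)
  have "degree A + 0 \<le> degree (monom (1::complex) (degree A))" by (simp add: degree_monom_eq)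
  moreover have "monom (1::complex) (degree A) \<noteq> 0" by simp
  ultimately obtain C' where C': "C' \<ge> 0"
    "\<forall>\<^sub>F z in at_infinity. norm (z ^ 0 * poly A z) \<le> C' * norm (poly (monom 1 (degree A)) z)"
    using poly_growth_bound by blast
  have "\<forall>\<^sub>F z in at_infinity. norm (poly A z) \<le> C' * norm z ^ degree A"
    using C'(2) by (simp add: poly_monom norm_power)
  from eventually_compose_filterlim[OF this ray_filterlim]
  have "\<forall>\<^sub>F r in at_top. norm (poly A (d + rcis r \<phi>)) \<le> C' * norm (d + rcis r \<phi>) ^ degree A" .
  with eventually_ge_at_top[of "max 1 (max R (norm d))"]
  have "\<forall>\<^sub>F r in at_top. norm (poly A (d + rcis r \<phi>) / g (d + rcis r \<phi>) ^ 2) \<le> C' * 2 ^ degree A / r"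
  proof eventually_elim
    case (elim r)
    then have r: "r \<ge> 1" "r \<ge> R" "norm d \<le> r" by auto
    have "norm (d + rcis r \<phi>) \<le> 2 * r" using norm_triangle_ineq[of d "rcis r \<phi>"] r by simp
    then have "norm (d + rcis r \<phi>) ^ degree A \<le> (2 * r) ^ degree A" by (intro power_mono) auto
    then have "C' * norm (d + rcis r \<phi>) ^ degree A \<le> C' * (2 * r) ^ degree A" by (rule mult_left_mono[OF _ C'(1)])
    then have 1: "norm (poly A (d + rcis r \<phi>)) \<le> C' * 2 ^ degree A * r ^ degree A"
      using elim(2) by (simp add: power_mult_distrib)
    have "r ^ n \<le> norm (g (d + rcis r \<phi>))" by (rule R[OF r(2) ang])
    then have "r ^ n * r ^ n \<le> norm (g (d + rcis r \<phi>)) ^ 2"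
      using r unfolding power2_eq_square by (intro mult_mono) auto
    moreover have "r ^ degree A * r \<le> r ^ n * r ^ n"
      using r one_le_power[OF r(1), of n] unfolding n_def by (simp add: mult_le_cancel_left1)
    ultimately have 2: "r ^ degree A * r \<le> norm (g (d + rcis r \<phi>)) ^ 2" by linarith
    have "norm (poly A (d + rcis r \<phi>) / g (d + rcis r \<phi>) ^ 2) = norm (poly A (d + rcis r \<phi>)) / norm (g (d + rcis r \<phi>)) ^ 2"
      by (simp add: norm_divide norm_power)
    also have "\<dots> \<le> (C' * 2 ^ degree A * r ^ degree A) / (r ^ degree A * r)"
      using 1 2 r C'(1) by (intro frac_le) auto
    also have "\<dots> = C' * 2 ^ degree A / r" using r by simp
    finally show ?case .
  qed
  moreover have "((\<lambda>r. C' * 2 ^ degree A / r) \<longlongrightarrow> 0) at_top" by real_asymp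
  ultimately show ?thesis by (rule Lim_null_comparison)
qed

text \<open>On a sector of half opening pi / (2 M) around the bisector |g| \<ge> r for large r, so
  it has no far zeros. A zero closer than c0 r to the ray point would have a direction within pi /
  (2 M) of the ray, by continuity of the argument at 1.\<close>

lemma generic_zeros_off_ray:
  assumes g: "solution_on P Q UNIV g" and gen: "generic_solution g"
    and \<phi>: "\<phi> = stokes_angle P Q 0 + pi / M"
  obtains c0 r1 where "c0 > 0" "r1 \<ge> 1" "\<And>r t. r \<ge> r1 \<Longrightarrow> g t = 0 \<Longrightarrow> norm (d + rcis r \<phi> - t) \<ge> c0 * r"
proof -
  define \<delta> where "\<delta> = pi / (2 * M)"
  have \<delta>: "0 < \<delta>" "\<delta> < pi / M" using M2 by (auto simp: field_simps \<delta>_def)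
  obtain R where R: "\<And>r \<phi>. r \<ge> R \<Longrightarrow> stokes_angle P Q 0 + \<delta> \<le> \<phi> \<Longrightarrow>
      \<phi> \<le> stokes_angle P Q (Suc 0) - \<delta> \<Longrightarrow> r ^ 1 \<le> norm (g (d + rcis r \<phi>))"
    using sector_growth[OF g gen _ \<delta>, of 0 1] by auto
  have \<phi>': "\<phi> = stokes_angle P Q 0 + 2 * \<delta>" "stokes_angle P Q (Suc 0) = stokes_angle P Q 0 + 4 * \<delta>"
    using M2 unfolding stokes_angle_Suc \<phi> \<delta>_def by (auto simp: field_simps)
  have "isCont Arg 1" by (rule continuous_at_Arg) (auto simp: complex_nonpos_Reals_iff)
  then obtain e where e: "e > 0" "\<And>v. dist v 1 < e \<Longrightarrow> dist (Arg v) (Arg 1) < \<delta>"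
    using \<delta>(1) unfolding continuous_at_eps_delta by (metis dist_commute)
  define c0 where "c0 = min e (1 / 2)"
  define R' where "R' = max 1 R"
  show ?thesis
  proof (rule that[of c0 "2 * R'"])
    show "c0 > 0" using e by (simp add: c0_def)
    show "2 * R' \<ge> 1" by (simp add: R'_def)
    fix r t assume r: "r \<ge> 2 * R'" and t: "g t = 0"
    have r0: "r > 0" using r by (simp add: R'_def)
    show "norm (d + rcis r \<phi> - t) \<ge> c0 * r"
    proof (rule ccontr)
      assume "\<not> norm (d + rcis r \<phi> - t) \<ge> c0 * r"
      then have lt: "norm (t - (d + rcis r \<phi>)) < c0 * r" by (simp add: norm_minus_commute)
      define v where "v = (t - d) / rcis r \<phi>"
      have nz: "rcis r \<phi> \<noteq> 0" using r0 by (simp add: rcis_def)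
      have "v - 1 = (t - (d + rcis r \<phi>)) / rcis r \<phi>" using nz by (simp add: v_def diff_divide_distrib add_divide_distrib)
      then have "norm (v - 1) = norm (t - (d + rcis r \<phi>)) / r" using r0 by (simp add: norm_divide)
      also have "\<dots> < c0" using lt r0 by (simp add: divide_less_eq)
      finally have v: "norm (v - 1) < e" "norm (v - 1) < 1 / 2" by (auto simp: c0_def)
      have "\<bar>Arg v\<bar> < \<delta>" using e(2)[of v] v(1) by (simp add: dist_norm)
      then have ang: "stokes_angle P Q 0 + \<delta> \<le> \<phi> + Arg v" "\<phi> + Arg v \<le> stokes_angle P Q (Suc 0) - \<delta>"
        unfolding \<phi>' by linarith+
      have "norm v \<ge> 1 / 2" using v(2) norm_triangle_ineq2[of 1 v] by (simp add: norm_minus_commute)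
      then have "r * (1 / 2) \<le> r * norm v" using r0 by (intro mult_left_mono) auto
      then have rv: "r * norm v \<ge> R'" using r by linarith
      have "t = d + rcis r \<phi> * v" using nz by (simp add: v_def)
      also have "v = rcis (norm v) (Arg v)" by (simp add: rcis_cmod_Arg)
      also have "rcis r \<phi> * rcis (norm v) (Arg v) = rcis (r * norm v) (\<phi> + Arg v)" by (rule rcis_mult)
      finally have "t = d + rcis (r * norm v) (\<phi> + Arg v)" by simp
      then have "(r * norm v) ^ 1 \<le> norm (g t)" using R[OF _ ang, of "r * norm v"] rv by (simp add: R'_def)
      then show False using t rv by (simp add: R'_def)
    qed
  qed
qed

text \<open>Dominated convergence in the form of a Weierstrass test on the ray: the distances to the
  zeros grow at least like r, and |z| at most like r, so the factor of each weight is bounded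
  uniformly in r, while every single term tends to 0.\<close>

lemma generic_ray_pole_series:
  fixes c :: "complex \<Rightarrow> complex"
  assumes g: "solution_on P Q UNIV g" and gen: "generic_solution g"
    and \<phi>: "\<phi> = stokes_angle P Q 0 + pi / M"
    and w: "(\<lambda>t. norm (c t) / (1 + norm t ^ 2)) summable_on {t. g t = 0}"
  shows "((\<lambda>r. \<Sum>\<^sub>\<infinity>t\<in>{t. g t = 0}. c t / (d + rcis r \<phi> - t) ^ 2) \<longlongrightarrow> 0) at_top"
proof -
  define T where "T = {t. g t = 0}"
  obtain c0 r1 where cr: "c0 > 0" "r1 \<ge> 1" "\<And>r t. r \<ge> r1 \<Longrightarrow> g t = 0 \<Longrightarrow> norm (d + rcis r \<phi> - t) \<ge> c0 * r"
    using generic_zeros_off_ray[OF g gen \<phi>] by blast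
  define Y where "Y = {max r1 (norm d)..}"
  have far: "(c0 * r) ^ 2 \<le> norm (d + rcis r \<phi> - t) ^ 2" "c0 * r > 0" if "t \<in> T" "r \<in> Y" for t r
    using that cr by (auto simp: Y_def T_def intro!: power_mono)
  have ul: "uniform_limit Y (\<lambda>X r. \<Sum>t\<in>X. c t / (d + rcis r \<phi> - t) ^ 2)
      (\<lambda>r. \<Sum>\<^sub>\<infinity>t\<in>T. c t / (d + rcis r \<phi> - t) ^ 2) (finite_subsets_at_top T)"
  proof (rule Weierstrass_m_test_general[where M = "\<lambda>t. norm (c t) / (1 + norm t ^ 2) * (2 + 9 / c0 ^ 2)"])
    fix t r assume t: "t \<in> T" and r: "r \<in> Y"
    have r': "r \<ge> 1" "norm d \<le> r" using r cr(2) by (auto simp: Y_def)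
    have "norm (d + rcis r \<phi>) \<le> 2 * r" using norm_triangle_ineq[of d "rcis r \<phi>"] r' by simp
    then have "norm (d + rcis r \<phi>) ^ 2 \<le> (2 * r) ^ 2" by (intro power_mono) auto
    moreover have "1 \<le> r ^ 2" using r' by (simp add: one_le_power)
    ultimately have "1 + 2 * norm (d + rcis r \<phi>) ^ 2 \<le> 9 * r ^ 2" by (simp add: power_mult_distrib)
    then have "(1 + 2 * norm (d + rcis r \<phi>) ^ 2) / (c0 * r) ^ 2 \<le> 9 * r ^ 2 / (c0 * r) ^ 2"
      by (intro divide_right_mono) auto
    also have "\<dots> = 9 / c0 ^ 2" using r' by (simp add: power_mult_distrib)
    finally have q: "(1 + 2 * norm (d + rcis r \<phi>) ^ 2) / (c0 * r) ^ 2 \<le> 9 / c0 ^ 2" .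
    have "norm (c t / (d + rcis r \<phi> - t) ^ 2)
      \<le> norm (c t) / (1 + norm t ^ 2) * (2 + (1 + 2 * norm (d + rcis r \<phi>) ^ 2) / (c0 * r) ^ 2)"
      using far[OF t r] by (intro pole_term_bound) auto
    also have "\<dots> \<le> norm (c t) / (1 + norm t ^ 2) * (2 + 9 / c0 ^ 2)"
      using q by (intro mult_left_mono add_left_mono) auto
    finally show "norm (c t / (d + rcis r \<phi> - t) ^ 2) \<le> norm (c t) / (1 + norm t ^ 2) * (2 + 9 / c0 ^ 2)" .
  qed (use summable_on_cmult_left[OF w] in \<open>simp add: T_def\<close>)
  have tlim: "((\<lambda>r. c t / (d + rcis r \<phi> - t) ^ 2) \<longlongrightarrow> 0) at_top" if t: "t \<in> T" for t
  proof (rule Lim_null_comparison)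
    show "\<forall>\<^sub>F r in at_top. norm (c t / (d + rcis r \<phi> - t) ^ 2) \<le> norm (c t) / (c0 * r) ^ 2"
      using eventually_ge_at_top[of "max r1 (norm d)"]
    proof eventually_elim
      case (elim r)
      then have "r \<in> Y" by (simp add: Y_def)
      from far[OF t this] show ?case by (auto simp: norm_divide norm_power intro!: divide_left_mono mult_pos_pos)
    qed
    show "((\<lambda>r. norm (c t) / (c0 * r) ^ 2) \<longlongrightarrow> 0) at_top" using cr(1) by real_asymp
  qed
  have "\<forall>\<^sub>F X in finite_subsets_at_top T. ((\<lambda>r. \<Sum>t\<in>X. c t / (d + rcis r \<phi> - t) ^ 2) \<longlongrightarrow> 0) at_top"
    by (rule eventually_finite_subsets_at_top_weakI) (auto intro!: tendsto_null_sum tlim)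
  moreover have "\<forall>\<^sub>F r in at_top. r \<in> Y" unfolding Y_def atLeast_iff by (rule eventually_ge_at_top)
  ultimately have "((\<lambda>r. \<Sum>\<^sub>\<infinity>t\<in>T. c t / (d + rcis r \<phi> - t) ^ 2) \<longlongrightarrow> 0) at_top"
    by (intro swap_uniform_limit'[OF _ tendsto_const ul]) (auto simp: finite_subsets_at_top_neq_bot)
  then show ?thesis by (simp add: T_def)
qed

lemma remainder_entire:
  fixes g :: "complex \<Rightarrow> complex"
  defines "c \<equiv> \<lambda>t. poly P t / deriv g t ^ 2"
  assumes g: "solution_on P Q UNIV g" and gen: "generic_solution g"
    and simple: "\<And>t. g t = 0 \<Longrightarrow> poly P t \<noteq> 0 \<and> deriv g t \<noteq> 0"
  obtains R where "R holomorphic_on UNIV"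
    "\<And>z. g z \<noteq> 0 \<Longrightarrow> R z = poly P z / g z ^ 2 - (\<Sum>\<^sub>\<infinity>t\<in>{t. g t = 0}. c t / (z - t) ^ 2)"
proof -
  define T where "T = {t. g t = 0}"
  have gh: "g holomorphic_on UNIV" using g by (simp add: solution_on_def)
  have w: "(\<lambda>t. norm (c t) / (1 + norm t ^ 2)) summable_on T"
    unfolding c_def T_def by (rule generic_zeros_summable[OF g gen])
  define h where "h z = poly P z / g z ^ 2 - (\<Sum>\<^sub>\<infinity>t\<in>T. c t / (z - t) ^ 2)" for z
  have local: "\<exists>r>0. (\<forall>t\<in>T - {z0}. r \<le> dist z0 t)" for z0
  proof -
    have "finite (T \<inter> cball z0 1)" unfolding T_def by (rule zero_set_discrete[OF g gen])
    from finite_set_avoid[OF this, of z0] obtain e where e: "e > 0" "\<And>x. x \<in> T \<inter> cball z0 1 \<Longrightarrow> x \<noteq> z0 \<Longrightarrow> e \<le> dist z0 x" by blast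
    have "min e 1 \<le> dist z0 t" if "t \<in> T - {z0}" for t
      using e(2)[of t] that by (cases "t \<in> cball z0 1") auto
    then show ?thesis using e(1) by (intro exI[of _ "min e 1"]) auto
  qed
  \<comment> \<open>The term of the centre is split off; the others have their poles at a positive
    distance.\<close>
  have split: "\<exists>r>0. \<exists>S. S holomorphic_on ball z0 r \<and> (\<forall>t\<in>T - {z0}. r \<le> dist z0 t) \<and>
      (\<forall>z\<in>ball z0 r. h z = poly P z / g z ^ 2 - (if z0 \<in> T then c z0 / (z - z0) ^ 2 else 0) - S z)" for z0
  proof -
    obtain r where r: "r > 0" "\<And>t. t \<in> T - {z0} \<Longrightarrow> r \<le> dist z0 t" using local by blast
    have w': "(\<lambda>t. norm (c t) / (1 + norm t ^ 2)) summable_on (T - {z0})"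
      by (rule summable_on_subset_banach[OF w]) auto
    define S where "S z = (\<Sum>\<^sub>\<infinity>t\<in>T - {z0}. c t / (z - t) ^ 2)" for z
    have "S holomorphic_on ball z0 (r / 2)"
      unfolding S_def[abs_def] by (rule pole_series_holomorphic[OF w' r])
    moreover have "h z = poly P z / g z ^ 2 - (if z0 \<in> T then c z0 / (z - z0) ^ 2 else 0) - S z"
      if z: "z \<in> ball z0 (r / 2)" for z
    proof (cases "z0 \<in> T")
      case True
      have "(r / 2) ^ 2 \<le> norm (z - t) ^ 2" if t: "t \<in> T - {z0}" for t
      proof -
        have "dist z0 t \<le> dist z0 z + dist z t" by (rule dist_triangle)
        then have "r / 2 \<le> norm (z - t)" using r(2)[OF t] z by (simp add: dist_norm)
        then show ?thesis using r(1) by (intro power_mono) auto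
      qed
      then have "(\<lambda>t. c t / (z - t) ^ 2) summable_on (T - {z0})"
        using r(1) by (intro pole_series_summable(2)[OF w', of "(r / 2) ^ 2"]) auto
      then have "(\<Sum>\<^sub>\<infinity>t\<in>insert z0 (T - {z0}). c t / (z - t) ^ 2) = c z0 / (z - z0) ^ 2 + S z"
        unfolding S_def by (intro infsum_insert) auto
      moreover have "insert z0 (T - {z0}) = T" using True by auto
      ultimately show ?thesis using True by (simp add: h_def)
    next
      case False
      then have "T - {z0} = T" by auto
      then show ?thesis using False by (simp add: h_def S_def)
    qed
    moreover have "\<forall>t\<in>T - {z0}. r / 2 \<le> dist z0 t" using r by fastforce
    ultimately show ?thesis using r(1) by (intro exI[of _ "r / 2"] conjI exI[of _ S]) auto
  qed
  have an: "h analytic_on {z0}" if z0: "z0 \<notin> T" for z0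
  proof -
    obtain r S where r: "r > 0" "S holomorphic_on ball z0 r" "\<And>t. t \<in> T - {z0} \<Longrightarrow> r \<le> dist z0 t"
      "\<And>z. z \<in> ball z0 r \<Longrightarrow> h z = poly P z / g z ^ 2 - (if z0 \<in> T then c z0 / (z - z0) ^ 2 else 0) - S z"
      using split[of z0] by blast
    have "g z \<noteq> 0" if "z \<in> ball z0 r" for z using r(3)[of z] that z0 by (auto simp: T_def)
    then have "(\<lambda>z. poly P z / g z ^ 2 - S z) holomorphic_on ball z0 r"
      using r(2) by (intro holomorphic_intros holomorphic_on_subset[OF gh]) auto
    then have "h holomorphic_on ball z0 r"
      using r(4) z0 by (subst holomorphic_cong[OF refl, of _ h "\<lambda>z. poly P z / g z ^ 2 - S z"]) auto
    then show ?thesis unfolding analytic_at using r(1) by (intro exI[of _ "ball z0 r"]) auto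
  qed
  have rs: "remove_sings h analytic_on {z0}" for z0
  proof (cases "z0 \<in> T")
    case False
    then show ?thesis using an by (intro remove_sings_analytic_on) auto
  next
    case True
    obtain r S where r: "r > 0" "S holomorphic_on ball z0 r" "\<And>t. t \<in> T - {z0} \<Longrightarrow> r \<le> dist z0 t"
      "\<And>z. z \<in> ball z0 r \<Longrightarrow> h z = poly P z / g z ^ 2 - (if z0 \<in> T then c z0 / (z - z0) ^ 2 else 0) - S z"
      using split[of z0] by blast
    have "z \<notin> T" if "z \<in> ball z0 r - {z0}" for z using r(3)[of z] that by auto
    then have "h analytic_on ball z0 r - {z0}" using an analytic_on_analytic_at by blast
    then have iso: "isolated_singularity_at h z0" unfolding isolated_singularity_at_def using r(1) by blast
    have gz: "g z0 = 0" using True by (simp add: T_def)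
    \<comment> \<open>At a zero of g the equation reduces to g'' = (P' / P) g', which is the
      vanishing of the residue.\<close>
    have "deriv (deriv g) z0 = poly (pderiv P) z0 / poly P z0 * deriv g z0"
      using g simple[OF gz] gz unfolding solution_on_def by (auto simp: algebra_simps)
    then obtain L where L: "((\<lambda>z. poly P z / g z ^ 2 - c z0 / (z - z0) ^ 2) \<longlongrightarrow> L) (at z0)"
      using double_pole_removable[OF gh gz _ _] simple[OF gz] unfolding c_def by blast
    have "isCont S z0" using r(1,2)
      by (metis centre_in_ball continuous_on_eq_continuous_at holomorphic_on_imp_continuous_on open_ball)
    then have "(S \<longlongrightarrow> S z0) (at z0)" by (simp add: isCont_def)
    then have "((\<lambda>z. poly P z / g z ^ 2 - c z0 / (z - z0) ^ 2 - S z) \<longlongrightarrow> L - S z0) (at z0)"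
      by (intro tendsto_diff L)
    moreover have "\<forall>\<^sub>F z in at z0. poly P z / g z ^ 2 - c z0 / (z - z0) ^ 2 - S z = h z"
      using eventually_at_in_open[of "ball z0 r" z0] r(1,4) True by (auto elim!: eventually_mono)
    ultimately have "(h \<longlongrightarrow> L - S z0) (at z0)" by (rule Lim_transform_eventually)
    then show ?thesis by (rule remove_sings_analytic_at[OF iso])
  qed
  show ?thesis
  proof (rule that[of "remove_sings h"])
    have "remove_sings h analytic_on UNIV" using rs analytic_on_analytic_at by blast
    then show "remove_sings h holomorphic_on UNIV" by (rule analytic_imp_holomorphic)
    fix z assume "g z \<noteq> 0"
    then have "h analytic_on {z}" by (intro an) (simp add: T_def)
    then show "remove_sings h z = poly P z / g z ^ 2 - (\<Sum>\<^sub>\<infinity>t\<in>{t. g t = 0}. c t / (z - t) ^ 2)"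
      by (simp add: h_def T_def)
  qed
qed

lemma generic_partial_fractions:
  fixes g :: "complex \<Rightarrow> complex"
  defines "c \<equiv> \<lambda>t. poly P t / deriv g t ^ 2"
  assumes g: "solution_on P Q UNIV g" and gen: "generic_solution g"
    and simple: "\<And>t. g t = 0 \<Longrightarrow> poly P t \<noteq> 0 \<and> deriv g t \<noteq> 0" and z: "g z \<noteq> 0"
  shows "poly P z / g z ^ 2 = (\<Sum>\<^sub>\<infinity>t\<in>{t. g t = 0}. c t / (z - t) ^ 2)"
proof -
  have w: "(\<lambda>t. norm (c t) / (1 + norm t ^ 2)) summable_on {t. g t = 0}"
    unfolding c_def by (rule generic_zeros_summable[OF g gen])
  obtain R where R: "R holomorphic_on UNIV"
    "\<And>z. g z \<noteq> 0 \<Longrightarrow> R z = poly P z / g z ^ 2 - (\<Sum>\<^sub>\<infinity>t\<in>{t. g t = 0}. c t / (z - t) ^ 2)"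
    using remainder_entire[OF g gen simple] unfolding c_def by blast
  have "\<exists>B. B \<ge> 0 \<and> (\<forall>s. Re (snd i * s) > K + 4 \<longrightarrow> norm (R (zmap (fst i) s)) \<le> B * norm (zmap (fst i) s - d) ^ (N + 2))"
    if i: "i \<in> region_indices" for i
  proof -
    obtain \<Phi> l where r: "stokes_region P Q r0 C (fst i) (snd i) \<Phi> l"
      "stokes_region.coefA P Q r0 C (fst i) (snd i) \<Phi> l g \<noteq> 0"
      "stokes_region.coefB P Q r0 C (fst i) (snd i) \<Phi> l g \<noteq> 0"
      using generic_region[OF gen i] by blast
    show ?thesis
      by (rule stokes_region.remainder_bound[OF r(1) g r(2,3) w R]) (assumption | blast)+
  qed
  then obtain B where B: "\<And>i. i \<in> region_indices \<Longrightarrow> B i \<ge> 0"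
    "\<And>i s. i \<in> region_indices \<Longrightarrow> Re (snd i * s) > K + 4 \<Longrightarrow> norm (R (zmap (fst i) s)) \<le> B i * norm (zmap (fst i) s - d) ^ (N + 2)"
    by metis
  \<comment> \<open>One constant for all of the finitely many half planes.\<close>
  define B' where "B' = (\<Sum>i\<in>region_indices. B i)"
  have B': "B i \<le> B'" if "i \<in> region_indices" for i
    unfolding B'_def using that B(1) region_indices_finite by (intro member_le_sum) auto
  have B0: "B' \<ge> 0" unfolding B'_def using B(1) by (intro sum_nonneg) auto
  define R0 where "R0 = max 1 (\<kappa> * (2 * K + 10))"
  have poly_bound: "norm (R z) \<le> B' * 2 ^ (N + 2) * norm z ^ (N + 2)" if z: "norm z \<ge> R0 + norm d" for z
  proof -
    have "norm z \<le> norm (z - d) + norm d" using norm_triangle_ineq[of "z - d" d] by simp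
    then have "norm (z - d) \<ge> R0" using z by linarith
    then obtain i s where i: "i \<in> region_indices" "z = zmap (fst i) s" "Re (snd i * s) > K + 4"
      using region_cover_indices unfolding R0_def by blast
    have "norm (z - d) \<le> 2 * norm z" using norm_triangle_ineq4[of z d] z R0_def by linarith
    then have "norm (z - d) ^ (N + 2) \<le> (2 * norm z) ^ (N + 2)" by (intro power_mono) auto
    then have "B' * norm (z - d) ^ (N + 2) \<le> B' * (2 * norm z) ^ (N + 2)" by (rule mult_left_mono[OF _ B0])
    moreover have "norm (R z) \<le> B i * norm (z - d) ^ (N + 2)" using B(2)[OF i(1,3)] i(2) by simp
    moreover have "B i * norm (z - d) ^ (N + 2) \<le> B' * norm (z - d) ^ (N + 2)"
      using B'[OF i(1)] by (intro mult_right_mono) auto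
    ultimately show ?thesis unfolding power_mult_distrib by (simp add: mult.assoc)
  qed
  define p where "p = (\<Sum>k\<le>N + 2. monom ((deriv ^^ k) R 0 / fact k) k)"
  have Rp: "R z = poly p z" for z
  proof -
    have "R z = (\<Sum>k\<le>N + 2. (deriv ^^ k) R 0 / fact k * z ^ k)"
      by (rule Liouville_polynomial[OF R(1), where A = "R0 + norm d" and B = "B' * 2 ^ (N + 2)"]) (rule poly_bound)
    then show ?thesis by (simp only: p_def poly_sum poly_monom)
  qed
  define \<phi> where "\<phi> = stokes_angle P Q 0 + pi / M"
  obtain c0 r1 where cr: "c0 > 0" "r1 \<ge> 1" "\<And>r t. r \<ge> r1 \<Longrightarrow> g t = 0 \<Longrightarrow> norm (d + rcis r \<phi> - t) \<ge> c0 * r"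
    using generic_zeros_off_ray[OF g gen \<phi>_def] by blast
  have "((\<lambda>r. poly P (d + rcis r \<phi>) / g (d + rcis r \<phi>) ^ 2
      - (\<Sum>\<^sub>\<infinity>t\<in>{t. g t = 0}. c t / (d + rcis r \<phi> - t) ^ 2)) \<longlongrightarrow> 0 - 0) at_top"
    by (intro tendsto_diff generic_ray_quotient[OF g gen \<phi>_def] generic_ray_pole_series[OF g gen \<phi>_def w])
  then have lim: "((\<lambda>r. poly P (d + rcis r \<phi>) / g (d + rcis r \<phi>) ^ 2
      - (\<Sum>\<^sub>\<infinity>t\<in>{t. g t = 0}. c t / (d + rcis r \<phi> - t) ^ 2)) \<longlongrightarrow> 0) at_top" by simp
  have "((\<lambda>r. poly p (d + rcis r \<phi>)) \<longlongrightarrow> 0) at_top"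
  proof (rule Lim_transform_eventually[OF lim])
    show "\<forall>\<^sub>F r in at_top. poly P (d + rcis r \<phi>) / g (d + rcis r \<phi>) ^ 2
      - (\<Sum>\<^sub>\<infinity>t\<in>{t. g t = 0}. c t / (d + rcis r \<phi> - t) ^ 2) = poly p (d + rcis r \<phi>)"
      using eventually_ge_at_top[of r1]
    proof eventually_elim
      case (elim r)
      have "g (d + rcis r \<phi>) \<noteq> 0"
      proof
        assume "g (d + rcis r \<phi>) = 0"
        from cr(3)[OF elim this] cr(1,2) elim show False by (simp add: mult_le_0_iff)
      qed
      then show ?case using R(2) Rp by simp
    qed
  qed
  then have "p = 0" by (rule poly_zero_of_ray_limit)
  then show ?thesis using R(2)[OF z] Rp[of z] by simp
qed

text \<open>
  If the zero set were finite, the expansion would exhibit \<open>P / g\<^sup>2\<close> as a rational function,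
  but on the bisector of a Stokes sector it decays faster than any power.
\<close>

lemma generic_zeros_infinite:
  assumes g: "solution_on P Q UNIV g" and gen: "generic_solution g"
    and simple: "\<And>t. g t = 0 \<Longrightarrow> poly P t \<noteq> 0 \<and> deriv g t \<noteq> 0"
  shows "infinite {t. g t = 0}"
proof
  define T where "T = {t. g t = 0}"
  assume "finite {t. g t = 0}"
  then have fin: "finite T" by (simp add: T_def)
  define c where "c t = poly P t / deriv g t ^ 2" for t
  \<comment> \<open>The common denominator of the finite sum; \<open>r\<close> is the
    numerator.\<close>
  define q where "q = (\<Prod>t\<in>T. [:- t, 1:] ^ 2)"
  define r where "r = (\<Sum>t\<in>T. Polynomial.smult (c t) (\<Prod>u\<in>T - {t}. [:- u, 1:] ^ 2))"
  have q0: "q \<noteq> 0" using fin by (simp add: q_def)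
  have rz: "poly r z = poly (P * q) z / g z ^ 2" if z: "g z \<noteq> 0" for z
  proof -
    have zT: "z - t \<noteq> 0" if "t \<in> T" for t using that z by (auto simp: T_def)
    have "poly P z / g z ^ 2 = (\<Sum>t\<in>T. c t / (z - t) ^ 2)"
      using generic_partial_fractions[OF g gen simple z] fin by (simp add: c_def T_def)
    moreover have "(\<Sum>t\<in>T. c t / (z - t) ^ 2) * poly q z = poly r z"
      unfolding r_def poly_sum sum_distrib_right
    proof (rule sum.cong[OF refl])
      fix t assume t: "t \<in> T"
      have "poly q z = (z - t) ^ 2 * poly (\<Prod>u\<in>T - {t}. [:- u, 1:] ^ 2) z"
        unfolding q_def using fin t by (subst prod.remove[of _ t]) (auto simp: poly_power)
      then show "c t / (z - t) ^ 2 * poly q z = poly (Polynomial.smult (c t) (\<Prod>u\<in>T - {t}. [:- u, 1:] ^ 2)) z"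
        using zT[OF t] by simp
    qed
    ultimately show ?thesis by (metis poly_mult times_divide_eq_left)
  qed
  define \<phi> where "\<phi> = stokes_angle P Q 0 + pi / M"
  obtain c0 r1 where cr: "c0 > 0" "r1 \<ge> 1" "\<And>r t. r \<ge> r1 \<Longrightarrow> g t = 0 \<Longrightarrow> norm (d + rcis r \<phi> - t) \<ge> c0 * r"
    using generic_zeros_off_ray[OF g gen \<phi>_def] by blast
  have gnz: "g (d + rcis x \<phi>) \<noteq> 0" if "x \<ge> r1" for x
  proof
    assume "g (d + rcis x \<phi>) = 0"
    from cr(3)[OF that this] cr(1,2) that show False by (simp add: mult_le_0_iff)
  qed
  have ev: "\<forall>\<^sub>F x in at_top. poly (P * q) (d + rcis x \<phi>) / g (d + rcis x \<phi>) ^ 2 = poly r (d + rcis x \<phi>)"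
    using eventually_ge_at_top[of r1] by eventually_elim (simp add: rz gnz)
  have "((\<lambda>x. poly r (d + rcis x \<phi>)) \<longlongrightarrow> 0) at_top"
    by (rule Lim_transform_eventually[OF generic_ray_quotient[OF g gen \<phi>_def] ev])
  then have "r = 0" by (rule poly_zero_of_ray_limit)
  have "\<forall>\<^sub>F x in at_top. poly (P * q) (d + rcis x \<phi>) = 0"
    using eventually_ge_at_top[of r1]
  proof eventually_elim
    case (elim x)
    then show ?case using rz[OF gnz[OF elim]] \<open>r = 0\<close> gnz[OF elim] by simp
  qed
  then have "((\<lambda>x. poly (P * q) (d + rcis x \<phi>)) \<longlongrightarrow> 0) at_top" by (rule tendsto_eventually)
  then have "P * q = 0" by (rule poly_zero_of_ray_limit)
  then show False using q0 P0 by simp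
qed

text \<open>The sum over the zero set becomes a series by an enumeration, available because the zero
  set is countable and infinite. The weights 1 + |t|^2 and |t|^2 are comparable for t \<noteq> 0,
  since the nonzero zeros keep a positive distance from 0.\<close>

lemma generic_expansion:
  assumes g: "solution_on P Q UNIV g" and gen: "generic_solution g"
    and simple: "\<And>t. g t = 0 \<Longrightarrow> poly P t \<noteq> 0 \<and> deriv g t \<noteq> 0"
  shows "\<exists>(t :: nat \<Rightarrow> complex) c. inj t \<and> range t = {z. g z = 0} \<and>
    (\<forall>z. g z \<noteq> 0 \<longrightarrow> (\<lambda>n. c n / (z - t n) ^ 2) sums (poly P z / g z ^ 2)) \<and>
    summable (\<lambda>n. if t n = 0 then 0 else norm (c n) / norm (t n) ^ 2)"
proof -
  define T where "T = {z. g z = 0}"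
  define c where "c t = poly P t / deriv g t ^ 2" for t
  have w: "(\<lambda>t. norm (c t) / (1 + norm t ^ 2)) summable_on T"
    unfolding c_def T_def by (rule generic_zeros_summable[OF g gen])
  have "countable {z \<in> UNIV. g z = 0}"
    using g generic_not_constant[OF g gen]
    by (intro holomorphic_countable_zeros) (auto simp: solution_on_def)
  then have "countable T" by (simp add: T_def)
  moreover have "infinite T" unfolding T_def by (rule generic_zeros_infinite[OF g gen simple])
  ultimately have bij: "bij_betw (from_nat_into T) UNIV T" by (rule bij_betw_from_nat_into)
  define t where "t = from_nat_into T"
  have bt: "bij_betw t UNIV T" using bij by (simp add: t_def)
  have sums: "(\<lambda>n. c (t n) / (z - t n) ^ 2) sums (poly P z / g z ^ 2)" if z: "g z \<noteq> 0" for z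
  proof -
    have "finite (T \<inter> cball z 1)" unfolding T_def by (rule zero_set_discrete[OF g gen])
    from finite_set_avoid[OF this, of z] obtain e where e: "e > 0" "\<And>x. x \<in> T \<inter> cball z 1 \<Longrightarrow> x \<noteq> z \<Longrightarrow> e \<le> dist z x" by blast
    have "min e 1 ^ 2 \<le> norm (z - u) ^ 2" if u: "u \<in> T" for u
    proof -
      have "u \<noteq> z" using u z by (auto simp: T_def)
      then have "min e 1 \<le> norm (z - u)" using e(2)[of u] u by (cases "u \<in> cball z 1") (auto simp: dist_norm)
      then show ?thesis using e(1) by (intro power_mono) auto
    qed
    then have "(\<lambda>u. c u / (z - u) ^ 2) summable_on T"
      using e(1) by (intro pole_series_summable(2)[OF w, of "min e 1 ^ 2"]) auto
    then have "((\<lambda>u. c u / (z - u) ^ 2) has_sum (\<Sum>\<^sub>\<infinity>u\<in>T. c u / (z - u) ^ 2)) T" by (rule has_sum_infsum)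
    also have "(\<Sum>\<^sub>\<infinity>u\<in>T. c u / (z - u) ^ 2) = poly P z / g z ^ 2"
      using generic_partial_fractions[OF g gen simple z] by (simp add: T_def c_def)
    finally have "((\<lambda>n. c (t n) / (z - t n) ^ 2) has_sum (poly P z / g z ^ 2)) UNIV"
      using has_sum_reindex_bij_betw[OF bt, of "\<lambda>u. c u / (z - u) ^ 2"] by simp
    then show ?thesis by (rule has_sum_imp_sums)
  qed
  have "(\<lambda>u. if u = 0 then 0 else norm (c u) / norm u ^ 2) summable_on T"
  proof -
    have "finite (T \<inter> cball 0 1)" unfolding T_def by (rule zero_set_discrete[OF g gen])
    from finite_set_avoid[OF this, of 0] obtain e where e: "e > 0" "\<And>x. x \<in> T \<inter> cball 0 1 \<Longrightarrow> x \<noteq> 0 \<Longrightarrow> e \<le> dist 0 x" by blast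
    define m where "m = min e 1"
    have m: "m > 0" "\<And>u. u \<in> T \<Longrightarrow> u \<noteq> 0 \<Longrightarrow> m \<le> norm u"
    proof -
      show "m > 0" using e by (simp add: m_def)
      fix u assume u: "u \<in> T" "u \<noteq> 0"
      then show "m \<le> norm u" using e(2)[of u] by (cases "u \<in> cball 0 1") (auto simp: m_def)
    qed
    have "(\<lambda>u. norm (c u) / (1 + norm u ^ 2) * (1 + 1 / m ^ 2)) summable_on T" by (rule summable_on_cmult_left[OF w])
    then show ?thesis
    proof (rule summable_on_comparison_test)
      fix u assume u: "u \<in> T"
      show "(if u = 0 then 0 else norm (c u) / norm u ^ 2) \<le> norm (c u) / (1 + norm u ^ 2) * (1 + 1 / m ^ 2)"
      proof (cases "u = 0")
        case False
        define x where "x = norm u ^ 2"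
        have x: "x > 0" "m ^ 2 \<le> x" using False m(2)[OF u False] m(1) by (auto simp: x_def intro!: power_mono)
        have "1 / x \<le> 1 / m ^ 2" using x m(1) by (intro divide_left_mono mult_pos_pos) auto
        then have "1 / (1 + x) * (1 / x + 1) \<le> 1 / (1 + x) * (1 + 1 / m ^ 2)"
          using x by (intro mult_left_mono) auto
        moreover have "1 / x = 1 / (1 + x) * (1 / x + 1)" using x by (simp add: field_simps)
        ultimately have "1 / x \<le> 1 / (1 + x) * (1 + 1 / m ^ 2)" by simp
        then have "norm (c u) * (1 / x) \<le> norm (c u) * (1 / (1 + x) * (1 + 1 / m ^ 2))" by (intro mult_left_mono) auto
        then show ?thesis using False by (simp add: x_def)
      qed simp
    qed auto
  qed
  then have "(\<lambda>n. if t n = 0 then 0 else norm (c (t n)) / norm (t n) ^ 2) summable_on UNIV"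
    using summable_on_reindex_bij_betw[OF bt, of "\<lambda>u. if u = 0 then 0 else norm (c u) / norm u ^ 2"] by simp
  then have "summable (\<lambda>n. if t n = 0 then 0 else norm (c (t n)) / norm (t n) ^ 2)" by (rule summable_on_imp_summable)
  moreover have "inj t" "range t = {z. g z = 0}" using bt by (auto simp: bij_betw_def T_def)
  ultimately show ?thesis
    using sums by (intro exI[of _ t] exI[of _ "\<lambda>n. c (t n)"] conjI allI impI) assumption+
qed

end

theorem theorem3p6:
  fixes P Q :: "complex poly"
  assumes "admissible P Q"
    and "laine_condition (\<lambda>z. 2 * schwarzian_potential P Q z)"
  shows
    "(\<forall>U g. open U \<and> connected U \<and> U \<noteq> {} \<and> solution_on P Q U g \<longrightarrow>
        (\<exists>G. G holomorphic_on UNIV \<and> (\<forall>z\<in>U. G z = g z))) \<and>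
     (\<forall>g\<^sub>1 g\<^sub>2. fundamental_system P Q g\<^sub>1 g\<^sub>2 \<longrightarrow>
        (\<exists>E. E \<subseteq> projective_line \<and> finite E \<and>
          (\<forall>\<alpha> \<beta>. (\<alpha>, \<beta>) \<noteq> (0, 0) \<and> proj_point \<alpha> \<beta> \<notin> E \<longrightarrow>
             (let g = (\<lambda>z. \<alpha> * g\<^sub>1 z + \<beta> * g\<^sub>2 z) in
               (\<forall>k \<le> degree Q - degree P + 1. tends_to_infinity_in_stokes_sector P Q k g) \<and>
               ((\<nexists>z. g z = 0 \<and> poly P z = 0) \<longrightarrow>
                 (\<exists>(t :: nat \<Rightarrow> complex) (c :: nat \<Rightarrow> complex).
                    inj t \<and> range t = {z. g z = 0} \<and>
                    (\<forall>z. g z \<noteq> 0 \<longrightarrow>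
                       (\<lambda>n. c n / (z - t n) ^ 2) sums (poly P z / g z ^ 2)) \<and>
                    summable (\<lambda>n. if t n = 0 then 0 else norm (c n) / norm (t n) ^ 2)))))))"
proof (intro conjI allI impI)
  fix U g assume "open U \<and> connected U \<and> U \<noteq> {} \<and> solution_on P Q U g"
  then have U: "open U" "connected U" "U \<noteq> {}" "solution_on P Q U g" by auto
  show "\<exists>G. G holomorphic_on UNIV \<and> (\<forall>z\<in>U. G z = g z)"
    by (rule solution_extends_to_entire[OF assms U]) blast
next
  fix g1 g2 assume fs: "fundamental_system P Q g1 g2"
  have lead: "lead_coeff P = 1" "Q \<noteq> 0" "degree P \<le> degree Q"
    using assms(1) by (auto simp: admissible_def)
  obtain r0 C where "stokes_setup P Q r0 C" using stokes_setup_exists[OF lead] by blast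
  then interpret stokes_setup P Q r0 C .
  obtain E where E: "E \<subseteq> projective_line" "finite E"
    "\<And>\<alpha> \<beta>. (\<alpha>, \<beta>) \<noteq> (0, 0) \<Longrightarrow> proj_point \<alpha> \<beta> \<notin> E \<Longrightarrow> generic_solution (\<lambda>z. \<alpha> * g1 z + \<beta> * g2 z)"
    using generic_exceptional_set[OF fs] by blast
  have sol: "solution_on P Q UNIV g1" "solution_on P Q UNIV g2"
    using fs by (auto simp: fundamental_system_def)
  show "\<exists>E. E \<subseteq> projective_line \<and> finite E \<and>
          (\<forall>\<alpha> \<beta>. (\<alpha>, \<beta>) \<noteq> (0, 0) \<and> proj_point \<alpha> \<beta> \<notin> E \<longrightarrow>
             (let g = (\<lambda>z. \<alpha> * g1 z + \<beta> * g2 z) in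
               (\<forall>k \<le> degree Q - degree P + 1. tends_to_infinity_in_stokes_sector P Q k g) \<and>
               ((\<nexists>z. g z = 0 \<and> poly P z = 0) \<longrightarrow>
                 (\<exists>(t :: nat \<Rightarrow> complex) (c :: nat \<Rightarrow> complex).
                    inj t \<and> range t = {z. g z = 0} \<and>
                    (\<forall>z. g z \<noteq> 0 \<longrightarrow>
                       (\<lambda>n. c n / (z - t n) ^ 2) sums (poly P z / g z ^ 2)) \<and>
                    summable (\<lambda>n. if t n = 0 then 0 else norm (c n) / norm (t n) ^ 2)))))"
  proof (intro exI[of _ E] conjI E(1,2) allI impI, elim conjE)
    fix \<alpha> \<beta> assume ab: "(\<alpha>, \<beta>) \<noteq> (0, 0)" "proj_point \<alpha> \<beta> \<notin> E"
    define g where "g = (\<lambda>z. \<alpha> * g1 z + \<beta> * g2 z)"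
    have g: "solution_on P Q UNIV g" unfolding g_def by (intro solution_on_lincomb open_UNIV sol)
    have gen: "generic_solution g" unfolding g_def by (rule E(3)[OF ab])
    have "deriv g t \<noteq> 0" if "g t = 0" "poly P t \<noteq> 0" for t
    proof
      \<comment> \<open>A multiple zero would make g vanish identically, while a generic solution is
        not constant.\<close>
      assume "deriv g t = 0"
      then have "g z = 0" for z
        using entire_solution_simple_zero[OF assms g that(2,1)] by blast
      then have "g constant_on UNIV" by (auto simp: constant_on_def)
      then show False using generic_not_constant[OF g gen] by blast
    qed
    then have simple: "\<And>t. (\<nexists>z. g z = 0 \<and> poly P z = 0) \<Longrightarrow> g t = 0 \<Longrightarrow> poly P t \<noteq> 0 \<and> deriv g t \<noteq> 0" by auto
    have exp: "(\<nexists>z. g z = 0 \<and> poly P z = 0) \<Longrightarrow>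
      \<exists>(t :: nat \<Rightarrow> complex) c. inj t \<and> range t = {z. g z = 0} \<and>
      (\<forall>z. g z \<noteq> 0 \<longrightarrow> (\<lambda>n. c n / (z - t n) ^ 2) sums (poly P z / g z ^ 2)) \<and>
      summable (\<lambda>n. if t n = 0 then 0 else norm (c n) / norm (t n) ^ 2)"
      by (rule generic_expansion[OF g gen simple])
    have inf: "\<forall>k \<le> degree Q - degree P + 1. tends_to_infinity_in_stokes_sector P Q k g"
      using generic_tends_to_infinity[OF g gen] by (simp add: N_def)
    show "let g = (\<lambda>z. \<alpha> * g1 z + \<beta> * g2 z) in
               (\<forall>k \<le> degree Q - degree P + 1. tends_to_infinity_in_stokes_sector P Q k g) \<and>
               ((\<nexists>z. g z = 0 \<and> poly P z = 0) \<longrightarrow>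
                 (\<exists>(t :: nat \<Rightarrow> complex) (c :: nat \<Rightarrow> complex).
                    inj t \<and> range t = {z. g z = 0} \<and>
                    (\<forall>z. g z \<noteq> 0 \<longrightarrow>
                       (\<lambda>n. c n / (z - t n) ^ 2) sums (poly P z / g z ^ 2)) \<and>
                    summable (\<lambda>n. if t n = 0 then 0 else norm (c n) / norm (t n) ^ 2)))"
      unfolding Let_def g_def[symmetric] using inf exp by blast
  qed
qed

end
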